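(* Let $G$ be a finite group, let $R$ be a principal ideal domain and $K$ its field of fractions. Let $V$ be an absolutely simple $KG$-module with $R$-forms $M$ and $N$. Suppose that $k\in\{1,\ldots,\dim_K(V)-1\}$ is such that also $\bigwedge^k(V)$ is an absolutely simple $KG$-module. Then $M\cong N$ as $RG$-lattices if and only if $\bigwedge^k(M)\cong \bigwedge^k(N)$ as $RG$-lattices.
   Context: An $RG$-lattice is a left $RG$-module that is finitely generated and free over $R$. $KG$-modules are finitely generated. An $R$-form of a $KG$-module $V$ is an $RG$-lattice $M$ with $K\otimes_R M\cong V$ as $KG$-modules. A $KG$-module $V$ is absolutely simple if $E\otimes_K V$ is a simple $EG$-module for every extension field $E$ of $K$. Exterior powers carry the action $g(m_1\wedge\cdots\wedge m_k)=gm_1\wedge\cdots\wedge gm_k$. *)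

theory Defs
  imports "HOL-Algebra.Algebra" "Jordan_Normal_Form.Missing_VectorSpace"
begin

section \<open>Modules over a group ring\<close>

text \<open>A left \<open>RG\<close>-module is an \<open>R\<close>-module together with an action of the group \<open>G\<close> by
  \<open>R\<close>-linear maps. As \<^const>\<open>group_action\<close> is a homomorphism into \<^const>\<open>BijGroup\<close>,
  the maps \<open>act M g\<close> are extensional functions on \<open>carrier M\<close>.\<close>

record ('r, 'm, 'g) gmodule = "('r, 'm) module" +
  act :: "'g \<Rightarrow> 'm \<Rightarrow> 'm"

locale RG_module =
  group_action G "carrier M" "act M" + module R M
  for G :: "('g, 'a) monoid_scheme" and R :: "('r, 'b) ring_scheme"
    and M :: "('r, 'm, 'g, 'c) gmodule_scheme" +
  assumes act_linear: "g \<in> carrier G \<Longrightarrow> act M g \<in> LinearCombinations.module_hom R M M"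

definition RG_hom :: "('g, 'a) monoid_scheme \<Rightarrow> ('r, 'b) ring_scheme \<Rightarrow>
    ('r, 'm, 'g, 'c) gmodule_scheme \<Rightarrow> ('r, 'n, 'g, 'd) gmodule_scheme \<Rightarrow> ('m \<Rightarrow> 'n) set"
  where "RG_hom G R M N =
    {f \<in> LinearCombinations.module_hom R M N.
       \<forall>g\<in>carrier G. \<forall>x\<in>carrier M. f (act M g x) = act N g (f x)}"

definition RG_isomorphic :: "('g, 'a) monoid_scheme \<Rightarrow> ('r, 'b) ring_scheme \<Rightarrow>
    ('r, 'm, 'g, 'c) gmodule_scheme \<Rightarrow> ('r, 'n, 'g, 'd) gmodule_scheme \<Rightarrow> bool"
  where "RG_isomorphic G R M N \<longleftrightarrow>
    (\<exists>f \<in> RG_hom G R M N. bij_betw f (carrier M) (carrier N))"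

definition fg_RG_module :: "('g, 'a) monoid_scheme \<Rightarrow> ('r, 'b) ring_scheme \<Rightarrow>
    ('r, 'm, 'g, 'c) gmodule_scheme \<Rightarrow> bool"
  where "fg_RG_module G R M \<longleftrightarrow> RG_module G R M \<and>
    (\<exists>A. finite A \<and> A \<subseteq> carrier M \<and>
       module.span R M (\<Union>g\<in>carrier G. act M g ` A) = carrier M)"

definition RG_lattice :: "('g, 'a) monoid_scheme \<Rightarrow> ('r, 'b) ring_scheme \<Rightarrow>
    ('r, 'm, 'g, 'c) gmodule_scheme \<Rightarrow> bool"
  where "RG_lattice G R M \<longleftrightarrow> RG_module G R M \<and>
    (\<exists>A. finite A \<and> A \<subseteq> carrier M \<and> module.span R M A = carrier M) \<and>
    (\<exists>B. B \<subseteq> carrier M \<and> \<not> module.lin_dep R M B \<and> module.span R M B = carrier M)"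

definition simple_RG_module :: "('g, 'a) monoid_scheme \<Rightarrow> ('r, 'b) ring_scheme \<Rightarrow>
    ('r, 'm, 'g, 'c) gmodule_scheme \<Rightarrow> bool"
  where "simple_RG_module G R M \<longleftrightarrow> RG_module G R M \<and> carrier M \<noteq> {\<zero>\<^bsub>M\<^esub>} \<and>
    (\<forall>W. LinearCombinations.submodule R W M \<and> (\<forall>g\<in>carrier G. act M g ` W \<subseteq> W)
       \<longrightarrow> W = {\<zero>\<^bsub>M\<^esub>} \<or> W = carrier M)"


section \<open>Modules given by generators and relations\<close>

text \<open>The free \<open>R\<close>-module on a set \<open>S\<close>: finitely supported functions vanishing outside \<open>S\<close>. The
  components \<^const>\<open>mult\<close> and \<^const>\<open>one\<close>, which the record for modules inherits from
  rings, play no role for a module and are left unspecified, here and below.\<close>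

definition free_module :: "('r, 'b) ring_scheme \<Rightarrow> 'x set \<Rightarrow> ('r, 'x \<Rightarrow> 'r) module"
  where "free_module R S =
    \<lparr>carrier = {f. range f \<subseteq> carrier R \<and> finite {x. f x \<noteq> \<zero>\<^bsub>R\<^esub>} \<and> {x. f x \<noteq> \<zero>\<^bsub>R\<^esub>} \<subseteq> S},
     monoid.mult = undefined, monoid.one = undefined,
     ring.zero = (\<lambda>x. \<zero>\<^bsub>R\<^esub>), add = (\<lambda>f g x. f x \<oplus>\<^bsub>R\<^esub> g x),
     smult = (\<lambda>a f x. a \<otimes>\<^bsub>R\<^esub> f x)\<rparr>"

definition free_gen :: "('r, 'b) ring_scheme \<Rightarrow> 'x \<Rightarrow> 'x \<Rightarrow> 'r"
  where "free_gen R x = (\<lambda>y. if y = x then \<one>\<^bsub>R\<^esub> else \<zero>\<^bsub>R\<^esub>)"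

text \<open>The linear map between free modules that sends the generator at \<open>x\<close> to the one at \<open>\<phi> x\<close>.\<close>

definition free_map :: "('r, 'b) ring_scheme \<Rightarrow> ('x \<Rightarrow> 'y) \<Rightarrow> ('x \<Rightarrow> 'r) \<Rightarrow> 'y \<Rightarrow> 'r"
  where "free_map R \<phi> f = (\<lambda>y. \<Oplus>\<^bsub>R\<^esub> x\<in>{x. f x \<noteq> \<zero>\<^bsub>R\<^esub> \<and> \<phi> x = y}. f x)"

definition quotient_module :: "('r, 'm, 'c) module_scheme \<Rightarrow> 'm set \<Rightarrow> ('r, 'm set) module"
  where "quotient_module M N =
    \<lparr>carrier = a_rcosets\<^bsub>M\<^esub> N,
     monoid.mult = undefined, monoid.one = undefined,
     ring.zero = N, add = (\<lambda>A B. A <+>\<^bsub>M\<^esub> B),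
     smult = (\<lambda>a A. \<Union>x\<in>A. N +>\<^bsub>M\<^esub> (a \<odot>\<^bsub>M\<^esub> x))\<rparr>"

text \<open>The map \<open>x + N \<mapsto> \<phi> x + N\<close> on cosets, for \<open>\<phi>\<close> additive with \<open>\<phi> ` N \<subseteq> N\<close>.\<close>

definition quotient_map :: "('r, 'm, 'c) module_scheme \<Rightarrow> 'm set \<Rightarrow> ('m \<Rightarrow> 'm) \<Rightarrow> 'm set \<Rightarrow> 'm set"
  where "quotient_map M N \<phi> A = (\<Union>x\<in>A. N +>\<^bsub>M\<^esub> \<phi> x)"


section \<open>Exterior powers\<close>

text \<open>The list \<open>[m\<^sub>1, \<dots>, m\<^sub>k]\<close> is the generator that represents \<open>m\<^sub>1 \<and> \<dots> \<and> m\<^sub>k\<close>.\<close>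

definition tuples :: "nat \<Rightarrow> ('r, 'm, 'c) module_scheme \<Rightarrow> 'm list set"
  where "tuples k M = {xs. length xs = k \<and> set xs \<subseteq> carrier M}"

definition exterior_relations ::
    "('r, 'b) ring_scheme \<Rightarrow> nat \<Rightarrow> ('r, 'm, 'c) module_scheme \<Rightarrow> ('m list \<Rightarrow> 'r) set"
  where "exterior_relations R k M =
    (let F = free_module R (tuples k M); \<delta> = free_gen R in
      {\<delta> (xs[i := x \<oplus>\<^bsub>M\<^esub> y]) \<ominus>\<^bsub>F\<^esub> (\<delta> (xs[i := x]) \<oplus>\<^bsub>F\<^esub> \<delta> (xs[i := y])) | xs i x y.
         xs \<in> tuples k M \<and> i < k \<and> x \<in> carrier M \<and> y \<in> carrier M}
    \<union> {\<delta> (xs[i := a \<odot>\<^bsub>M\<^esub> x]) \<ominus>\<^bsub>F\<^esub> (a \<odot>\<^bsub>F\<^esub> \<delta> (xs[i := x])) | xs i a x.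
         xs \<in> tuples k M \<and> i < k \<and> a \<in> carrier R \<and> x \<in> carrier M}
    \<union> {\<delta> xs | xs. xs \<in> tuples k M \<and> (\<exists>i j. i < j \<and> j < k \<and> xs ! i = xs ! j)})"

definition exterior_power :: "('r, 'b) ring_scheme \<Rightarrow> nat \<Rightarrow> ('r, 'm, 'g, 'c) gmodule_scheme \<Rightarrow>
    ('r, ('m list \<Rightarrow> 'r) set, 'g) gmodule"
  where "exterior_power R k M =
    (let F = free_module R (tuples k M);
         N = module.span R F (exterior_relations R k M);
         Q = quotient_module F N
     in \<lparr>carrier = carrier Q, monoid.mult = undefined, monoid.one = undefined,
         ring.zero = \<zero>\<^bsub>Q\<^esub>, add = add Q, smult = smult Q,
         act = (\<lambda>g. \<lambda>A\<in>carrier Q. quotient_map F N (free_map R (map (act M g))) A)\<rparr>)"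


section \<open>Tensor products and extension of scalars\<close>

definition tensor_relations :: "('r, 'b) ring_scheme \<Rightarrow> ('r, 'm, 'c) module_scheme \<Rightarrow>
    ('r, 'n, 'd) module_scheme \<Rightarrow> ('m \<times> 'n \<Rightarrow> 'r) set"
  where "tensor_relations R M N =
    (let F = free_module R (carrier M \<times> carrier N); \<delta> = free_gen R in
      {\<delta> (x \<oplus>\<^bsub>M\<^esub> x', y) \<ominus>\<^bsub>F\<^esub> (\<delta> (x, y) \<oplus>\<^bsub>F\<^esub> \<delta> (x', y)) | x x' y.
         x \<in> carrier M \<and> x' \<in> carrier M \<and> y \<in> carrier N}
    \<union> {\<delta> (x, y \<oplus>\<^bsub>N\<^esub> y') \<ominus>\<^bsub>F\<^esub> (\<delta> (x, y) \<oplus>\<^bsub>F\<^esub> \<delta> (x, y')) | x y y'.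
         x \<in> carrier M \<and> y \<in> carrier N \<and> y' \<in> carrier N}
    \<union> {\<delta> (a \<odot>\<^bsub>M\<^esub> x, y) \<ominus>\<^bsub>F\<^esub> (a \<odot>\<^bsub>F\<^esub> \<delta> (x, y)) | a x y.
         a \<in> carrier R \<and> x \<in> carrier M \<and> y \<in> carrier N}
    \<union> {\<delta> (x, a \<odot>\<^bsub>N\<^esub> y) \<ominus>\<^bsub>F\<^esub> (a \<odot>\<^bsub>F\<^esub> \<delta> (x, y)) | a x y.
         a \<in> carrier R \<and> x \<in> carrier M \<and> y \<in> carrier N})"

definition ring_as_module :: "('r \<Rightarrow> 's) \<Rightarrow> ('s, 'b) ring_scheme \<Rightarrow> ('r, 's) module"
  where "ring_as_module \<iota> S =
    \<lparr>carrier = carrier S, monoid.mult = monoid.mult S, monoid.one = \<one>\<^bsub>S\<^esub>,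
     ring.zero = \<zero>\<^bsub>S\<^esub>, add = add S, smult = (\<lambda>a s. \<iota> a \<otimes>\<^bsub>S\<^esub> s)\<rparr>"

text \<open>For a ring homomorphism \<open>\<iota> : R \<rightarrow> S\<close> and an \<open>RG\<close>-module \<open>M\<close>, this is the \<open>SG\<close>-module
  \<open>S \<otimes>\<^sub>R M\<close> with \<open>s (s' \<otimes> m) = s s' \<otimes> m\<close> and \<open>g (s' \<otimes> m) = s' \<otimes> g m\<close>.\<close>

definition extend_scalars :: "('r, 'b) ring_scheme \<Rightarrow> ('s, 'd) ring_scheme \<Rightarrow> ('r \<Rightarrow> 's) \<Rightarrow>
    ('r, 'm, 'g, 'c) gmodule_scheme \<Rightarrow> ('s, ('s \<times> 'm \<Rightarrow> 'r) set, 'g) gmodule"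
  where "extend_scalars R S \<iota> M =
    (let F = free_module R (carrier S \<times> carrier M);
         N = module.span R F (tensor_relations R (ring_as_module \<iota> S) M);
         T = quotient_module F N
     in \<lparr>carrier = carrier T, monoid.mult = undefined, monoid.one = undefined,
         ring.zero = \<zero>\<^bsub>T\<^esub>, add = add T,
         smult = (\<lambda>s. quotient_map F N (free_map R (\<lambda>(s', m). (s \<otimes>\<^bsub>S\<^esub> s', m)))),
         act = (\<lambda>g. \<lambda>A\<in>carrier T. quotient_map F N (free_map R (\<lambda>(s', m). (s', act M g m))) A)\<rparr>)"


section \<open>Fields of fractions, forms, absolute simplicity\<close>

definition field_of_fractions ::
    "('r, 'b) ring_scheme \<Rightarrow> ('k, 'd) ring_scheme \<Rightarrow> ('r \<Rightarrow> 'k) \<Rightarrow> bool"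
  where "field_of_fractions R K \<iota> \<longleftrightarrow> field K \<and> \<iota> \<in> ring_hom R K \<and> inj_on \<iota> (carrier R) \<and>
    (\<forall>x\<in>carrier K. \<exists>a\<in>carrier R. \<exists>b\<in>carrier R - {\<zero>\<^bsub>R\<^esub>}. x = \<iota> a \<otimes>\<^bsub>K\<^esub> inv\<^bsub>K\<^esub> (\<iota> b))"

definition is_form :: "('g, 'a) monoid_scheme \<Rightarrow> ('r, 'b) ring_scheme \<Rightarrow> ('k, 'd) ring_scheme \<Rightarrow>
    ('r \<Rightarrow> 'k) \<Rightarrow> ('k, 'v, 'g, 'e) gmodule_scheme \<Rightarrow> ('r, 'm, 'g, 'c) gmodule_scheme \<Rightarrow> bool"
  where "is_form G R K \<iota> V M \<longleftrightarrow>
    RG_lattice G R M \<and> RG_isomorphic G K (extend_scalars R K \<iota> M) V"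

text \<open>HOL cannot quantify over all types, so the extension fields \<open>E\<close> range over all fields whose
  elements are taken from the type \<open>('k list \<times> nat) multiset \<Rightarrow> 'k\<close>, the type in which
  \<^const>\<open>field.alg_closure\<close> is built. This is no restriction. Every extension field of \<open>K\<close> of
  cardinality at most \<open>max \<bar>K\<bar> \<aleph>\<^sub>0\<close> has an isomorphic copy there, in particular every finitely
  generated one, and an invariant proper subspace of \<open>E \<otimes> V\<close> for an arbitrary \<open>E\<close> is already
  defined over a finitely generated subextension, since \<open>V\<close> is finite-dimensional.\<close>

definition absolutely_simple ::
    "('g, 'a) monoid_scheme \<Rightarrow> ('k, 'd) ring_scheme \<Rightarrow> ('k, 'v, 'g, 'e) gmodule_scheme \<Rightarrow> bool"
  where "absolutely_simple G K V \<longleftrightarrow>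
    (\<forall>(E :: (('k list \<times> nat) multiset \<Rightarrow> 'k) ring) \<epsilon>.
       field E \<and> \<epsilon> \<in> ring_hom K E \<longrightarrow> simple_RG_module G E (extend_scalars K E \<epsilon> V))"

end

theory Submission
  imports Defs
begin

text \<open>Both lattices embed into \<open>V\<close>, by \<open>iM\<close> and \<open>iN\<close> say, and their exterior powers map to \<open>\<Lambda>\<^sup>k V\<close>.
  An isomorphism \<open>\<phi>\<close> of the exterior powers extends to an endomorphism of \<open>\<Lambda>\<^sup>k V\<close>, which is
  multiplication by some \<open>c\<close> by Schur's lemma. For a common denominator \<open>t\<close>, the map
  \<open>f = t (iN\<inverse> \<circ> iM)\<close> from \<open>M\<close> to \<open>N\<close> has elementary divisors \<open>d\<^sub>1, \<dots>, d\<^sub>n\<close>. Determinants of coordinate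
  functionals show that the product of any \<open>k\<close> of them at distinct places is \<open>t\<^sup>k / c\<close> up to a unit.
  As \<open>1 \<le> k < n\<close>, exchanging a single place shows that all \<open>d\<^sub>i\<close> are associated, so \<open>f\<close> is
  \<open>d\<^sub>1\<close> times an isomorphism. It commutes with the group because \<open>iM\<close> and \<open>iN\<close> do.\<close>

text \<open>The exterior powers are quotients of free modules on lists, so they are reached only
  through maps: a map out of them comes from an alternating map, and an element is judged by the
  values of linear functionals. This shapes the comparison. For an injection \<open>I\<close> of
  \<open>k\<close> places, the minor formed by the coordinate functionals at these places, with
  respect to the diagonalising family of \<open>N\<close>, is a functional \<open>F\<close> on
  \<open>\<Lambda>\<^sup>k V\<close>. On the image of \<open>\<Lambda>\<^sup>k N\<close> its values
  lie in \<open>R\<close>, and 1 occurs. On the image of \<open>\<Lambda>\<^sup>k M\<close> the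
  values of \<open>t\<^sup>k F\<close> are multiples of the product of the \<open>d\<^sub>i\<close>
  at \<open>I\<close>, and the product itself occurs. As \<open>\<phi>\<close> is onto and becomes
  multiplication by \<open>c\<close>, each of the two special values gives one divisibility.

  Absolute simplicity enters over an algebraic closure of \<open>K\<close>, where an endomorphism of
  \<open>\<Lambda>\<^sup>k V\<close> acquires an eigenvector; reading off one coordinate shows that
  the eigenvalue comes from \<open>K\<close>. The diagonal form of \<open>f\<close> carries no chain
  of divisibilities; these come only from the exchange of a place.\<close>

section \<open>Semilinear maps and presented modules\<close>

text \<open>One notion covers the three kinds of map in use: linear maps over one ring (with
  \<open>\<iota>\<close> the identity), maps from a lattice into a vector space over the field of
  fractions, and maps into an extension of scalars. They compose without any explicit restriction of
  scalars.\<close>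

locale semilinear =
  fixes R :: "('r, 'b) ring_scheme" and S :: "('s, 'd) ring_scheme" and \<iota> :: "'r \<Rightarrow> 's"
    and M :: "('r, 'm, 'c) module_scheme" and P :: "('s, 'p, 'e) module_scheme" and f :: "'m \<Rightarrow> 'p"
  assumes dom: "module R M" and cod: "module S P" and scal: "\<iota> \<in> ring_hom R S"
    and closed: "x \<in> carrier M \<Longrightarrow> f x \<in> carrier P"
    and add: "x \<in> carrier M \<Longrightarrow> y \<in> carrier M \<Longrightarrow> f (x \<oplus>\<^bsub>M\<^esub> y) = f x \<oplus>\<^bsub>P\<^esub> f y"
    and smult: "a \<in> carrier R \<Longrightarrow> x \<in> carrier M \<Longrightarrow> f (a \<odot>\<^bsub>M\<^esub> x) = \<iota> a \<odot>\<^bsub>P\<^esub> f x"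
begin

lemma scal_closed: "a \<in> carrier R \<Longrightarrow> \<iota> a \<in> carrier S"
  using scal by (rule ring_hom_closed)

lemma zero: "f \<zero>\<^bsub>M\<^esub> = \<zero>\<^bsub>P\<^esub>"
proof -
  interpret M: module R M by (rule dom)
  interpret P: module S P by (rule cod)
  have "f \<zero>\<^bsub>M\<^esub> \<oplus>\<^bsub>P\<^esub> f \<zero>\<^bsub>M\<^esub> = f \<zero>\<^bsub>M\<^esub>"
    using add[of "\<zero>\<^bsub>M\<^esub>" "\<zero>\<^bsub>M\<^esub>"] by simp
  then show ?thesis using closed[of "\<zero>\<^bsub>M\<^esub>"] by (simp add: P.add.l_cancel_one)
qed

lemma neg: assumes "x \<in> carrier M" shows "f (\<ominus>\<^bsub>M\<^esub> x) = \<ominus>\<^bsub>P\<^esub> f x"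
proof -
  interpret M: module R M by (rule dom)
  interpret P: module S P by (rule cod)
  have "f (\<ominus>\<^bsub>M\<^esub> x) \<oplus>\<^bsub>P\<^esub> f x = \<zero>\<^bsub>P\<^esub>"
    using add[of "\<ominus>\<^bsub>M\<^esub> x" x] assms by (simp add: M.M.l_neg zero)
  then show ?thesis using closed[of "\<ominus>\<^bsub>M\<^esub> x"] closed[of x] assms
    by (simp add: P.M.minus_equality)
qed

lemma minus:
  assumes "x \<in> carrier M" "y \<in> carrier M"
  shows "f (x \<ominus>\<^bsub>M\<^esub> y) = f x \<ominus>\<^bsub>P\<^esub> f y"
proof -
  interpret M: module R M by (rule dom)
  show ?thesis using assms by (simp add: a_minus_def add neg)
qed

lemma finsum:
  assumes "finite A" "g \<in> A \<rightarrow> carrier M"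
  shows "f (\<Oplus>\<^bsub>M\<^esub> x\<in>A. g x) = (\<Oplus>\<^bsub>P\<^esub> x\<in>A. f (g x))"
proof -
  interpret M: module R M by (rule dom)
  interpret P: module S P by (rule cod)
  show ?thesis using assms
  proof (induction rule: finite_induct)
    case empty then show ?case by (simp add: zero)
  next
    case (insert a A)
    have g: "g a \<in> carrier M" "g \<in> A \<rightarrow> carrier M" using insert.prems by auto
    have "f (\<Oplus>\<^bsub>M\<^esub> x\<in>insert a A. g x) = f (g a \<oplus>\<^bsub>M\<^esub> (\<Oplus>\<^bsub>M\<^esub> x\<in>A. g x))"
      using insert.hyps g by (subst M.M.finsum_insert) auto
    also have "\<dots> = f (g a) \<oplus>\<^bsub>P\<^esub> (\<Oplus>\<^bsub>P\<^esub> x\<in>A. f (g x))"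
      using insert g by (subst add) (auto intro: M.M.finsum_closed)
    also have "\<dots> = (\<Oplus>\<^bsub>P\<^esub> x\<in>insert a A. f (g x))"
      using insert.hyps g by (subst P.M.finsum_insert) (auto intro: closed)
    finally show ?case .
  qed
qed

lemma kernel_submodule: "LinearCombinations.submodule R {x \<in> carrier M. f x = \<zero>\<^bsub>P\<^esub>} M"
proof -
  interpret M: module R M by (rule dom)
  interpret P: module S P by (rule cod)
  show ?thesis
    by (rule LinearCombinations.submodule.intro) (auto simp: dom add smult zero scal_closed)
qed

lemma comp:
  assumes "semilinear S T \<kappa> P Q g"
  shows "semilinear R T (\<kappa> \<circ> \<iota>) M Q (g \<circ> f)"
proof -
  interpret g: semilinear S T \<kappa> P Q g by (rule assms)
  show ?thesis
    by (rule semilinear.intro)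
      (auto simp: dom g.cod closed add smult g.closed g.add g.smult scal_closed
        intro: ring_hom_trans[OF scal g.scal])
qed

end

lemma ring_as_module_sel [simp]:
  "carrier (ring_as_module \<iota> S) = carrier S" "\<zero>\<^bsub>ring_as_module \<iota> S\<^esub> = \<zero>\<^bsub>S\<^esub>"
  "x \<oplus>\<^bsub>ring_as_module \<iota> S\<^esub> y = x \<oplus>\<^bsub>S\<^esub> y"
  "a \<odot>\<^bsub>ring_as_module \<iota> S\<^esub> x = \<iota> a \<otimes>\<^bsub>S\<^esub> x"
  by (simp_all add: ring_as_module_def)

lemma ring_as_module_module:
  assumes "cring R" "cring S" and \<iota>: "\<iota> \<in> ring_hom R S"
  shows "module R (ring_as_module \<iota> S)"
proof -
  interpret S: cring S by (rule assms)
  show ?thesis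
    by (rule module_criteria[OF assms(1)])
      (auto simp: S.a_ac S.m_assoc S.l_distr S.r_distr ring_hom_closed[OF \<iota>] ring_hom_add[OF \<iota>]
        ring_hom_mult[OF \<iota>] ring_hom_one[OF \<iota>] intro: bexI[of _ "\<ominus>\<^bsub>S\<^esub> _"] S.r_neg S.a_inv_closed)
qed

text \<open>The bridge to the maps that occur in \<open>RG_hom\<close> and in the action of an
  \<open>RG_module\<close>.\<close>

lemma semilinear_id_iff:
  assumes "module R M" "module R P"
  shows "semilinear R R (\<lambda>x. x) M P f \<longleftrightarrow> f \<in> LinearCombinations.module_hom R M P"
  using assms
  by (auto simp: semilinear_def LinearCombinations.module_hom_def ring_hom_def)

subsection \<open>Free modules\<close>

lemma free_module_carrier:
  "carrier (free_module R Y) =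
    {f. range f \<subseteq> carrier R \<and> finite {x. f x \<noteq> \<zero>\<^bsub>R\<^esub>} \<and> {x. f x \<noteq> \<zero>\<^bsub>R\<^esub>} \<subseteq> Y}"
  by (simp add: free_module_def)

lemma free_module_sel [simp]:
  "\<zero>\<^bsub>free_module R Y\<^esub> = (\<lambda>x. \<zero>\<^bsub>R\<^esub>)"
  "f \<oplus>\<^bsub>free_module R Y\<^esub> g = (\<lambda>x. f x \<oplus>\<^bsub>R\<^esub> g x)"
  "a \<odot>\<^bsub>free_module R Y\<^esub> f = (\<lambda>x. a \<otimes>\<^bsub>R\<^esub> f x)"
  by (simp_all add: free_module_def)

lemma free_module_carrierD:
  assumes "f \<in> carrier (free_module R Y)"
  shows "f x \<in> carrier R" and "finite {x. f x \<noteq> \<zero>\<^bsub>R\<^esub>}" and "f x \<noteq> \<zero>\<^bsub>R\<^esub> \<Longrightarrow> x \<in> Y"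
    and "{x. f x \<noteq> \<zero>\<^bsub>R\<^esub>} \<subseteq> Y"
  using assms by (auto simp: free_module_carrier)

lemma free_module_module:
  assumes "cring R" shows "module R (free_module R Y)"
proof -
  interpret cring R by (rule assms)
  have supp_add: "finite {x. f x \<oplus>\<^bsub>R\<^esub> g x \<noteq> \<zero>\<^bsub>R\<^esub>} \<and> {x. f x \<oplus>\<^bsub>R\<^esub> g x \<noteq> \<zero>\<^bsub>R\<^esub>} \<subseteq> Y"
    if "finite {x. f x \<noteq> \<zero>\<^bsub>R\<^esub>}" "{x. f x \<noteq> \<zero>\<^bsub>R\<^esub>} \<subseteq> Y"
      "finite {x. g x \<noteq> \<zero>\<^bsub>R\<^esub>}" "{x. g x \<noteq> \<zero>\<^bsub>R\<^esub>} \<subseteq> Y" for f g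
  proof -
    have "{x. f x \<oplus>\<^bsub>R\<^esub> g x \<noteq> \<zero>\<^bsub>R\<^esub>} \<subseteq> {x. f x \<noteq> \<zero>\<^bsub>R\<^esub>} \<union> {x. g x \<noteq> \<zero>\<^bsub>R\<^esub>}" by auto
    then show ?thesis using that by (meson Un_least finite_Un finite_subset subset_trans)
  qed
  have supp_smult: "finite {x. a \<otimes>\<^bsub>R\<^esub> f x \<noteq> \<zero>\<^bsub>R\<^esub>} \<and> {x. a \<otimes>\<^bsub>R\<^esub> f x \<noteq> \<zero>\<^bsub>R\<^esub>} \<subseteq> Y"
    if "finite {x. f x \<noteq> \<zero>\<^bsub>R\<^esub>}" "{x. f x \<noteq> \<zero>\<^bsub>R\<^esub>} \<subseteq> Y" "a \<in> carrier R" for a f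
  proof -
    have "{x. a \<otimes>\<^bsub>R\<^esub> f x \<noteq> \<zero>\<^bsub>R\<^esub>} \<subseteq> {x. f x \<noteq> \<zero>\<^bsub>R\<^esub>}" using that(3) by auto
    then show ?thesis using that by (meson finite_subset subset_trans)
  qed
  have r: "f x \<in> carrier R" if "range f \<subseteq> carrier R" for f :: "'c \<Rightarrow> 'a" and x using that by auto
  show ?thesis
  proof (rule module_criteria[OF assms])
    show "\<forall>v\<in>carrier (free_module R Y). \<exists>w\<in>carrier (free_module R Y).
        v \<oplus>\<^bsub>free_module R Y\<^esub> w = \<zero>\<^bsub>free_module R Y\<^esub>"
    proof
      fix v assume v: "v \<in> carrier (free_module R Y)"
      have "{x. \<ominus>\<^bsub>R\<^esub> v x \<noteq> \<zero>\<^bsub>R\<^esub>} = {x. v x \<noteq> \<zero>\<^bsub>R\<^esub>}"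
        using free_module_carrierD(1)[OF v] by (auto simp: add.inv_eq_1_iff)
      then have "(\<lambda>x. \<ominus>\<^bsub>R\<^esub> v x) \<in> carrier (free_module R Y)" using v by (auto simp: free_module_carrier)
      moreover have "v \<oplus>\<^bsub>free_module R Y\<^esub> (\<lambda>x. \<ominus>\<^bsub>R\<^esub> v x) = \<zero>\<^bsub>free_module R Y\<^esub>"
        using free_module_carrierD(1)[OF v] by (auto simp: r_neg)
      ultimately show "\<exists>w\<in>carrier (free_module R Y). v \<oplus>\<^bsub>free_module R Y\<^esub> w = \<zero>\<^bsub>free_module R Y\<^esub>"
        by blast
    qed
  qed (use supp_add supp_smult in \<open>auto simp: free_module_carrier fun_eq_iff r a_ac m_assoc l_distr r_distr\<close>)
qed

lemma free_gen_closed: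
  assumes "cring R" "x \<in> Y" shows "free_gen R x \<in> carrier (free_module R Y)"
proof -
  interpret cring R by (rule assms)
  have "{y. free_gen R x y \<noteq> \<zero>\<^bsub>R\<^esub>} \<subseteq> {x}" by (auto simp: free_gen_def)
  then have "finite {y. free_gen R x y \<noteq> \<zero>\<^bsub>R\<^esub>}" "{y. free_gen R x y \<noteq> \<zero>\<^bsub>R\<^esub>} \<subseteq> Y"
    using assms(2) finite_subset by auto
  then show ?thesis by (auto simp: free_gen_def free_module_carrier)
qed

text \<open>Induction on a finite set containing the support: one point is split off as a multiple
  of its generator. Stating generation through arbitrary submodules \<open>H\<close> lets later
  proofs take for \<open>H\<close> the set where two maps agree or where values are
  integral.\<close>

lemma free_module_generated:
  assumes R: "cring R" and H: "LinearCombinations.submodule R H (free_module R Y)"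
    and gen: "\<And>x. x \<in> Y \<Longrightarrow> free_gen R x \<in> H"
    and f: "f \<in> carrier (free_module R Y)"
  shows "f \<in> H"
proof -
  interpret cring R by (rule R)
  interpret H: LinearCombinations.submodule R H "free_module R Y" by (rule H)
  have "f \<in> H" if "finite A" "f \<in> carrier (free_module R Y)" "{x. f x \<noteq> \<zero>\<^bsub>R\<^esub>} \<subseteq> A" for A f
    using that
  proof (induction A arbitrary: f rule: finite_induct)
    case empty
    then have "f = \<zero>\<^bsub>free_module R Y\<^esub>" by auto
    then show ?case using H.zero_closed by simp
  next
    case (insert a A)
    show ?case
    proof (cases "f a = \<zero>\<^bsub>R\<^esub>")
      case True
      then have "{x. f x \<noteq> \<zero>\<^bsub>R\<^esub>} \<subseteq> A" using insert.prems by auto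
      then show ?thesis using insert by blast
    next
      case False
      note fc = free_module_carrierD[OF insert.prems(1)]
      have a: "a \<in> Y" using fc(3) False by blast
      let ?g = "f(a := \<zero>\<^bsub>R\<^esub>)"
      have sub: "{x. ?g x \<noteq> \<zero>\<^bsub>R\<^esub>} \<subseteq> {x. f x \<noteq> \<zero>\<^bsub>R\<^esub>} - {a}" by auto
      have "?g \<in> carrier (free_module R Y)"
        using fc sub by (auto simp: free_module_carrier intro: finite_subset)
      then have "?g \<in> H" using insert.IH sub insert.prems(2) by blast
      moreover have "f a \<odot>\<^bsub>free_module R Y\<^esub> free_gen R a \<in> H"
        using gen[OF a] fc(1) by blast
      moreover have "f = (f a \<odot>\<^bsub>free_module R Y\<^esub> free_gen R a) \<oplus>\<^bsub>free_module R Y\<^esub> ?g"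
        using fc(1) by (auto simp: free_gen_def fun_eq_iff)
      ultimately show ?thesis using H.m_closed by metis
    qed
  qed
  then show ?thesis using f free_module_carrierD(2)[OF f] by blast
qed

text \<open>The extension of a map \<open>h\<close> on generators, semilinear along
  \<open>\<iota>\<close>; the sum is finite because it runs over the support of
  \<open>f\<close>.\<close>

definition lin_ext ::
    "('r, 'b) ring_scheme \<Rightarrow> ('r \<Rightarrow> 's) \<Rightarrow> ('s, 'p, 'e) module_scheme \<Rightarrow> ('x \<Rightarrow> 'p) \<Rightarrow> ('x \<Rightarrow> 'r) \<Rightarrow> 'p"
  where "lin_ext R \<iota> P h f = (\<Oplus>\<^bsub>P\<^esub> x\<in>{x. f x \<noteq> \<zero>\<^bsub>R\<^esub>}. \<iota> (f x) \<odot>\<^bsub>P\<^esub> h x)"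

text \<open>Summands off the support vanish. Additivity relies on this: two functions and their sum
  have different supports, and one finite set has to serve all three.\<close>

lemma lin_ext_superset:
  assumes R: "cring R" and P: "module S P" and \<iota>: "\<iota> \<in> ring_hom R S" and h: "h \<in> Y \<rightarrow> carrier P"
    and f: "f \<in> carrier (free_module R Y)" and A: "finite A" "{x. f x \<noteq> \<zero>\<^bsub>R\<^esub>} \<subseteq> A" "A \<subseteq> Y"
  shows "lin_ext R \<iota> P h f = (\<Oplus>\<^bsub>P\<^esub> x\<in>A. \<iota> (f x) \<odot>\<^bsub>P\<^esub> h x)"
proof -
  interpret R: cring R by (rule R)
  interpret P: module S P by (rule P)
  interpret \<iota>: ring_hom_cring R S \<iota> by unfold_locales (rule \<iota>)
  show ?thesis unfolding lin_ext_def
  proof (rule P.M.add.finprod_mono_neutral_cong_left[OF A(1,2)])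
    show "\<And>i. i \<in> A - {x. f x \<noteq> \<zero>\<^bsub>R\<^esub>} \<Longrightarrow> \<iota> (f i) \<odot>\<^bsub>P\<^esub> h i = \<zero>\<^bsub>P\<^esub>"
      using A h by (auto simp: Pi_iff subset_iff)
    show "(\<lambda>x. \<iota> (f x) \<odot>\<^bsub>P\<^esub> h x) \<in> A \<rightarrow> carrier P"
      using A h free_module_carrierD(1)[OF f] by (auto intro!: P.smult_closed ring_hom_closed[OF \<iota>])
  qed auto
qed

lemma lin_ext_semilinear:
  assumes R: "cring R" and P: "module S P" and \<iota>: "\<iota> \<in> ring_hom R S" and h: "h \<in> Y \<rightarrow> carrier P"
  shows "semilinear R S \<iota> (free_module R Y) P (lin_ext R \<iota> P h)"
proof -
  interpret R: cring R by (rule R)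
  interpret P: module S P by (rule P)
  interpret \<iota>: ring_hom_cring R S \<iota> by unfold_locales (rule \<iota>)
  interpret F: module R "free_module R Y" by (rule free_module_module[OF R])
  note sup = lin_ext_superset[OF R P \<iota> h]
  have tm: "\<iota> (f x) \<odot>\<^bsub>P\<^esub> h x \<in> carrier P" if "f \<in> carrier (free_module R Y)" "x \<in> Y" for f x
    using that h free_module_carrierD(1)[OF that(1)]
    by (auto intro!: P.smult_closed ring_hom_closed[OF \<iota>])
  show ?thesis
  proof (rule semilinear.intro[OF F.module_axioms P \<iota>])
    fix f assume f: "f \<in> carrier (free_module R Y)"
    then show "lin_ext R \<iota> P h f \<in> carrier P"
      unfolding lin_ext_def by (intro P.M.finsum_closed) (use tm[OF f] free_module_carrierD(3)[OF f] in auto)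
  next
    fix f g assume fg: "f \<in> carrier (free_module R Y)" "g \<in> carrier (free_module R Y)"
    let ?A = "{x. f x \<noteq> \<zero>\<^bsub>R\<^esub>} \<union> {x. g x \<noteq> \<zero>\<^bsub>R\<^esub>}"
    have A: "finite ?A" "?A \<subseteq> Y" 
      using free_module_carrierD(2,4)[OF fg(1)] free_module_carrierD(2,4)[OF fg(2)] by auto
    have c: "f x \<in> carrier R" "g x \<in> carrier R" for x 
      by (rule free_module_carrierD(1)[OF fg(1)] free_module_carrierD(1)[OF fg(2)])+
    have fgc: "f \<oplus>\<^bsub>free_module R Y\<^esub> g \<in> carrier (free_module R Y)"
      using fg by (rule F.M.a_closed)
    have tf: "\<iota> (f x) \<odot>\<^bsub>P\<^esub> h x \<in> carrier P" "\<iota> (g x) \<odot>\<^bsub>P\<^esub> h x \<in> carrier P" "h x \<in> carrier P"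
      if "x \<in> ?A" for x
    proof -
      have "x \<in> Y" using A(2) that by blast
      then show "\<iota> (f x) \<odot>\<^bsub>P\<^esub> h x \<in> carrier P" "\<iota> (g x) \<odot>\<^bsub>P\<^esub> h x \<in> carrier P" "h x \<in> carrier P"
        using tm[OF fg(1)] tm[OF fg(2)] h by auto
    qed
    have "lin_ext R \<iota> P h (f \<oplus>\<^bsub>free_module R Y\<^esub> g) =
        (\<Oplus>\<^bsub>P\<^esub> x\<in>?A. \<iota> ((f \<oplus>\<^bsub>free_module R Y\<^esub> g) x) \<odot>\<^bsub>P\<^esub> h x)"
      by (rule sup[OF fgc A(1) _ A(2)]) (auto simp: c)
    also have "\<dots> = (\<Oplus>\<^bsub>P\<^esub> x\<in>?A. \<iota> (f x) \<odot>\<^bsub>P\<^esub> h x \<oplus>\<^bsub>P\<^esub> \<iota> (g x) \<odot>\<^bsub>P\<^esub> h x)"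
      by (rule P.M.finsum_cong') (use c tf in \<open>auto simp: P.smult_l_distr\<close>)
    also have "\<dots> = (\<Oplus>\<^bsub>P\<^esub> x\<in>?A. \<iota> (f x) \<odot>\<^bsub>P\<^esub> h x) \<oplus>\<^bsub>P\<^esub> (\<Oplus>\<^bsub>P\<^esub> x\<in>?A. \<iota> (g x) \<odot>\<^bsub>P\<^esub> h x)"
      by (rule P.M.finsum_addf) (use tf in auto)
    also have "\<dots> = lin_ext R \<iota> P h f \<oplus>\<^bsub>P\<^esub> lin_ext R \<iota> P h g"
      using sup[OF fg(1) A(1) _ A(2)] sup[OF fg(2) A(1) _ A(2)] by auto
    finally show "lin_ext R \<iota> P h (f \<oplus>\<^bsub>free_module R Y\<^esub> g) =
      lin_ext R \<iota> P h f \<oplus>\<^bsub>P\<^esub> lin_ext R \<iota> P h g" .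
  next
    fix a f assume a: "a \<in> carrier R" and f: "f \<in> carrier (free_module R Y)"
    let ?A = "{x. f x \<noteq> \<zero>\<^bsub>R\<^esub>}"
    have A: "finite ?A" "?A \<subseteq> Y" using free_module_carrierD(2,4)[OF f] by blast+
    have c: "f x \<in> carrier R" for x using free_module_carrierD(1)[OF f] .
    have afc: "a \<odot>\<^bsub>free_module R Y\<^esub> f \<in> carrier (free_module R Y)"
      using a f by (rule F.smult_closed)
    have tf: "\<iota> (f x) \<odot>\<^bsub>P\<^esub> h x \<in> carrier P" "h x \<in> carrier P" if "x \<in> ?A" for x
      using tm[OF f] A(2) h that by blast+
    have "lin_ext R \<iota> P h (a \<odot>\<^bsub>free_module R Y\<^esub> f) =
        (\<Oplus>\<^bsub>P\<^esub> x\<in>?A. \<iota> ((a \<odot>\<^bsub>free_module R Y\<^esub> f) x) \<odot>\<^bsub>P\<^esub> h x)"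
      by (rule sup[OF afc A(1) _ A(2)]) (auto simp: a)
    also have "\<dots> = (\<Oplus>\<^bsub>P\<^esub> x\<in>?A. \<iota> a \<odot>\<^bsub>P\<^esub> (\<iota> (f x) \<odot>\<^bsub>P\<^esub> h x))"
      by (rule P.M.finsum_cong') (use a c tf in \<open>auto simp: P.smult_assoc1\<close>)
    also have "\<dots> = \<iota> a \<odot>\<^bsub>P\<^esub> lin_ext R \<iota> P h f"
      unfolding lin_ext_def by (rule P.finsum_smult[symmetric]) (use a tf in auto)
    finally show "lin_ext R \<iota> P h (a \<odot>\<^bsub>free_module R Y\<^esub> f) = \<iota> a \<odot>\<^bsub>P\<^esub> lin_ext R \<iota> P h f" .
  qed
qed

lemma lin_ext_gen:
  assumes R: "cring R" and P: "module S P" and \<iota>: "\<iota> \<in> ring_hom R S" and h: "h \<in> Y \<rightarrow> carrier P"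
    and x: "x \<in> Y"
  shows "lin_ext R \<iota> P h (free_gen R x) = h x"
proof -
  interpret R: cring R by (rule R)
  interpret P: module S P by (rule P)
  have "lin_ext R \<iota> P h (free_gen R x) = (\<Oplus>\<^bsub>P\<^esub> y\<in>{x}. \<iota> (free_gen R x y) \<odot>\<^bsub>P\<^esub> h y)"
    by (rule lin_ext_superset[OF R P \<iota> h free_gen_closed[OF R x]]) (use x in \<open>auto simp: free_gen_def\<close>)
  also have "\<dots> = h x"
    using h x ring_hom_one[OF \<iota>] by (auto simp: free_gen_def Pi_iff)
  finally show ?thesis .
qed

text \<open>\<open>free_map\<close> is given pointwise by sums over fibres, \<open>lin_ext\<close>
  as a sum of functions. Evaluation at \<open>y\<close> is linear, so it passes under the sum and
  turns each generator into the indicator of \<open>\<phi> x = y\<close>.\<close>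

lemma free_map_eq_lin_ext:
  assumes R: "cring R" and \<phi>: "\<phi> \<in> Y \<rightarrow> Y" and f: "f \<in> carrier (free_module R Y)"
  shows "free_map R \<phi> f = lin_ext R (\<lambda>a. a) (free_module R Y) (\<lambda>x. free_gen R (\<phi> x)) f"
proof
  fix y
  interpret R: cring R by (rule R)
  interpret F: module R "free_module R Y" by (rule free_module_module[OF R])
  let ?A = "{x. f x \<noteq> \<zero>\<^bsub>R\<^esub>}"
  have A: "finite ?A" "?A \<subseteq> Y" using free_module_carrierD(2,4)[OF f] by blast+
  have c: "f x \<in> carrier R" for x using free_module_carrierD(1)[OF f] .
  have "semilinear R R (\<lambda>a. a) (free_module R Y) (ring_as_module (\<lambda>a. a) R) (\<lambda>f. f y)"
  proof (rule semilinear.intro[OF F.module_axioms])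
    show "module R (ring_as_module (\<lambda>a. a) R)"
      by (rule ring_as_module_module[OF R R]) (simp add: ring_hom_def)
  qed (auto simp: ring_hom_def free_module_carrierD(1))
  then interpret ev: semilinear R R "\<lambda>a. a" "free_module R Y" "ring_as_module (\<lambda>a. a) R" "\<lambda>f. f y" .
  have "lin_ext R (\<lambda>a. a) (free_module R Y) (\<lambda>x. free_gen R (\<phi> x)) f y =
     (\<Oplus>\<^bsub>ring_as_module (\<lambda>a. a) R\<^esub> x\<in>?A. (f x \<odot>\<^bsub>free_module R Y\<^esub> free_gen R (\<phi> x)) y)"
    unfolding lin_ext_def
    by (rule ev.finsum[OF A(1)], rule Pi_I, intro F.smult_closed free_gen_closed[OF R] c)
      (use \<phi> A in blast)
  \<comment> \<open>Sums in the ring regarded as a module over itself are sums in the ring, both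
    having the same addition.\<close>
  also have "\<dots> = (\<Oplus>\<^bsub>R\<^esub> x\<in>?A. if y = \<phi> x then f x else \<zero>\<^bsub>R\<^esub>)"
    unfolding finsum_def finprod_def by (auto simp: ring_as_module_def free_gen_def c if_distrib cong: if_cong)
  also have "\<dots> = (\<Oplus>\<^bsub>R\<^esub> x\<in>{x. f x \<noteq> \<zero>\<^bsub>R\<^esub> \<and> \<phi> x = y}. f x)"
    by (rule R.add.finprod_mono_neutral_cong_right) (use A c in auto)
  finally show "free_map R \<phi> f y = lin_ext R (\<lambda>a. a) (free_module R Y) (\<lambda>x. free_gen R (\<phi> x)) f y"
    by (simp add: free_map_def)
qed


lemma free_map_semilinear:
  assumes R: "cring R" and \<phi>: "\<phi> \<in> Y \<rightarrow> Y"
  shows "semilinear R R (\<lambda>a. a) (free_module R Y) (free_module R Y) (free_map R \<phi>)"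
    and "x \<in> Y \<Longrightarrow> free_map R \<phi> (free_gen R x) = free_gen R (\<phi> x)"
proof -
  have F: "module R (free_module R Y)" by (rule free_module_module[OF R])
  have id: "(\<lambda>a. a) \<in> ring_hom R R" by (simp add: ring_hom_def)
  have h: "(\<lambda>x. free_gen R (\<phi> x)) \<in> Y \<rightarrow> carrier (free_module R Y)"
    by (rule Pi_I, rule free_gen_closed[OF R]) (use \<phi> in blast)
  interpret E: semilinear R R "\<lambda>a. a" "free_module R Y" "free_module R Y"
      "lin_ext R (\<lambda>a. a) (free_module R Y) (\<lambda>x. free_gen R (\<phi> x))"
    by (rule lin_ext_semilinear[OF R F id h])
  interpret F: module R "free_module R Y" by (rule F)
  show "semilinear R R (\<lambda>a. a) (free_module R Y) (free_module R Y) (free_map R \<phi>)"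
    by (rule semilinear.intro[OF F F id])
      (simp_all only: free_map_eq_lin_ext[OF R \<phi>] F.M.add.m_closed F.smult_closed E.closed E.add E.smult)
  show "free_map R \<phi> (free_gen R x) = free_gen R (\<phi> x)" if "x \<in> Y"
    using lin_ext_gen[OF R F id h that] free_map_eq_lin_ext[OF R \<phi> free_gen_closed[OF R that]] by simp
qed

text \<open>The equaliser of two semilinear maps is a submodule. Generation is asked for the single
  element \<open>x\<close>, so that any description of generators can be plugged in.\<close>

lemma (in semilinear) eq_on_generated:
  assumes g: "semilinear R S \<iota> M P g"
    and gen: "\<And>H. LinearCombinations.submodule R H M \<Longrightarrow> B \<subseteq> H \<Longrightarrow> x \<in> H"
    and eq: "\<And>b. b \<in> B \<Longrightarrow> f b = g b" and B: "B \<subseteq> carrier M"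
  shows "f x = g x"
proof -
  interpret g: semilinear R S \<iota> M P g by (rule g)
  interpret P: module S P by (rule cod)
  interpret M: module R M by (rule dom)
  have "LinearCombinations.submodule R {x \<in> carrier M. f x = g x} M"
    by (rule LinearCombinations.submodule.intro) (auto simp: dom add smult zero g.add g.smult g.zero)
  then show ?thesis using gen[of "{x \<in> carrier M. f x = g x}"] eq B by auto
qed

subsection \<open>Quotient modules\<close>

locale module_quotient = M: module R M + N: LinearCombinations.submodule R N M
  for R :: "('r, 'b) ring_scheme" and M :: "('r, 'm, 'c) module_scheme" and N :: "'m set"
begin

sublocale N: abelian_subgroup N M
proof (rule abelian_subgroupI3)
  show "additive_subgroup N M"
  proof (rule additive_subgroup.intro, rule M.M.add.subgroupI)
    show "\<And>a. a \<in> N \<Longrightarrow> \<ominus>\<^bsub>M\<^esub> a \<in> N"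
      using M.smult_minus_1 N.smult_closed N.subset by (metis M.R.a_inv_closed M.R.one_closed subsetD)
  qed (insert N.subset N.zero_closed, auto simp del: N.zero_closed)
qed (rule M.M.abelian_group_axioms)

abbreviation proj :: "'m \<Rightarrow> 'm set" where "proj x \<equiv> N +>\<^bsub>M\<^esub> x"


lemma Nsub: "subgroup N (add_monoid M)"
  by (rule N.a_subgroup)

lemma mem_proj: "x \<in> carrier M \<Longrightarrow> x \<in> proj x"
  by (rule N.a_rcos_self)

lemma mem_projD:
  assumes "y \<in> proj x" "x \<in> carrier M"
  shows "y \<in> carrier M" "y \<ominus>\<^bsub>M\<^esub> x \<in> N"
proof -
  obtain n where n: "n \<in> N" "y = n \<oplus>\<^bsub>M\<^esub> x"
    using assms(1) by (auto simp: a_r_coset_def')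
  have "n \<in> carrier M" using n(1) N.subset by blast
  then show "y \<in> carrier M" "y \<ominus>\<^bsub>M\<^esub> x \<in> N"
    using n assms(2) by (auto simp: a_minus_def M.M.a_assoc M.M.r_neg)
qed

lemma proj_eqI:
  assumes "x \<in> carrier M" "y \<in> carrier M" "y \<ominus>\<^bsub>M\<^esub> x \<in> N"
  shows "proj y = proj x"
proof -
  have "y = (y \<ominus>\<^bsub>M\<^esub> x) \<oplus>\<^bsub>M\<^esub> x" using assms by (simp add: a_minus_def M.M.a_assoc M.M.l_neg)
  then have "y \<in> proj x" using assms(3) by (auto simp: a_r_coset_def')
  then show ?thesis using M.M.a_repr_independence[OF _ assms(1) Nsub] by simp
qed

lemma proj_zero: "n \<in> N \<Longrightarrow> proj n = N"
  using M.M.a_coset_join2[OF _ Nsub] N.subset by blast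

text \<open>Scalar multiplication and induced maps on cosets are defined by a union over all
  representatives. As \<open>\<phi>\<close> respects differences and preserves \<open>N\<close>, the
  cosets in this union coincide.\<close>

lemma Union_proj:
  assumes \<phi>: "\<phi> \<in> carrier M \<rightarrow> carrier M"
    and minus: "\<And>x y. x \<in> carrier M \<Longrightarrow> y \<in> carrier M \<Longrightarrow> \<phi> y \<ominus>\<^bsub>M\<^esub> \<phi> x = \<phi> (y \<ominus>\<^bsub>M\<^esub> x)"
    and N: "\<And>n. n \<in> N \<Longrightarrow> \<phi> n \<in> N" and x: "x \<in> carrier M"
  shows "(\<Union>y\<in>proj x. proj (\<phi> y)) = proj (\<phi> x)"
proof -
  have "proj (\<phi> y) = proj (\<phi> x)" if "y \<in> proj x" for y
    using mem_projD[OF that x] \<phi> x minus N by (intro proj_eqI) auto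
  then show ?thesis using mem_proj[OF x] by blast
qed

abbreviation Q :: "('r, 'm set) module" where "Q \<equiv> quotient_module M N"

lemma carrier_Q: "carrier Q = proj ` carrier M"
  by (auto simp: quotient_module_def A_RCOSETS_def')

lemma zero_Q: "\<zero>\<^bsub>Q\<^esub> = proj \<zero>\<^bsub>M\<^esub>"
  using proj_zero[OF N.zero_closed] by (simp add: quotient_module_def)

lemma add_Q: "x \<in> carrier M \<Longrightarrow> y \<in> carrier M \<Longrightarrow> proj x \<oplus>\<^bsub>Q\<^esub> proj y = proj (x \<oplus>\<^bsub>M\<^esub> y)"
  by (simp add: quotient_module_def N.a_rcos_sum)

lemma smult_Q:
  assumes "a \<in> carrier R" "x \<in> carrier M"
  shows "a \<odot>\<^bsub>Q\<^esub> proj x = proj (a \<odot>\<^bsub>M\<^esub> x)"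
  unfolding quotient_module_def
  using assms by (simp add: Union_proj[of "\<lambda>x. a \<odot>\<^bsub>M\<^esub> x"] a_minus_def M.smult_r_distr M.smult_r_minus)

lemma module_Q: "module R Q"
proof (rule module_criteria[OF M.R.cring_axioms])
  show "\<forall>v\<in>carrier Q. \<exists>w\<in>carrier Q. v \<oplus>\<^bsub>Q\<^esub> w = \<zero>\<^bsub>Q\<^esub>"
  proof
    fix v assume "v \<in> carrier Q"
    then obtain x where x: "x \<in> carrier M" "v = proj x" by (auto simp: carrier_Q)
    then have "v \<oplus>\<^bsub>Q\<^esub> proj (\<ominus>\<^bsub>M\<^esub> x) = \<zero>\<^bsub>Q\<^esub>" by (simp add: add_Q zero_Q M.M.r_neg)
    then show "\<exists>w\<in>carrier Q. v \<oplus>\<^bsub>Q\<^esub> w = \<zero>\<^bsub>Q\<^esub>" using x by (auto simp: carrier_Q)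
  qed
qed (auto simp: carrier_Q add_Q smult_Q zero_Q M.M.a_ac M.smult_assoc1 M.smult_l_distr M.smult_r_distr)

lemma proj_semilinear: "semilinear R R (\<lambda>a. a) M Q proj"
  by (rule semilinear.intro[OF M.module_axioms module_Q])
    (auto simp: carrier_Q add_Q smult_Q ring_hom_def)

text \<open>Generation passes to the quotient because the preimage of a submodule under the
  projection is a submodule.\<close>

lemma quotient_generated:
  assumes "LinearCombinations.submodule R H Q" "proj x \<in> carrier Q"
    and "\<And>H'. LinearCombinations.submodule R H' M \<Longrightarrow> B \<subseteq> H' \<Longrightarrow> x \<in> H'"
    and "proj ` B \<subseteq> H" "B \<subseteq> carrier M"
  shows "proj x \<in> H"
proof -
  interpret H: LinearCombinations.submodule R H Q by (rule assms)
  have "LinearCombinations.submodule R {x \<in> carrier M. proj x \<in> H} M"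
    by (rule LinearCombinations.submodule.intro)
      (use H.zero_closed in \<open>auto simp: M.module_axioms zero_Q simp flip: add_Q smult_Q\<close>)
  then show ?thesis using assms(3)[of "{x \<in> carrier M. proj x \<in> H}"] assms(4,5) by auto
qed

text \<open>The induced map evaluates \<open>f\<close> at a chosen representative; two
  representatives differ by an element of \<open>N\<close>, where \<open>f\<close> vanishes.\<close>

lemma factor:
  assumes f: "semilinear R S \<iota> M P f" and ker: "\<And>n. n \<in> N \<Longrightarrow> f n = \<zero>\<^bsub>P\<^esub>"
  shows "\<exists>g. semilinear R S \<iota> Q P g \<and> (\<forall>x\<in>carrier M. g (proj x) = f x)"
proof -
  interpret f: semilinear R S \<iota> M P f by (rule f)
  interpret P: module S P by (rule f.cod)
  define g where "g A = f (SOME y. y \<in> A)" for A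
  have g: "g (proj x) = f x" if x: "x \<in> carrier M" for x
  proof -
    have "(SOME y. y \<in> proj x) \<in> proj x" by (rule someI[of _ x]) (rule mem_proj[OF x])
    note y = mem_projD[OF this x]
    have "f (SOME y. y \<in> proj x) \<ominus>\<^bsub>P\<^esub> f x = \<zero>\<^bsub>P\<^esub>"
      using f.minus[OF y(1) x] ker[OF y(2)] by simp
    then show ?thesis unfolding g_def
      using f.closed[OF x] f.closed[OF y(1)] by (simp add: P.M.minus_other_side)
  qed
  have "semilinear R S \<iota> Q P g"
    by (rule semilinear.intro[OF module_Q f.cod f.scal])
      (auto simp: carrier_Q add_Q smult_Q g f.closed f.add f.smult)
  then show ?thesis using g by blast
qed

lemma quotient_map_semilinear:
  assumes \<phi>: "semilinear R R (\<lambda>a. a) M M \<phi>" and N: "\<And>n. n \<in> N \<Longrightarrow> \<phi> n \<in> N"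
  shows "x \<in> carrier M \<Longrightarrow> quotient_map M N \<phi> (proj x) = proj (\<phi> x)"
    and "semilinear R R (\<lambda>a. a) Q Q (quotient_map M N \<phi>)"
proof -
  interpret \<phi>: semilinear R R "\<lambda>a. a" M M \<phi> by (rule \<phi>)
  show *: "quotient_map M N \<phi> (proj x) = proj (\<phi> x)" if "x \<in> carrier M" for x
    unfolding quotient_map_def using that N
    by (intro Union_proj) (auto simp: \<phi>.closed \<phi>.minus)
  show "semilinear R R (\<lambda>a. a) Q Q (quotient_map M N \<phi>)"
    by (rule semilinear.intro[OF module_Q module_Q \<phi>.scal])
      (auto simp: carrier_Q add_Q smult_Q * \<phi>.closed \<phi>.add \<phi>.smult)
qed

end

subsection \<open>Generators and relations\<close>

text \<open>The common frame of exterior powers and tensor products, both being quotients of a free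
  module on a set \<open>Y\<close> by the span of explicit relations.\<close>

locale presentation =
  fixes R :: "('r, 'b) ring_scheme" and Y :: "'x set" and rels :: "('x \<Rightarrow> 'r) set"
  assumes R: "cring R" and rels: "rels \<subseteq> carrier (free_module R Y)"
begin

abbreviation F :: "('r, 'x \<Rightarrow> 'r) module" where "F \<equiv> free_module R Y"
abbreviation N :: "('x \<Rightarrow> 'r) set" where "N \<equiv> module.span R F rels"

sublocale F: module R F by (rule free_module_module[OF R])

sublocale quot: module_quotient R F N
  by (intro module_quotient.intro F.module_axioms F.span_is_submodule rels)

definition gen :: "'x \<Rightarrow> ('x \<Rightarrow> 'r) set" where "gen x = quot.proj (free_gen R x)"

lemma gen_closed: "x \<in> Y \<Longrightarrow> gen x \<in> carrier quot.Q"
  unfolding gen_def quot.carrier_Q by (intro imageI free_gen_closed[OF R])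

lemma proj_rel: "r \<in> rels \<Longrightarrow> quot.proj r = \<zero>\<^bsub>quot.Q\<^esub>"
  using quot.proj_zero[of r] quot.proj_zero[OF quot.N.zero_closed] F.in_own_span[OF rels]
  by (auto simp: quot.zero_Q)

lemma generated:
  assumes H: "LinearCombinations.submodule R H quot.Q" and gen: "\<And>y. y \<in> Y \<Longrightarrow> gen y \<in> H"
    and A: "A \<in> carrier quot.Q"
  shows "A \<in> H"
proof -
  obtain f where f: "f \<in> carrier F" "A = quot.proj f" using A by (auto simp: quot.carrier_Q)
  have "quot.proj f \<in> H"
  proof (rule quot.quotient_generated[OF H, where B = "free_gen R ` Y"])
    show "f \<in> H'" if "LinearCombinations.submodule R H' F" "free_gen R ` Y \<subseteq> H'" for H'
      by (rule free_module_generated[OF R that(1) _ f(1)]) (use that(2) in blast)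
    show "free_gen R ` Y \<subseteq> carrier F" by (auto intro: free_gen_closed[OF R])
  qed (use A f gen in \<open>auto simp: gen_def\<close>)
  then show ?thesis using f(2) by simp
qed

lemma eq_on_gens:
  assumes "semilinear R S \<iota> quot.Q P f" "semilinear R S \<iota> quot.Q P g"
    and "\<And>y. y \<in> Y \<Longrightarrow> f (gen y) = g (gen y)" and "A \<in> carrier quot.Q"
  shows "f A = g A"
proof (rule semilinear.eq_on_generated[OF assms(1,2), where B = "gen ` Y"])
  show "A \<in> H" if "LinearCombinations.submodule R H quot.Q" "gen ` Y \<subseteq> H" for H
    by (rule generated[OF that(1) _ assms(4)]) (use that(2) in blast)
qed (use assms(3) gen_closed in auto)

lemma universal:
  assumes P: "module S P" and \<iota>: "\<iota> \<in> ring_hom R S" and h: "h \<in> Y \<rightarrow> carrier P"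
    and rel: "\<And>r. r \<in> rels \<Longrightarrow> lin_ext R \<iota> P h r = \<zero>\<^bsub>P\<^esub>"
  shows "\<exists>g. semilinear R S \<iota> quot.Q P g \<and> (\<forall>x\<in>Y. g (gen x) = h x)"
proof -
  interpret E: semilinear R S \<iota> F P "lin_ext R \<iota> P h" by (rule lin_ext_semilinear[OF R P \<iota> h])
  \<comment> \<open>The kernel of the extended map is a submodule that contains the relations, hence
    also their span.\<close>
  have "N \<subseteq> {x \<in> carrier F. lin_ext R \<iota> P h x = \<zero>\<^bsub>P\<^esub>}"
    by (rule F.span_is_subset[OF _ E.kernel_submodule]) (use rel rels in blast)
  then obtain g where "semilinear R S \<iota> quot.Q P g" "\<forall>x\<in>carrier F. g (quot.proj x) = lin_ext R \<iota> P h x"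
    using quot.factor[OF E.semilinear_axioms] by blast
  then show ?thesis
    by (intro exI[of _ g] conjI ballI) (auto simp: gen_def lin_ext_gen[OF R P \<iota> h] free_gen_closed[OF R])
qed

text \<open>Instead of writing the moved relation as a combination of relations, it suffices that
  the linear extension of \<open>gen \<circ> \<phi>\<close> kills it: this extension agrees on
  generators with the projection of \<open>free_map R \<phi>\<close>.\<close>

lemma map_rel:
  assumes \<phi>: "\<phi> \<in> Y \<rightarrow> Y" and r: "r \<in> carrier F"
    and 0: "lin_ext R (\<lambda>a. a) quot.Q (\<lambda>y. gen (\<phi> y)) r = \<zero>\<^bsub>quot.Q\<^esub>"
  shows "free_map R \<phi> r \<in> N"
proof -
  have id: "(\<lambda>a. a) \<in> ring_hom R R" by (simp add: ring_hom_def)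
  have h: "(\<lambda>y. gen (\<phi> y)) \<in> Y \<rightarrow> carrier quot.Q" using \<phi> gen_closed by blast
  note fm = free_map_semilinear[OF R \<phi>]
  interpret m: semilinear R R "\<lambda>a. a" F F "free_map R \<phi>" by (rule fm(1))
  have "(quot.proj \<circ> free_map R \<phi>) r = lin_ext R (\<lambda>a. a) quot.Q (\<lambda>y. gen (\<phi> y)) r"
  proof (rule semilinear.eq_on_generated[where B = "free_gen R ` Y"])
    show "semilinear R R (\<lambda>a. a) F quot.Q (quot.proj \<circ> free_map R \<phi>)"
      using m.comp[OF quot.proj_semilinear] by (simp add: comp_def)
    show "semilinear R R (\<lambda>a. a) F quot.Q (lin_ext R (\<lambda>a. a) quot.Q (\<lambda>y. gen (\<phi> y)))"
      by (rule lin_ext_semilinear[OF R quot.module_Q id h])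
    show "r \<in> H" if "LinearCombinations.submodule R H F" "free_gen R ` Y \<subseteq> H" for H
      by (rule free_module_generated[OF R that(1) _ r]) (use that(2) in blast)
    show "\<And>b. b \<in> free_gen R ` Y \<Longrightarrow>
        (quot.proj \<circ> free_map R \<phi>) b = lin_ext R (\<lambda>a. a) quot.Q (\<lambda>y. gen (\<phi> y)) b"
      by (auto simp: fm(2) gen_def[symmetric] lin_ext_gen[OF R quot.module_Q id h])
  qed (auto intro: free_gen_closed[OF R])
  then have "quot.proj (free_map R \<phi> r) = quot.proj \<zero>\<^bsub>F\<^esub>" using 0 by (simp add: quot.zero_Q)
  then have "quot.proj (free_map R \<phi> r) = N" using quot.proj_zero[OF quot.N.zero_closed] by simp
  \<comment> \<open>An element lies in its own coset, so an element with coset \<open>N\<close> lies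
    in \<open>N\<close>.\<close>
  then show ?thesis using quot.mem_proj[OF m.closed[OF r]] by simp
qed

lemma map_gens:
  assumes \<phi>: "\<phi> \<in> Y \<rightarrow> Y" and rel: "\<And>r. r \<in> rels \<Longrightarrow> free_map R \<phi> r \<in> N"
  shows "semilinear R R (\<lambda>a. a) quot.Q quot.Q (quotient_map F N (free_map R \<phi>))"
    and "x \<in> Y \<Longrightarrow> quotient_map F N (free_map R \<phi>) (gen x) = gen (\<phi> x)"
proof -
  note fm = free_map_semilinear[OF R \<phi>]
  interpret m: semilinear R R "\<lambda>a. a" F F "free_map R \<phi>" by (rule fm(1))
  have sub: "LinearCombinations.submodule R {x \<in> carrier F. free_map R \<phi> x \<in> N} F"
    by (rule LinearCombinations.submodule.intro)
      (use quot.N.zero_closed in \<open>auto simp: F.module_axioms m.zero m.add m.smult simp del: free_module_sel\<close>)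
  have "N \<subseteq> {x \<in> carrier F. free_map R \<phi> x \<in> N}"
    by (rule F.span_is_subset[OF _ sub]) (use rel rels in blast)
  then have N: "\<And>n. n \<in> N \<Longrightarrow> free_map R \<phi> n \<in> N" by blast
  show "semilinear R R (\<lambda>a. a) quot.Q quot.Q (quotient_map F N (free_map R \<phi>))"
    by (rule quot.quotient_map_semilinear(2)[OF fm(1) N])
  show "quotient_map F N (free_map R \<phi>) (gen x) = gen (\<phi> x)" if "x \<in> Y"
    unfolding gen_def using quot.quotient_map_semilinear(1)[OF fm(1) N free_gen_closed[OF R that]] fm(2)[OF that]
    by simp
qed

end

text \<open>An exterior power repeats carrier, zero, addition and scalar multiplication of a
  quotient module in a record with an additional action. This lemma and the next two move modules,
  maps and submodules between such records.\<close>

lemma module_cong: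
  assumes M: "module R M" and "carrier M' = carrier M" "\<zero>\<^bsub>M'\<^esub> = \<zero>\<^bsub>M\<^esub>" "add M' = add M" "smult M' = smult M"
  shows "module R M'"
proof -
  interpret M: module R M by (rule M)
  show ?thesis
    by (rule module_criteria[OF M.R.cring_axioms])
      (auto simp: assms(2-) M.M.a_ac M.smult_assoc1 M.smult_l_distr M.smult_r_distr
        intro: bexI[of _ "\<ominus>\<^bsub>M\<^esub> _"] M.M.r_neg M.M.a_inv_closed)
qed

lemma semilinear_cong_dom:
  assumes f: "semilinear R S \<iota> M P f"
    and M': "carrier M' = carrier M" "\<zero>\<^bsub>M'\<^esub> = \<zero>\<^bsub>M\<^esub>" "add M' = add M" "smult M' = smult M"
  shows "semilinear R S \<iota> M' P f"
proof -
  interpret f: semilinear R S \<iota> M P f by (rule f)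
  show ?thesis
    by (rule semilinear.intro[OF module_cong[OF f.dom M'] f.cod f.scal])
      (auto simp: M' f.closed f.add f.smult)
qed

lemma submodule_cong:
  assumes H: "LinearCombinations.submodule R H M"
    and M': "carrier M' = carrier M" "\<zero>\<^bsub>M'\<^esub> = \<zero>\<^bsub>M\<^esub>" "add M' = add M" "smult M' = smult M"
  shows "LinearCombinations.submodule R H M'"
proof -
  interpret H: LinearCombinations.submodule R H M by (rule H)
  show ?thesis
    by (rule LinearCombinations.submodule.intro[OF module_cong[OF H.module M']])
      (use H.subset H.zero_closed in \<open>auto simp: M'\<close>)
qed

section \<open>Exterior powers\<close>

lemma tuples_iff: "xs \<in> tuples k M \<longleftrightarrow> length xs = k \<and> set xs \<subseteq> carrier M"
  by (simp add: tuples_def)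

lemma tuples_update: "xs \<in> tuples k M \<Longrightarrow> x \<in> carrier M \<Longrightarrow> xs[i := x] \<in> tuples k M"
  using set_update_subset_insert[of xs i x] by (auto simp: tuples_iff)

lemma tuples_map: "xs \<in> tuples k M \<Longrightarrow> f \<in> carrier M \<rightarrow> carrier N \<Longrightarrow> map f xs \<in> tuples k N"
  by (auto simp: tuples_iff)

text \<open>Multilinearity is written with list updates: one place varies while the others stay
  fixed. The map \<open>\<iota>\<close> on scalars admits alternating maps from a lattice into a
  vector space. Vanishing on equal entries, rather than a change of sign, is the right condition in
  characteristic two.\<close>

locale alternating =
  fixes R :: "('r, 'b) ring_scheme" and \<iota> :: "'r \<Rightarrow> 's" and k :: nat
    and M :: "('r, 'm, 'c) module_scheme" and P :: "('s, 'p, 'e) module_scheme" and h :: "'m list \<Rightarrow> 'p"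
  assumes closed: "xs \<in> tuples k M \<Longrightarrow> h xs \<in> carrier P"
    and add: "xs \<in> tuples k M \<Longrightarrow> i < k \<Longrightarrow> x \<in> carrier M \<Longrightarrow> y \<in> carrier M \<Longrightarrow>
      h (xs[i := x \<oplus>\<^bsub>M\<^esub> y]) = h (xs[i := x]) \<oplus>\<^bsub>P\<^esub> h (xs[i := y])"
    and smult: "xs \<in> tuples k M \<Longrightarrow> i < k \<Longrightarrow> a \<in> carrier R \<Longrightarrow> x \<in> carrier M \<Longrightarrow>
      h (xs[i := a \<odot>\<^bsub>M\<^esub> x]) = \<iota> a \<odot>\<^bsub>P\<^esub> h (xs[i := x])"
    and alt: "xs \<in> tuples k M \<Longrightarrow> i < j \<Longrightarrow> j < k \<Longrightarrow> xs ! i = xs ! j \<Longrightarrow> h xs = \<zero>\<^bsub>P\<^esub>"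

lemma alternating_map:
  assumes h: "alternating S \<kappa> k N P h" and f: "semilinear R S \<iota> M N f"
  shows "alternating R (\<kappa> \<circ> \<iota>) k M P (h \<circ> map f)"
proof -
  interpret h: alternating S \<kappa> k N P h by (rule h)
  interpret f: semilinear R S \<iota> M N f by (rule f)
  have t: "map f xs \<in> tuples k N" if "xs \<in> tuples k M" for xs
    using that f.closed by (auto intro: tuples_map)
  show ?thesis
  proof
    fix xs i j assume xs: "xs \<in> tuples k M" and "i < j" "j < k" "xs ! i = xs ! j"
    then have "map f xs ! i = map f xs ! j" by (auto simp: tuples_iff)
    then show "(h \<circ> map f) xs = \<zero>\<^bsub>P\<^esub>"
      using h.alt[OF t[OF xs] \<open>i < j\<close> \<open>j < k\<close>] by simp
  qed (auto simp: t h.closed map_update f.add f.smult h.add h.smult f.closed f.scal_closed)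
qed

lemma alternating_comp:
  assumes h: "alternating R \<iota> k M P h" and g: "semilinear S T \<kappa> P Q g"
    and \<iota>: "\<iota> \<in> carrier R \<rightarrow> carrier S"
  shows "alternating R (\<kappa> \<circ> \<iota>) k M Q (g \<circ> h)"
proof -
  interpret h: alternating R \<iota> k M P h by (rule h)
  interpret g: semilinear S T \<kappa> P Q g by (rule g)
  show ?thesis
  proof
    fix xs i a x
    assume "xs \<in> tuples k M" "i < k" "a \<in> carrier R" "x \<in> carrier M"
    then show "(g \<circ> h) (xs[i := a \<odot>\<^bsub>M\<^esub> x]) = (\<kappa> \<circ> \<iota>) a \<odot>\<^bsub>Q\<^esub> (g \<circ> h) (xs[i := x])"
      using funcset_mem[OF \<iota>, of a] h.closed[OF tuples_update[of xs k M x i]] by (simp add: h.smult g.smult)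
  next
    fix xs i j assume "xs \<in> tuples k M" "i < j" "j < k" "xs ! i = xs ! j"
    from h.alt[OF this] show "(g \<circ> h) xs = \<zero>\<^bsub>Q\<^esub>" by (simp add: g.zero)
  qed (auto simp: h.closed h.add g.closed g.add tuples_update)
qed

locale exterior =
  fixes R :: "('r, 'b) ring_scheme" and M :: "('r, 'm, 'g, 'c) gmodule_scheme" and k :: nat
  assumes module: "module R M"
begin

sublocale M: module R M by (rule module)

lemma relations_closed: "exterior_relations R k M \<subseteq> carrier (free_module R (tuples k M))"
proof -
  have R: "cring R" ..
  interpret F: module R "free_module R (tuples k M)" by (rule free_module_module[OF R])
  have g: "free_gen R (xs[i := x]) \<in> carrier (free_module R (tuples k M))"
    if "xs \<in> tuples k M" "x \<in> carrier M" for xs i x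
    by (rule free_gen_closed[OF R tuples_update[OF that]])
  show ?thesis
    unfolding exterior_relations_def Let_def
    by (auto simp del: free_module_sel intro!: F.M.minus_closed F.M.a_closed F.smult_closed g free_gen_closed[OF R] tuples_update)
qed

sublocale pres: presentation R "tuples k M" "exterior_relations R k M"
  using relations_closed by (intro presentation.intro) unfold_locales

abbreviation E :: "('r, ('m list \<Rightarrow> 'r) set, 'g) gmodule" where "E \<equiv> exterior_power R k M"

definition wedge :: "'m list \<Rightarrow> ('m list \<Rightarrow> 'r) set" where "wedge = pres.gen"

lemma E_sel:
  "carrier E = carrier pres.quot.Q" "\<zero>\<^bsub>E\<^esub> = \<zero>\<^bsub>pres.quot.Q\<^esub>"
  "add E = add pres.quot.Q" "smult E = smult pres.quot.Q"
  by (simp_all add: exterior_power_def Let_def)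

lemma module_E: "module R E"
  by (rule module_cong[OF pres.quot.module_Q E_sel])

lemma wedge_closed: "xs \<in> tuples k M \<Longrightarrow> wedge xs \<in> carrier E"
  using pres.gen_closed by (simp add: E_sel wedge_def)

lemma generated:
  assumes "LinearCombinations.submodule R H E" "\<And>xs. xs \<in> tuples k M \<Longrightarrow> wedge xs \<in> H" "A \<in> carrier E"
  shows "A \<in> H"
proof (rule pres.generated)
  show "LinearCombinations.submodule R H pres.quot.Q"
    by (rule submodule_cong[OF assms(1)]) (simp_all add: E_sel)
qed (use assms in \<open>auto simp: wedge_def E_sel\<close>)

lemma eq_on_wedges:
  assumes "semilinear R S \<iota> E P f" "semilinear R S \<iota> E P g"
    and "\<And>xs. xs \<in> tuples k M \<Longrightarrow> f (wedge xs) = g (wedge xs)" and "A \<in> carrier E"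
  shows "f A = g A"
proof (rule semilinear.eq_on_generated[OF assms(1,2), where B = "wedge ` tuples k M"])
  show "A \<in> H" if "LinearCombinations.submodule R H E" "wedge ` tuples k M \<subseteq> H" for H
    by (rule generated[OF that(1) _ assms(4)]) (use that(2) in blast)
qed (use assms(3) wedge_closed in auto)

text \<open>Each of the three families of relations encodes one axiom of \<open>alternating\<close>;
  their vanishing is what the universal property of the presentation asks for.\<close>

lemma alternating_relations:
  assumes P: "module S P" and \<iota>: "\<iota> \<in> ring_hom R S" and h: "alternating R \<iota> k M P h"
    and r: "r \<in> exterior_relations R k M"
  shows "lin_ext R \<iota> P h r = \<zero>\<^bsub>P\<^esub>"
proof -
  interpret h: alternating R \<iota> k M P h by (rule h)
  interpret P: module S P by (rule P)
  have h': "h \<in> tuples k M \<rightarrow> carrier P" using h.closed by blast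
  note gen = lin_ext_gen[OF pres.R P \<iota> h']
  interpret L: semilinear R S \<iota> pres.F P "lin_ext R \<iota> P h" by (rule lin_ext_semilinear[OF pres.R P \<iota> h'])
  note [simp del] = free_module_sel
  have g: "free_gen R xs \<in> carrier pres.F" if "xs \<in> tuples k M" for xs
    by (rule free_gen_closed[OF pres.R that])
  consider xs i x y where "xs \<in> tuples k M" "i < k" "x \<in> carrier M" "y \<in> carrier M"
      "r = free_gen R (xs[i := x \<oplus>\<^bsub>M\<^esub> y]) \<ominus>\<^bsub>pres.F\<^esub> (free_gen R (xs[i := x]) \<oplus>\<^bsub>pres.F\<^esub> free_gen R (xs[i := y]))"
    | xs i a x where "xs \<in> tuples k M" "i < k" "a \<in> carrier R" "x \<in> carrier M"
      "r = free_gen R (xs[i := a \<odot>\<^bsub>M\<^esub> x]) \<ominus>\<^bsub>pres.F\<^esub> (a \<odot>\<^bsub>pres.F\<^esub> free_gen R (xs[i := x]))"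
    | xs i j where "xs \<in> tuples k M" "i < j" "j < k" "xs ! i = xs ! j" "r = free_gen R xs"
    using r unfolding exterior_relations_def Let_def by blast
  then show ?thesis
  proof cases
    case 1
    then show ?thesis
      by (simp add: L.minus L.add g gen tuples_update h.add h.closed P.M.r_neg a_minus_def[of P])
  next
    case 2
    then show ?thesis
      by (simp add: L.minus L.smult g gen tuples_update h.smult h.closed L.scal_closed P.M.r_neg a_minus_def[of P])
  next
    case 3
    then show ?thesis using h.alt[OF 3(1-4)] by (simp add: gen)
  qed
qed

text \<open>A relation projects to zero; written out for classes of generators, this is the
  corresponding axiom.\<close>

lemma wedge_alternating: "alternating R (\<lambda>a. a) k M E wedge"
proof
  interpret p: semilinear R R "\<lambda>a. a" pres.F pres.quot.Q pres.quot.proj by (rule pres.quot.proj_semilinear)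
  interpret Q: module R pres.quot.Q by (rule pres.quot.module_Q)
  note [simp del] = free_module_sel
  have g: "free_gen R xs \<in> carrier pres.F" if "xs \<in> tuples k M" for xs
    by (rule free_gen_closed[OF pres.R that])
  have z: "pres.quot.proj r = \<zero>\<^bsub>pres.quot.Q\<^esub>" if "r \<in> exterior_relations R k M" for r
    by (rule pres.proj_rel[OF that])
  show "wedge xs \<in> carrier E" if "xs \<in> tuples k M" for xs by (rule wedge_closed[OF that])
  show "wedge (xs[i := x \<oplus>\<^bsub>M\<^esub> y]) = wedge (xs[i := x]) \<oplus>\<^bsub>E\<^esub> wedge (xs[i := y])"
    if *: "xs \<in> tuples k M" "i < k" "x \<in> carrier M" "y \<in> carrier M" for xs i x y
  proof -
    have "free_gen R (xs[i := x \<oplus>\<^bsub>M\<^esub> y]) \<ominus>\<^bsub>pres.F\<^esub> (free_gen R (xs[i := x]) \<oplus>\<^bsub>pres.F\<^esub> free_gen R (xs[i := y]))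
        \<in> exterior_relations R k M"
      using * unfolding exterior_relations_def Let_def by blast
    from z[OF this] have "pres.gen (xs[i := x \<oplus>\<^bsub>M\<^esub> y]) \<ominus>\<^bsub>pres.quot.Q\<^esub>
        (pres.gen (xs[i := x]) \<oplus>\<^bsub>pres.quot.Q\<^esub> pres.gen (xs[i := y])) = \<zero>\<^bsub>pres.quot.Q\<^esub>"
      using * by (simp add: p.minus p.add g tuples_update pres.gen_def)
    then show ?thesis
      using * by (simp add: E_sel wedge_def pres.gen_closed tuples_update Q.M.minus_other_side)
  qed
  show "wedge (xs[i := a \<odot>\<^bsub>M\<^esub> x]) = a \<odot>\<^bsub>E\<^esub> wedge (xs[i := x])"
    if *: "xs \<in> tuples k M" "i < k" "a \<in> carrier R" "x \<in> carrier M" for xs i a x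
  proof -
    have "free_gen R (xs[i := a \<odot>\<^bsub>M\<^esub> x]) \<ominus>\<^bsub>pres.F\<^esub> (a \<odot>\<^bsub>pres.F\<^esub> free_gen R (xs[i := x]))
        \<in> exterior_relations R k M"
      using * unfolding exterior_relations_def Let_def by blast
    from z[OF this] have "pres.gen (xs[i := a \<odot>\<^bsub>M\<^esub> x]) \<ominus>\<^bsub>pres.quot.Q\<^esub>
        (a \<odot>\<^bsub>pres.quot.Q\<^esub> pres.gen (xs[i := x])) = \<zero>\<^bsub>pres.quot.Q\<^esub>"
      using * by (simp add: p.minus p.smult g tuples_update pres.gen_def)
    then show ?thesis
      using * by (simp add: E_sel wedge_def pres.gen_closed tuples_update Q.M.minus_other_side)
  qed
  show "wedge xs = \<zero>\<^bsub>E\<^esub>" if "xs \<in> tuples k M" "i < j" "j < k" "xs ! i = xs ! j" for xs i j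
  proof -
    have "free_gen R xs \<in> exterior_relations R k M"
      using that unfolding exterior_relations_def Let_def by blast
    from z[OF this] show ?thesis by (simp add: E_sel wedge_def pres.gen_def)
  qed
qed

lemma universal:
  assumes P: "module S P" and \<iota>: "\<iota> \<in> ring_hom R S" and h: "alternating R \<iota> k M P h"
  shows "\<exists>g. semilinear R S \<iota> E P g \<and> (\<forall>xs\<in>tuples k M. g (wedge xs) = h xs)"
proof -
  interpret h: alternating R \<iota> k M P h by (rule h)
  have "h \<in> tuples k M \<rightarrow> carrier P" using h.closed by blast
  from pres.universal[OF P \<iota> this alternating_relations[OF P \<iota> h]]
  obtain g where g: "semilinear R S \<iota> pres.quot.Q P g" "\<forall>xs\<in>tuples k M. g (pres.gen xs) = h xs" by blast
  show ?thesis
    using semilinear_cong_dom[OF g(1) E_sel] g(2) by (auto simp: wedge_def)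
qed

text \<open>The action on cosets is well defined because \<open>wedge\<close>, after the action has
  been applied to every entry, is again alternating and hence kills the relations.\<close>

lemma act_semilinear:
  assumes f: "semilinear R R (\<lambda>a. a) M M (act M g)"
  shows "semilinear R R (\<lambda>a. a) E E (act E g)"
    and "xs \<in> tuples k M \<Longrightarrow> act E g (wedge xs) = wedge (map (act M g) xs)"
proof -
  interpret f: semilinear R R "\<lambda>a. a" M M "act M g" by (rule f)
  have m: "map (act M g) \<in> tuples k M \<rightarrow> tuples k M" using f.closed by (auto intro: tuples_map)
  have id: "(\<lambda>a. a) \<in> ring_hom R R" by (simp add: ring_hom_def)
  have alt: "alternating R (\<lambda>a. a) k M E (wedge \<circ> map (act M g))"
    using alternating_map[OF wedge_alternating f] by (simp add: comp_def)
  have rel: "free_map R (map (act M g)) r \<in> pres.N" if r: "r \<in> exterior_relations R k M" for r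
  proof (rule pres.map_rel[OF m])
    show "r \<in> carrier pres.F" using r pres.rels by blast
    have "lin_ext R (\<lambda>a. a) E (wedge \<circ> map (act M g)) r = \<zero>\<^bsub>E\<^esub>"
      by (rule alternating_relations[OF module_E id alt r])
    \<comment> \<open>\<open>E\<close> and the quotient module share carrier, zero, addition and
      scalar multiplication, so both sides are the same sum.\<close>
    moreover have "lin_ext R (\<lambda>a. a) E (wedge \<circ> map (act M g)) r =
        lin_ext R (\<lambda>a. a) pres.quot.Q (wedge \<circ> map (act M g)) r"
      unfolding lin_ext_def finsum_def finprod_def by (simp add: E_sel)
    ultimately show "lin_ext R (\<lambda>a. a) pres.quot.Q (\<lambda>y. pres.gen (map (act M g) y)) r = \<zero>\<^bsub>pres.quot.Q\<^esub>"
      by (simp add: E_sel wedge_def comp_def)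
  qed
  have act: "act E g A = quotient_map pres.F pres.N (free_map R (map (act M g))) A"
    if "A \<in> carrier E" for A
    using that by (simp add: exterior_power_def Let_def)
  interpret q: semilinear R R "\<lambda>a. a" pres.quot.Q pres.quot.Q
      "quotient_map pres.F pres.N (free_map R (map (act M g)))"
    by (rule pres.map_gens(1)[OF m rel])
  interpret Q: module R pres.quot.Q by (rule pres.quot.module_Q)
  show "semilinear R R (\<lambda>a. a) E E (act E g)"
    by (rule semilinear.intro[OF module_E module_E id])
      (simp_all add: act, simp_all add: E_sel q.closed q.add q.smult act)
  show "act E g (wedge xs) = wedge (map (act M g) xs)" if "xs \<in> tuples k M"
    using pres.map_gens(2)[OF m rel that] act[OF wedge_closed[OF that]] by (simp add: wedge_def)
qed

end

section \<open>Extension of scalars\<close>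

text \<open>Bilinear maps whose target may be a module over another ring, reached along
  \<open>\<kappa>\<close>.\<close>

locale balanced =
  fixes R :: "('r, 'b) ring_scheme" and \<kappa> :: "'r \<Rightarrow> 't" and A :: "('r, 'x, 'c) module_scheme"
    and M :: "('r, 'm, 'd) module_scheme" and P :: "('t, 'p, 'e) module_scheme" and h :: "'x \<times> 'm \<Rightarrow> 'p"
  assumes closed: "x \<in> carrier A \<Longrightarrow> y \<in> carrier M \<Longrightarrow> h (x, y) \<in> carrier P"
    and add_left: "x \<in> carrier A \<Longrightarrow> x' \<in> carrier A \<Longrightarrow> y \<in> carrier M \<Longrightarrow>
      h (x \<oplus>\<^bsub>A\<^esub> x', y) = h (x, y) \<oplus>\<^bsub>P\<^esub> h (x', y)"
    and add_right: "x \<in> carrier A \<Longrightarrow> y \<in> carrier M \<Longrightarrow> y' \<in> carrier M \<Longrightarrow>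
      h (x, y \<oplus>\<^bsub>M\<^esub> y') = h (x, y) \<oplus>\<^bsub>P\<^esub> h (x, y')"
    and smult_left: "a \<in> carrier R \<Longrightarrow> x \<in> carrier A \<Longrightarrow> y \<in> carrier M \<Longrightarrow>
      h (a \<odot>\<^bsub>A\<^esub> x, y) = \<kappa> a \<odot>\<^bsub>P\<^esub> h (x, y)"
    and smult_right: "a \<in> carrier R \<Longrightarrow> x \<in> carrier A \<Longrightarrow> y \<in> carrier M \<Longrightarrow>
      h (x, a \<odot>\<^bsub>M\<^esub> y) = \<kappa> a \<odot>\<^bsub>P\<^esub> h (x, y)"

locale tensor_product =
  fixes R :: "('r, 'b) ring_scheme" and A :: "('r, 'x, 'c) module_scheme" and M :: "('r, 'm, 'd) module_scheme"
  assumes modA: "module R A" and modM: "module R M"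
begin

sublocale A: module R A by (rule modA)
sublocale M: module R M by (rule modM)

lemma relations_closed: "tensor_relations R A M \<subseteq> carrier (free_module R (carrier A \<times> carrier M))"
proof -
  have R: "cring R" ..
  interpret F: module R "free_module R (carrier A \<times> carrier M)" by (rule free_module_module[OF R])
  show ?thesis
    unfolding tensor_relations_def Let_def
    by (auto simp del: free_module_sel
        intro!: F.M.minus_closed F.M.a_closed F.smult_closed free_gen_closed[OF R])
qed

sublocale pres: presentation R "carrier A \<times> carrier M" "tensor_relations R A M"
  using relations_closed by (intro presentation.intro) unfold_locales

lemma balanced_relations:
  assumes P: "module T P" and \<kappa>: "\<kappa> \<in> ring_hom R T" and h: "balanced R \<kappa> A M P h"
    and r: "r \<in> tensor_relations R A M"
  shows "lin_ext R \<kappa> P h r = \<zero>\<^bsub>P\<^esub>"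
proof -
  interpret h: balanced R \<kappa> A M P h by (rule h)
  interpret P: module T P by (rule P)
  have h': "h \<in> carrier A \<times> carrier M \<rightarrow> carrier P" using h.closed by auto
  note gen = lin_ext_gen[OF pres.R P \<kappa> h']
  interpret L: semilinear R T \<kappa> pres.F P "lin_ext R \<kappa> P h" by (rule lin_ext_semilinear[OF pres.R P \<kappa> h'])
  note [simp del] = free_module_sel
  have g: "free_gen R (x, y) \<in> carrier pres.F" if "x \<in> carrier A" "y \<in> carrier M" for x y
    by (rule free_gen_closed[OF pres.R]) (use that in simp)
  show ?thesis
    using r unfolding tensor_relations_def Let_def
    by (elim UnE CollectE exE conjE)
      (simp_all add: L.minus L.add L.smult g gen h.add_left h.add_right h.smult_left h.smult_right
        h.closed L.scal_closed P.M.r_neg a_minus_def[of P])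
qed

lemma gen_balanced: "balanced R (\<lambda>a. a) A M pres.quot.Q pres.gen"
proof -
  interpret p: semilinear R R "\<lambda>a. a" pres.F pres.quot.Q pres.quot.proj by (rule pres.quot.proj_semilinear)
  interpret Q: module R pres.quot.Q by (rule pres.quot.module_Q)
  note [simp del] = free_module_sel
  have g: "free_gen R (x, y) \<in> carrier pres.F" if "x \<in> carrier A" "y \<in> carrier M" for x y
    by (rule free_gen_closed[OF pres.R]) (use that in simp)
  have c: "pres.gen (x, y) \<in> carrier pres.quot.Q" if "x \<in> carrier A" "y \<in> carrier M" for x y
    by (rule pres.gen_closed) (use that in simp)
  have z: "pres.quot.proj (u \<ominus>\<^bsub>pres.F\<^esub> v) = \<zero>\<^bsub>pres.quot.Q\<^esub> \<Longrightarrow> u \<in> carrier pres.F \<Longrightarrow> v \<in> carrier pres.F \<Longrightarrow>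
      pres.quot.proj u = pres.quot.proj v" for u v
    using p.minus[of u v] p.closed[of u] p.closed[of v] by (simp add: Q.M.minus_other_side)
  show ?thesis
  proof
    fix x x' y assume *: "x \<in> carrier A" "x' \<in> carrier A" "y \<in> carrier M"
    have "free_gen R (x \<oplus>\<^bsub>A\<^esub> x', y) \<ominus>\<^bsub>pres.F\<^esub> (free_gen R (x, y) \<oplus>\<^bsub>pres.F\<^esub> free_gen R (x', y))
        \<in> tensor_relations R A M"
      using * unfolding tensor_relations_def Let_def by blast
    from z[OF pres.proj_rel[OF this]] * show "pres.gen (x \<oplus>\<^bsub>A\<^esub> x', y) =
        pres.gen (x, y) \<oplus>\<^bsub>pres.quot.Q\<^esub> pres.gen (x', y)"
      by (simp add: p.add g pres.gen_def)
  next
    fix x y y' assume *: "x \<in> carrier A" "y \<in> carrier M" "y' \<in> carrier M"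
    have "free_gen R (x, y \<oplus>\<^bsub>M\<^esub> y') \<ominus>\<^bsub>pres.F\<^esub> (free_gen R (x, y) \<oplus>\<^bsub>pres.F\<^esub> free_gen R (x, y'))
        \<in> tensor_relations R A M"
      using * unfolding tensor_relations_def Let_def by blast
    from z[OF pres.proj_rel[OF this]] * show "pres.gen (x, y \<oplus>\<^bsub>M\<^esub> y') =
        pres.gen (x, y) \<oplus>\<^bsub>pres.quot.Q\<^esub> pres.gen (x, y')"
      by (simp add: p.add g pres.gen_def)
  next
    fix a x y assume *: "a \<in> carrier R" "x \<in> carrier A" "y \<in> carrier M"
    have "free_gen R (a \<odot>\<^bsub>A\<^esub> x, y) \<ominus>\<^bsub>pres.F\<^esub> (a \<odot>\<^bsub>pres.F\<^esub> free_gen R (x, y)) \<in> tensor_relations R A M"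
      using * unfolding tensor_relations_def Let_def by blast
    from z[OF pres.proj_rel[OF this]] *
    show "pres.gen (a \<odot>\<^bsub>A\<^esub> x, y) = a \<odot>\<^bsub>pres.quot.Q\<^esub> pres.gen (x, y)"
      by (simp add: p.smult g pres.gen_def)
    have "free_gen R (x, a \<odot>\<^bsub>M\<^esub> y) \<ominus>\<^bsub>pres.F\<^esub> (a \<odot>\<^bsub>pres.F\<^esub> free_gen R (x, y)) \<in> tensor_relations R A M"
      using * unfolding tensor_relations_def Let_def by blast
    from z[OF pres.proj_rel[OF this]] *
    show "pres.gen (x, a \<odot>\<^bsub>M\<^esub> y) = a \<odot>\<^bsub>pres.quot.Q\<^esub> pres.gen (x, y)"
      by (simp add: p.smult g pres.gen_def)
  qed (rule c)
qed

text \<open>A map of pairs induces a map of tensor products as soon as its composite with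
  \<open>pres.gen\<close> is balanced.\<close>

lemma map_gens:
  assumes \<phi>: "\<phi> \<in> carrier A \<times> carrier M \<rightarrow> carrier A \<times> carrier M"
    and bal: "balanced R (\<lambda>a. a) A M pres.quot.Q (\<lambda>z. pres.gen (\<phi> z))"
  shows "semilinear R R (\<lambda>a. a) pres.quot.Q pres.quot.Q (quotient_map pres.F pres.N (free_map R \<phi>))"
    and "z \<in> carrier A \<times> carrier M \<Longrightarrow> quotient_map pres.F pres.N (free_map R \<phi>) (pres.gen z) = pres.gen (\<phi> z)"
proof -
  have id: "(\<lambda>a. a) \<in> ring_hom R R" by (simp add: ring_hom_def)
  have rel: "free_map R \<phi> r \<in> pres.N" if r: "r \<in> tensor_relations R A M" for r
    by (rule pres.map_rel[OF \<phi> _ balanced_relations[OF pres.quot.module_Q id bal r]])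
      (use r pres.rels in blast)
  show "semilinear R R (\<lambda>a. a) pres.quot.Q pres.quot.Q (quotient_map pres.F pres.N (free_map R \<phi>))"
    by (rule pres.map_gens(1)[OF \<phi> rel])
  show "z \<in> carrier A \<times> carrier M \<Longrightarrow> quotient_map pres.F pres.N (free_map R \<phi>) (pres.gen z) = pres.gen (\<phi> z)"
    by (rule pres.map_gens(2)[OF \<phi> rel])
qed

end

text \<open>Two structures live on one set: \<open>Q\<close> is the tensor product over
  \<open>R\<close>, and \<open>U\<close> has the same carrier and addition but scalars from
  \<open>S\<close>. Generation by pure tensors is an \<open>R\<close>-statement about
  \<open>Q\<close> that has to be carried over to \<open>U\<close>.\<close>

locale scalar_extension =
  fixes R :: "('r, 'b) ring_scheme" and S :: "('s, 'd) ring_scheme" and \<iota> :: "'r \<Rightarrow> 's"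
    and M :: "('r, 'm, 'g, 'c) gmodule_scheme"
  assumes module: "module R M" and cringS: "cring S" and \<iota>: "\<iota> \<in> ring_hom R S"
begin

sublocale S: cring S by (rule cringS)

sublocale tp: tensor_product R "ring_as_module \<iota> S" M
  by (intro tensor_product.intro module ring_as_module_module[OF _ cringS \<iota>] module.axioms(1)[OF module])

sublocale bal: balanced R "\<lambda>a. a" "ring_as_module \<iota> S" M tp.pres.quot.Q tp.pres.gen
  by (rule tp.gen_balanced)

abbreviation U :: "('s, ('s \<times> 'm \<Rightarrow> 'r) set, 'g) gmodule" where "U \<equiv> extend_scalars R S \<iota> M"
abbreviation Q :: "('r, ('s \<times> 'm \<Rightarrow> 'r) set) module" where "Q \<equiv> tp.pres.quot.Q"

sublocale Q: module R Q by (rule tp.pres.quot.module_Q)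

definition tens :: "'s \<Rightarrow> 'm \<Rightarrow> ('s \<times> 'm \<Rightarrow> 'r) set" where "tens s m = tp.pres.gen (s, m)"

lemma U_sel:
  "carrier U = carrier Q" "\<zero>\<^bsub>U\<^esub> = \<zero>\<^bsub>Q\<^esub>" "add U = add Q"
  "smult U s = quotient_map tp.pres.F tp.pres.N (free_map R (\<lambda>(s', m). (s \<otimes>\<^bsub>S\<^esub> s', m)))"
  by (simp_all add: extend_scalars_def Let_def)

lemma tens_closed: "s \<in> carrier S \<Longrightarrow> m \<in> carrier M \<Longrightarrow> tens s m \<in> carrier U"
  using bal.closed by (simp add: tens_def U_sel)

lemma \<iota>_closed: "a \<in> carrier R \<Longrightarrow> \<iota> a \<in> carrier S"
  by (rule ring_hom_closed[OF \<iota>])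

text \<open>Multiplication of the first factor by \<open>s\<close> is balanced, since
  \<open>S\<close> is commutative, and so it descends to the tensor product.\<close>

lemma smult_U:
  assumes s: "s \<in> carrier S"
  shows "semilinear R R (\<lambda>a. a) Q Q (smult U s)"
    and "t \<in> carrier S \<Longrightarrow> m \<in> carrier M \<Longrightarrow> s \<odot>\<^bsub>U\<^esub> tens t m = tens (s \<otimes>\<^bsub>S\<^esub> t) m"
proof -
  have \<phi>: "(\<lambda>(s', m). (s \<otimes>\<^bsub>S\<^esub> s', m)) \<in> carrier (ring_as_module \<iota> S) \<times> carrier M \<rightarrow>
      carrier (ring_as_module \<iota> S) \<times> carrier M"
    using s by auto
  have b: "balanced R (\<lambda>a. a) (ring_as_module \<iota> S) M Q (\<lambda>z. tp.pres.gen ((\<lambda>(s', m). (s \<otimes>\<^bsub>S\<^esub> s', m)) z))"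
  proof
    fix a x y assume "a \<in> carrier R" "x \<in> carrier (ring_as_module \<iota> S)" "y \<in> carrier M"
    then show "tp.pres.gen (case (a \<odot>\<^bsub>ring_as_module \<iota> S\<^esub> x, y) of (s', m) \<Rightarrow> (s \<otimes>\<^bsub>S\<^esub> s', m)) =
        a \<odot>\<^bsub>Q\<^esub> tp.pres.gen (case (x, y) of (s', m) \<Rightarrow> (s \<otimes>\<^bsub>S\<^esub> s', m))"
      using s bal.smult_left[of a "s \<otimes>\<^bsub>S\<^esub> x" y] by (simp add: \<iota>_closed S.m_lcomm)
  qed (use s bal.closed bal.add_left bal.add_right bal.smult_right in \<open>auto simp: S.r_distr\<close>)
  show "semilinear R R (\<lambda>a. a) Q Q (smult U s)"
    using tp.map_gens(1)[OF \<phi> b] by (simp add: U_sel)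
  show "s \<odot>\<^bsub>U\<^esub> tens t m = tens (s \<otimes>\<^bsub>S\<^esub> t) m" if "t \<in> carrier S" "m \<in> carrier M"
    using tp.map_gens(2)[OF \<phi> b, of "(t, m)"] that by (simp add: U_sel tens_def)
qed

lemma generated_Q:
  assumes "LinearCombinations.submodule R H Q"
    and "\<And>s m. s \<in> carrier S \<Longrightarrow> m \<in> carrier M \<Longrightarrow> tens s m \<in> H" and "u \<in> carrier U"
  shows "u \<in> H"
  by (rule tp.pres.generated[OF assms(1)]) (use assms in \<open>auto simp: tens_def U_sel\<close>)

lemma eq_on_tens:
  assumes f: "semilinear R T \<kappa> Q P f" and g: "semilinear R T \<kappa> Q P g"
    and eq: "\<And>s m. s \<in> carrier S \<Longrightarrow> m \<in> carrier M \<Longrightarrow> f (tens s m) = g (tens s m)" and u: "u \<in> carrier U"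
  shows "f u = g u"
  by (rule tp.pres.eq_on_gens[OF f g]) (use eq u in \<open>auto simp: tens_def U_sel\<close>)

lemma tens_add_left:
  "s \<in> carrier S \<Longrightarrow> t \<in> carrier S \<Longrightarrow> m \<in> carrier M \<Longrightarrow> tens (s \<oplus>\<^bsub>S\<^esub> t) m = tens s m \<oplus>\<^bsub>U\<^esub> tens t m"
  using bal.add_left[of s t m] by (simp add: tens_def U_sel)

lemma tens_add_right:
  "s \<in> carrier S \<Longrightarrow> m \<in> carrier M \<Longrightarrow> n \<in> carrier M \<Longrightarrow> tens s (m \<oplus>\<^bsub>M\<^esub> n) = tens s m \<oplus>\<^bsub>U\<^esub> tens s n"
  using bal.add_right[of s m n] by (simp add: tens_def U_sel)

lemma tens_smult_right:
  "a \<in> carrier R \<Longrightarrow> s \<in> carrier S \<Longrightarrow> m \<in> carrier M \<Longrightarrow> tens s (a \<odot>\<^bsub>M\<^esub> m) = tens (\<iota> a \<otimes>\<^bsub>S\<^esub> s) m"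
  using bal.smult_right[of a s m] bal.smult_left[of a s m] by (simp add: tens_def)

lemma tens_smult_left:
  "a \<in> carrier R \<Longrightarrow> s \<in> carrier S \<Longrightarrow> m \<in> carrier M \<Longrightarrow> tens (\<iota> a \<otimes>\<^bsub>S\<^esub> s) m = a \<odot>\<^bsub>Q\<^esub> tens s m"
  using bal.smult_left[of a s m] by (simp add: tens_def)

declare ring_as_module_sel [simp del]

text \<open>Associativity, the unit law and distributivity over sums of scalars are checked on pure
  tensors; both sides are \<open>R\<close>-linear in the vector.\<close>

lemma module_U: "module S U"
proof (rule module_criteria[OF cringS])
  have sm: "semilinear R R (\<lambda>a. a) Q Q (smult U s)" if "s \<in> carrier S" for s by (rule smult_U(1)[OF that])
  note sc = semilinear.closed[OF sm] and sa = semilinear.add[OF sm] and ss = semilinear.smult[OF sm]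
    and sz = semilinear.zero[OF sm]
  have cc: "semilinear R R (\<lambda>a. a) Q Q (\<lambda>u. a \<odot>\<^bsub>U\<^esub> (b \<odot>\<^bsub>U\<^esub> u))" if "a \<in> carrier S" "b \<in> carrier S" for a b
    using semilinear.comp[OF sm[OF that(2)] sm[OF that(1)]] by (simp add: comp_def)
  have ident: "semilinear R R (\<lambda>a. a) Q Q (\<lambda>u. u)"
    by (rule semilinear.intro[OF Q.module_axioms Q.module_axioms]) (auto simp: ring_hom_def)
  show "\<forall>v\<in>carrier U. \<exists>w\<in>carrier U. v \<oplus>\<^bsub>U\<^esub> w = \<zero>\<^bsub>U\<^esub>"
    unfolding U_sel using Q.M.r_neg Q.M.a_inv_closed by blast
  show "\<forall>a b v. a \<in> carrier S \<and> b \<in> carrier S \<and> v \<in> carrier U \<longrightarrow> (a \<otimes>\<^bsub>S\<^esub> b) \<odot>\<^bsub>U\<^esub> v = a \<odot>\<^bsub>U\<^esub> (b \<odot>\<^bsub>U\<^esub> v)"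
  proof (intro allI impI)
    fix a b v assume *: "a \<in> carrier S \<and> b \<in> carrier S \<and> v \<in> carrier U"
    then have ab: "a \<in> carrier S" "b \<in> carrier S" "a \<otimes>\<^bsub>S\<^esub> b \<in> carrier S" and v: "v \<in> carrier U" by auto
    show "(a \<otimes>\<^bsub>S\<^esub> b) \<odot>\<^bsub>U\<^esub> v = a \<odot>\<^bsub>U\<^esub> (b \<odot>\<^bsub>U\<^esub> v)"
      by (rule eq_on_tens[OF sm[OF ab(3)] cc[OF ab(1,2)] _ v]) (simp add: smult_U(2) S.m_assoc ab)
  qed
  show "\<forall>v\<in>carrier U. \<one>\<^bsub>S\<^esub> \<odot>\<^bsub>U\<^esub> v = v"
    by (rule ballI, rule eq_on_tens[OF sm[OF S.one_closed] ident]) (auto simp: smult_U(2))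
  show "\<forall>a b v. a \<in> carrier S \<and> b \<in> carrier S \<and> v \<in> carrier U \<longrightarrow>
      (a \<oplus>\<^bsub>S\<^esub> b) \<odot>\<^bsub>U\<^esub> v = (a \<odot>\<^bsub>U\<^esub> v) \<oplus>\<^bsub>U\<^esub> (b \<odot>\<^bsub>U\<^esub> v)"
  proof (intro allI impI)
    fix a b v assume *: "a \<in> carrier S \<and> b \<in> carrier S \<and> v \<in> carrier U"
    then have ab: "a \<in> carrier S" "b \<in> carrier S" "a \<oplus>\<^bsub>S\<^esub> b \<in> carrier S" by auto
    have "v \<in> {v \<in> carrier Q. (a \<oplus>\<^bsub>S\<^esub> b) \<odot>\<^bsub>U\<^esub> v = (a \<odot>\<^bsub>U\<^esub> v) \<oplus>\<^bsub>Q\<^esub> (b \<odot>\<^bsub>U\<^esub> v)}" (is "v \<in> ?H")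
    proof (rule generated_Q)
      show "LinearCombinations.submodule R ?H Q"
        by (rule LinearCombinations.submodule.intro[OF Q.module_axioms])
          (use ab in \<open>auto simp: sc sa ss sz Q.M.a_ac Q.smult_r_distr\<close>)
      show "tens s m \<in> ?H" if "s \<in> carrier S" "m \<in> carrier M" for s m
        using ab that tens_closed[OF that] tens_add_left[of "a \<otimes>\<^bsub>S\<^esub> s" "b \<otimes>\<^bsub>S\<^esub> s" m]
        by (simp add: smult_U(2) S.l_distr U_sel(1,3))
    qed (use * in blast)
    then show "(a \<oplus>\<^bsub>S\<^esub> b) \<odot>\<^bsub>U\<^esub> v = (a \<odot>\<^bsub>U\<^esub> v) \<oplus>\<^bsub>U\<^esub> (b \<odot>\<^bsub>U\<^esub> v)" by (simp add: U_sel(3))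
  qed
  show "\<forall>c v. c \<in> carrier S \<and> v \<in> carrier U \<longrightarrow> c \<odot>\<^bsub>U\<^esub> v \<in> carrier U"
    using sc by (simp add: U_sel(1))
  show "\<forall>a v w. a \<in> carrier S \<and> v \<in> carrier U \<and> w \<in> carrier U \<longrightarrow>
      a \<odot>\<^bsub>U\<^esub> (v \<oplus>\<^bsub>U\<^esub> w) = (a \<odot>\<^bsub>U\<^esub> v) \<oplus>\<^bsub>U\<^esub> (a \<odot>\<^bsub>U\<^esub> w)"
    using sa by (simp add: U_sel(1,3))
qed (auto simp: U_sel(1-3) Q.M.a_ac)

sublocale U: module S U by (rule module_U)

lemma smult_Q_U:
  assumes a: "a \<in> carrier R" and u: "u \<in> carrier U"
  shows "a \<odot>\<^bsub>Q\<^esub> u = \<iota> a \<odot>\<^bsub>U\<^esub> u"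
proof (rule eq_on_tens[OF _ smult_U(1)[OF \<iota>_closed[OF a]] _ u])
  show "semilinear R R (\<lambda>a. a) Q Q (smult Q a)"
    by (rule semilinear.intro[OF Q.module_axioms Q.module_axioms])
      (use a in \<open>auto simp: ring_hom_def Q.smult_r_distr Q.smult_assoc1[symmetric] tp.A.R.m_comm\<close>)
  show "a \<odot>\<^bsub>Q\<^esub> tens s m = \<iota> a \<odot>\<^bsub>U\<^esub> tens s m" if "s \<in> carrier S" "m \<in> carrier M" for s m
    using a that by (simp add: smult_U(2) \<iota>_closed tens_smult_left)
qed

lemma smult_tens_one: "s \<in> carrier S \<Longrightarrow> m \<in> carrier M \<Longrightarrow> s \<odot>\<^bsub>U\<^esub> tens \<one>\<^bsub>S\<^esub> m = tens s m"
  by (simp add: smult_U(2))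

text \<open>An \<open>S\<close>-submodule is closed under scalars of \<open>R\<close>, which act
  through \<open>\<iota>\<close>, and \<open>tens s m\<close> is \<open>s\<close> times
  \<open>tens \<one> m\<close>.\<close>

lemma generated:
  assumes H: "LinearCombinations.submodule S H U"
    and t: "\<And>m. m \<in> carrier M \<Longrightarrow> tens \<one>\<^bsub>S\<^esub> m \<in> H" and u: "u \<in> carrier U"
  shows "u \<in> H"
proof (rule generated_Q[OF _ _ u])
  interpret H: LinearCombinations.submodule S H U by (rule H)
  show "LinearCombinations.submodule R H Q"
  proof (rule LinearCombinations.submodule.intro[OF Q.module_axioms])
    show "\<And>c v. c \<in> carrier R \<Longrightarrow> v \<in> H \<Longrightarrow> c \<odot>\<^bsub>Q\<^esub> v \<in> H"
      using smult_Q_U[OF _ subsetD[OF H.subset]] H.smult_closed[OF \<iota>_closed] by simp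
  qed (use H.subset H.m_closed H.zero_closed in \<open>auto simp: U_sel(1-3)\<close>)
  show "tens s m \<in> H" if "s \<in> carrier S" "m \<in> carrier M" for s m
    using H.smult_closed[OF that(1) t[OF that(2)]] smult_tens_one[OF that] by simp
qed

lemma eq_on_tens_one:
  assumes f: "semilinear S T \<kappa> U P f" and g: "semilinear S T \<kappa> U P g"
    and eq: "\<And>m. m \<in> carrier M \<Longrightarrow> f (tens \<one>\<^bsub>S\<^esub> m) = g (tens \<one>\<^bsub>S\<^esub> m)" and u: "u \<in> carrier U"
  shows "f u = g u"
proof (rule semilinear.eq_on_generated[OF f g, where B = "tens \<one>\<^bsub>S\<^esub> ` carrier M"])
  show "u \<in> H" if "LinearCombinations.submodule S H U" "tens \<one>\<^bsub>S\<^esub> ` carrier M \<subseteq> H" for H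
    by (rule generated[OF that(1) _ u]) (use that(2) in blast)
qed (auto simp: eq tens_closed)

text \<open>For fixed \<open>s\<close>, the vectors on which \<open>f\<close> commutes with
  \<open>s\<close> form an \<open>R\<close>-submodule, and the pure tensors belong to it.\<close>

lemma semilinear_over_S:
  assumes P: "module S P" and f: "semilinear R S \<iota> Q P f"
    and lin: "\<And>s t m. s \<in> carrier S \<Longrightarrow> t \<in> carrier S \<Longrightarrow> m \<in> carrier M \<Longrightarrow>
      f (tens (s \<otimes>\<^bsub>S\<^esub> t) m) = s \<odot>\<^bsub>P\<^esub> f (tens t m)"
  shows "semilinear S S (\<lambda>a. a) U P f"
proof (rule semilinear.intro[OF module_U P])
  interpret P: module S P by (rule P)
  interpret f: semilinear R S \<iota> Q P f by (rule f)
  show "f (s \<odot>\<^bsub>U\<^esub> u) = s \<odot>\<^bsub>P\<^esub> f u" if s: "s \<in> carrier S" and u: "u \<in> carrier U" for s u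
  proof -
    interpret s: semilinear R R "\<lambda>a. a" Q Q "smult U s" by (rule smult_U(1)[OF s])
    have "u \<in> {u \<in> carrier Q. f (s \<odot>\<^bsub>U\<^esub> u) = s \<odot>\<^bsub>P\<^esub> f u}" (is "u \<in> ?H")
    proof (rule generated_Q[OF _ _ u])
      have "s \<odot>\<^bsub>P\<^esub> (\<iota> a \<odot>\<^bsub>P\<^esub> x) = \<iota> a \<odot>\<^bsub>P\<^esub> (s \<odot>\<^bsub>P\<^esub> x)" if "a \<in> carrier R" "x \<in> carrier P" for a x
        using that s by (simp add: P.smult_assoc1[symmetric] S.m_comm \<iota>_closed)
      then show "LinearCombinations.submodule R ?H Q"
        by (intro LinearCombinations.submodule.intro[OF Q.module_axioms])
          (use s in \<open>auto simp: s.closed s.add s.smult s.zero f.closed f.add f.smult f.zero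
            P.smult_r_distr\<close>)
      show "tens t m \<in> ?H" if "t \<in> carrier S" "m \<in> carrier M" for t m
        using lin[OF s that] tens_closed[OF that] smult_U(2)[OF s that] by (simp add: U_sel(1))
    qed
    then show ?thesis by blast
  qed
  show "(\<lambda>a. a) \<in> ring_hom S S" by (simp add: ring_hom_def)
qed (use semilinear.closed[OF f] semilinear.add[OF f] in \<open>simp_all add: U_sel(1,3)\<close>)

text \<open>The adjunction between extension and restriction of scalars. Below it turns coordinate
  functionals and endomorphisms of a module into those of its extension.\<close>

lemma universal:
  assumes P: "module S P" and f: "semilinear R S \<iota> M P f"
  shows "\<exists>g. semilinear S S (\<lambda>a. a) U P g \<and> (\<forall>s\<in>carrier S. \<forall>m\<in>carrier M. g (tens s m) = s \<odot>\<^bsub>P\<^esub> f m)"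
proof -
  interpret P: module S P by (rule P)
  interpret f: semilinear R S \<iota> M P f by (rule f)
  let ?h = "\<lambda>(s, m). s \<odot>\<^bsub>P\<^esub> f m"
  have comm: "s \<odot>\<^bsub>P\<^esub> (\<iota> a \<odot>\<^bsub>P\<^esub> x) = \<iota> a \<odot>\<^bsub>P\<^esub> (s \<odot>\<^bsub>P\<^esub> x)"
    if "a \<in> carrier R" "x \<in> carrier P" "s \<in> carrier S" for a s x
    using that by (simp add: P.smult_assoc1[symmetric] S.m_comm \<iota>_closed)
  have "balanced R \<iota> (ring_as_module \<iota> S) M P ?h"
    by (rule balanced.intro)
      (auto simp: f.closed f.add f.smult P.smult_l_distr P.smult_r_distr P.smult_assoc1 \<iota>_closed comm
        ring_as_module_sel)
  note rel = tp.balanced_relations[OF P \<iota> this]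
  have "?h \<in> carrier (ring_as_module \<iota> S) \<times> carrier M \<rightarrow> carrier P"
    by (auto simp: f.closed ring_as_module_sel)
  from tp.pres.universal[OF P \<iota> this rel]
  obtain g where g: "semilinear R S \<iota> Q P g"
    "\<forall>z\<in>carrier (ring_as_module \<iota> S) \<times> carrier M. g (tp.pres.gen z) = ?h z" by blast
  have gt: "g (tens s m) = s \<odot>\<^bsub>P\<^esub> f m" if "s \<in> carrier S" "m \<in> carrier M" for s m
    using g(2) that by (simp add: tens_def ring_as_module_sel)
  have "semilinear S S (\<lambda>a. a) U P g"
    by (rule semilinear_over_S[OF P g(1)]) (simp add: gt P.smult_assoc1 f.closed)
  then show ?thesis using gt by blast
qed

lemma semilinear_tens_one: "semilinear R S \<iota> M U (tens \<one>\<^bsub>S\<^esub>)"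
  by (rule semilinear.intro[OF module module_U \<iota>])
    (simp_all add: tens_closed tens_add_right tens_smult_right smult_U(2) \<iota>_closed)

lemma act_tens:
  assumes f: "semilinear R R (\<lambda>a. a) M M (act M g)"
  shows "semilinear S S (\<lambda>a. a) U U (act U g)"
    and "s \<in> carrier S \<Longrightarrow> m \<in> carrier M \<Longrightarrow> act U g (tens s m) = tens s (act M g m)"
proof -
  interpret f: semilinear R R "\<lambda>a. a" M M "act M g" by (rule f)
  have \<phi>: "(\<lambda>(s', m). (s', act M g m)) \<in> carrier (ring_as_module \<iota> S) \<times> carrier M \<rightarrow>
      carrier (ring_as_module \<iota> S) \<times> carrier M"
    using f.closed by auto
  have b: "balanced R (\<lambda>a. a) (ring_as_module \<iota> S) M Q (\<lambda>z. tp.pres.gen ((\<lambda>(s', m). (s', act M g m)) z))"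
    by (rule balanced.intro)
      (use bal.closed bal.add_left bal.add_right bal.smult_left bal.smult_right
        in \<open>auto simp: f.closed f.add f.smult\<close>)
  let ?q = "quotient_map tp.pres.F tp.pres.N (free_map R (\<lambda>(s', m). (s', act M g m)))"
  interpret q: semilinear R R "\<lambda>a. a" Q Q ?q by (rule tp.map_gens(1)[OF \<phi> b])
  have act: "act U g u = ?q u" if "u \<in> carrier U" for u
    using that by (simp add: extend_scalars_def Let_def ring_as_module_sel(1))
  show *: "act U g (tens s m) = tens s (act M g m)" if "s \<in> carrier S" "m \<in> carrier M" for s m
    using tp.map_gens(2)[OF \<phi> b, of "(s, m)"] that act[OF tens_closed[OF that]]
    by (simp add: tens_def ring_as_module_sel(1))
  have "semilinear R S \<iota> Q U (act U g)"
    by (rule semilinear.intro[OF Q.module_axioms module_U \<iota>])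
      (use act q.closed q.add q.smult Q.smult_closed in \<open>simp_all add: smult_Q_U[symmetric] U_sel(1,3)\<close>)
  then show "semilinear S S (\<lambda>a. a) U U (act U g)"
    by (rule semilinear_over_S[OF module_U]) (simp add: * smult_U(2) f.closed)
qed

end

section \<open>Free modules and forms\<close>

abbreviation (input) self_module :: "('r, 'b) ring_scheme \<Rightarrow> ('r, 'r) module"
  where "self_module R \<equiv> ring_as_module (\<lambda>a. a) R"

lemma id_ring_hom: "(\<lambda>a. a) \<in> ring_hom R R"
  by (simp add: ring_hom_def)

lemma self_module_module: "cring R \<Longrightarrow> module R (self_module R)"
  by (rule ring_as_module_module[OF _ _ id_ring_hom])

context module
begin

lemma lincomb_unique:
  assumes B: "finite B" "B \<subseteq> carrier M" "lin_indpt B"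
    and a: "a \<in> B \<rightarrow> carrier R" "a' \<in> B \<rightarrow> carrier R" and eq: "lincomb a B = lincomb a' B" and b: "b \<in> B"
  shows "a b = a' b"
proof -
  have "lincomb (\<lambda>v. a v \<ominus>\<^bsub>R\<^esub> a' v) B = \<zero>\<^bsub>M\<^esub>"
    using lincomb_diff[OF B(1,2) a] eq B(2) a by (simp add: M.r_neg a_minus_def)
  moreover have "(\<lambda>v. a v \<ominus>\<^bsub>R\<^esub> a' v) \<in> B \<rightarrow> carrier R" using a by (auto intro: R.minus_closed)
  ultimately have "a b \<ominus>\<^bsub>R\<^esub> a' b = \<zero>\<^bsub>R\<^esub>" using B(1,3) b unfolding lin_dep_def by blast
  then show ?thesis using a b by (simp add: funcset_mem)
qed

text \<open>The dual basis. Coefficients are chosen for each vector, and their uniqueness makes the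
  choice additive and homogeneous.\<close>

lemma coordinates_exist:
  assumes B: "finite B" "B \<subseteq> carrier M" "lin_indpt B" "span B = carrier M"
  obtains c where "\<And>b. b \<in> B \<Longrightarrow> semilinear R R (\<lambda>a. a) M (self_module R) (c b)"
    and "\<And>b b'. b \<in> B \<Longrightarrow> b' \<in> B \<Longrightarrow> c b b' = (if b = b' then \<one>\<^bsub>R\<^esub> else \<zero>\<^bsub>R\<^esub>)"
    and "\<And>x. x \<in> carrier M \<Longrightarrow> x = (\<Oplus>\<^bsub>M\<^esub> b\<in>B. c b x \<odot>\<^bsub>M\<^esub> b)"
proof -
  define a where "a x = (SOME a. a \<in> B \<rightarrow> carrier R \<and> lincomb a B = x)" for x
  have a: "a x \<in> B \<rightarrow> carrier R" "lincomb (a x) B = x" if "x \<in> carrier M" for x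
    using someI_ex[OF finite_in_span[OF B(1,2), of x]] that B(4) unfolding a_def by auto
  have eq: "a x b = a' b" if "a' \<in> B \<rightarrow> carrier R" "lincomb a' B = x" "b \<in> B" "x \<in> carrier M" for a' x b
    by (rule lincomb_unique[OF B(1-3)]) (use that a in auto)
  show thesis
  proof (rule that[of "\<lambda>b x. a x b"])
    fix b assume b: "b \<in> B"
    have Rc: "a x b' \<in> carrier R" if "x \<in> carrier M" "b' \<in> B" for x b' using a(1)[OF that(1)] that(2) by blast
    show "semilinear R R (\<lambda>a. a) M (self_module R) (\<lambda>x. a x b)"
    proof (rule semilinear.intro[OF module_axioms self_module_module[OF R.cring_axioms] id_ring_hom])
      show "a x b \<in> carrier (self_module R)" if "x \<in> carrier M" for x using Rc[OF that b] by simp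
      show "a (x \<oplus>\<^bsub>M\<^esub> y) b = a x b \<oplus>\<^bsub>self_module R\<^esub> a y b" if "x \<in> carrier M" "y \<in> carrier M" for x y
        using eq[of "\<lambda>v. a x v \<oplus>\<^bsub>R\<^esub> a y v" "x \<oplus>\<^bsub>M\<^esub> y" b] lincomb_sum[OF B(1,2) a(1)[OF that(1)] a(1)[OF that(2)]]
          a[OF that(1)] a[OF that(2)] that b Rc by (simp add: Pi_iff)
      show "a (r \<odot>\<^bsub>M\<^esub> x) b = r \<odot>\<^bsub>self_module R\<^esub> a x b" if "r \<in> carrier R" "x \<in> carrier M" for r x
        using eq[of "\<lambda>v. r \<otimes>\<^bsub>R\<^esub> a x v" "r \<odot>\<^bsub>M\<^esub> x" b] lincomb_smult[OF B(2) a(1)[OF that(2)] that(1)]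
          a[OF that(2)] that b Rc by (simp add: Pi_iff)
    qed
  next
    fix b b' assume b: "b \<in> B" "b' \<in> B"
    have "lincomb (\<lambda>v. if v = b' then \<one>\<^bsub>R\<^esub> else \<zero>\<^bsub>R\<^esub>) B = b'"
    proof -
      have "(\<Oplus>\<^bsub>M\<^esub> v\<in>B. (if v = b' then \<one>\<^bsub>R\<^esub> else \<zero>\<^bsub>R\<^esub>) \<odot>\<^bsub>M\<^esub> v) = (\<Oplus>\<^bsub>M\<^esub> v\<in>B. if b' = v then v else \<zero>\<^bsub>M\<^esub>)"
        by (rule M.finsum_cong') (use B(2) in auto)
      also have "\<dots> = b'" using M.add.finprod_singleton[OF b(2) B(1), of "\<lambda>v. v"] B(2) by auto
      finally show ?thesis by (simp add: lincomb_def)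
    qed
    then show "a b' b = (if b = b' then \<one>\<^bsub>R\<^esub> else \<zero>\<^bsub>R\<^esub>)"
      using eq[of "\<lambda>v. if v = b' then \<one>\<^bsub>R\<^esub> else \<zero>\<^bsub>R\<^esub>" b' b] b B(2) by auto
  next
    fix x assume "x \<in> carrier M"
    then show "x = (\<Oplus>\<^bsub>M\<^esub> b\<in>B. a x b \<odot>\<^bsub>M\<^esub> b)" using a(2) by (simp add: lincomb_def)
  qed
qed

text \<open>A lattice comes with a finite generating set and, separately, with a basis. Each
  generator involves finitely many basis vectors, and a basis vector beyond all of these would be a
  combination of the others.\<close>

lemma finite_basis_of_finite_span:
  assumes A: "finite A" "A \<subseteq> carrier M" "span A = carrier M"
    and B: "B \<subseteq> carrier M" "lin_indpt B" "span B = carrier M" and nontriv: "\<one>\<^bsub>R\<^esub> \<noteq> \<zero>\<^bsub>R\<^esub>"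
  shows "finite B"
proof -
  have "\<exists>B'. finite B' \<and> B' \<subseteq> B \<and> x \<in> span B'" if "x \<in> A" for x
  proof -
    have "x \<in> span B" using that A B(3) by blast
    then obtain a B' where "finite B'" "B' \<subseteq> B" "a \<in> B' \<rightarrow> carrier R" "x = lincomb a B'"
      unfolding span_def by blast
    then show ?thesis unfolding span_def by blast
  qed
  then obtain f where f: "\<And>x. x \<in> A \<Longrightarrow> finite (f x) \<and> f x \<subseteq> B \<and> x \<in> span (f x)" by metis
  let ?C = "\<Union> (f ` A)"
  have C: "finite ?C" "?C \<subseteq> B" using f A(1) by auto
  have "A \<subseteq> span ?C"
  proof
    fix x assume x: "x \<in> A"
    then have "f x \<subseteq> ?C" by blast
    then show "x \<in> span ?C" using span_is_monotone[of "f x" ?C] f[OF x] by blast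
  qed
  then have "carrier M \<subseteq> span ?C"
    using span_is_subset[OF _ span_is_submodule[of ?C], of A] C(2) B(1) A(3) by blast
  have "B \<subseteq> ?C"
  proof (rule ccontr)
    assume "\<not> B \<subseteq> ?C"
    then obtain b where b: "b \<in> B" "b \<notin> ?C" by blast
    have bM: "b \<in> carrier M" and CM: "?C \<subseteq> carrier M" using b(1) B(1) C(2) by blast+
    obtain a where a: "a \<in> ?C \<rightarrow> carrier R" "lincomb a ?C = b"
      using finite_in_span[OF C(1) CM, of b] \<open>carrier M \<subseteq> span ?C\<close> bM by blast
    have fin: "finite (insert b ?C)" and sub: "insert b ?C \<subseteq> carrier M" using C CM bM by auto
    \<comment> \<open>The two expressions of \<open>b\<close> over \<open>insert b ?C\<close>:
      coefficient one at \<open>b\<close> and zero elsewhere, or coefficient zero at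
      \<open>b\<close> and those of \<open>a\<close> elsewhere.\<close>
    have ib: "(\<lambda>v. if v = b then \<one>\<^bsub>R\<^esub> else \<zero>\<^bsub>R\<^esub>) \<in> insert b ?C \<rightarrow> carrier R" by auto
    have ia: "(\<lambda>v. if v = b then \<zero>\<^bsub>R\<^esub> else a v) \<in> insert b ?C \<rightarrow> carrier R" using a(1) by auto
    have z: "lincomb (\<lambda>v. if v = b then \<zero>\<^bsub>R\<^esub> else a v) (insert b ?C) = b"
    proof -
      have "lincomb (\<lambda>v. if v = b then \<zero>\<^bsub>R\<^esub> else a v) (insert b ?C) =
          \<zero>\<^bsub>R\<^esub> \<odot>\<^bsub>M\<^esub> b \<oplus>\<^bsub>M\<^esub> lincomb (\<lambda>v. if v = b then \<zero>\<^bsub>R\<^esub> else a v) ?C"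
        using lincomb_insert[OF C(1) CM _ b(2) bM, of "\<lambda>v. if v = b then \<zero>\<^bsub>R\<^esub> else a v"] ia by simp
      also have "lincomb (\<lambda>v. if v = b then \<zero>\<^bsub>R\<^esub> else a v) ?C = lincomb a ?C"
        by (rule lincomb_cong[OF refl CM]) (use b(2) a(1) in auto)
      finally show ?thesis using a(2) bM by simp
    qed
    have o: "lincomb (\<lambda>v. if v = b then \<one>\<^bsub>R\<^esub> else \<zero>\<^bsub>R\<^esub>) (insert b ?C) = b"
    proof -
      have "lincomb (\<lambda>v. if v = b then \<one>\<^bsub>R\<^esub> else \<zero>\<^bsub>R\<^esub>) (insert b ?C) =
          \<one>\<^bsub>R\<^esub> \<odot>\<^bsub>M\<^esub> b \<oplus>\<^bsub>M\<^esub> lincomb (\<lambda>v. if v = b then \<one>\<^bsub>R\<^esub> else \<zero>\<^bsub>R\<^esub>) ?C"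
        using lincomb_insert[OF C(1) CM _ b(2) bM, of "\<lambda>v. if v = b then \<one>\<^bsub>R\<^esub> else \<zero>\<^bsub>R\<^esub>"] by simp
      also have "lincomb (\<lambda>v. if v = b then \<one>\<^bsub>R\<^esub> else \<zero>\<^bsub>R\<^esub>) ?C = lincomb (\<lambda>v. \<zero>\<^bsub>R\<^esub>) ?C"
        by (rule lincomb_cong[OF refl CM]) (use b(2) in auto)
      also have "\<dots> = \<zero>\<^bsub>M\<^esub>" unfolding lincomb_def
        by (rule M.finsum_all0) (use CM in auto)
      finally show ?thesis using bM by simp
    qed
    have li: "lin_indpt (insert b ?C)" by (rule subset_li_is_li[OF B(2)]) (use b(1) C(2) in blast)
    have "(if b = b then \<one>\<^bsub>R\<^esub> else \<zero>\<^bsub>R\<^esub>) = (if b = b then \<zero>\<^bsub>R\<^esub> else a b)"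
      using lincomb_unique[OF fin sub li ib ia, of b] z o by simp
    then show False using nontriv by simp
  qed
  then show ?thesis using C(1) finite_subset by blast
qed

lemma smult_cancel:
  assumes "field R" "a \<in> carrier R" "a \<noteq> \<zero>\<^bsub>R\<^esub>" "x \<in> carrier M" "y \<in> carrier M" "a \<odot>\<^bsub>M\<^esub> x = a \<odot>\<^bsub>M\<^esub> y"
  shows "x = y"
proof -
  interpret field R by (rule assms)
  have inv: "inv\<^bsub>R\<^esub> a \<in> carrier R" "inv\<^bsub>R\<^esub> a \<otimes>\<^bsub>R\<^esub> a = \<one>\<^bsub>R\<^esub>"
    using assms(2,3) field_Units by auto
  have "(inv\<^bsub>R\<^esub> a \<otimes>\<^bsub>R\<^esub> a) \<odot>\<^bsub>M\<^esub> x = (inv\<^bsub>R\<^esub> a \<otimes>\<^bsub>R\<^esub> a) \<odot>\<^bsub>M\<^esub> y"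
    using assms inv(1) by (simp add: smult_assoc1)
  then show ?thesis unfolding inv(2) smult_one[OF assms(4)] smult_one[OF assms(5)] .
qed

end

text \<open>\<open>P b t\<close> is meant as: \<open>t\<close> is a denominator for
  \<open>b\<close>. Stability under multiples lets the product of finitely many denominators serve
  all elements.\<close>

lemma (in domain) common_multiple:
  assumes "finite B" and "\<And>b. b \<in> B \<Longrightarrow> \<exists>t\<in>carrier R - {\<zero>}. P b t"
    and "\<And>b s t. b \<in> B \<Longrightarrow> s \<in> carrier R - {\<zero>} \<Longrightarrow> t \<in> carrier R - {\<zero>} \<Longrightarrow> P b t \<Longrightarrow> P b (s \<otimes> t)"
  shows "\<exists>t\<in>carrier R - {\<zero>}. \<forall>b\<in>B. P b t"
  using assms
proof (induction rule: finite_induct)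
  case empty
  then show ?case using one_closed one_not_zero by blast
next
  case (insert b B)
  obtain t where t: "t \<in> carrier R - {\<zero>}" "\<forall>b\<in>B. P b t"
    using insert.IH insert.prems by blast
  obtain s where s: "s \<in> carrier R - {\<zero>}" "P b s" using insert.prems(1) by blast
  have "s \<otimes> t \<in> carrier R - {\<zero>}" using s t integral by auto
  moreover have "\<forall>b\<in>B. P b (s \<otimes> t)" using insert.prems(2) s t by blast
  moreover have "P b (s \<otimes> t)"
    using insert.prems(2)[of b t s] s t by (simp add: m_comm)
  ultimately show ?case by blast
qed

section \<open>Fields of fractions and full lattices in a vector space\<close>

locale fraction_field = R: domain R + K: field K
  for R :: "('r, 'b) ring_scheme" and K :: "('k, 'd) ring_scheme" and \<iota> :: "'r \<Rightarrow> 'k" +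
  assumes fof: "field_of_fractions R K \<iota>"
begin

lemma \<iota>_hom: "\<iota> \<in> ring_hom R K" and \<iota>_inj: "inj_on \<iota> (carrier R)"
  using fof by (auto simp: field_of_fractions_def)

sublocale \<iota>: ring_hom_cring R K \<iota>
  by unfold_locales (rule \<iota>_hom)

lemma \<iota>_eq_zero_iff: "a \<in> carrier R \<Longrightarrow> \<iota> a = \<zero>\<^bsub>K\<^esub> \<longleftrightarrow> a = \<zero>\<^bsub>R\<^esub>"
  using inj_onD[OF \<iota>_inj, of a "\<zero>\<^bsub>R\<^esub>"] by auto

lemma fraction:
  assumes "x \<in> carrier K"
  obtains a b where "a \<in> carrier R" "b \<in> carrier R" "b \<noteq> \<zero>\<^bsub>R\<^esub>" "\<iota> b \<otimes>\<^bsub>K\<^esub> x = \<iota> a"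
proof -
  obtain a b where ab: "a \<in> carrier R" "b \<in> carrier R - {\<zero>\<^bsub>R\<^esub>}" "x = \<iota> a \<otimes>\<^bsub>K\<^esub> inv\<^bsub>K\<^esub> (\<iota> b)"
    using fof assms unfolding field_of_fractions_def by blast
  have u: "\<iota> b \<in> Units K" using ab(2) \<iota>_eq_zero_iff K.field_Units by auto
  have "\<iota> b \<otimes>\<^bsub>K\<^esub> x = \<iota> a \<otimes>\<^bsub>K\<^esub> (\<iota> b \<otimes>\<^bsub>K\<^esub> inv\<^bsub>K\<^esub> (\<iota> b))"
    using ab u by (simp add: K.m_lcomm)
  also have "\<dots> = \<iota> a" using u ab(1) by simp
  finally show thesis using that ab by blast
qed

end

text \<open>A form seen as a full lattice inside \<open>V\<close>: by \<open>denom\<close> every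
  vector has a nonzero multiple in the lattice. Together with injectivity this stands for the
  isomorphism of \<open>K \<otimes> M\<close> with \<open>V\<close>, and all comparisons are made
  inside \<open>V\<close>.\<close>

locale form_embedding = fraction_field R K \<iota> + M: module R M + V: module K V
  for R :: "('r, 'b) ring_scheme" and K :: "('k, 'd) ring_scheme" and \<iota> :: "'r \<Rightarrow> 'k"
    and M :: "('r, 'm, 'c) module_scheme" and V :: "('k, 'v, 'e) module_scheme" +
  fixes i :: "'m \<Rightarrow> 'v"
  assumes semilin: "semilinear R K \<iota> M V i" and inj: "inj_on i (carrier M)"
    and denom: "x \<in> carrier V \<Longrightarrow> \<exists>t\<in>carrier R - {\<zero>\<^bsub>R\<^esub>}. \<exists>m\<in>carrier M. \<iota> t \<odot>\<^bsub>V\<^esub> x = i m"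
begin

sublocale i: semilinear R K \<iota> M V i by (rule semilin)

lemma cancel:
  "module K P \<Longrightarrow> t \<in> carrier R \<Longrightarrow> t \<noteq> \<zero>\<^bsub>R\<^esub> \<Longrightarrow> x \<in> carrier P \<Longrightarrow> y \<in> carrier P \<Longrightarrow>
    \<iota> t \<odot>\<^bsub>P\<^esub> x = \<iota> t \<odot>\<^bsub>P\<^esub> y \<Longrightarrow> x = y"
  by (rule module.smult_cancel[of K P "\<iota> t"]) (auto simp: \<iota>_eq_zero_iff K.field_axioms)

text \<open>The span contains all lattice vectors, and any vector is a lattice vector divided by a
  denominator.\<close>

lemma image_generates:
  assumes A: "A \<subseteq> carrier M" "M.span A = carrier M"
  shows "V.span (i ` A) = carrier V"
proof
  have iA: "i ` A \<subseteq> carrier V" using A i.closed by blast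
  interpret sp: LinearCombinations.submodule K "V.span (i ` A)" V by (rule V.span_is_submodule[OF iA])
  show "V.span (i ` A) \<subseteq> carrier V" by (rule sp.subset)
  have "LinearCombinations.submodule R {m \<in> carrier M. i m \<in> V.span (i ` A)} M"
    by (rule LinearCombinations.submodule.intro[OF M.module_axioms])
      (use sp.zero_closed in \<open>auto simp: i.add i.smult i.zero\<close>)
  then have "M.span A \<subseteq> {m \<in> carrier M. i m \<in> V.span (i ` A)}"
    by (rule M.span_is_subset[rotated]) (use A(1) V.in_own_span[OF iA] in auto)
  then have im: "i m \<in> V.span (i ` A)" if "m \<in> carrier M" for m using that A(2) by blast
  show "carrier V \<subseteq> V.span (i ` A)"
  proof
    fix x assume x: "x \<in> carrier V"
    obtain t m where t: "t \<in> carrier R - {\<zero>\<^bsub>R\<^esub>}" "m \<in> carrier M" "\<iota> t \<odot>\<^bsub>V\<^esub> x = i m" using denom[OF x] by blast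
    have u: "\<iota> t \<in> Units K" using t(1) \<iota>_eq_zero_iff K.field_Units by auto
    have "x = inv\<^bsub>K\<^esub> (\<iota> t) \<odot>\<^bsub>V\<^esub> (\<iota> t \<odot>\<^bsub>V\<^esub> x)"
      using u x t(1) by (simp add: V.smult_assoc1[symmetric])
    then show "x \<in> V.span (i ` A)" using sp.smult_closed[OF _ im[OF t(2)], of "inv\<^bsub>K\<^esub> (\<iota> t)"] u t(3) by simp
  qed
qed

text \<open>A relation over \<open>K\<close> between images of basis vectors becomes a relation over
  \<open>R\<close> after multiplication by a common denominator, and injectivity pulls it back to
  \<open>M\<close>. Thus two forms of \<open>V\<close> have bases of equal size.\<close>

lemma card_basis_eq_dim:
  assumes B: "finite B" "B \<subseteq> carrier M" "M.lin_indpt B" "M.span B = carrier M"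
  shows "card B = vectorspace.dim K V"
proof -
  interpret VS: vectorspace K V by unfold_locales
  have iB: "finite (i ` B)" "i ` B \<subseteq> carrier V" using B i.closed by auto
  have injB: "inj_on i B" using inj B(2) inj_on_subset by blast
  have "V.lin_indpt (i ` B)"
  proof (rule V.finite_lin_indpt2[OF iB])
    fix a assume a: "a \<in> i ` B \<rightarrow> carrier K" and 0: "V.lincomb a (i ` B) = \<zero>\<^bsub>V\<^esub>"
    have "\<exists>t\<in>carrier R - {\<zero>\<^bsub>R\<^esub>}. \<forall>b\<in>B. \<exists>r\<in>carrier R. \<iota> t \<otimes>\<^bsub>K\<^esub> a (i b) = \<iota> r"
    proof (rule R.common_multiple[OF B(1)])
      fix b assume "b \<in> B"
      then have "a (i b) \<in> carrier K" using a by blast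
      then show "\<exists>t\<in>carrier R - {\<zero>\<^bsub>R\<^esub>}. \<exists>r\<in>carrier R. \<iota> t \<otimes>\<^bsub>K\<^esub> a (i b) = \<iota> r"
        by (rule fraction) blast
    next
      fix b s t assume *: "b \<in> B" "s \<in> carrier R - {\<zero>\<^bsub>R\<^esub>}" "t \<in> carrier R - {\<zero>\<^bsub>R\<^esub>}"
        "\<exists>r\<in>carrier R. \<iota> t \<otimes>\<^bsub>K\<^esub> a (i b) = \<iota> r"
      then obtain r where r: "r \<in> carrier R" "\<iota> t \<otimes>\<^bsub>K\<^esub> a (i b) = \<iota> r" by blast
      have "a (i b) \<in> carrier K" using a *(1) by blast
      then have "\<iota> (s \<otimes>\<^bsub>R\<^esub> t) \<otimes>\<^bsub>K\<^esub> a (i b) = \<iota> (s \<otimes>\<^bsub>R\<^esub> r)"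
        using * r by (simp add: K.m_assoc)
      then show "\<exists>r\<in>carrier R. \<iota> (s \<otimes>\<^bsub>R\<^esub> t) \<otimes>\<^bsub>K\<^esub> a (i b) = \<iota> r" using * r by blast
    qed
    then obtain t r where t: "t \<in> carrier R - {\<zero>\<^bsub>R\<^esub>}"
      and r: "\<And>b. b \<in> B \<Longrightarrow> r b \<in> carrier R \<and> \<iota> t \<otimes>\<^bsub>K\<^esub> a (i b) = \<iota> (r b)" by metis
    have rB: "r \<in> B \<rightarrow> carrier R" using r by blast
    have aK: "a (i b) \<in> carrier K" if "b \<in> B" for b using a that by blast
    have bM: "b \<in> carrier M" if "b \<in> B" for b using B(2) that by blast
    have "i (M.lincomb r B) = (\<Oplus>\<^bsub>V\<^esub> b\<in>B. i (r b \<odot>\<^bsub>M\<^esub> b))"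
      unfolding M.lincomb_def by (rule i.finsum[OF B(1)]) (use rB bM in auto)
    also have "\<dots> = (\<Oplus>\<^bsub>V\<^esub> b\<in>B. \<iota> t \<odot>\<^bsub>V\<^esub> (a (i b) \<odot>\<^bsub>V\<^esub> i b))"
    proof (rule V.M.finsum_cong'[OF refl])
      show "(\<lambda>b. \<iota> t \<odot>\<^bsub>V\<^esub> (a (i b) \<odot>\<^bsub>V\<^esub> i b)) \<in> B \<rightarrow> carrier V" using aK bM i.closed t by auto
      show "i (r b \<odot>\<^bsub>M\<^esub> b) = \<iota> t \<odot>\<^bsub>V\<^esub> (a (i b) \<odot>\<^bsub>V\<^esub> i b)" if "b \<in> B" for b
        using r[OF that] aK[OF that] bM[OF that] i.closed t by (simp add: i.smult V.smult_assoc1[symmetric])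
    qed
    also have "\<dots> = \<iota> t \<odot>\<^bsub>V\<^esub> (\<Oplus>\<^bsub>V\<^esub> b\<in>B. a (i b) \<odot>\<^bsub>V\<^esub> i b)"
      by (rule V.finsum_smult[symmetric]) (use t aK bM i.closed in auto)
    also have "(\<Oplus>\<^bsub>V\<^esub> b\<in>B. a (i b) \<odot>\<^bsub>V\<^esub> i b) = V.lincomb a (i ` B)"
      unfolding V.lincomb_def
      by (rule V.M.add.finprod_reindex[symmetric]) (use injB aK bM i.closed in auto)
    finally have "i (M.lincomb r B) = i \<zero>\<^bsub>M\<^esub>" using 0 t by (simp add: i.zero)
    then have "M.lincomb r B = \<zero>\<^bsub>M\<^esub>"
      by (rule inj_onD[OF inj]) (use B(2) rB in auto)
    then have r0: "r b = \<zero>\<^bsub>R\<^esub>" if "b \<in> B" for b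
      using B(1,3) rB that unfolding M.lin_dep_def by blast
    show "\<forall>v\<in>i ` B. a v = \<zero>\<^bsub>K\<^esub>"
    proof
      fix v assume "v \<in> i ` B"
      then obtain b where b: "b \<in> B" "v = i b" by blast
      have "\<iota> t \<otimes>\<^bsub>K\<^esub> a v = \<zero>\<^bsub>K\<^esub>" using r[OF b(1)] r0[OF b(1)] b(2) by simp
      then show "a v = \<zero>\<^bsub>K\<^esub>" using K.integral[of "\<iota> t" "a v"] t aK[OF b(1)] b(2) \<iota>_eq_zero_iff by auto
    qed
  qed
  then have "VS.basis (i ` B)" unfolding VS.basis_def using image_generates[OF B(2,4)] iB by blast
  then have "VS.dim = card (i ` B)" using VS.dim_basis iB(1) by blast
  then show ?thesis using card_image[OF injB] by simp
qed

end

subsection \<open>Extending alternating maps along a form\<close>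

text \<open>The prefix \<open>ys\<close> holds the places already freed of their scalars; the
  induction moves from left to right by shifting the head of \<open>xs\<close> into it.\<close>

lemma (in alternating) smult_all:
  assumes M: "module R M" and P: "module S P" and \<iota>: "\<iota> \<in> ring_hom R S"
    and "length (ys @ xs) = k" "length ts = length xs" "set ts \<subseteq> carrier R"
      "set ys \<subseteq> carrier M" "set xs \<subseteq> carrier M"
  shows "h (ys @ map2 (smult M) ts xs) = \<iota> (foldr (\<otimes>\<^bsub>R\<^esub>) ts \<one>\<^bsub>R\<^esub>) \<odot>\<^bsub>P\<^esub> h (ys @ xs)"
  using assms(4-)
proof (induction ts arbitrary: ys xs)
  interpret M: module R M by (rule M)
  interpret P: module S P by (rule P)
  case Nil
  then have "ys \<in> tuples k M" by (simp add: tuples_iff)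
  then show ?case using Nil closed by (simp add: ring_hom_one[OF \<iota>])
next
  interpret M: module R M by (rule M)
  interpret P: module S P by (rule P)
  case (Cons t ts)
  obtain x xs' where xs: "xs = x # xs'" using Cons.prems(2) by (cases xs) auto
  let ?zs = "map2 (smult M) ts xs'"
  have c: "set ?zs \<subseteq> carrier M" "length ?zs = length ts"
    using Cons.prems xs
    by (auto simp: subset_iff dest: set_zip_leftD set_zip_rightD intro!: M.smult_closed)
  have tup: "ys @ x # ?zs \<in> tuples k M" "ys @ x # xs' \<in> tuples k M"
    using c Cons.prems xs by (auto simp: tuples_iff)
  have f: "foldr (\<otimes>\<^bsub>R\<^esub>) ts \<one>\<^bsub>R\<^esub> \<in> carrier R" if "set ts \<subseteq> carrier R" for ts
    using that by (induction ts) auto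
  have "h (ys @ map2 (smult M) (t # ts) xs) = h ((ys @ x # ?zs)[length ys := t \<odot>\<^bsub>M\<^esub> x])"
    by (simp add: xs)
  also have "\<dots> = \<iota> t \<odot>\<^bsub>P\<^esub> h ((ys @ x # ?zs)[length ys := x])"
    by (rule smult[OF tup(1)]) (use Cons.prems xs in auto)
  also have "(ys @ x # ?zs)[length ys := x] = (ys @ [x]) @ ?zs" by simp
  also have "h \<dots> = \<iota> (foldr (\<otimes>\<^bsub>R\<^esub>) ts \<one>\<^bsub>R\<^esub>) \<odot>\<^bsub>P\<^esub> h ((ys @ [x]) @ xs')"
    by (rule Cons.IH) (use Cons.prems xs in auto)
  finally show ?case
    using Cons.prems closed[OF tup(2)] f[of ts]
    by (simp add: xs P.smult_assoc1[symmetric] ring_hom_mult[OF \<iota>] ring_hom_closed[OF \<iota>])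
qed

lemma map2_nthI:
  assumes "length xs = length ys" "length us = length vs" "length xs = length us"
    and "\<And>a. a < length xs \<Longrightarrow> f (xs ! a) (ys ! a) = g (us ! a) (vs ! a)"
  shows "map2 f xs ys = map2 g us vs"
  by (rule nth_equalityI) (use assms in auto)

context form_embedding
begin

text \<open>Place by place, the formal quotient of the lattice vector in \<open>ms\<close> by the
  denominator in \<open>ts\<close> stands for the vector in \<open>xs\<close>.\<close>

definition fractions :: "nat \<Rightarrow> 'v list \<Rightarrow> 'r list \<Rightarrow> 'm list \<Rightarrow> bool" where
  "fractions k xs ts ms \<longleftrightarrow> xs \<in> tuples k V \<and> length ts = k \<and> set ts \<subseteq> carrier R - {\<zero>\<^bsub>R\<^esub>} \<and>
    ms \<in> tuples k M \<and> (\<forall>a<k. \<iota> (ts ! a) \<odot>\<^bsub>V\<^esub> (xs ! a) = i (ms ! a))"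

abbreviation rprod :: "'r list \<Rightarrow> 'r" where "rprod ts \<equiv> foldr (\<otimes>\<^bsub>R\<^esub>) ts \<one>\<^bsub>R\<^esub>"

lemma rprod_nonzero: "set ts \<subseteq> carrier R - {\<zero>\<^bsub>R\<^esub>} \<Longrightarrow> rprod ts \<in> carrier R - {\<zero>\<^bsub>R\<^esub>}"
proof (induction ts)
  case (Cons t ts)
  then show ?case using R.integral by auto
qed simp

lemma fractions_update:
  assumes "fractions k xs ts ms" "x \<in> carrier V" "t \<in> carrier R - {\<zero>\<^bsub>R\<^esub>}" "m \<in> carrier M"
    "\<iota> t \<odot>\<^bsub>V\<^esub> x = i m"
  shows "fractions k (xs[j := x]) (ts[j := t]) (ms[j := m])"
proof -
  have "set (ts[j := t]) \<subseteq> carrier R - {\<zero>\<^bsub>R\<^esub>}"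
    using set_update_subset_insert[of ts j t] assms unfolding fractions_def by blast
  then show ?thesis
    using assms
    by (auto simp: fractions_def tuples_update) (metis (no_types, lifting) nth_list_update_eq nth_list_update_neq tuples_iff)
qed

lemma fractions_exist:
  assumes "xs \<in> tuples k V" shows "\<exists>ts ms. fractions k xs ts ms"
proof -
  have "\<forall>a<k. \<exists>t m. t \<in> carrier R - {\<zero>\<^bsub>R\<^esub>} \<and> m \<in> carrier M \<and> \<iota> t \<odot>\<^bsub>V\<^esub> (xs ! a) = i m"
  proof (intro allI impI)
    fix a assume "a < k"
    then have "xs ! a \<in> carrier V" using assms by (auto simp: tuples_iff)
    from denom[OF this] show "\<exists>t m. t \<in> carrier R - {\<zero>\<^bsub>R\<^esub>} \<and> m \<in> carrier M \<and> \<iota> t \<odot>\<^bsub>V\<^esub> (xs ! a) = i m"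
      by blast
  qed
  then obtain t m where tm: "\<And>a. a < k \<Longrightarrow> t a \<in> carrier R - {\<zero>\<^bsub>R\<^esub>} \<and> m a \<in> carrier M \<and>
      \<iota> (t a) \<odot>\<^bsub>V\<^esub> (xs ! a) = i (m a)" by metis
  have "fractions k xs (map t [0..<k]) (map m [0..<k])"
    unfolding fractions_def tuples_iff using tm assms by (auto simp: tuples_iff)
  then show ?thesis by blast
qed

text \<open>Cross multiplication: both sides have the same image in \<open>V\<close>, and
  \<open>i\<close> is injective.\<close>

lemma fractions_compare:
  assumes "fractions k xs ts ms" "fractions k xs ts' ms'"
  shows "map2 (smult M) ts' ms = map2 (smult M) ts ms'"
proof (rule map2_nthI)
  note f = assms[unfolded fractions_def tuples_iff]
  fix a assume "a < length ts'"
  then have a: "a < k" using f by simp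
  have c: "ts ! a \<in> carrier R" "ts' ! a \<in> carrier R" "ms ! a \<in> carrier M" "ms' ! a \<in> carrier M" "xs ! a \<in> carrier V"
  proof -
    have "ts ! a \<in> set ts" "ts' ! a \<in> set ts'" "ms ! a \<in> set ms" "ms' ! a \<in> set ms'" "xs ! a \<in> set xs"
      using f a by simp_all
    then show "ts ! a \<in> carrier R" "ts' ! a \<in> carrier R" "ms ! a \<in> carrier M" "ms' ! a \<in> carrier M"
        "xs ! a \<in> carrier V"
      using f by blast+
  qed
  have eqs: "i (ms ! a) = \<iota> (ts ! a) \<odot>\<^bsub>V\<^esub> (xs ! a)" "i (ms' ! a) = \<iota> (ts' ! a) \<odot>\<^bsub>V\<^esub> (xs ! a)"
    using f a by auto
  have "i (ts' ! a \<odot>\<^bsub>M\<^esub> ms ! a) = i (ts ! a \<odot>\<^bsub>M\<^esub> ms' ! a)"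
    using c by (simp add: i.smult eqs V.smult_assoc1[symmetric] K.m_comm)
  then show "ts' ! a \<odot>\<^bsub>M\<^esub> ms ! a = ts ! a \<odot>\<^bsub>M\<^esub> ms' ! a"
    by (rule inj_onD[OF inj]) (use c in auto)
qed (use assms in \<open>auto simp: fractions_def tuples_iff\<close>)

text \<open>The value of the extension is forced: the value at the numerators, divided by the
  product of the denominators. Cross multiplication makes it independent of the choice, so for each
  axiom the denominators can be adapted to the places concerned. The lemma plays the part of the
  isomorphism of \<open>K \<otimes> \<Lambda>\<^sup>k M\<close> with
  \<open>\<Lambda>\<^sup>k V\<close>.\<close>

lemma extend_alternating:
  assumes P: "module K P" and \<eta>: "alternating R \<iota> k M P \<eta>"
  shows "\<exists>h. alternating K (\<lambda>a. a) k V P h \<and> (\<forall>ms\<in>tuples k M. h (map i ms) = \<eta> ms)"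
proof -
  interpret \<eta>: alternating R \<iota> k M P \<eta> by (rule \<eta>)
  interpret P: module K P by (rule P)
  have all: "\<eta> (map2 (smult M) ts ms) = \<iota> (rprod ts) \<odot>\<^bsub>P\<^esub> \<eta> ms"
    if "ms \<in> tuples k M" "length ts = k" "set ts \<subseteq> carrier R" for ts ms
    using \<eta>.smult_all[OF M.module_axioms P \<iota>_hom, where ys = "[]" and ts = ts and xs = ms] that
    by (simp add: tuples_iff)
  define f where "f xs = (SOME p. fractions k xs (fst p) (snd p))" for xs
  have f: "fractions k xs (fst (f xs)) (snd (f xs))" if "xs \<in> tuples k V" for xs
    using someI_ex[of "\<lambda>p. fractions k xs (fst p) (snd p)"] fractions_exist[OF that]
    unfolding f_def by auto
  define h where "h xs = inv\<^bsub>K\<^esub> (\<iota> (rprod (fst (f xs)))) \<odot>\<^bsub>P\<^esub> \<eta> (snd (f xs))" for xs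
  have unit: "\<iota> (rprod ts) \<in> Units K" if "fractions k xs ts ms" for xs ts ms
    using that rprod_nonzero[of ts] \<iota>_eq_zero_iff K.field_Units by (auto simp: fractions_def)
  \<comment> \<open>This holds for all fractions that represent \<open>xs\<close>, not only for
    those selected by \<open>f\<close>.\<close>
  have key: "\<iota> (rprod ts) \<odot>\<^bsub>P\<^esub> h xs = \<eta> ms" and hc: "h xs \<in> carrier P"
    if fr: "fractions k xs ts ms" for xs ts ms
  proof -
    have xs: "xs \<in> tuples k V" using fr by (simp add: fractions_def)
    let ?ts = "fst (f xs)" and ?ms = "snd (f xs)"
    note fx = f[OF xs]
    have c: "set ts \<subseteq> carrier R" "length ts = k" "ms \<in> tuples k M" "set ?ts \<subseteq> carrier R" "length ?ts = k"
        "?ms \<in> tuples k M"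
      using fr fx unfolding fractions_def by blast+
    have u: "\<iota> (rprod ts) \<in> carrier K" "\<iota> (rprod ?ts) \<in> Units K" "\<iota> (rprod ?ts) \<in> carrier K"
        "inv\<^bsub>K\<^esub> (\<iota> (rprod ?ts)) \<in> carrier K"
      using unit[OF fr] unit[OF fx] by auto
    have e: "\<eta> ms \<in> carrier P" "\<eta> ?ms \<in> carrier P" using \<eta>.closed c by blast+
    show "h xs \<in> carrier P" unfolding h_def using u e by blast
    have "\<iota> (rprod ?ts) \<odot>\<^bsub>P\<^esub> \<eta> ms = \<iota> (rprod ts) \<odot>\<^bsub>P\<^esub> \<eta> ?ms"
      using all[OF c(3,5,4)] all[OF c(6,2,1)] fractions_compare[OF fr fx] by simp
    then have "\<iota> (rprod ts) \<odot>\<^bsub>P\<^esub> h xs = inv\<^bsub>K\<^esub> (\<iota> (rprod ?ts)) \<odot>\<^bsub>P\<^esub> (\<iota> (rprod ?ts) \<odot>\<^bsub>P\<^esub> \<eta> ms)"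
      unfolding h_def using u e by (simp add: P.smult_assoc1[symmetric] K.m_comm)
    then show "\<iota> (rprod ts) \<odot>\<^bsub>P\<^esub> h xs = \<eta> ms"
      using u e by (simp add: P.smult_assoc1[symmetric])
  qed
  have cancel_unit: "x = y" if "fractions k xs ts ms" "\<iota> (rprod ts) \<odot>\<^bsub>P\<^esub> x = \<iota> (rprod ts) \<odot>\<^bsub>P\<^esub> y"
    "x \<in> carrier P" "y \<in> carrier P" for xs ts ms x y
    using cancel[OF P, of "rprod ts" x y] rprod_nonzero[of ts] that by (auto simp: fractions_def)
  have "alternating K (\<lambda>a. a) k V P h"
  proof
    fix xs j x y assume xs: "xs \<in> tuples k V" and j: "j < k" and x: "x \<in> carrier V" and y: "y \<in> carrier V"
    obtain t m where t: "t \<in> carrier R - {\<zero>\<^bsub>R\<^esub>}" "m \<in> carrier M" "\<iota> t \<odot>\<^bsub>V\<^esub> x = i m" using denom[OF x] by blast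
    obtain s n where s: "s \<in> carrier R - {\<zero>\<^bsub>R\<^esub>}" "n \<in> carrier M" "\<iota> s \<odot>\<^bsub>V\<^esub> y = i n" using denom[OF y] by blast
    let ?ts = "fst (f xs)" and ?ms = "snd (f xs)"
    note fx = f[OF xs]
    \<comment> \<open>With the common denominator \<open>t \<otimes> s\<close> at place
      \<open>j\<close>, the three lists of fractions have the same denominators and differ only in
      one numerator.\<close>
    have ts: "t \<otimes>\<^bsub>R\<^esub> s \<in> carrier R - {\<zero>\<^bsub>R\<^esub>}" using t s R.integral by auto
    have ms: "s \<odot>\<^bsub>M\<^esub> m \<in> carrier M" "t \<odot>\<^bsub>M\<^esub> n \<in> carrier M" using s t by auto
    have e1: "\<iota> (t \<otimes>\<^bsub>R\<^esub> s) \<odot>\<^bsub>V\<^esub> x = i (s \<odot>\<^bsub>M\<^esub> m)"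
      using t s x by (simp add: i.smult t(3)[symmetric] V.smult_assoc1[symmetric] K.m_comm)
    have e2: "\<iota> (t \<otimes>\<^bsub>R\<^esub> s) \<odot>\<^bsub>V\<^esub> y = i (t \<odot>\<^bsub>M\<^esub> n)"
      using t s y by (simp add: i.smult s(3)[symmetric] V.smult_assoc1[symmetric])
    have e3: "\<iota> (t \<otimes>\<^bsub>R\<^esub> s) \<odot>\<^bsub>V\<^esub> (x \<oplus>\<^bsub>V\<^esub> y) = i (s \<odot>\<^bsub>M\<^esub> m \<oplus>\<^bsub>M\<^esub> t \<odot>\<^bsub>M\<^esub> n)"
      using e1 e2 ts x y ms by (simp add: V.smult_r_distr i.add)
    have xy: "x \<oplus>\<^bsub>V\<^esub> y \<in> carrier V" "s \<odot>\<^bsub>M\<^esub> m \<oplus>\<^bsub>M\<^esub> t \<odot>\<^bsub>M\<^esub> n \<in> carrier M" using x y ms by auto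
    note f1 = fractions_update[OF fx x ts ms(1) e1, of j]
    note f2 = fractions_update[OF fx y ts ms(2) e2, of j]
    note f3 = fractions_update[OF fx xy(1) ts xy(2) e3, of j]
    have mst: "?ms \<in> tuples k M" using fx by (simp add: fractions_def)
    have K: "\<iota> (rprod (?ts[j := t \<otimes>\<^bsub>R\<^esub> s])) \<in> carrier K" using unit[OF f1] by blast
    show "h (xs[j := x \<oplus>\<^bsub>V\<^esub> y]) = h (xs[j := x]) \<oplus>\<^bsub>P\<^esub> h (xs[j := y])"
    proof (rule cancel_unit[OF f3])
      show "\<iota> (rprod (?ts[j := t \<otimes>\<^bsub>R\<^esub> s])) \<odot>\<^bsub>P\<^esub> h (xs[j := x \<oplus>\<^bsub>V\<^esub> y]) =
          \<iota> (rprod (?ts[j := t \<otimes>\<^bsub>R\<^esub> s])) \<odot>\<^bsub>P\<^esub> (h (xs[j := x]) \<oplus>\<^bsub>P\<^esub> h (xs[j := y]))"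
        using hc[OF f1] hc[OF f2] K \<eta>.add[OF mst j ms]
        by (simp add: P.smult_r_distr key[OF f1] key[OF f2] key[OF f3])
    qed (use hc[OF f1] hc[OF f2] hc[OF f3] in auto)
  next
    fix xs j a x assume xs: "xs \<in> tuples k V" and j: "j < k" and a: "a \<in> carrier K" and x: "x \<in> carrier V"
    obtain t m where t: "t \<in> carrier R - {\<zero>\<^bsub>R\<^esub>}" "m \<in> carrier M" "\<iota> t \<odot>\<^bsub>V\<^esub> x = i m" using denom[OF x] by blast
    \<comment> \<open>The scalar \<open>a\<close> is the fraction of \<open>p\<close> by
      \<open>q\<close>, so the denominator \<open>q \<otimes> t\<close> fits both \<open>x\<close>
      and its multiple by \<open>a\<close>.\<close>
    obtain p q where pq: "p \<in> carrier R" "q \<in> carrier R" "q \<noteq> \<zero>\<^bsub>R\<^esub>" "\<iota> q \<otimes>\<^bsub>K\<^esub> a = \<iota> p" using fraction[OF a] .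
    let ?ts = "fst (f xs)" and ?ms = "snd (f xs)"
    note fx = f[OF xs]
    have mst: "?ms \<in> tuples k M" using fx by (simp add: fractions_def)
    have qt: "q \<otimes>\<^bsub>R\<^esub> t \<in> carrier R - {\<zero>\<^bsub>R\<^esub>}" using t pq R.integral by auto
    have ax: "a \<odot>\<^bsub>V\<^esub> x \<in> carrier V" "p \<odot>\<^bsub>M\<^esub> m \<in> carrier M" "q \<odot>\<^bsub>M\<^esub> m \<in> carrier M" using a x pq t by auto
    have "\<iota> (q \<otimes>\<^bsub>R\<^esub> t) \<odot>\<^bsub>V\<^esub> (a \<odot>\<^bsub>V\<^esub> x) = (\<iota> t \<otimes>\<^bsub>K\<^esub> (\<iota> q \<otimes>\<^bsub>K\<^esub> a)) \<odot>\<^bsub>V\<^esub> x"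
      using pq(1-3) t a x by (simp add: V.smult_assoc1[symmetric] K.m_ac)
    also have "\<dots> = i (p \<odot>\<^bsub>M\<^esub> m)"
      using pq t x by (simp add: i.smult t(3)[symmetric] V.smult_assoc1[symmetric] K.m_comm)
    finally have e1: "\<iota> (q \<otimes>\<^bsub>R\<^esub> t) \<odot>\<^bsub>V\<^esub> (a \<odot>\<^bsub>V\<^esub> x) = i (p \<odot>\<^bsub>M\<^esub> m)" .
    have e2: "\<iota> (q \<otimes>\<^bsub>R\<^esub> t) \<odot>\<^bsub>V\<^esub> x = i (q \<odot>\<^bsub>M\<^esub> m)"
      using pq(1-3) t x by (simp add: i.smult t(3)[symmetric] V.smult_assoc1[symmetric])
    note f1 = fractions_update[OF fx ax(1) qt ax(2) e1, of j]
    note f2 = fractions_update[OF fx x qt ax(3) e2, of j]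
    let ?T = "\<iota> (rprod (?ts[j := q \<otimes>\<^bsub>R\<^esub> t]))"
    have T: "?T \<in> carrier K" using unit[OF f1] by blast
    have em: "\<eta> (?ms[j := m]) \<in> carrier P" using mst t by (intro \<eta>.closed tuples_update)
    show "h (xs[j := a \<odot>\<^bsub>V\<^esub> x]) = a \<odot>\<^bsub>P\<^esub> h (xs[j := x])"
    proof (rule cancel_unit[OF f1])
      have "?T \<odot>\<^bsub>P\<^esub> (a \<odot>\<^bsub>P\<^esub> h (xs[j := x])) = a \<odot>\<^bsub>P\<^esub> (?T \<odot>\<^bsub>P\<^esub> h (xs[j := x]))"
        using T a hc[OF f2] by (simp add: P.smult_assoc1[symmetric] K.m_comm)
      also have "\<dots> = (\<iota> q \<otimes>\<^bsub>K\<^esub> a) \<odot>\<^bsub>P\<^esub> \<eta> (?ms[j := m])"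
        using pq(1-3) a em \<eta>.smult[OF mst j pq(2) t(2)] by (simp add: key[OF f2] P.smult_assoc1[symmetric] K.m_comm)
      also have "\<dots> = ?T \<odot>\<^bsub>P\<^esub> h (xs[j := a \<odot>\<^bsub>V\<^esub> x])"
        using \<eta>.smult[OF mst j pq(1) t(2)] by (simp add: key[OF f1] pq(4))
      finally show "?T \<odot>\<^bsub>P\<^esub> h (xs[j := a \<odot>\<^bsub>V\<^esub> x]) = ?T \<odot>\<^bsub>P\<^esub> (a \<odot>\<^bsub>P\<^esub> h (xs[j := x]))" ..
    qed (use hc[OF f1] hc[OF f2] a in auto)
  next
    fix xs a b assume xs: "xs \<in> tuples k V" and ab: "a < b" "b < k" "xs ! a = xs ! b"
    have x: "xs ! a \<in> carrier V" using xs ab(1,2) nth_mem[of a xs] by (auto simp: tuples_iff simp del: nth_mem)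
    obtain t m where t: "t \<in> carrier R - {\<zero>\<^bsub>R\<^esub>}" "m \<in> carrier M" "\<iota> t \<odot>\<^bsub>V\<^esub> (xs ! a) = i m"
      using denom[OF x] by blast
    note fx = f[OF xs]
    \<comment> \<open>The same fraction is put at both places, so that the numerators have equal
      entries there too.\<close>
    note f1 = fractions_update[OF fractions_update[OF fx x t, of a] x t, of b]
    have upd: "xs[a := xs ! a, b := xs ! a] = xs" by (metis ab(3) list_update_id)
    have "(snd (f xs))[a := m, b := m] \<in> tuples k M" and "length (snd (f xs)) = k"
      using f1 fx by (simp_all add: fractions_def tuples_iff)
    then have "\<eta> ((snd (f xs))[a := m, b := m]) = \<zero>\<^bsub>P\<^esub>"
      using ab by (intro \<eta>.alt[of _ a b]) (auto simp: nth_list_update)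
    then have "\<iota> (rprod ((fst (f xs))[a := t, b := t])) \<odot>\<^bsub>P\<^esub> h xs =
        \<iota> (rprod ((fst (f xs))[a := t, b := t])) \<odot>\<^bsub>P\<^esub> \<zero>\<^bsub>P\<^esub>"
      using key[OF f1, unfolded upd] unit[OF f1] by (simp add: K.Units_closed)
    then show "h xs = \<zero>\<^bsub>P\<^esub>"
      by (rule cancel_unit[OF f1]) (use hc[OF fx] in auto)
  qed (use f hc in blast)
  moreover have "h (map i ms) = \<eta> ms" if ms: "ms \<in> tuples k M" for ms
  proof -
    have one: "rprod (replicate l \<one>\<^bsub>R\<^esub>) = \<one>\<^bsub>R\<^esub>" for l by (induction l) auto
    \<comment> \<open>Lattice vectors have denominator one.\<close>
    have fr: "fractions k (map i ms) (replicate k \<one>\<^bsub>R\<^esub>) ms"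
      unfolding fractions_def
    proof (intro conjI allI impI)
      fix a assume a: "a < k"
      then have "ms ! a \<in> carrier M" using ms nth_mem[of a ms] unfolding tuples_iff by blast
      then show "\<iota> (replicate k \<one>\<^bsub>R\<^esub> ! a) \<odot>\<^bsub>V\<^esub> map i ms ! a = i (ms ! a)"
        using a ms i.closed by (simp add: tuples_iff)
    qed (use ms i.closed in \<open>auto simp: tuples_iff set_replicate_conv_if\<close>)
    show ?thesis using key[OF fr, unfolded one] hc[OF fr] by simp
  qed
  ultimately show ?thesis by blast
qed

text \<open>Every \<open>w xs\<close> has a nonzero scalar multiple that comes from a list of
  lattice vectors, and nonzero scalars cancel in \<open>P\<close>.\<close>

lemma eq_on_form_wedges:
  fixes P :: "('k, 'p, 'f) module_scheme" and W :: "('k, 'w, 'e2) module_scheme"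
  assumes W: "alternating K (\<lambda>a. a) k V W w" and gen: "\<And>H. LinearCombinations.submodule K H W \<Longrightarrow>
      (\<And>xs. xs \<in> tuples k V \<Longrightarrow> w xs \<in> H) \<Longrightarrow> x \<in> H"
    and f: "semilinear K K (\<lambda>a. a) W P f" and g: "semilinear K K (\<lambda>a. a) W P g"
    and eq: "\<And>ms. ms \<in> tuples k M \<Longrightarrow> f (w (map i ms)) = g (w (map i ms))"
  shows "f x = g x"
proof (rule semilinear.eq_on_generated[OF f g, where B = "w ` tuples k V"])
  interpret W: alternating K "\<lambda>a. a" k V W w by (rule W)
  interpret f: semilinear K K "\<lambda>a. a" W P f by (rule f)
  interpret g: semilinear K K "\<lambda>a. a" W P g by (rule g)
  show "x \<in> H" if "LinearCombinations.submodule K H W" "w ` tuples k V \<subseteq> H" for H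
    by (rule gen[OF that(1)]) (use that(2) in blast)
  show "f b = g b" if "b \<in> w ` tuples k V" for b
  proof -
    from that obtain xs where xs: "xs \<in> tuples k V" "b = w xs" by blast
    obtain ts ms where fr: "fractions k xs ts ms" using fractions_exist[OF xs(1)] by blast
    note c = fr[unfolded fractions_def]
    have T: "rprod ts \<in> carrier R" "rprod ts \<noteq> \<zero>\<^bsub>R\<^esub>" using rprod_nonzero[of ts] c by auto
    have "set (map \<iota> ts) \<subseteq> carrier K" using c by auto
    then have "w (map2 (smult V) (map \<iota> ts) xs) = foldr (\<otimes>\<^bsub>K\<^esub>) (map \<iota> ts) \<one>\<^bsub>K\<^esub> \<odot>\<^bsub>W\<^esub> w xs"
      using W.smult_all[OF V.module_axioms f.dom id_ring_hom, where ys = "[]" and ts = "map \<iota> ts" and xs = xs] c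
      by (simp add: tuples_iff)
    moreover have "map2 (smult V) (map \<iota> ts) xs = map i ms"
      by (rule nth_equalityI) (use c in \<open>auto simp: tuples_iff\<close>)
    moreover have "set us \<subseteq> carrier R \<Longrightarrow>
        foldr (\<otimes>\<^bsub>K\<^esub>) (map \<iota> us) \<one>\<^bsub>K\<^esub> = \<iota> (rprod us) \<and> rprod us \<in> carrier R" for us
      by (induction us) auto
    then have "foldr (\<otimes>\<^bsub>K\<^esub>) (map \<iota> ts) \<one>\<^bsub>K\<^esub> = \<iota> (rprod ts)" using c by blast
    ultimately have wm: "w (map i ms) = \<iota> (rprod ts) \<odot>\<^bsub>W\<^esub> w xs" by simp
    have wx: "w xs \<in> carrier W" by (rule W.closed[OF xs(1)])
    have "\<iota> (rprod ts) \<odot>\<^bsub>P\<^esub> f (w xs) = \<iota> (rprod ts) \<odot>\<^bsub>P\<^esub> g (w xs)"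
      using eq[of ms] c wx T by (simp add: wm f.smult g.smult)
    then show "f b = g b" unfolding xs(2)
      by (rule cancel[OF f.cod T f.closed[OF wx] g.closed[OF wx]])
  qed
qed (use alternating.closed[OF W] in blast)

end

section \<open>Schur's lemma for absolutely simple modules\<close>

subsection \<open>Polynomials acting on a module\<close>

text \<open>The polynomial \<open>p\<close>, evaluated at the endomorphism \<open>T\<close> and
  applied to \<open>x\<close>. Lists carry the leading coefficient first, so the head belongs to the
  power of \<open>T\<close> given by the length of the rest.\<close>

primrec poly_act :: "('s, 'p, 'e) module_scheme \<Rightarrow> ('p \<Rightarrow> 'p) \<Rightarrow> 's list \<Rightarrow> 'p \<Rightarrow> 'p" where
  "poly_act U T [] x = \<zero>\<^bsub>U\<^esub>"
| "poly_act U T (a # p) x = a \<odot>\<^bsub>U\<^esub> (T ^^ length p) x \<oplus>\<^bsub>U\<^esub> poly_act U T p x"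

locale module_endo = U: module E U + T: semilinear E E "\<lambda>a. a" U U T
  for E :: "('s, 'b) ring_scheme" and U :: "('s, 'p, 'e) module_scheme" and T :: "'p \<Rightarrow> 'p"
begin

lemma funpow_closed: "x \<in> carrier U \<Longrightarrow> (T ^^ n) x \<in> carrier U"
  by (induction n) (auto simp: T.closed)

lemma poly_act_closed: "set p \<subseteq> carrier E \<Longrightarrow> x \<in> carrier U \<Longrightarrow> poly_act U T p x \<in> carrier U"
  by (induction p) (auto simp: funpow_closed)

text \<open>Horner's step: a new constant term is appended, and all other coefficients move up by
  one power of \<open>T\<close>.\<close>

lemma poly_act_snoc:
  assumes "set p \<subseteq> carrier E" "a \<in> carrier E" "x \<in> carrier U"
  shows "poly_act U T (p @ [a]) x = T (poly_act U T p x) \<oplus>\<^bsub>U\<^esub> a \<odot>\<^bsub>U\<^esub> x"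
  using assms(1)
proof (induction p)
  case Nil
  then show ?case using assms by (simp add: T.zero)
next
  case (Cons b p)
  have c: "(T ^^ length p) x \<in> carrier U" "poly_act U T p x \<in> carrier U" "b \<in> carrier E"
    using Cons.prems assms by (auto simp: funpow_closed poly_act_closed)
  show ?case using Cons c assms by (simp add: T.add T.smult T.closed U.M.a_assoc)
qed

text \<open>Synthetic division by \<open>X - l\<close>: the quotient of \<open>p @ [a]\<close>
  arises from that of \<open>p\<close> by appending the value of \<open>p\<close> at
  \<open>l\<close>. Keeping the head guarantees that the leading coefficient of the quotient stays
  nonzero.\<close>

lemma poly_act_divide_root:
  assumes p: "set p \<subseteq> carrier E" "p \<noteq> []" and l: "l \<in> carrier E"
  shows "\<exists>q. set q \<subseteq> carrier E \<and> Suc (length q) = length p \<and> (q \<noteq> [] \<longrightarrow> hd q = hd p) \<and>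
    (\<forall>x\<in>carrier U. poly_act U T p x =
      (T (poly_act U T q x) \<ominus>\<^bsub>U\<^esub> l \<odot>\<^bsub>U\<^esub> poly_act U T q x) \<oplus>\<^bsub>U\<^esub> ring.eval E p l \<odot>\<^bsub>U\<^esub> x)"
  using p
proof (induction p rule: rev_induct)
  case (snoc a p)
  note ev = U.R.eval_in_carrier
  show ?case
  proof (cases "p = []")
    case True
    then show ?thesis using snoc.prems l
      by (intro exI[of _ "[]"]) (auto simp: T.zero)
  next
    case False
    have pc: "set p \<subseteq> carrier E" "a \<in> carrier E" using snoc.prems by auto
    obtain q where q: "set q \<subseteq> carrier E" "Suc (length q) = length p" "q \<noteq> [] \<longrightarrow> hd q = hd p"
      and eq: "\<And>x. x \<in> carrier U \<Longrightarrow> poly_act U T p x =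
        (T (poly_act U T q x) \<ominus>\<^bsub>U\<^esub> l \<odot>\<^bsub>U\<^esub> poly_act U T q x) \<oplus>\<^bsub>U\<^esub> ring.eval E p l \<odot>\<^bsub>U\<^esub> x"
      using snoc.IH[OF pc(1) False] by blast
    let ?e = "ring.eval E p l"
    have e: "?e \<in> carrier E" by (rule ev[OF pc(1) l])
    \<comment> \<open>For \<open>p\<close> of length one the quotient \<open>q\<close> is empty, and
      the appended value is the leading coefficient itself.\<close>
    have hd: "hd (q @ [?e]) = hd p"
    proof (cases "q = []")
      case True
      then obtain b where "p = [b]" using q(2) by (cases p) auto
      then show ?thesis using True pc by simp
    qed (use q(3) in simp)
    have "poly_act U T (p @ [a]) x = (T (poly_act U T (q @ [?e]) x) \<ominus>\<^bsub>U\<^esub>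
        l \<odot>\<^bsub>U\<^esub> poly_act U T (q @ [?e]) x) \<oplus>\<^bsub>U\<^esub> ring.eval E (p @ [a]) l \<odot>\<^bsub>U\<^esub> x"
      if x: "x \<in> carrier U" for x
    proof -
      define u where "u = poly_act U T q x"
      define w where "w = poly_act U T p x"
      define z where "z = poly_act U T (q @ [?e]) x"
      have u: "u \<in> carrier U" unfolding u_def by (rule poly_act_closed[OF q(1) x])
      have wc: "w \<in> carrier U" unfolding w_def by (rule poly_act_closed[OF pc(1) x])
      have w: "w = (T u \<ominus>\<^bsub>U\<^esub> l \<odot>\<^bsub>U\<^esub> u) \<oplus>\<^bsub>U\<^esub> ?e \<odot>\<^bsub>U\<^esub> x" unfolding w_def u_def by (rule eq[OF x])
      have cl: "T u \<in> carrier U" "l \<odot>\<^bsub>U\<^esub> u \<in> carrier U" "?e \<odot>\<^bsub>U\<^esub> x \<in> carrier U" "l \<odot>\<^bsub>U\<^esub> T u \<in> carrier U"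
          "(l \<otimes>\<^bsub>E\<^esub> ?e) \<odot>\<^bsub>U\<^esub> x \<in> carrier U" "T w \<in> carrier U" "a \<odot>\<^bsub>U\<^esub> x \<in> carrier U"
        using u x l e wc pc by (auto simp: T.closed)
      have z: "z = T u \<oplus>\<^bsub>U\<^esub> ?e \<odot>\<^bsub>U\<^esub> x" unfolding z_def u_def by (rule poly_act_snoc[OF q(1) e x])
      have "w \<oplus>\<^bsub>U\<^esub> l \<odot>\<^bsub>U\<^esub> u = (T u \<oplus>\<^bsub>U\<^esub> ?e \<odot>\<^bsub>U\<^esub> x) \<oplus>\<^bsub>U\<^esub> (\<ominus>\<^bsub>U\<^esub> (l \<odot>\<^bsub>U\<^esub> u) \<oplus>\<^bsub>U\<^esub> l \<odot>\<^bsub>U\<^esub> u)"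
        unfolding w a_minus_def using cl by (simp only: U.M.a_ac U.M.add.m_closed U.M.a_inv_closed)
      then have zw: "z = w \<oplus>\<^bsub>U\<^esub> l \<odot>\<^bsub>U\<^esub> u" using cl z by (simp add: U.M.l_neg)
      have Tz: "T z = T w \<oplus>\<^bsub>U\<^esub> l \<odot>\<^bsub>U\<^esub> T u" using zw wc cl u l by (simp add: T.add T.smult)
      have lz: "l \<odot>\<^bsub>U\<^esub> z = l \<odot>\<^bsub>U\<^esub> T u \<oplus>\<^bsub>U\<^esub> (l \<otimes>\<^bsub>E\<^esub> ?e) \<odot>\<^bsub>U\<^esub> x"
        using z cl l e x by (simp add: U.smult_r_distr U.smult_assoc1)
      have ea: "ring.eval E (p @ [a]) l \<odot>\<^bsub>U\<^esub> x = (l \<otimes>\<^bsub>E\<^esub> ?e) \<odot>\<^bsub>U\<^esub> x \<oplus>\<^bsub>U\<^esub> a \<odot>\<^bsub>U\<^esub> x"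
        using U.R.eval_append_aux[OF pc l] e l pc x by (simp add: U.smult_l_distr U.R.m_comm)
      have "(T z \<ominus>\<^bsub>U\<^esub> l \<odot>\<^bsub>U\<^esub> z) \<oplus>\<^bsub>U\<^esub> ring.eval E (p @ [a]) l \<odot>\<^bsub>U\<^esub> x =
          (T w \<oplus>\<^bsub>U\<^esub> a \<odot>\<^bsub>U\<^esub> x) \<oplus>\<^bsub>U\<^esub> ((l \<odot>\<^bsub>U\<^esub> T u \<oplus>\<^bsub>U\<^esub> \<ominus>\<^bsub>U\<^esub> (l \<odot>\<^bsub>U\<^esub> T u)) \<oplus>\<^bsub>U\<^esub>
            ((l \<otimes>\<^bsub>E\<^esub> ?e) \<odot>\<^bsub>U\<^esub> x \<oplus>\<^bsub>U\<^esub> \<ominus>\<^bsub>U\<^esub> ((l \<otimes>\<^bsub>E\<^esub> ?e) \<odot>\<^bsub>U\<^esub> x)))"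
        unfolding Tz lz ea a_minus_def using cl
        by (simp only: U.M.minus_add U.M.a_ac U.M.add.m_closed U.M.a_inv_closed)
      also have "\<dots> = T w \<oplus>\<^bsub>U\<^esub> a \<odot>\<^bsub>U\<^esub> x" using cl by (simp add: U.M.r_neg)
      also have "\<dots> = poly_act U T (p @ [a]) x" unfolding w_def by (rule poly_act_snoc[OF pc x, symmetric])
      finally show ?thesis unfolding z_def ..
    qed
    then show ?thesis
      using q e hd False by (intro exI[of _ "q @ [?e]"]) auto
  qed
qed simp

text \<open>A root \<open>l\<close> of \<open>p\<close> is split off. Either the quotient applied to
  \<open>x\<close> is nonzero, and then it is an eigenvector for \<open>l\<close>, or a shorter
  polynomial annihilates \<open>x\<close>. The descent cannot reach a nonzero constant, because
  \<open>x\<close> is nonzero.\<close>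

lemma eigenvector_exists:
  assumes E: "algebraically_closed E"
    and "x \<in> carrier U" "x \<noteq> \<zero>\<^bsub>U\<^esub>" "set p \<subseteq> carrier E" "p \<noteq> []" "hd p \<noteq> \<zero>\<^bsub>E\<^esub>" "poly_act U T p x = \<zero>\<^bsub>U\<^esub>"
  shows "\<exists>l\<in>carrier E. \<exists>y\<in>carrier U. y \<noteq> \<zero>\<^bsub>U\<^esub> \<and> T y = l \<odot>\<^bsub>U\<^esub> y"
  using assms(2-)
proof (induction "length p" arbitrary: p rule: less_induct)
  case less
  interpret E: algebraically_closed E by (rule E)
  have field: "field E" ..
  show ?case
  proof (cases "length p = 1")
    case True
    then obtain a where a: "p = [a]" by (cases p) auto
    then have "a \<odot>\<^bsub>U\<^esub> x = a \<odot>\<^bsub>U\<^esub> \<zero>\<^bsub>U\<^esub>" "a \<in> carrier E" "a \<noteq> \<zero>\<^bsub>E\<^esub>" using less.prems by auto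
    then have "x = \<zero>\<^bsub>U\<^esub>" using U.smult_cancel[OF field] less.prems(1) by blast
    then show ?thesis using less.prems by blast
  next
    case False
    have poly: "p \<in> carrier (poly_ring E)"
      using less.prems by (simp add: univ_poly_carrier[symmetric] polynomial_def)
    then have "size (U.R.roots p) = length p - 1" using E.roots_over_carrier unfolding U.R.splitted_def by simp
    moreover have "length p > 1" using False less.prems(4) by (cases p) auto
    ultimately have "U.R.roots p \<noteq> {#}" by auto
    then obtain l where "l \<in># U.R.roots p" by blast
    then have l: "l \<in> carrier E" "U.R.eval p l = \<zero>\<^bsub>E\<^esub>"
      using E.roots_mem_iff_is_root[OF poly] by (auto simp: U.R.is_root_def)
    obtain q where q: "set q \<subseteq> carrier E" "Suc (length q) = length p" "q \<noteq> [] \<longrightarrow> hd q = hd p"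
      "\<forall>x\<in>carrier U. poly_act U T p x =
        (T (poly_act U T q x) \<ominus>\<^bsub>U\<^esub> l \<odot>\<^bsub>U\<^esub> poly_act U T q x) \<oplus>\<^bsub>U\<^esub> U.R.eval p l \<odot>\<^bsub>U\<^esub> x"
      using poly_act_divide_root[OF less.prems(3,4) l(1)] by blast
    let ?y = "poly_act U T q x"
    have y: "?y \<in> carrier U" by (rule poly_act_closed[OF q(1) less.prems(1)])
    have "T ?y \<ominus>\<^bsub>U\<^esub> l \<odot>\<^bsub>U\<^esub> ?y = \<zero>\<^bsub>U\<^esub>"
      using q(4) less.prems(1,6) l y by (auto simp: T.closed)
    then have Ty: "T ?y = l \<odot>\<^bsub>U\<^esub> ?y" using y l by (simp add: T.closed)
    show ?thesis
    proof (cases "?y = \<zero>\<^bsub>U\<^esub>")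
      case True
      have "q \<noteq> []" using q(2) \<open>length p > 1\<close> by auto
      then show ?thesis
        using less.hyps[of q] q(1-3) less.prems True by auto
    qed (use Ty y l in blast)
  qed
qed

lemma poly_act_add:
  assumes "length p = length q" "set p \<subseteq> carrier E" "set q \<subseteq> carrier E" "x \<in> carrier U"
  shows "poly_act U T (map2 (\<oplus>\<^bsub>E\<^esub>) p q) x = poly_act U T p x \<oplus>\<^bsub>U\<^esub> poly_act U T q x"
  using assms(1-3)
proof (induction p q rule: list_induct2)
  case (Cons a p b q)
  have c: "(T ^^ length q) x \<in> carrier U" "poly_act U T p x \<in> carrier U" "poly_act U T q x \<in> carrier U"
    using Cons.prems assms by (auto simp: funpow_closed poly_act_closed)
  show ?case using Cons c by (simp add: U.smult_l_distr U.M.a_ac)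
qed simp

lemma poly_act_smult:
  assumes "a \<in> carrier E" "set p \<subseteq> carrier E" "x \<in> carrier U"
  shows "poly_act U T (map (\<lambda>b. a \<otimes>\<^bsub>E\<^esub> b) p) x = a \<odot>\<^bsub>U\<^esub> poly_act U T p x"
  using assms(2)
proof (induction p)
  case (Cons b p)
  have c: "(T ^^ length p) x \<in> carrier U" "poly_act U T p x \<in> carrier U"
    using Cons.prems assms by (auto simp: funpow_closed poly_act_closed)
  show ?case using Cons c assms by (simp add: U.smult_r_distr U.smult_assoc1)
qed (use assms in simp)

lemma poly_act_replicate_zero: "x \<in> carrier U \<Longrightarrow> poly_act U T (replicate n \<zero>\<^bsub>E\<^esub>) x = \<zero>\<^bsub>U\<^esub>"
  by (induction n) (auto simp: funpow_closed)

text \<open>The lists have length exactly \<open>d\<close>, padded with leading zeros where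
  necessary, so that sums can be formed entry by entry.\<close>

lemma span_funpow:
  assumes x: "x \<in> carrier U" and v: "v \<in> U.span ((\<lambda>j. (T ^^ j) x) ` {..<d})"
  shows "\<exists>q. set q \<subseteq> carrier E \<and> length q = d \<and> v = poly_act U T q x"
proof -
  let ?H = "{poly_act U T q x | q. set q \<subseteq> carrier E \<and> length q = d}"
  have "LinearCombinations.submodule E ?H U"
  proof (rule LinearCombinations.submodule.intro[OF U.module_axioms])
    show "?H \<subseteq> carrier U" using poly_act_closed[OF _ x] by blast
    show "\<zero>\<^bsub>U\<^esub> \<in> ?H"
      using poly_act_replicate_zero[OF x, of d]
      by (intro CollectI exI[of _ "replicate d \<zero>\<^bsub>E\<^esub>"]) (auto simp: set_replicate_conv_if)
    show "v \<oplus>\<^bsub>U\<^esub> w \<in> ?H" if vw: "v \<in> ?H" "w \<in> ?H" for v w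
    proof -
      from vw obtain p q where pq: "v = poly_act U T p x" "set p \<subseteq> carrier E" "length p = d"
        "w = poly_act U T q x" "set q \<subseteq> carrier E" "length q = d" by blast
      have "set (map2 (\<oplus>\<^bsub>E\<^esub>) p q) \<subseteq> carrier E"
        using pq by (auto simp: subset_iff dest: set_zip_leftD set_zip_rightD intro!: U.R.add.m_closed)
      then show ?thesis using poly_act_add[of p q x] pq x
        by (intro CollectI exI[of _ "map2 (\<oplus>\<^bsub>E\<^esub>) p q"]) auto
    qed
    show "c \<odot>\<^bsub>U\<^esub> v \<in> ?H" if c: "c \<in> carrier E" and v: "v \<in> ?H" for c v
    proof -
      from v obtain p where p: "v = poly_act U T p x" "set p \<subseteq> carrier E" "length p = d" by blast
      show ?thesis using poly_act_smult[OF c p(2) x] p c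
        by (intro CollectI exI[of _ "map (\<lambda>b. c \<otimes>\<^bsub>E\<^esub> b) p"]) auto
    qed
  qed
  moreover have "(T ^^ j) x \<in> ?H" if j: "j < d" for j
  proof -
    have pad: "poly_act U T (replicate n \<zero>\<^bsub>E\<^esub> @ q) x = poly_act U T q x" if "set q \<subseteq> carrier E" for n q
      using that x by (induction n) (auto simp: funpow_closed poly_act_closed)
    have one: "poly_act U T (\<one>\<^bsub>E\<^esub> # replicate j \<zero>\<^bsub>E\<^esub>) x = (T ^^ j) x"
      using x by (simp add: poly_act_replicate_zero funpow_closed)
    have s: "set (\<one>\<^bsub>E\<^esub> # replicate j \<zero>\<^bsub>E\<^esub>) \<subseteq> carrier E" by (auto simp: set_replicate_conv_if)
    show ?thesis
      using pad[OF s, of "d - Suc j"] one s j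
      by (intro CollectI exI[of _ "replicate (d - Suc j) \<zero>\<^bsub>E\<^esub> @ \<one>\<^bsub>E\<^esub> # replicate j \<zero>\<^bsub>E\<^esub>"])
        (auto simp: set_replicate_conv_if)
  qed
  ultimately have "U.span ((\<lambda>j. (T ^^ j) x) ` {..<d}) \<subseteq> ?H"
    by (intro U.span_is_subset) auto
  then show ?thesis using v by blast
qed

text \<open>In finite dimension some iterate of \<open>x\<close> lies in the span of the earlier
  ones; otherwise arbitrarily many iterates would be independent.\<close>

lemma annihilating_polynomial:
  assumes E: "field E" and fin: "vectorspace.fin_dim E U" and x: "x \<in> carrier U"
  shows "\<exists>p. set p \<subseteq> carrier E \<and> p \<noteq> [] \<and> hd p \<noteq> \<zero>\<^bsub>E\<^esub> \<and> poly_act U T p x = \<zero>\<^bsub>U\<^esub>"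
proof -
  interpret field E by (rule E)
  interpret VS: vectorspace E U by unfold_locales
  let ?w = "\<lambda>j. (T ^^ j) x"
  have wc: "?w ` A \<subseteq> carrier U" for A using funpow_closed[OF x] by auto
  have "\<exists>d. ?w d \<in> U.span (?w ` {..<d})"
  proof (rule ccontr)
    assume "\<not> ?thesis"
    then have notin: "?w d \<notin> U.span (?w ` {..<d})" for d by blast
    have "U.lin_indpt (?w ` {..<d}) \<and> card (?w ` {..<d}) = d" for d
    proof (induction d)
      case 0
      then show ?case by (auto simp: U.lin_dep_def)
    next
      case (Suc d)
      have nd: "?w d \<notin> ?w ` {..<d}" using notin[of d] U.in_own_span[OF wc, of "{..<d}"] by blast
      have ins: "?w ` {..<Suc d} = ?w ` {..<d} \<union> {?w d}" by (auto simp: lessThan_Suc)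
      have "U.lin_indpt (?w ` {..<d} \<union> {?w d})"
        using VS.lin_dep_iff_in_span[OF wc _ funpow_closed[OF x] nd] Suc notin[of d] by blast
      moreover have "card (?w ` {..<d} \<union> {?w d}) = Suc d" using Suc nd by simp
      ultimately show ?case unfolding ins by blast
    qed
    then have "Suc VS.dim \<le> VS.dim"
      using VS.li_le_dim(2)[OF fin wc, of "{..<Suc VS.dim}"] by metis
    then show False by simp
  qed
  then obtain d where "?w d \<in> U.span (?w ` {..<d})" by blast
  from span_funpow[OF x this] obtain q where q: "set q \<subseteq> carrier E" "length q = d" "?w d = poly_act U T q x"
    by blast
  \<comment> \<open>The polynomial \<open>X^d - q\<close>. Because \<open>q\<close> has length
    exactly \<open>d\<close>, the leading one stands at the power \<open>d\<close>.\<close>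
  let ?p = "\<one>\<^bsub>E\<^esub> # map (\<lambda>b. \<ominus>\<^bsub>E\<^esub> \<one>\<^bsub>E\<^esub> \<otimes>\<^bsub>E\<^esub> b) q"
  have qc: "poly_act U T q x \<in> carrier U" by (rule poly_act_closed[OF q(1) x])
  have "poly_act U T ?p x = poly_act U T q x \<oplus>\<^bsub>U\<^esub> \<ominus>\<^bsub>E\<^esub> \<one>\<^bsub>E\<^esub> \<odot>\<^bsub>U\<^esub> poly_act U T q x"
    using poly_act_smult[of "\<ominus>\<^bsub>E\<^esub> \<one>\<^bsub>E\<^esub>" q x] q x qc funpow_closed[OF x, of d] by simp
  also have "\<dots> = \<zero>\<^bsub>U\<^esub>" using qc by (simp add: U.smult_l_minus U.M.r_neg)
  finally show ?thesis using q(1) by (intro exI[of _ ?p]) auto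
qed

end

text \<open>\<open>f\<close> intertwines the two endomorphisms, so a polynomial that annihilates a
  vector over \<open>K\<close> annihilates its image over \<open>E\<close>.\<close>

lemma poly_act_semilinear:
  assumes \<theta>: "module_endo K W \<theta>" and f: "semilinear K E \<epsilon> W U f"
    and comm: "\<And>x. x \<in> carrier W \<Longrightarrow> T (f x) = f (\<theta> x)" and p: "set p \<subseteq> carrier K" and x: "x \<in> carrier W"
  shows "poly_act U T (map \<epsilon> p) (f x) = f (poly_act W \<theta> p x)"
  using p
proof (induction p)
  interpret f: semilinear K E \<epsilon> W U f by (rule f)
  interpret \<theta>: module_endo K W \<theta> by (rule \<theta>)
  case Nil
  then show ?case by (simp add: f.zero)
next
  interpret f: semilinear K E \<epsilon> W U f by (rule f)
  interpret \<theta>: module_endo K W \<theta> by (rule \<theta>)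
  case (Cons a p)
  have pow: "(T ^^ n) (f x) = f ((\<theta> ^^ n) x)" for n
    by (induction n) (auto simp: comm \<theta>.funpow_closed x)
  show ?case
    using Cons x by (simp add: pow f.add f.smult \<theta>.funpow_closed \<theta>.poly_act_closed)
qed

subsection \<open>Endomorphisms are scalars\<close>

text \<open>Over an algebraically closed extension the endomorphism has an eigenvector; the
  eigenspace is invariant under the group, and simplicity makes it everything. The eigenvalue is
  then brought back to \<open>K\<close>.\<close>

lemma absolutely_simple_endomorphism:
  fixes W :: "('k, 'w, 'g) gmodule" and K :: "('k, 'd) ring_scheme" and G :: "('g, 'a) monoid_scheme"
  assumes K: "field K" and simple: "absolutely_simple G K W" and W: "module K W"
    and fin: "vectorspace.fin_dim K W"
    and act: "\<And>g. g \<in> carrier G \<Longrightarrow> semilinear K K (\<lambda>a. a) W W (act W g)"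
  shows "carrier W \<noteq> {\<zero>\<^bsub>W\<^esub>}"
    and "semilinear K K (\<lambda>a. a) W W \<theta> \<Longrightarrow>
      (\<And>g x. g \<in> carrier G \<Longrightarrow> x \<in> carrier W \<Longrightarrow> \<theta> (act W g x) = act W g (\<theta> x)) \<Longrightarrow>
      \<exists>c\<in>carrier K. \<forall>x\<in>carrier W. \<theta> x = c \<odot>\<^bsub>W\<^esub> x"
proof -
  interpret K: field K by (rule K)
  interpret W: module K W by (rule W)
  interpret VS: vectorspace K W by unfold_locales
  \<comment> \<open>The elements of this algebraic closure have the very type over which
    \<open>absolutely_simple\<close> quantifies.\<close>
  define E where "E = K.alg_closure"
  define \<epsilon> :: "'k \<Rightarrow> ('k list \<times> nat) multiset \<Rightarrow> 'k" where "\<epsilon> = K.indexed_const"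
  have clos: "algebraic_closure E (\<epsilon> ` carrier K)" and \<epsilon>: "\<epsilon> \<in> ring_hom K E"
    using K.alg_closureE unfolding E_def \<epsilon>_def by auto
  interpret E: algebraic_closure E "\<epsilon> ` carrier K" by (rule clos)
  have Ef: "field E" and Ecr: "cring E" by unfold_locales
  have \<epsilon>inj: "inj_on \<epsilon> (carrier K)" unfolding \<epsilon>_def by (rule K.indexed_const_inj_on)
  interpret \<epsilon>: ring_hom_cring K E \<epsilon> by unfold_locales (rule \<epsilon>)
  interpret X: scalar_extension K E \<epsilon> W by (rule scalar_extension.intro[OF W Ecr \<epsilon>])
  note ring_as_module_sel [simp]
  have oneE: "\<one>\<^bsub>E\<^esub> \<in> carrier E" using cring.cring_simprules(6)[OF Ecr] .
  let ?U = "extend_scalars K E \<epsilon> W"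
  have sU: "simple_RG_module G E ?U"
    using simple Ef \<epsilon> unfolding absolutely_simple_def by blast
  interpret t1: semilinear K E \<epsilon> W ?U "X.tens \<one>\<^bsub>E\<^esub>" by (rule X.semilinear_tens_one)
  \<comment> \<open>The extension of a zero module is zero and hence not simple. Below this provides
    a basis vector \<open>b0\<close>.\<close>
  show nz: "carrier W \<noteq> {\<zero>\<^bsub>W\<^esub>}"
  proof
    assume W0: "carrier W = {\<zero>\<^bsub>W\<^esub>}"
    have "LinearCombinations.submodule E {\<zero>\<^bsub>?U\<^esub>} ?U"
      by (rule LinearCombinations.submodule.intro[OF X.module_U]) auto
    then have "carrier ?U \<subseteq> {\<zero>\<^bsub>?U\<^esub>}" using X.generated[of "{\<zero>\<^bsub>?U\<^esub>}"] W0 t1.zero by auto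
    then show False using sU X.U.M.zero_closed unfolding simple_RG_module_def by blast
  qed
  assume \<theta>: "semilinear K K (\<lambda>a. a) W W \<theta>"
    and equiv: "\<And>g x. g \<in> carrier G \<Longrightarrow> x \<in> carrier W \<Longrightarrow> \<theta> (act W g x) = act W g (\<theta> x)"
  interpret \<theta>: semilinear K K "\<lambda>a. a" W W \<theta> by (rule \<theta>)
  interpret \<theta>': module_endo K W \<theta> by unfold_locales
  obtain B where B: "finite B" "VS.basis B" using VS.finite_basis_exists[OF fin] by blast
  then have B': "B \<subseteq> carrier W" "W.lin_indpt B" "W.span B = carrier W" by (auto simp: VS.basis_def)
  obtain c where c: "\<And>b. b \<in> B \<Longrightarrow> semilinear K K (\<lambda>a. a) W (self_module K) (c b)"
    and \<delta>: "\<And>b b'. b \<in> B \<Longrightarrow> b' \<in> B \<Longrightarrow> c b b' = (if b = b' then \<one>\<^bsub>K\<^esub> else \<zero>\<^bsub>K\<^esub>)"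
    and expand: "\<And>x. x \<in> carrier W \<Longrightarrow> x = (\<Oplus>\<^bsub>W\<^esub> b\<in>B. c b x \<odot>\<^bsub>W\<^esub> b)"
    by (rule W.coordinates_exist[OF B(1) B'], rule that; assumption)
  have cc: "c b x \<in> carrier K" if "b \<in> B" "x \<in> carrier W" for b x
    using semilinear.closed[OF c[OF that(1)] that(2)] by simp
  have "B \<noteq> {}"
  proof
    assume "B = {}"
    then have "carrier W = {\<zero>\<^bsub>W\<^esub>}" using VS.span_empty B'(3) by simp
    then show False using nz by blast
  qed
  then obtain b0 where b0: "b0 \<in> B" by blast
  then have b0W: "b0 \<in> carrier W" using B' by blast
  have selfE: "module E (self_module E)" by (rule self_module_module[OF Ecr])
  \<comment> \<open>The coordinates with respect to \<open>B\<close>, extended to functionals on the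
    extended module. They detect that a tensor is nonzero and later compare scalars.\<close>
  have "\<exists>\<phi>. semilinear E E (\<lambda>a. a) ?U (self_module E) \<phi> \<and>
      (\<forall>s\<in>carrier E. \<forall>w\<in>carrier W. \<phi> (X.tens s w) = s \<otimes>\<^bsub>E\<^esub> \<epsilon> (c b w))" if b: "b \<in> B" for b
  proof -
    interpret cb: semilinear K K "\<lambda>a. a" W "self_module K" "c b" by (rule c[OF b])
    have "semilinear K E \<epsilon> W (self_module E) (\<lambda>w. \<epsilon> (c b w))"
      by (rule semilinear.intro[OF W selfE \<epsilon>]) (use cb.add cb.smult cc[OF b] in auto)
    from X.universal[OF selfE this] show ?thesis by simp
  qed
  then obtain \<phi> where \<phi>: "\<And>b. b \<in> B \<Longrightarrow> semilinear E E (\<lambda>a. a) ?U (self_module E) (\<phi> b)"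
    and \<phi>t: "\<And>b s w. b \<in> B \<Longrightarrow> s \<in> carrier E \<Longrightarrow> w \<in> carrier W \<Longrightarrow> \<phi> b (X.tens s w) = s \<otimes>\<^bsub>E\<^esub> \<epsilon> (c b w)"
    by metis
  have \<theta>t: "semilinear K E \<epsilon> W ?U (\<lambda>w. X.tens \<one>\<^bsub>E\<^esub> (\<theta> w))"
    using \<theta>.comp[OF X.semilinear_tens_one] by (simp add: comp_def)
  obtain T where T: "semilinear E E (\<lambda>a. a) ?U ?U T"
    and Tt': "\<And>s w. s \<in> carrier E \<Longrightarrow> w \<in> carrier W \<Longrightarrow> T (X.tens s w) = s \<odot>\<^bsub>?U\<^esub> X.tens \<one>\<^bsub>E\<^esub> (\<theta> w)"
    using X.universal[OF X.module_U \<theta>t] by blast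
  interpret T: semilinear E E "\<lambda>a. a" ?U ?U T by (rule T)
  interpret T': module_endo E ?U T by unfold_locales
  have Tt: "T (X.tens \<one>\<^bsub>E\<^esub> w) = X.tens \<one>\<^bsub>E\<^esub> (\<theta> w)" if "w \<in> carrier W" for w
    using Tt'[of "\<one>\<^bsub>E\<^esub>" w] that X.tens_closed \<theta>.closed by simp
  \<comment> \<open>The polynomial is found in \<open>W\<close>, which is known to be
    finite-dimensional, and its coefficients are then mapped to \<open>E\<close>.\<close>
  obtain p where p: "set p \<subseteq> carrier K" "p \<noteq> []" "hd p \<noteq> \<zero>\<^bsub>K\<^esub>" "poly_act W \<theta> p b0 = \<zero>\<^bsub>W\<^esub>"
    using \<theta>'.annihilating_polynomial[OF K fin b0W] by blast
  have ann: "poly_act ?U T (map \<epsilon> p) (X.tens \<one>\<^bsub>E\<^esub> b0) = \<zero>\<^bsub>?U\<^esub>"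
    using poly_act_semilinear[OF \<theta>'.module_endo_axioms X.semilinear_tens_one Tt p(1) b0W] p(4) t1.zero by simp
  have hd: "hd (map \<epsilon> p) \<noteq> \<zero>\<^bsub>E\<^esub>"
    using p inj_onD[OF \<epsilon>inj, of "hd p" "\<zero>\<^bsub>K\<^esub>"] by (cases p) auto
  have t0: "X.tens \<one>\<^bsub>E\<^esub> b0 \<noteq> \<zero>\<^bsub>?U\<^esub>"
    using \<phi>t[OF b0 oneE b0W] semilinear.zero[OF \<phi>[OF b0]] \<delta>[OF b0 b0] E.one_not_zero by auto
  have alg: "algebraically_closed E" by unfold_locales
  have "\<exists>l\<in>carrier E. \<exists>y\<in>carrier ?U. y \<noteq> \<zero>\<^bsub>?U\<^esub> \<and> T y = l \<odot>\<^bsub>?U\<^esub> y"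
    by (rule T'.eigenvector_exists[OF alg X.tens_closed[OF oneE b0W] t0 _ _ hd ann])
      (use p in auto)
  then obtain l y where l: "l \<in> carrier E" and y: "y \<in> carrier ?U" "y \<noteq> \<zero>\<^bsub>?U\<^esub>" "T y = l \<odot>\<^bsub>?U\<^esub> y" by blast
  \<comment> \<open>The eigenspace of \<open>l\<close>. It is invariant because \<open>T\<close>,
    the extension of \<open>\<theta>\<close>, commutes with the group.\<close>
  let ?S = "{u \<in> carrier ?U. T u = l \<odot>\<^bsub>?U\<^esub> u}"
  have sub: "LinearCombinations.submodule E ?S ?U"
  proof (rule LinearCombinations.submodule.intro[OF X.module_U])
    show "\<And>a v. a \<in> carrier E \<Longrightarrow> v \<in> ?S \<Longrightarrow> a \<odot>\<^bsub>?U\<^esub> v \<in> ?S"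
      using l by (auto simp: T.smult X.U.smult_assoc1[symmetric] E.m_comm)
  qed (use l in \<open>auto simp: T.add T.zero X.U.smult_r_distr\<close>)
  have inv: "act ?U g ` ?S \<subseteq> ?S" if g: "g \<in> carrier G" for g
  proof -
    interpret a: semilinear E E "\<lambda>a. a" ?U ?U "act ?U g" by (rule X.act_tens(1)[OF act[OF g]])
    note at = X.act_tens(2)[OF act[OF g]]
    have actW: "act W g w \<in> carrier W" if "w \<in> carrier W" for w using semilinear.closed[OF act[OF g] that] .
    have comm: "T (act ?U g u) = act ?U g (T u)" if "u \<in> carrier ?U" for u
    proof -
      have "(T \<circ> act ?U g) u = (act ?U g \<circ> T) u"
      proof (rule X.eq_on_tens_one[OF _ _ _ that])
        show "semilinear E E (\<lambda>a. a) ?U ?U (T \<circ> act ?U g)" using a.comp[OF T] by (simp add: comp_def)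
        show "semilinear E E (\<lambda>a. a) ?U ?U (act ?U g \<circ> T)"
          using T.comp[OF a.semilinear_axioms] by (simp add: comp_def)
        show "(T \<circ> act ?U g) (X.tens \<one>\<^bsub>E\<^esub> m) = (act ?U g \<circ> T) (X.tens \<one>\<^bsub>E\<^esub> m)" if "m \<in> carrier W" for m
          using that g by (simp add: at Tt actW equiv \<theta>.closed)
      qed
      then show ?thesis by simp
    qed
    show ?thesis using comm l by (auto simp: a.closed a.smult)
  qed
  have "?S = {\<zero>\<^bsub>?U\<^esub>} \<or> ?S = carrier ?U"
    using sU[unfolded simple_RG_module_def, THEN conjunct2, THEN conjunct2, THEN spec, THEN mp, of ?S] sub inv by simp
  then have S: "T u = l \<odot>\<^bsub>?U\<^esub> u" if "u \<in> carrier ?U" for u using y that by blast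
  have tl: "X.tens \<one>\<^bsub>E\<^esub> (\<theta> w) = X.tens l w" if "w \<in> carrier W" for w
    using S[OF X.tens_closed[OF oneE that]] Tt[OF that] X.smult_tens_one[OF l that] by simp
  have key: "\<epsilon> (c b (\<theta> w)) = l \<otimes>\<^bsub>E\<^esub> \<epsilon> (c b w)" if "b \<in> B" "w \<in> carrier W" for b w
    using tl[OF that(2)] \<phi>t[OF that(1) oneE \<theta>.closed[OF that(2)]] \<phi>t[OF that(1) l that(2)]
      cc[OF that(1) \<theta>.closed[OF that(2)]] by simp
  let ?c = "c b0 (\<theta> b0)"
  have c0: "?c \<in> carrier K" by (rule cc[OF b0 \<theta>.closed[OF b0W]])
  \<comment> \<open>The coordinate of \<open>b0\<close> at \<open>b0\<close> is one, so
    \<open>l\<close> is the image of an element of \<open>K\<close>.\<close>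
  have lc: "l = \<epsilon> ?c" using key[OF b0 b0W] \<delta>[OF b0 b0] l by simp
  have ck: "c b (\<theta> w) = ?c \<otimes>\<^bsub>K\<^esub> c b w" if "b \<in> B" "w \<in> carrier W" for b w
    by (rule inj_onD[OF \<epsilon>inj]) (use key[OF that] lc c0 cc that \<theta>.closed in auto)
  have "\<theta> w = ?c \<odot>\<^bsub>W\<^esub> w" if w: "w \<in> carrier W" for w
  proof -
    have "\<theta> w = (\<Oplus>\<^bsub>W\<^esub> b\<in>B. c b (\<theta> w) \<odot>\<^bsub>W\<^esub> b)" by (rule expand[OF \<theta>.closed[OF w]])
    also have "\<dots> = (\<Oplus>\<^bsub>W\<^esub> b\<in>B. ?c \<odot>\<^bsub>W\<^esub> (c b w \<odot>\<^bsub>W\<^esub> b))"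
    proof (rule W.M.finsum_cong'[OF refl])
      show "(\<lambda>b. ?c \<odot>\<^bsub>W\<^esub> (c b w \<odot>\<^bsub>W\<^esub> b)) \<in> B \<rightarrow> carrier W"
        by (intro Pi_I W.smult_closed c0 cc w subsetD[OF B'(1)])
      show "c b (\<theta> w) \<odot>\<^bsub>W\<^esub> b = ?c \<odot>\<^bsub>W\<^esub> (c b w \<odot>\<^bsub>W\<^esub> b)" if "b \<in> B" for b
        unfolding ck[OF that w] by (rule W.smult_assoc1[OF c0 cc[OF that w] subsetD[OF B'(1) that]])
    qed
    also have "\<dots> = ?c \<odot>\<^bsub>W\<^esub> (\<Oplus>\<^bsub>W\<^esub> b\<in>B. c b w \<odot>\<^bsub>W\<^esub> b)"
      by (rule W.finsum_smult[symmetric, OF c0]) (intro Pi_I W.smult_closed cc w subsetD[OF B'(1)])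
    also have "\<dots> = ?c \<odot>\<^bsub>W\<^esub> w" using expand[OF w] by (rule arg_cong[OF sym])
    finally show ?thesis .
  qed
  then show "\<exists>c\<in>carrier K. \<forall>x\<in>carrier W. \<theta> x = c \<odot>\<^bsub>W\<^esub> x" using c0 by blast
qed

section \<open>Determinants\<close>

text \<open>The even and the odd permutations are summed separately, so that two equal columns cancel in
  every characteristic.\<close>

definition perms :: "nat \<Rightarrow> bool \<Rightarrow> (nat \<Rightarrow> nat) set" where
  "perms k e = {p. p permutes {..<k} \<and> evenperm p = e}"

definition leibniz :: "('r, 'b) ring_scheme \<Rightarrow> nat \<Rightarrow> bool \<Rightarrow> (nat \<Rightarrow> nat \<Rightarrow> 'r) \<Rightarrow> 'r" where
  "leibniz R k e A = (\<Oplus>\<^bsub>R\<^esub> p\<in>perms k e. \<Otimes>\<^bsub>R\<^esub> a\<in>{..<k}. A (p a) a)"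

definition mdet :: "('r, 'b) ring_scheme \<Rightarrow> nat \<Rightarrow> (nat \<Rightarrow> nat \<Rightarrow> 'r) \<Rightarrow> 'r" where
  "mdet R k A = leibniz R k True A \<ominus>\<^bsub>R\<^esub> leibniz R k False A"

lemma finite_perms: "finite (perms k e)"
  using finite_permutations[of "{..<k}"] by (auto simp: perms_def intro: finite_subset)

lemma permsD: "p \<in> perms k e \<Longrightarrow> p permutes {..<k}"
  by (simp add: perms_def)

lemma perms_less: "p \<in> perms k e \<Longrightarrow> a < k \<Longrightarrow> p a < k"
  using permutes_in_image[OF permsD] by fastforce

context cring
begin

lemma leibniz_term_closed:
  assumes "p \<in> perms k e" "\<And>a b. a < k \<Longrightarrow> b < k \<Longrightarrow> A a b \<in> carrier R"
  shows "(\<Otimes> a\<in>{..<k}. A (p a) a) \<in> carrier R"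
  using assms perms_less by (intro finprod_closed) auto

lemma leibniz_closed:
  assumes "\<And>a b. a < k \<Longrightarrow> b < k \<Longrightarrow> A a b \<in> carrier R"
  shows "leibniz R k e A \<in> carrier R"
  unfolding leibniz_def using leibniz_term_closed assms by (intro finsum_closed) auto

lemma mdet_closed:
  assumes "\<And>a b. a < k \<Longrightarrow> b < k \<Longrightarrow> A a b \<in> carrier R"
  shows "mdet R k A \<in> carrier R"
  unfolding mdet_def using leibniz_closed[OF assms] by simp

text \<open>Each permutation uses exactly one entry of column \<open>j\<close>. Both linearity
  statements below follow from this expansion.\<close>

lemma leibniz_column:
  assumes A: "\<And>a b. a < k \<Longrightarrow> b < k \<Longrightarrow> A a b \<in> carrier R" and j: "j < k"
    and C: "\<And>a. a < k \<Longrightarrow> C a \<in> carrier R"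
  shows "leibniz R k e (\<lambda>a b. if b = j then C a else A a b) =
    (\<Oplus> p\<in>perms k e. C (p j) \<otimes> (\<Otimes> a\<in>{..<k} - {j}. A (p a) a))"
  unfolding leibniz_def
proof (rule finsum_cong'[OF refl])
  have c: "(\<Otimes> a\<in>{..<k} - {j}. A (p a) a) \<in> carrier R" if "p \<in> perms k e" for p
    using that A perms_less by (intro finprod_closed) auto
  show "(\<lambda>p. C (p j) \<otimes> (\<Otimes> a\<in>{..<k} - {j}. A (p a) a)) \<in> perms k e \<rightarrow> carrier R"
    using c C perms_less[OF _ j] by auto
  fix p assume p: "p \<in> perms k e"
  have "(\<Otimes> a\<in>insert j ({..<k} - {j}). if a = j then C (p a) else A (p a) a) =
      C (p j) \<otimes> (\<Otimes> a\<in>{..<k} - {j}. if a = j then C (p a) else A (p a) a)"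
    by (subst finprod_insert) (use p j A C perms_less in auto)
  also have "(\<Otimes> a\<in>{..<k} - {j}. if a = j then C (p a) else A (p a) a) = (\<Otimes> a\<in>{..<k} - {j}. A (p a) a)"
    by (rule finprod_cong') (use p A perms_less in auto)
  also have "insert j ({..<k} - {j}) = {..<k}" using j by auto
  finally show "(\<Otimes> a\<in>{..<k}. if a = j then C (p a) else A (p a) a) =
      C (p j) \<otimes> (\<Otimes> a\<in>{..<k} - {j}. A (p a) a)" .
qed

lemma leibniz_column_add:
  assumes A: "\<And>a b. a < k \<Longrightarrow> b < k \<Longrightarrow> A a b \<in> carrier R" and j: "j < k"
    and C: "\<And>a. a < k \<Longrightarrow> C a \<in> carrier R" and D: "\<And>a. a < k \<Longrightarrow> D a \<in> carrier R"
  shows "leibniz R k e (\<lambda>a b. if b = j then C a \<oplus> D a else A a b) =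
    leibniz R k e (\<lambda>a b. if b = j then C a else A a b) \<oplus> leibniz R k e (\<lambda>a b. if b = j then D a else A a b)"
proof -
  have c: "(\<Otimes> a\<in>{..<k} - {j}. A (p a) a) \<in> carrier R" if "p \<in> perms k e" for p
    using that A perms_less by (intro finprod_closed) auto
  have "leibniz R k e (\<lambda>a b. if b = j then C a \<oplus> D a else A a b) =
      (\<Oplus> p\<in>perms k e. (C (p j) \<oplus> D (p j)) \<otimes> (\<Otimes> a\<in>{..<k} - {j}. A (p a) a))"
    by (rule leibniz_column[OF A j, where C = "\<lambda>a. C a \<oplus> D a"]) (use C D in auto)
  also have "\<dots> = (\<Oplus> p\<in>perms k e. C (p j) \<otimes> (\<Otimes> a\<in>{..<k} - {j}. A (p a) a) \<oplus>
      D (p j) \<otimes> (\<Otimes> a\<in>{..<k} - {j}. A (p a) a))"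
    by (rule finsum_cong'[OF refl]) (use c C D perms_less[OF _ j] in \<open>auto simp: l_distr\<close>)
  also have "\<dots> = (\<Oplus> p\<in>perms k e. C (p j) \<otimes> (\<Otimes> a\<in>{..<k} - {j}. A (p a) a)) \<oplus>
      (\<Oplus> p\<in>perms k e. D (p j) \<otimes> (\<Otimes> a\<in>{..<k} - {j}. A (p a) a))"
    by (rule finsum_addf) (use c C D perms_less[OF _ j] in auto)
  finally show ?thesis using leibniz_column[OF A j C] leibniz_column[OF A j D] by simp
qed

lemma leibniz_column_smult:
  assumes A: "\<And>a b. a < k \<Longrightarrow> b < k \<Longrightarrow> A a b \<in> carrier R" and j: "j < k"
    and C: "\<And>a. a < k \<Longrightarrow> C a \<in> carrier R" and r: "r \<in> carrier R"
  shows "leibniz R k e (\<lambda>a b. if b = j then r \<otimes> C a else A a b) =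
    r \<otimes> leibniz R k e (\<lambda>a b. if b = j then C a else A a b)"
proof -
  have c: "(\<Otimes> a\<in>{..<k} - {j}. A (p a) a) \<in> carrier R" if "p \<in> perms k e" for p
    using that A perms_less by (intro finprod_closed) auto
  have "leibniz R k e (\<lambda>a b. if b = j then r \<otimes> C a else A a b) =
      (\<Oplus> p\<in>perms k e. (r \<otimes> C (p j)) \<otimes> (\<Otimes> a\<in>{..<k} - {j}. A (p a) a))"
    by (rule leibniz_column[OF A j, where C = "\<lambda>a. r \<otimes> C a"]) (use C r in auto)
  also have "\<dots> = (\<Oplus> p\<in>perms k e. r \<otimes> (C (p j) \<otimes> (\<Otimes> a\<in>{..<k} - {j}. A (p a) a)))"
    by (rule finsum_cong'[OF refl]) (use c C r perms_less[OF _ j] in \<open>auto simp: m_assoc\<close>)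
  also have "\<dots> = r \<otimes> (\<Oplus> p\<in>perms k e. C (p j) \<otimes> (\<Otimes> a\<in>{..<k} - {j}. A (p a) a))"
    by (rule finsum_rdistr[symmetric, OF finite_perms r]) (use c C perms_less[OF _ j] in auto)
  finally show ?thesis using leibniz_column[OF A j C] by simp
qed

text \<open>Composition with the transposition of \<open>i\<close> and \<open>j\<close> matches even
  with odd permutations and leaves every product unchanged, so the two halves of the determinant
  coincide.\<close>

lemma mdet_equal_columns:
  assumes A: "\<And>a b. a < k \<Longrightarrow> b < k \<Longrightarrow> A a b \<in> carrier R" and ij: "i < j" "j < k"
    and eq: "\<And>a. a < k \<Longrightarrow> A a i = A a j"
  shows "mdet R k A = \<zero>"
proof -
  let ?t = "transpose i j"
  have t: "?t permutes {..<k}" using ij by (intro permutes_swap_id) auto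
  have comp: "(\<lambda>p. p \<circ> ?t) ` perms k e \<subseteq> perms k (\<not> e)" for e
  proof
    fix q assume "q \<in> (\<lambda>p. p \<circ> ?t) ` perms k e"
    then obtain p where p: "p \<in> perms k e" "q = p \<circ> ?t" by blast
    have "permutation p" "permutation ?t"
      using permsD[OF p(1)] t permutation_permutes by blast+
    then show "q \<in> perms k (\<not> e)"
      using p ij permutes_compose[OF t permsD[OF p(1)]] by (auto simp: perms_def evenperm_comp evenperm_swap)
  qed
  have invol: "p \<circ> ?t \<circ> ?t = p" for p :: "nat \<Rightarrow> nat" by (simp add: fun_eq_iff)
  have bij: "(\<lambda>p. p \<circ> ?t) ` perms k True = perms k False"
  proof
    show "perms k False \<subseteq> (\<lambda>p. p \<circ> ?t) ` perms k True"
    proof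
      fix p assume "p \<in> perms k False"
      then have "p \<circ> ?t \<in> perms k True" using comp[of False] by auto
      then show "p \<in> (\<lambda>p. p \<circ> ?t) ` perms k True" using invol[of p] by (intro image_eqI[of _ _ "p \<circ> ?t"]) auto
    qed
  qed (use comp[of True] in simp)
  have inj: "inj_on (\<lambda>p. p \<circ> ?t) (perms k True)"
    by (rule inj_onI) (metis invol)
  have sym: "(\<Otimes> a\<in>{..<k}. A ((p \<circ> ?t) a) a) = (\<Otimes> a\<in>{..<k}. A (p a) a)" if p: "p \<in> perms k e" for p e
  proof -
    have timg: "?t ` {..<k} = {..<k}" by (rule permutes_image[OF t])
    have "(\<Otimes> a\<in>{..<k}. A ((p \<circ> ?t) a) a) = (\<Otimes> a\<in>?t ` {..<k}. A ((p \<circ> ?t) a) a)" by (simp only: timg)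
    also have "\<dots> = (\<Otimes> a\<in>{..<k}. A ((p \<circ> ?t) (?t a)) (?t a))"
    proof (rule finprod_reindex)
      show "(\<lambda>a. A ((p \<circ> ?t) a) a) \<in> ?t ` {..<k} \<rightarrow> carrier R"
        unfolding timg using comp[of e] p A perms_less[of "p \<circ> ?t" k "\<not> e"] by auto
      show "inj_on ?t {..<k}" using permutes_inj_on[OF t] .
    qed
    also have "\<dots> = (\<Otimes> a\<in>{..<k}. A (p a) a)"
    proof (rule finprod_cong'[OF refl])
      show "(\<lambda>a. A (p a) a) \<in> {..<k} \<rightarrow> carrier R" using p A perms_less by auto
      show "A ((p \<circ> ?t) (?t a)) (?t a) = A (p a) a" if "a \<in> {..<k}" for a
        using eq[OF perms_less[OF p, of a]] that by (auto simp: transpose_def)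
    qed
    finally show ?thesis .
  qed
  have "leibniz R k False A = (\<Oplus> p\<in>perms k True. \<Otimes> a\<in>{..<k}. A ((p \<circ> ?t) a) a)"
    unfolding leibniz_def bij[symmetric]
    by (rule add.finprod_reindex[OF _ inj]) (use bij leibniz_term_closed A in auto)
  also have "\<dots> = leibniz R k True A"
    unfolding leibniz_def
    by (rule finsum_cong'[OF refl]) (use sym leibniz_term_closed A in auto)
  finally show ?thesis using leibniz_closed[OF A, where e = True] by (simp add: mdet_def)
qed

lemma mdet_cong:
  assumes "\<And>a b. a < k \<Longrightarrow> b < k \<Longrightarrow> A a b = B a b" "\<And>a b. a < k \<Longrightarrow> b < k \<Longrightarrow> B a b \<in> carrier R"
  shows "mdet R k A = mdet R k B"
proof -
  have "leibniz R k e A = leibniz R k e B" for e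
    unfolding leibniz_def
  proof (rule finsum_cong'[OF refl])
    show "(\<lambda>p. \<Otimes> a\<in>{..<k}. B (p a) a) \<in> perms k e \<rightarrow> carrier R"
      using leibniz_term_closed assms(2) by auto
    show "(\<Otimes> a\<in>{..<k}. A (p a) a) = (\<Otimes> a\<in>{..<k}. B (p a) a)" if "p \<in> perms k e" for p
      by (rule finprod_cong') (use assms perms_less[OF that] in auto)
  qed
  then show ?thesis by (simp add: mdet_def)
qed

text \<open>A permutation other than the identity moves some \<open>a\<close>, and the factor at
  \<open>a\<close> is zero.\<close>

lemma mdet_identity: "mdet R k (\<lambda>a b. if a = b then \<one> else \<zero>) = \<one>"
proof -
  let ?A = "\<lambda>a b. if a = b then \<one> else \<zero>"
  have t: "(\<Otimes> a\<in>{..<k}. ?A (p a) a) = (if p = id then \<one> else \<zero>)" if p: "p \<in> perms k e" for p e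
  proof (cases "p = id")
    case False
    then obtain a where a: "p a \<noteq> a" by (auto simp: fun_eq_iff)
    then have "a \<in> {..<k}" using permutes_not_in[OF permsD[OF p]] by blast
    then have "(\<Otimes> a\<in>{..<k}. ?A (p a) a) = (\<Otimes> a\<in>insert a ({..<k} - {a}). ?A (p a) a)"
      by (simp add: insert_absorb)
    also have "\<dots> = ?A (p a) a \<otimes> (\<Otimes> a\<in>{..<k} - {a}. ?A (p a) a)"
      by (rule finprod_insert) auto
    also have "\<dots> = \<zero>" using a by simp
    finally show ?thesis using False by simp
  qed simp
  have "leibniz R k False ?A = (\<Oplus> p\<in>perms k False. \<zero>)"
    unfolding leibniz_def
    by (rule finsum_cong'[OF refl]) (auto simp: t, auto simp: perms_def)
  moreover have "leibniz R k True ?A = (\<Oplus> p\<in>perms k True. if id = p then \<one> else \<zero>)"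
    unfolding leibniz_def by (rule finsum_cong'[OF refl]) (auto simp: t)
  moreover have "\<dots> = \<one>"
  proof -
    have "id \<in> perms k True" by (simp add: perms_def permutes_id)
    from add.finprod_singleton[OF this finite_perms, of "\<lambda>_. \<one>"] show ?thesis by simp
  qed
  ultimately show ?thesis by (simp add: mdet_def a_minus_def)
qed

text \<open>In the product for \<open>p\<close> the row factors occur as \<open>d (p a)\<close>;
  reindexing along \<open>p\<close> makes their product independent of \<open>p\<close>.\<close>

lemma mdet_scale_rows:
  assumes A: "\<And>a b. a < k \<Longrightarrow> b < k \<Longrightarrow> A a b \<in> carrier R" and d: "\<And>a. a < k \<Longrightarrow> d a \<in> carrier R"
  shows "mdet R k (\<lambda>a b. d a \<otimes> A a b) = (\<Otimes> a\<in>{..<k}. d a) \<otimes> mdet R k A"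
proof -
  let ?d = "\<Otimes> a\<in>{..<k}. d a"
  have dc: "?d \<in> carrier R" using d by (intro finprod_closed) auto
  have "leibniz R k e (\<lambda>a b. d a \<otimes> A a b) = ?d \<otimes> leibniz R k e A" for e
  proof -
    have "leibniz R k e (\<lambda>a b. d a \<otimes> A a b) = (\<Oplus> p\<in>perms k e. ?d \<otimes> (\<Otimes> a\<in>{..<k}. A (p a) a))"
      unfolding leibniz_def
    proof (rule finsum_cong'[OF refl])
      fix p assume p: "p \<in> perms k e"
      have "(\<Otimes> a\<in>{..<k}. d (p a) \<otimes> A (p a) a) = (\<Otimes> a\<in>{..<k}. d (p a)) \<otimes> (\<Otimes> a\<in>{..<k}. A (p a) a)"
        by (rule finprod_multf) (use A d perms_less[OF p] in auto)
      also have "(\<Otimes> a\<in>{..<k}. d (p a)) = (\<Otimes> a\<in>p ` {..<k}. d a)"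
        by (rule finprod_reindex[symmetric])
          (use d permutes_image[OF permsD[OF p]] permutes_inj_on[OF permsD[OF p]] in auto)
      also have "p ` {..<k} = {..<k}" by (rule permutes_image[OF permsD[OF p]])
      finally show "(\<Otimes> a\<in>{..<k}. d (p a) \<otimes> A (p a) a) = ?d \<otimes> (\<Otimes> a\<in>{..<k}. A (p a) a)" .
    qed (use dc leibniz_term_closed A in auto)
    also have "\<dots> = ?d \<otimes> leibniz R k e A"
      unfolding leibniz_def by (rule finsum_rdistr[symmetric, OF finite_perms dc]) (use leibniz_term_closed A in auto)
    finally show ?thesis .
  qed
  then show ?thesis using leibniz_closed[OF A] dc by (simp add: mdet_def r_minus r_distr a_minus_def)
qed

end

lemma (in ring_hom_cring) mdet_hom:
  assumes A: "\<And>a b. a < k \<Longrightarrow> b < k \<Longrightarrow> A a b \<in> carrier R"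
  shows "mdet S k (\<lambda>a b. h (A a b)) = h (mdet R k A)"
proof -
  have "leibniz S k e (\<lambda>a b. h (A a b)) = h (leibniz R k e A)" for e
  proof -
    have "h (leibniz R k e A) = (\<Oplus>\<^bsub>S\<^esub> p\<in>perms k e. (h \<circ> (\<lambda>p. \<Otimes> a\<in>{..<k}. A (p a) a)) p)"
      unfolding leibniz_def by (rule hom_finsum) (use R.leibniz_term_closed A in auto)
    also have "\<dots> = (\<Oplus>\<^bsub>S\<^esub> p\<in>perms k e. \<Otimes>\<^bsub>S\<^esub> a\<in>{..<k}. h (A (p a) a))"
    proof (rule S.finsum_cong'[OF refl])
      show "(\<lambda>p. \<Otimes>\<^bsub>S\<^esub> a\<in>{..<k}. h (A (p a) a)) \<in> perms k e \<rightarrow> carrier S"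
        using S.leibniz_term_closed[of _ k e "\<lambda>a b. h (A a b)"] A by auto
      show "(h \<circ> (\<lambda>p. \<Otimes> a\<in>{..<k}. A (p a) a)) p = (\<Otimes>\<^bsub>S\<^esub> a\<in>{..<k}. h (A (p a) a))" if "p \<in> perms k e" for p
        using hom_finprod[of "\<lambda>a. A (p a) a" "{..<k}"] A perms_less[OF that] by (auto simp: comp_def)
    qed
    finally show ?thesis by (simp add: leibniz_def)
  qed
  then show ?thesis using R.leibniz_closed[OF A] by (simp add: mdet_def a_minus_def)
qed

text \<open>The vectors of \<open>xs\<close> give the columns, the functionals \<open>f a\<close>
  the rows. Through the universal property such minors become linear functionals on the exterior
  power.\<close>

lemma mdet_alternating:
  assumes K: "cring K" and f: "\<And>a. a < k \<Longrightarrow> semilinear K K (\<lambda>a. a) V (self_module K) (f a)"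
  shows "alternating K (\<lambda>a. a) k V (self_module K) (\<lambda>xs. mdet K k (\<lambda>a b. f a (xs ! b)))"
proof -
  interpret K: cring K by (rule K)
  have fc: "f a x \<in> carrier K" if "a < k" "x \<in> carrier V" for a x
    using semilinear.closed[OF f[OF that(1)] that(2)] by simp
  have nth: "xs ! b \<in> carrier V" if "xs \<in> tuples k V" "b < k" for xs b
    using that nth_mem[of b xs] by (auto simp: tuples_iff simp del: nth_mem)
  have c: "f a (xs ! b) \<in> carrier K" if "xs \<in> tuples k V" "a < k" "b < k" for xs a b
    using fc nth that by blast
  have upd: "mdet K k (\<lambda>a b. f a (xs[j := x] ! b)) =
      mdet K k (\<lambda>a b. if b = j then f a x else f a (xs ! b))"
    if "xs \<in> tuples k V" "j < k" "x \<in> carrier V" for xs j x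
    by (rule K.mdet_cong) (use that c fc in \<open>auto simp: tuples_iff nth_list_update\<close>)
  show ?thesis
  proof
    fix xs assume xs: "xs \<in> tuples k V"
    show "mdet K k (\<lambda>a b. f a (xs ! b)) \<in> carrier (self_module K)"
      using K.mdet_closed[of k "\<lambda>a b. f a (xs ! b)"] c[OF xs] by simp
    fix j x assume j: "j < k" and x: "x \<in> carrier V"
    have lc: "leibniz K k e (\<lambda>a b. if b = j then C a else f a (xs ! b)) \<in> carrier K"
      if "\<And>a. a < k \<Longrightarrow> C a \<in> carrier K" for e C
      by (rule K.leibniz_closed) (use that c[OF xs] in auto)
    {
      fix y assume y: "y \<in> carrier V"
      have V: "x \<oplus>\<^bsub>V\<^esub> y \<in> carrier V"
        using module.axioms(2)[OF semilinear.dom[OF f[OF j]]] x y by (simp add: abelian_group.axioms abelian_monoid.a_closed)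
      have e: "mdet K k (\<lambda>a b. if b = j then f a (x \<oplus>\<^bsub>V\<^esub> y) else f a (xs ! b)) =
          mdet K k (\<lambda>a b. if b = j then f a x \<oplus>\<^bsub>K\<^esub> f a y else f a (xs ! b))"
        by (rule K.mdet_cong) (use semilinear.add[OF f] x y fc c[OF xs] in auto)
      show "mdet K k (\<lambda>a b. f a (xs[j := x \<oplus>\<^bsub>V\<^esub> y] ! b)) = mdet K k (\<lambda>a b. f a (xs[j := x] ! b))
          \<oplus>\<^bsub>self_module K\<^esub> mdet K k (\<lambda>a b. f a (xs[j := y] ! b))"
        using lc[of "\<lambda>a. f a x"] lc[of "\<lambda>a. f a y"] fc[OF _ x] fc[OF _ y]
        unfolding upd[OF xs j V] upd[OF xs j x] upd[OF xs j y] e unfolding mdet_def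
        by (simp add: K.leibniz_column_add[OF c[OF xs] j fc[OF _ x] fc[OF _ y]] a_minus_def K.minus_add K.a_ac)
    }
    fix r assume r: "r \<in> carrier K"
    have V: "r \<odot>\<^bsub>V\<^esub> x \<in> carrier V"
      using module.smult_closed[OF semilinear.dom[OF f[OF j]] r x] .
    have e: "mdet K k (\<lambda>a b. if b = j then f a (r \<odot>\<^bsub>V\<^esub> x) else f a (xs ! b)) =
        mdet K k (\<lambda>a b. if b = j then r \<otimes>\<^bsub>K\<^esub> f a x else f a (xs ! b))"
      by (rule K.mdet_cong) (use semilinear.smult[OF f] x r fc c[OF xs] in auto)
    show "mdet K k (\<lambda>a b. f a (xs[j := r \<odot>\<^bsub>V\<^esub> x] ! b)) =
        r \<odot>\<^bsub>self_module K\<^esub> mdet K k (\<lambda>a b. f a (xs[j := x] ! b))"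
      using lc[of "\<lambda>a. f a x"] fc[OF _ x] r
      unfolding upd[OF xs j V] upd[OF xs j x] e unfolding mdet_def
      by (simp add: K.leibniz_column_smult[OF c[OF xs] j fc[OF _ x] r] a_minus_def K.r_distr K.r_minus)
  next
    fix xs i j assume xs: "xs \<in> tuples k V" and "i < j" "j < k" "xs ! i = xs ! j"
    then show "mdet K k (\<lambda>a b. f a (xs ! b)) = \<zero>\<^bsub>self_module K\<^esub>"
      using K.mdet_equal_columns[of k "\<lambda>a b. f a (xs ! b)" i j] c[OF xs] by simp
  qed
qed

section \<open>Diagonalisation over a principal ideal domain\<close>

context principal_domain
begin

text \<open>The maximum condition on ideals, from Zorn's lemma and the fact that a nonempty chain of
  ideals contains its union. In the diagonalisation it replaces a termination argument.\<close>

lemma maximal_principal_ideal: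
  assumes "S \<subseteq> carrier R" "S \<noteq> {}"
  obtains a where "a \<in> S" "\<And>b. b \<in> S \<Longrightarrow> PIdl a \<subseteq> PIdl b \<Longrightarrow> PIdl b = PIdl a"
proof -
  have "\<exists>I\<in>(\<lambda>a. PIdl a) ` S. \<forall>J\<in>(\<lambda>a. PIdl a) ` S. I \<subseteq> J \<longrightarrow> J = I"
  proof (rule subset_Zorn_nonempty)
    fix C assume C: "C \<noteq> {}" "subset.chain ((\<lambda>a. PIdl a) ` S) C"
    have "subset.chain {I. ideal I R} C"
    proof -
      have "C \<subseteq> {I. ideal I R}"
      proof
        fix I assume "I \<in> C"
        then obtain a where "a \<in> S" "I = PIdl a" using C(2) unfolding pred_on.chain_def by blast
        then show "I \<in> {I. ideal I R}" using cgenideal_ideal assms(1) by blast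
      qed
      then show ?thesis using C(2) unfolding pred_on.chain_def by simp
    qed
    then have "\<Union> C \<in> C" by (rule ideal_chain_is_trivial[OF C(1)])
    then show "\<Union> C \<in> (\<lambda>a. PIdl a) ` S" using C(2) unfolding pred_on.chain_def by blast
  qed (use assms in auto)
  then obtain a where "a \<in> S" "\<forall>J\<in>(\<lambda>a. PIdl a) ` S. PIdl a \<subseteq> J \<longrightarrow> J = PIdl a" by auto
  then show thesis by (intro that) auto
qed

text \<open>\<open>g\<close> is a greatest common divisor with Bezout coefficients \<open>x\<close>
  and \<open>y\<close>. The last equation says that the row \<open>p\<close>, \<open>q\<close> can
  be completed to a matrix of determinant one.\<close>

lemma unimodular_pair:
  assumes a: "a \<in> carrier R" and b: "b \<in> carrier R"
  obtains g p q x y where "g \<in> carrier R" "p \<in> carrier R" "q \<in> carrier R" "x \<in> carrier R" "y \<in> carrier R"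
    "a = p \<otimes> g" "b = q \<otimes> g" "g = x \<otimes> a \<oplus> y \<otimes> b" "x \<otimes> p \<oplus> y \<otimes> q = \<one>"
proof -
  interpret I: ideal "PIdl a <+>\<^bsub>R\<^esub> PIdl b" R
    by (rule add_ideals[OF cgenideal_ideal[OF a] cgenideal_ideal[OF b]])
  obtain g where g: "g \<in> carrier R" "PIdl a <+>\<^bsub>R\<^esub> PIdl b = PIdl g" using exists_gen[OF I.is_ideal] by blast
  have az: "\<zero> \<in> PIdl a" "\<zero> \<in> PIdl b"
    using cgenideal_ideal[OF a] cgenideal_ideal[OF b] by (simp_all add: additive_subgroup.zero_closed ideal.axioms(1))
  have "a \<oplus> \<zero> \<in> PIdl g" "\<zero> \<oplus> b \<in> PIdl g"
    using az cgenideal_self[OF a] cgenideal_self[OF b] unfolding g(2)[symmetric] set_add_def' by blast+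
  then obtain p q where pq: "p \<in> carrier R" "q \<in> carrier R" "a = p \<otimes> g" "b = q \<otimes> g"
    using a b unfolding cgenideal_def by auto
  have "g \<in> PIdl a <+>\<^bsub>R\<^esub> PIdl b" using g cgenideal_self by blast
  then obtain x y where xy: "x \<in> carrier R" "y \<in> carrier R" "g = x \<otimes> a \<oplus> y \<otimes> b"
    unfolding set_add_def' cgenideal_def by blast
  show thesis
  proof (cases "g = \<zero>")
    case True
    then have "a = \<zero>" "b = \<zero>" using pq by auto
    \<comment> \<open>For \<open>a = b = 0\<close> nothing can be cancelled; the choice is
      \<open>p = x = 1\<close> and \<open>q = y = 0\<close>.\<close>
    then show ?thesis using that[of \<zero> \<one> \<zero> \<one> \<zero>] by simp
  next
    case False
    have "(x \<otimes> p \<oplus> y \<otimes> q) \<otimes> g = x \<otimes> (p \<otimes> g) \<oplus> y \<otimes> (q \<otimes> g)"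
      using pq(1,2) xy(1,2) g(1) by (simp add: l_distr m_assoc)
    also have "\<dots> = x \<otimes> a \<oplus> y \<otimes> b" by (simp only: pq(3,4)[symmetric])
    also have "\<dots> = g" by (rule xy(3)[symmetric])
    also have "\<dots> = \<one> \<otimes> g" using g(1) by simp
    finally have "x \<otimes> p \<oplus> y \<otimes> q = \<one>"
      using m_rcancel[OF False g(1)] pq(1,2) xy(1,2) by simp
    then show ?thesis using that[OF g(1) pq(1,2) xy(1,2) pq(3,4) xy(3)] by blast
  qed
qed

end

section \<open>Spans under changes of generators, and the diagonal form\<close>

context module
begin

lemma span_eqI:
  assumes "A \<subseteq> carrier M" "B \<subseteq> carrier M" "A \<subseteq> span B" "B \<subseteq> span A"
  shows "span A = span B"
  using span_is_subset[OF assms(3) span_is_submodule[OF assms(2)]]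
    span_is_subset[OF assms(4) span_is_submodule[OF assms(1)]] by blast

lemma span_insert_cong:
  assumes "x \<in> carrier M" "A \<subseteq> carrier M" "B \<subseteq> carrier M" "span A = span B"
  shows "span (insert x A) = span (insert x B)"
proof (rule span_eqI)
  show "insert x A \<subseteq> carrier M" "insert x B \<subseteq> carrier M" using assms by auto
  show "insert x A \<subseteq> span (insert x B)"
    using in_own_span[of "insert x B"] in_own_span[of A] span_is_monotone[of B "insert x B"] assms by blast
  show "insert x B \<subseteq> span (insert x A)"
    using in_own_span[of "insert x A"] in_own_span[of B] span_is_monotone[of A "insert x A"] assms by blast
qed

lemma submodule_finsum:
  assumes H: "LinearCombinations.submodule R H M" and f: "\<And>i. i \<in> A \<Longrightarrow> f i \<in> H"
  shows "(\<Oplus>\<^bsub>M\<^esub> i\<in>A. f i) \<in> H"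
proof -
  interpret H: LinearCombinations.submodule R H M by (rule H)
  show ?thesis using f
  proof (induction A rule: infinite_finite_induct)
    case (insert a A)
    have "(\<Oplus>\<^bsub>M\<^esub> i\<in>insert a A. f i) = f a \<oplus>\<^bsub>M\<^esub> (\<Oplus>\<^bsub>M\<^esub> i\<in>A. f i)"
      by (rule M.finsum_insert) (use insert H.subset in auto)
    then show ?case using insert by simp
  qed simp_all
qed

text \<open>The span refers to the image of \<open>v\<close> as a set, the sum to the family with
  its possible repetitions; the coefficients are therefore indexed by places.\<close>

lemma span_family:
  assumes I: "finite I" and v: "v ` I \<subseteq> carrier M" and x: "x \<in> span (v ` I)"
  shows "\<exists>c. c \<in> I \<rightarrow> carrier R \<and> x = (\<Oplus>\<^bsub>M\<^esub> i\<in>I. c i \<odot>\<^bsub>M\<^esub> v i)"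
proof -
  let ?H = "{\<Oplus>\<^bsub>M\<^esub> i\<in>I. c i \<odot>\<^bsub>M\<^esub> v i | c. c \<in> I \<rightarrow> carrier R}"
  have vc: "v i \<in> carrier M" if "i \<in> I" for i using v that by blast
  have tc: "(\<lambda>i. c i \<odot>\<^bsub>M\<^esub> v i) \<in> I \<rightarrow> carrier M" if "c \<in> I \<rightarrow> carrier R" for c
    using that vc by (auto simp: Pi_iff)
  have "LinearCombinations.submodule R ?H M"
  proof (rule LinearCombinations.submodule.intro[OF module_axioms])
    show "?H \<subseteq> carrier M" using tc by (auto intro: M.finsum_closed)
    show "\<zero>\<^bsub>M\<^esub> \<in> ?H"
    proof -
      have "(\<Oplus>\<^bsub>M\<^esub> i\<in>I. \<zero>\<^bsub>R\<^esub> \<odot>\<^bsub>M\<^esub> v i) = \<zero>\<^bsub>M\<^esub>" by (rule M.finsum_all0) (use vc in auto)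
      then show ?thesis by (intro CollectI exI[of _ "\<lambda>_. \<zero>\<^bsub>R\<^esub>"]) auto
    qed
    fix x y assume "x \<in> ?H" "y \<in> ?H"
    then obtain c d where cd: "c \<in> I \<rightarrow> carrier R" "x = (\<Oplus>\<^bsub>M\<^esub> i\<in>I. c i \<odot>\<^bsub>M\<^esub> v i)"
      "d \<in> I \<rightarrow> carrier R" "y = (\<Oplus>\<^bsub>M\<^esub> i\<in>I. d i \<odot>\<^bsub>M\<^esub> v i)" by blast
    have "(\<Oplus>\<^bsub>M\<^esub> i\<in>I. (c i \<oplus>\<^bsub>R\<^esub> d i) \<odot>\<^bsub>M\<^esub> v i) = (\<Oplus>\<^bsub>M\<^esub> i\<in>I. c i \<odot>\<^bsub>M\<^esub> v i \<oplus>\<^bsub>M\<^esub> d i \<odot>\<^bsub>M\<^esub> v i)"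
      by (rule M.finsum_cong'[OF refl]) (use cd vc in \<open>auto simp: Pi_iff smult_l_distr\<close>)
    also have "\<dots> = x \<oplus>\<^bsub>M\<^esub> y" unfolding cd(2,4) by (rule M.finsum_addf[OF tc[OF cd(1)] tc[OF cd(3)]])
    finally show "x \<oplus>\<^bsub>M\<^esub> y \<in> ?H"
      using cd by (intro CollectI exI[of _ "\<lambda>i. c i \<oplus>\<^bsub>R\<^esub> d i"]) auto
  next
    fix r x assume r: "r \<in> carrier R" and "x \<in> ?H"
    then obtain c where c: "c \<in> I \<rightarrow> carrier R" "x = (\<Oplus>\<^bsub>M\<^esub> i\<in>I. c i \<odot>\<^bsub>M\<^esub> v i)" by blast
    have "(\<Oplus>\<^bsub>M\<^esub> i\<in>I. (r \<otimes>\<^bsub>R\<^esub> c i) \<odot>\<^bsub>M\<^esub> v i) = (\<Oplus>\<^bsub>M\<^esub> i\<in>I. r \<odot>\<^bsub>M\<^esub> (c i \<odot>\<^bsub>M\<^esub> v i))"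
      by (rule M.finsum_cong'[OF refl]) (use c vc r in \<open>auto simp: Pi_iff smult_assoc1\<close>)
    also have "\<dots> = r \<odot>\<^bsub>M\<^esub> x" unfolding c(2) by (rule finsum_smult[symmetric, OF r tc[OF c(1)]])
    finally show "r \<odot>\<^bsub>M\<^esub> x \<in> ?H" using c r by (intro CollectI exI[of _ "\<lambda>i. r \<otimes>\<^bsub>R\<^esub> c i"]) auto
  qed
  moreover have "v j \<in> ?H" if j: "j \<in> I" for j
  proof -
    have "(\<Oplus>\<^bsub>M\<^esub> i\<in>I. (if j = i then \<one>\<^bsub>R\<^esub> else \<zero>\<^bsub>R\<^esub>) \<odot>\<^bsub>M\<^esub> v i) = (\<Oplus>\<^bsub>M\<^esub> i\<in>I. if j = i then v i else \<zero>\<^bsub>M\<^esub>)"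
      by (rule M.finsum_cong'[OF refl]) (use vc in auto)
    also have "\<dots> = v j" by (rule M.add.finprod_singleton[OF j I]) (use vc in auto)
    finally show ?thesis by (intro CollectI exI[of _ "\<lambda>i. if j = i then \<one>\<^bsub>R\<^esub> else \<zero>\<^bsub>R\<^esub>"]) auto
  qed
  ultimately have "span (v ` I) \<subseteq> ?H" by (intro span_is_subset) auto
  then show ?thesis using x by blast
qed

text \<open>The change of the pair has the rows \<open>p\<close>, \<open>q\<close> and
  \<open>- y\<close>, \<open>x\<close>, with determinant one. The inverse substitution is
  \<open>u = x s - q t\<close> and \<open>v = y s + p t\<close>.\<close>

lemma span_unimodular_pair:
  assumes c: "u \<in> carrier M" "v \<in> carrier M" "A \<subseteq> carrier M"
    and r: "p \<in> carrier R" "q \<in> carrier R" "x \<in> carrier R" "y \<in> carrier R"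
    and one: "x \<otimes>\<^bsub>R\<^esub> p \<oplus>\<^bsub>R\<^esub> y \<otimes>\<^bsub>R\<^esub> q = \<one>\<^bsub>R\<^esub>"
  shows "span (insert (p \<odot>\<^bsub>M\<^esub> u \<oplus>\<^bsub>M\<^esub> q \<odot>\<^bsub>M\<^esub> v) (insert (x \<odot>\<^bsub>M\<^esub> v \<ominus>\<^bsub>M\<^esub> y \<odot>\<^bsub>M\<^esub> u) A)) = span (insert u (insert v A))"
    (is "span (insert ?s (insert ?t A)) = _")
proof (rule span_eqI)
  have st: "?s \<in> carrier M" "?t \<in> carrier M" using c r by auto
  then show sub: "insert ?s (insert ?t A) \<subseteq> carrier M" "insert u (insert v A) \<subseteq> carrier M" using c by auto
  interpret L: LinearCombinations.submodule R "span (insert ?s (insert ?t A))" M by (rule span_is_submodule[OF sub(1)])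
  interpret S: LinearCombinations.submodule R "span (insert u (insert v A))" M by (rule span_is_submodule[OF sub(2)])
  have L: "?s \<in> span (insert ?s (insert ?t A))" "?t \<in> span (insert ?s (insert ?t A))" "A \<subseteq> span (insert ?s (insert ?t A))"
    using in_own_span[OF sub(1)] by auto
  have S: "u \<in> span (insert u (insert v A))" "v \<in> span (insert u (insert v A))" "A \<subseteq> span (insert u (insert v A))"
    using in_own_span[OF sub(2)] by auto
  have minus: "a \<ominus>\<^bsub>M\<^esub> r \<odot>\<^bsub>M\<^esub> b = a \<oplus>\<^bsub>M\<^esub> (\<ominus>\<^bsub>R\<^esub> r) \<odot>\<^bsub>M\<^esub> b" if "r \<in> carrier R" "b \<in> carrier M" for a b r
    using that by (simp add: a_minus_def smult_l_minus)
  have "?s \<in> span (insert u (insert v A))" using S r by blast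
  moreover have "?t \<in> span (insert u (insert v A))" using S r c by (simp add: minus)
  ultimately show "insert ?s (insert ?t A) \<subseteq> span (insert u (insert v A))" using S(3) by blast
  have t: "?t = x \<odot>\<^bsub>M\<^esub> v \<oplus>\<^bsub>M\<^esub> \<ominus>\<^bsub>M\<^esub> (y \<odot>\<^bsub>M\<^esub> u)" by (simp add: a_minus_def)
  have qt: "(\<ominus>\<^bsub>R\<^esub> q) \<odot>\<^bsub>M\<^esub> ?t = \<ominus>\<^bsub>M\<^esub> ((x \<otimes>\<^bsub>R\<^esub> q) \<odot>\<^bsub>M\<^esub> v) \<oplus>\<^bsub>M\<^esub> (y \<otimes>\<^bsub>R\<^esub> q) \<odot>\<^bsub>M\<^esub> u"
  proof -
    have "q \<odot>\<^bsub>M\<^esub> ?t = (x \<otimes>\<^bsub>R\<^esub> q) \<odot>\<^bsub>M\<^esub> v \<oplus>\<^bsub>M\<^esub> \<ominus>\<^bsub>M\<^esub> ((y \<otimes>\<^bsub>R\<^esub> q) \<odot>\<^bsub>M\<^esub> u)"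
      using c r unfolding t by (simp add: smult_r_distr smult_assoc1[symmetric] smult_r_minus R.m_comm)
    moreover have "(\<ominus>\<^bsub>R\<^esub> q) \<odot>\<^bsub>M\<^esub> ?t = \<ominus>\<^bsub>M\<^esub> (q \<odot>\<^bsub>M\<^esub> ?t)" by (rule smult_l_minus[OF r(2) st(2)])
    ultimately show ?thesis using c r by (simp add: M.minus_add)
  qed
  have u: "u = x \<odot>\<^bsub>M\<^esub> ?s \<oplus>\<^bsub>M\<^esub> (\<ominus>\<^bsub>R\<^esub> q) \<odot>\<^bsub>M\<^esub> ?t"
  proof -
    have "x \<odot>\<^bsub>M\<^esub> ?s \<oplus>\<^bsub>M\<^esub> (\<ominus>\<^bsub>R\<^esub> q) \<odot>\<^bsub>M\<^esub> ?t =
        ((x \<otimes>\<^bsub>R\<^esub> p) \<odot>\<^bsub>M\<^esub> u \<oplus>\<^bsub>M\<^esub> (x \<otimes>\<^bsub>R\<^esub> q) \<odot>\<^bsub>M\<^esub> v) \<oplus>\<^bsub>M\<^esub> (\<ominus>\<^bsub>M\<^esub> ((x \<otimes>\<^bsub>R\<^esub> q) \<odot>\<^bsub>M\<^esub> v) \<oplus>\<^bsub>M\<^esub> (y \<otimes>\<^bsub>R\<^esub> q) \<odot>\<^bsub>M\<^esub> u)"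
      unfolding qt using c r by (simp add: smult_r_distr smult_assoc1[symmetric])
    also have "\<dots> = ((x \<otimes>\<^bsub>R\<^esub> p) \<odot>\<^bsub>M\<^esub> u \<oplus>\<^bsub>M\<^esub> (y \<otimes>\<^bsub>R\<^esub> q) \<odot>\<^bsub>M\<^esub> u) \<oplus>\<^bsub>M\<^esub>
        ((x \<otimes>\<^bsub>R\<^esub> q) \<odot>\<^bsub>M\<^esub> v \<oplus>\<^bsub>M\<^esub> \<ominus>\<^bsub>M\<^esub> ((x \<otimes>\<^bsub>R\<^esub> q) \<odot>\<^bsub>M\<^esub> v))"
      using c r by (simp only: M.a_ac M.add.m_closed M.a_inv_closed smult_closed R.m_closed)
    also have "\<dots> = (x \<otimes>\<^bsub>R\<^esub> p \<oplus>\<^bsub>R\<^esub> y \<otimes>\<^bsub>R\<^esub> q) \<odot>\<^bsub>M\<^esub> u"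
      using c r by (simp add: M.r_neg smult_l_distr)
    finally show ?thesis using one c by simp
  qed
  have v: "v = y \<odot>\<^bsub>M\<^esub> ?s \<oplus>\<^bsub>M\<^esub> p \<odot>\<^bsub>M\<^esub> ?t"
  proof -
    have "y \<odot>\<^bsub>M\<^esub> ?s \<oplus>\<^bsub>M\<^esub> p \<odot>\<^bsub>M\<^esub> ?t =
        ((y \<otimes>\<^bsub>R\<^esub> p) \<odot>\<^bsub>M\<^esub> u \<oplus>\<^bsub>M\<^esub> (y \<otimes>\<^bsub>R\<^esub> q) \<odot>\<^bsub>M\<^esub> v) \<oplus>\<^bsub>M\<^esub> ((x \<otimes>\<^bsub>R\<^esub> p) \<odot>\<^bsub>M\<^esub> v \<oplus>\<^bsub>M\<^esub> \<ominus>\<^bsub>M\<^esub> ((y \<otimes>\<^bsub>R\<^esub> p) \<odot>\<^bsub>M\<^esub> u))"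
      using c r unfolding t
      by (simp add: smult_r_distr smult_assoc1[symmetric] smult_r_minus R.m_comm)
    also have "\<dots> = ((x \<otimes>\<^bsub>R\<^esub> p) \<odot>\<^bsub>M\<^esub> v \<oplus>\<^bsub>M\<^esub> (y \<otimes>\<^bsub>R\<^esub> q) \<odot>\<^bsub>M\<^esub> v) \<oplus>\<^bsub>M\<^esub>
        ((y \<otimes>\<^bsub>R\<^esub> p) \<odot>\<^bsub>M\<^esub> u \<oplus>\<^bsub>M\<^esub> \<ominus>\<^bsub>M\<^esub> ((y \<otimes>\<^bsub>R\<^esub> p) \<odot>\<^bsub>M\<^esub> u))"
      using c r by (simp only: M.a_ac M.add.m_closed M.a_inv_closed smult_closed R.m_closed)
    also have "\<dots> = (x \<otimes>\<^bsub>R\<^esub> p \<oplus>\<^bsub>R\<^esub> y \<otimes>\<^bsub>R\<^esub> q) \<odot>\<^bsub>M\<^esub> v"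
      using c r by (simp add: M.r_neg smult_l_distr)
    finally show ?thesis using one c by simp
  qed
  have "u \<in> span (insert ?s (insert ?t A))"
    by (subst u) (use L(1,2) r in blast)
  moreover have "v \<in> span (insert ?s (insert ?t A))"
    by (subst v) (use L(1,2) r in blast)
  ultimately show "insert u (insert v A) \<subseteq> span (insert ?s (insert ?t A))" using L(3) by blast
qed

text \<open>Both families are changed by steps that preserve their spans, and only spans are
  recorded, so dependent families are allowed. An optimal corner entry is chosen among all that can
  occur; optimality lets it clear its row and its column, and induction treats the rest.\<close>

lemma diagonalise:
  fixes n :: nat
  assumes pd: "principal_domain R"
  shows "\<forall>i<n. v i \<in> carrier M \<Longrightarrow> \<forall>j<n. w j \<in> span (v ` {..<n}) \<Longrightarrow>
    \<exists>v' w' d. (\<forall>i<n. v' i \<in> carrier M \<and> d i \<in> carrier R \<and> w' i = d i \<odot>\<^bsub>M\<^esub> v' i) \<and>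
      span (v' ` {..<n}) = span (v ` {..<n}) \<and> span (w' ` {..<n}) = span (w ` {..<n})"
proof (induction n arbitrary: v w)
  case 0
  then show ?case by auto
next
  case (Suc n)
  interpret pd: principal_domain R by (rule pd)
  let ?I = "{..<Suc n}" and ?J = "{1..<Suc n}"
  define good where "good v' w' \<longleftrightarrow> v' ` ?I \<subseteq> carrier M \<and> span (v' ` ?I) = span (v ` ?I) \<and>
      w' ` ?I \<subseteq> carrier M \<and> span (w' ` ?I) = span (w ` ?I)" for v' w'
  \<comment> \<open>All entries that can occur in the corner after admissible changes. The
    expression of \<open>w' 0\<close> through the family may fail to be unique, so every possible
    coefficient of \<open>v' 0\<close> is collected.\<close>
  define S where "S = {a \<in> carrier R. \<exists>v' w' x. good v' w' \<and> x \<in> span (v' ` ?J) \<and> w' 0 = a \<odot>\<^bsub>M\<^esub> v' 0 \<oplus>\<^bsub>M\<^esub> x}"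
  have IJ: "?I = insert 0 ?J" by auto
  have vI: "v ` ?I \<subseteq> carrier M" using Suc.prems(1) by auto
  have wI: "w ` ?I \<subseteq> span (v ` ?I)" using Suc.prems(2) by auto
  have good0: "good v w" unfolding good_def using vI wI span_is_subset2[OF vI] by auto
  have split: "\<exists>a\<in>carrier R. \<exists>x. x \<in> span (v' ` ?J) \<and> z = a \<odot>\<^bsub>M\<^esub> v' 0 \<oplus>\<^bsub>M\<^esub> x"
    if v': "v' ` ?I \<subseteq> carrier M" and z: "z \<in> span (v' ` ?I)" for v' z
  proof -
    obtain c where c: "c \<in> ?I \<rightarrow> carrier R" "z = (\<Oplus>\<^bsub>M\<^esub> i\<in>?I. c i \<odot>\<^bsub>M\<^esub> v' i)"
      using span_family[OF _ v' z] by auto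
    have v'J: "v' ` ?J \<subseteq> carrier M" using v' by auto
    interpret s: LinearCombinations.submodule R "span (v' ` ?J)" M by (rule span_is_submodule[OF v'J])
    have tc: "c i \<odot>\<^bsub>M\<^esub> v' i \<in> carrier M" if "i \<in> ?I" for i using c(1) v' that by blast
    have "z = c 0 \<odot>\<^bsub>M\<^esub> v' 0 \<oplus>\<^bsub>M\<^esub> (\<Oplus>\<^bsub>M\<^esub> i\<in>?J. c i \<odot>\<^bsub>M\<^esub> v' i)"
      unfolding c(2) IJ by (rule M.finsum_insert) (use tc in auto)
    moreover have "(\<Oplus>\<^bsub>M\<^esub> i\<in>?J. c i \<odot>\<^bsub>M\<^esub> v' i) \<in> span (v' ` ?J)"
    proof (rule submodule_finsum[OF s.submodule_axioms])
      fix i assume i: "i \<in> ?J"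
      have "v' i \<in> span (v' ` ?J)" "c i \<in> carrier R" using i in_own_span[OF v'J] c(1) by auto
      then show "c i \<odot>\<^bsub>M\<^esub> v' i \<in> span (v' ` ?J)" by (intro s.smult_closed)
    qed
    ultimately show ?thesis using c(1) by blast
  qed
  have "w 0 \<in> span (v ` ?I)" using wI by auto
  then have "S \<noteq> {}" using split[OF vI] good0 unfolding S_def by blast
  moreover have "S \<subseteq> carrier R" unfolding S_def by blast
  ultimately obtain a where a: "a \<in> S" "\<And>b. b \<in> S \<Longrightarrow> PIdl\<^bsub>R\<^esub> a \<subseteq> PIdl\<^bsub>R\<^esub> b \<Longrightarrow> PIdl\<^bsub>R\<^esub> b = PIdl\<^bsub>R\<^esub> a"
    using pd.maximal_principal_ideal[of S] by blast
  have aR: "a \<in> carrier R" using a(1) by (simp add: S_def)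
  \<comment> \<open>The ideal of \<open>a\<close> is maximal within \<open>S\<close>: a member
    \<open>g\<close> of \<open>S\<close> that divides \<open>a\<close> generates the same ideal, so
    \<open>a\<close> divides every multiple of \<open>g\<close>.\<close>
  have divides: "\<exists>e\<in>carrier R. b = e \<otimes>\<^bsub>R\<^esub> a"
    if g: "g \<in> S" and pq: "p \<in> carrier R" "q \<in> carrier R" "a = p \<otimes>\<^bsub>R\<^esub> g" "b = q \<otimes>\<^bsub>R\<^esub> g" for b g p q
  proof -
    have gR: "g \<in> carrier R" using g by (simp add: S_def)
    have "PIdl\<^bsub>R\<^esub> a \<subseteq> PIdl\<^bsub>R\<^esub> g"
    proof
      fix z assume "z \<in> PIdl\<^bsub>R\<^esub> a"
      then obtain r where "r \<in> carrier R" "z = r \<otimes>\<^bsub>R\<^esub> a" unfolding cgenideal_def by blast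
      then have "z = (r \<otimes>\<^bsub>R\<^esub> p) \<otimes>\<^bsub>R\<^esub> g" "r \<otimes>\<^bsub>R\<^esub> p \<in> carrier R" using pq gR by (auto simp: R.m_assoc)
      then show "z \<in> PIdl\<^bsub>R\<^esub> g" unfolding cgenideal_def by blast
    qed
    then have "g \<in> PIdl\<^bsub>R\<^esub> a" using a(2)[OF g] R.cgenideal_self[OF gR] by blast
    then obtain r where "r \<in> carrier R" "g = r \<otimes>\<^bsub>R\<^esub> a" unfolding cgenideal_def by blast
    then have "b = (q \<otimes>\<^bsub>R\<^esub> r) \<otimes>\<^bsub>R\<^esub> a" "q \<otimes>\<^bsub>R\<^esub> r \<in> carrier R" using pq aR by (auto simp: R.m_assoc)
    then show ?thesis by blast
  qed
  obtain v1 w1 x1 where g1: "good v1 w1" and x1: "x1 \<in> span (v1 ` ?J)" "w1 0 = a \<odot>\<^bsub>M\<^esub> v1 0 \<oplus>\<^bsub>M\<^esub> x1"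
    using a(1) unfolding S_def by blast
  have v1I: "v1 ` ?I \<subseteq> carrier M" and w1I: "w1 ` ?I \<subseteq> carrier M" using g1 by (auto simp: good_def)
  have v1J: "v1 ` ?J \<subseteq> carrier M" using v1I by auto
  have v1c: "v1 i \<in> carrier M" if "i < Suc n" for i using v1I that by blast
  have w1c: "w1 i \<in> carrier M" if "i < Suc n" for i using w1I that by blast
  obtain c where c: "c \<in> ?J \<rightarrow> carrier R" "x1 = (\<Oplus>\<^bsub>M\<^esub> i\<in>?J. c i \<odot>\<^bsub>M\<^esub> v1 i)"
    using span_family[OF _ v1J x1(1)] by auto
  have cR: "c i \<in> carrier R" if "i \<in> ?J" for i using c(1) that by blast
  text \<open>Every entry of the first column is divisible by \<open>a\<close>: replacing \<open>v1 0\<close> and \<open>v1 i\<close> by a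
    unimodular combination turns the corner entry into \<open>gcd a (c i)\<close>.\<close>
  have "\<exists>e\<in>carrier R. c i = e \<otimes>\<^bsub>R\<^esub> a" if i: "i \<in> ?J" for i
  proof -
    obtain g p q x y where gp: "g \<in> carrier R" "p \<in> carrier R" "q \<in> carrier R" "x \<in> carrier R" "y \<in> carrier R"
      "a = p \<otimes>\<^bsub>R\<^esub> g" "c i = q \<otimes>\<^bsub>R\<^esub> g" "g = x \<otimes>\<^bsub>R\<^esub> a \<oplus>\<^bsub>R\<^esub> y \<otimes>\<^bsub>R\<^esub> c i" "x \<otimes>\<^bsub>R\<^esub> p \<oplus>\<^bsub>R\<^esub> y \<otimes>\<^bsub>R\<^esub> q = \<one>\<^bsub>R\<^esub>"
      using pd.unimodular_pair[OF aR cR[OF i]] .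
    let ?s = "p \<odot>\<^bsub>M\<^esub> v1 0 \<oplus>\<^bsub>M\<^esub> q \<odot>\<^bsub>M\<^esub> v1 i" and ?t = "x \<odot>\<^bsub>M\<^esub> v1 i \<ominus>\<^bsub>M\<^esub> y \<odot>\<^bsub>M\<^esub> v1 0"
    define v2 where "v2 = v1(0 := ?s, i := ?t)"
    have i0: "i \<noteq> 0" "i < Suc n" using i by auto
    have vc: "v1 0 \<in> carrier M" "v1 i \<in> carrier M" "v1 ` (?J - {i}) \<subseteq> carrier M" using v1c i by auto
    have im2: "v2 ` ?I = insert ?s (insert ?t (v1 ` (?J - {i})))" using i0 unfolding v2_def by (auto simp: image_iff)
    have "?I = insert 0 (insert i (?J - {i}))" using i0 by auto
    then have im1: "v1 ` ?I = insert (v1 0) (insert (v1 i) (v1 ` (?J - {i})))" by (simp only: image_insert)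
    have "span (v2 ` ?I) = span (v1 ` ?I)"
      unfolding im1 im2 by (rule span_unimodular_pair[OF vc gp(2-5,9)])
    moreover have st: "?s \<in> carrier M" "?t \<in> carrier M" using vc gp(2-5) by auto
    ultimately have good2: "good v2 w1"
      using g1 vc(3) unfolding good_def im2 by auto
    let ?x = "\<Oplus>\<^bsub>M\<^esub> j\<in>?J - {i}. c j \<odot>\<^bsub>M\<^esub> v1 j"
    have tc: "c j \<odot>\<^bsub>M\<^esub> v1 j \<in> carrier M" if "j \<in> ?J" for j using cR[OF that] v1c that by auto
    have xc: "?x \<in> carrier M" using tc by (intro M.finsum_closed) auto
    have "x1 = (\<Oplus>\<^bsub>M\<^esub> j\<in>insert i (?J - {i}). c j \<odot>\<^bsub>M\<^esub> v1 j)" unfolding c(2) using i by (simp add: insert_absorb)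
    also have "\<dots> = c i \<odot>\<^bsub>M\<^esub> v1 i \<oplus>\<^bsub>M\<^esub> ?x" by (rule M.finsum_insert) (use tc i in auto)
    finally have x1': "x1 = c i \<odot>\<^bsub>M\<^esub> v1 i \<oplus>\<^bsub>M\<^esub> ?x" .
    have "w1 0 = (a \<odot>\<^bsub>M\<^esub> v1 0 \<oplus>\<^bsub>M\<^esub> c i \<odot>\<^bsub>M\<^esub> v1 i) \<oplus>\<^bsub>M\<^esub> ?x"
      unfolding x1(2) x1' using vc aR cR[OF i] xc by (simp add: M.a_assoc)
    also have "a \<odot>\<^bsub>M\<^esub> v1 0 \<oplus>\<^bsub>M\<^esub> c i \<odot>\<^bsub>M\<^esub> v1 i = g \<odot>\<^bsub>M\<^esub> ?s"
      using gp(1-3) vc unfolding gp(6,7) by (simp add: smult_r_distr smult_assoc1[symmetric] R.m_comm)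
    finally have w10: "w1 0 = g \<odot>\<^bsub>M\<^esub> v2 0 \<oplus>\<^bsub>M\<^esub> ?x" using i0 by (simp add: v2_def)
    have v2J: "v2 ` ?J \<subseteq> carrier M" using st v1c unfolding v2_def by auto
    have "?x \<in> span (v2 ` ?J)"
    proof (rule submodule_finsum[OF span_is_submodule[OF v2J]])
      interpret s: LinearCombinations.submodule R "span (v2 ` ?J)" M by (rule span_is_submodule[OF v2J])
      fix b assume "b \<in> ?J - {i}"
      then have b: "b \<in> ?J" "b \<noteq> i" "b \<noteq> 0" by auto
      have "v2 b \<in> span (v2 ` ?J)" using in_own_span[OF v2J] b(1) by blast
      then have "v1 b \<in> span (v2 ` ?J)" using b unfolding v2_def by simp
      then show "c b \<odot>\<^bsub>M\<^esub> v1 b \<in> span (v2 ` ?J)" using cR[OF b(1)] by (intro s.smult_closed)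
    qed
    then have "g \<in> S" unfolding S_def using good2 w10 gp(1) by blast
    then show ?thesis using divides gp(2,3,6,7) by blast
  qed
  then obtain e where e: "\<And>i. i \<in> ?J \<Longrightarrow> e i \<in> carrier R \<and> c i = e i \<otimes>\<^bsub>R\<^esub> a" by metis
  let ?y = "\<Oplus>\<^bsub>M\<^esub> i\<in>?J. e i \<odot>\<^bsub>M\<^esub> v1 i"
  have ec: "e i \<odot>\<^bsub>M\<^esub> v1 i \<in> carrier M" if "i \<in> ?J" for i using e[OF that] v1c that by auto
  have yc: "?y \<in> carrier M" using ec by (intro M.finsum_closed) auto
  have "x1 = (\<Oplus>\<^bsub>M\<^esub> i\<in>?J. a \<odot>\<^bsub>M\<^esub> (e i \<odot>\<^bsub>M\<^esub> v1 i))"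
    unfolding c(2)
  proof (rule M.finsum_cong'[OF refl])
    show "(\<lambda>i. a \<odot>\<^bsub>M\<^esub> (e i \<odot>\<^bsub>M\<^esub> v1 i)) \<in> ?J \<rightarrow> carrier M" using ec aR by auto
    show "c i \<odot>\<^bsub>M\<^esub> v1 i = a \<odot>\<^bsub>M\<^esub> (e i \<odot>\<^bsub>M\<^esub> v1 i)" if "i \<in> ?J" for i
      using e[OF that] aR v1c[of i] that by (simp add: smult_assoc1[symmetric] R.m_comm)
  qed
  also have "\<dots> = a \<odot>\<^bsub>M\<^esub> ?y" by (rule finsum_smult[symmetric, OF aR]) (use ec in auto)
  finally have x1y: "x1 = a \<odot>\<^bsub>M\<^esub> ?y" .
  \<comment> \<open>All coefficients of \<open>x1\<close> are multiples of \<open>a\<close>, so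
    \<open>x1\<close> is absorbed into the first vector, and \<open>w1 0\<close> becomes
    \<open>a\<close> times that vector.\<close>
  define v2 where "v2 = v1(0 := v1 0 \<oplus>\<^bsub>M\<^esub> ?y)"
  have v20: "v2 0 \<in> carrier M" "w1 0 = a \<odot>\<^bsub>M\<^esub> v2 0"
    using yc v1c[of 0] aR unfolding v2_def x1(2) x1y by (auto simp: smult_r_distr)
  have v2J: "v2 ` ?J = v1 ` ?J" unfolding v2_def by auto
  have im: "v2 ` ?I = insert (v2 0) (v1 ` ?J)" "v1 ` ?I = insert (v1 0) (v1 ` ?J)"
    unfolding IJ image_insert v2J by simp_all
  interpret sJ: LinearCombinations.submodule R "span (v1 ` ?J)" M by (rule span_is_submodule[OF v1J])
  have yJ: "?y \<in> span (v1 ` ?J)"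
  proof (rule submodule_finsum[OF sJ.submodule_axioms])
    fix b assume b: "b \<in> ?J"
    have "v1 b \<in> span (v1 ` ?J)" using in_own_span[OF v1J] b by blast
    then show "e b \<odot>\<^bsub>M\<^esub> v1 b \<in> span (v1 ` ?J)" using e[OF b] by (intro sJ.smult_closed) auto
  qed
  have sp2: "span (v2 ` ?I) = span (v1 ` ?I)"
  proof (rule span_eqI)
    show s2: "v2 ` ?I \<subseteq> carrier M" unfolding im using v20 v1J by auto
    show "v1 ` ?I \<subseteq> carrier M" by (rule v1I)
    interpret s1: LinearCombinations.submodule R "span (v1 ` ?I)" M by (rule span_is_submodule[OF v1I])
    interpret s2: LinearCombinations.submodule R "span (v2 ` ?I)" M by (rule span_is_submodule[OF s2])
    have y1: "?y \<in> span (v1 ` ?I)" using yJ span_is_monotone[of "v1 ` ?J" "v1 ` ?I"] im(2) by blast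
    have y2: "?y \<in> span (v2 ` ?I)" using yJ span_is_monotone[of "v1 ` ?J" "v2 ` ?I"] im(1) by blast
    have "v2 0 \<in> span (v1 ` ?I)"
      unfolding v2_def fun_upd_same using y1 in_own_span[OF v1I] by (intro s1.m_closed) auto
    then show "v2 ` ?I \<subseteq> span (v1 ` ?I)" unfolding im(1) using in_own_span[OF v1I] by auto
    have "v1 0 = v2 0 \<oplus>\<^bsub>M\<^esub> (\<ominus>\<^bsub>R\<^esub> \<one>\<^bsub>R\<^esub>) \<odot>\<^bsub>M\<^esub> ?y"
      using yc v1c[of 0] unfolding v2_def by (simp add: smult_l_minus M.a_assoc M.r_neg)
    moreover have "v2 0 \<in> span (v2 ` ?I)" using in_own_span[OF s2] by auto
    ultimately have "v1 0 \<in> span (v2 ` ?I)" using y2 by (simp add: s2.m_closed s2.smult_closed)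
    moreover have "v1 ` ?J \<subseteq> span (v2 ` ?I)" using in_own_span[OF s2] unfolding im(1) by blast
    ultimately show "v1 ` ?I \<subseteq> span (v2 ` ?I)" unfolding im(2) by blast
  qed
  have v2I: "v2 ` ?I \<subseteq> carrier M" unfolding im using v20 v1J by auto
  have good2: "good v2 w1" using g1 sp2 v2I unfolding good_def by simp
  have v2w: "w1 ` ?I \<subseteq> span (v2 ` ?I)"
  proof -
    have "span (w1 ` ?I) \<subseteq> span (v ` ?I)"
      using g1 span_is_subset[OF wI span_is_submodule[OF vI]] unfolding good_def by simp
    then show ?thesis using in_own_span[OF w1I] good2 unfolding good_def by blast
  qed
  \<comment> \<open>Now the changes take place among the \<open>w\<close>. A unimodular combination
    of \<open>w1 0\<close> and \<open>w1 j\<close> brings the greatest common divisor of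
    \<open>a\<close> and \<open>b\<close> into the corner; hence \<open>a\<close> divides
    \<open>b\<close>, and \<open>w1 j\<close> can be reduced by a multiple of
    \<open>w1 0\<close>.\<close>
  have "\<exists>e x. e \<in> carrier R \<and> x \<in> span (v2 ` ?J) \<and> w1 j = e \<odot>\<^bsub>M\<^esub> w1 0 \<oplus>\<^bsub>M\<^esub> x" if j: "j \<in> ?J" for j
  proof -
    have wc: "w1 0 \<in> carrier M" "w1 j \<in> carrier M" "w1 ` (?J - {j}) \<subseteq> carrier M" using w1c j by auto
    have "w1 j \<in> span (v2 ` ?I)" using v2w j by auto
    then obtain b x0 where b: "b \<in> carrier R" "x0 \<in> span (v2 ` ?J)" "w1 j = b \<odot>\<^bsub>M\<^esub> v2 0 \<oplus>\<^bsub>M\<^esub> x0"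
      using split[OF v2I] by blast
    have x0c: "x0 \<in> carrier M" using b(2) sJ.subset unfolding v2J by blast
    obtain g p q x y where gp: "g \<in> carrier R" "p \<in> carrier R" "q \<in> carrier R" "x \<in> carrier R" "y \<in> carrier R"
      "a = p \<otimes>\<^bsub>R\<^esub> g" "b = q \<otimes>\<^bsub>R\<^esub> g" "g = x \<otimes>\<^bsub>R\<^esub> a \<oplus>\<^bsub>R\<^esub> y \<otimes>\<^bsub>R\<^esub> b" "x \<otimes>\<^bsub>R\<^esub> p \<oplus>\<^bsub>R\<^esub> y \<otimes>\<^bsub>R\<^esub> q = \<one>\<^bsub>R\<^esub>"
      using pd.unimodular_pair[OF aR b(1)] .
    let ?s = "x \<odot>\<^bsub>M\<^esub> w1 0 \<oplus>\<^bsub>M\<^esub> y \<odot>\<^bsub>M\<^esub> w1 j" and ?t = "p \<odot>\<^bsub>M\<^esub> w1 j \<ominus>\<^bsub>M\<^esub> q \<odot>\<^bsub>M\<^esub> w1 0"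
    define w2 where "w2 = w1(0 := ?s, j := ?t)"
    have j0: "j \<noteq> 0" "j < Suc n" using j by auto
    have im2: "w2 ` ?I = insert ?s (insert ?t (w1 ` (?J - {j})))" using j0 unfolding w2_def by (auto simp: image_iff)
    have "?I = insert 0 (insert j (?J - {j}))" using j0 by auto
    then have im1: "w1 ` ?I = insert (w1 0) (insert (w1 j) (w1 ` (?J - {j})))" by (simp only: image_insert)
    \<comment> \<open>Here the matrix has the rows \<open>x\<close>, \<open>y\<close> and
      \<open>- q\<close>, \<open>p\<close>, so the two pairs exchange their parts.\<close>
    have "p \<otimes>\<^bsub>R\<^esub> x \<oplus>\<^bsub>R\<^esub> q \<otimes>\<^bsub>R\<^esub> y = \<one>\<^bsub>R\<^esub>" using gp(2-5,9) by (simp add: R.m_comm)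
    then have "span (w2 ` ?I) = span (w1 ` ?I)"
      unfolding im1 im2 by (rule span_unimodular_pair[OF wc gp(4,5,2,3)])
    moreover have "?s \<in> carrier M" "?t \<in> carrier M" using wc gp(2-5) by auto
    ultimately have g2: "good v2 w2" using good2 wc(3) unfolding good_def im2 by auto
    have "w2 0 = x \<odot>\<^bsub>M\<^esub> (a \<odot>\<^bsub>M\<^esub> v2 0) \<oplus>\<^bsub>M\<^esub> y \<odot>\<^bsub>M\<^esub> (b \<odot>\<^bsub>M\<^esub> v2 0 \<oplus>\<^bsub>M\<^esub> x0)"
      using j0 b(3) v20(2) unfolding w2_def by simp
    also have "\<dots> = (x \<otimes>\<^bsub>R\<^esub> a \<oplus>\<^bsub>R\<^esub> y \<otimes>\<^bsub>R\<^esub> b) \<odot>\<^bsub>M\<^esub> v2 0 \<oplus>\<^bsub>M\<^esub> y \<odot>\<^bsub>M\<^esub> x0"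
      using gp(4,5) aR b(1) v20(1) x0c by (simp add: smult_r_distr smult_l_distr smult_assoc1 M.a_assoc)
    finally have "w2 0 = g \<odot>\<^bsub>M\<^esub> v2 0 \<oplus>\<^bsub>M\<^esub> y \<odot>\<^bsub>M\<^esub> x0" using gp(8) by simp
    moreover have "y \<odot>\<^bsub>M\<^esub> x0 \<in> span (v2 ` ?J)"
      using b(2) gp(5) sJ.smult_closed unfolding v2J by blast
    ultimately have "g \<in> S" unfolding S_def using g2 gp(1) by blast
    then obtain r where r: "r \<in> carrier R" "b = r \<otimes>\<^bsub>R\<^esub> a" using divides gp(2,3,6,7) by blast
    then have "w1 j = r \<odot>\<^bsub>M\<^esub> w1 0 \<oplus>\<^bsub>M\<^esub> x0" using b(3) v20 aR by (simp add: smult_assoc1)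
    then show ?thesis using r(1) b(2) by blast
  qed
  then obtain f x where fx: "\<And>j. j \<in> ?J \<Longrightarrow> f j \<in> carrier R \<and> x j \<in> span (v2 ` ?J) \<and> w1 j = f j \<odot>\<^bsub>M\<^esub> w1 0 \<oplus>\<^bsub>M\<^esub> x j"
    by metis
  have w10: "w1 0 \<in> carrier M" using w1I by auto
  have xc: "x j \<in> carrier M" if "j \<in> ?J" for j using fx[OF that] sJ.subset unfolding v2J by blast
  have xJ: "x ` ?J \<subseteq> carrier M" using xc by blast
  \<comment> \<open>Subtracting multiples of \<open>w1 0\<close> from the other members preserves
    the span.\<close>
  have spw: "span (insert (w1 0) (x ` ?J)) = span (w1 ` ?I)"
  proof (rule span_eqI)
    show s1: "insert (w1 0) (x ` ?J) \<subseteq> carrier M" using w10 xJ by auto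
    show "w1 ` ?I \<subseteq> carrier M" by (rule w1I)
    interpret s1: LinearCombinations.submodule R "span (insert (w1 0) (x ` ?J))" M by (rule span_is_submodule[OF s1])
    interpret s2: LinearCombinations.submodule R "span (w1 ` ?I)" M by (rule span_is_submodule[OF w1I])
    have w0: "w1 0 \<in> span (insert (w1 0) (x ` ?J))" "w1 0 \<in> span (w1 ` ?I)"
      using in_own_span[OF s1] in_own_span[OF w1I] by auto
    have "x j \<in> span (w1 ` ?I)" if j: "j \<in> ?J" for j
    proof -
      have xj: "w1 j \<oplus>\<^bsub>M\<^esub> (\<ominus>\<^bsub>R\<^esub> f j) \<odot>\<^bsub>M\<^esub> w1 0 = x j"
      proof -
        have "w1 j \<oplus>\<^bsub>M\<^esub> (\<ominus>\<^bsub>R\<^esub> f j) \<odot>\<^bsub>M\<^esub> w1 0 = x j \<oplus>\<^bsub>M\<^esub> (f j \<odot>\<^bsub>M\<^esub> w1 0 \<oplus>\<^bsub>M\<^esub> \<ominus>\<^bsub>M\<^esub> (f j \<odot>\<^bsub>M\<^esub> w1 0))"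
          using fx[OF j] w10 xc[OF j] by (simp add: smult_l_minus M.a_ac)
        then show ?thesis using fx[OF j] w10 xc[OF j] by (simp add: M.r_neg)
      qed
      have "w1 j \<in> span (w1 ` ?I)" using in_own_span[OF w1I] j by auto
      then have "w1 j \<oplus>\<^bsub>M\<^esub> (\<ominus>\<^bsub>R\<^esub> f j) \<odot>\<^bsub>M\<^esub> w1 0 \<in> span (w1 ` ?I)"
        using w0(2) conjunct1[OF fx[OF j]] by (intro s2.m_closed s2.smult_closed R.a_inv_closed)
      then show ?thesis unfolding xj .
    qed
    then show "insert (w1 0) (x ` ?J) \<subseteq> span (w1 ` ?I)" using w0(2) by blast
    have "w1 j \<in> span (insert (w1 0) (x ` ?J))" if j: "j \<in> ?J" for j
    proof -
      have "x j \<in> span (insert (w1 0) (x ` ?J))" using in_own_span[OF s1] j by blast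
      then show ?thesis using fx[OF j] w0(1) by (metis s1.m_closed s1.smult_closed)
    qed
    then show "w1 ` ?I \<subseteq> span (insert (w1 0) (x ` ?J))" unfolding IJ using w0(1) by blast
  qed
  \<comment> \<open>The induction hypothesis speaks of families indexed from 0, so the remaining
    members are shifted.\<close>
  have SucI: "Suc ` {..<n} = ?J" by (auto simp: image_iff less_Suc_eq_0_disj)
  have imS: "(\<lambda>i. h (Suc i)) ` {..<n} = h ` ?J" for h :: "nat \<Rightarrow> 'c" unfolding SucI[symmetric] by (simp add: image_image)
  have "\<exists>v' w' d. (\<forall>i<n. v' i \<in> carrier M \<and> d i \<in> carrier R \<and> w' i = d i \<odot>\<^bsub>M\<^esub> v' i) \<and>
      span (v' ` {..<n}) = span ((\<lambda>i. v2 (Suc i)) ` {..<n}) \<and> span (w' ` {..<n}) = span ((\<lambda>i. x (Suc i)) ` {..<n})"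
    by (rule Suc.IH) (use v2I fx imS[of v2] in auto)
  then obtain v' w' d where d: "\<And>i. i < n \<Longrightarrow> v' i \<in> carrier M \<and> d i \<in> carrier R \<and> w' i = d i \<odot>\<^bsub>M\<^esub> v' i"
    and sv: "span (v' ` {..<n}) = span (v2 ` ?J)" and sw: "span (w' ` {..<n}) = span (x ` ?J)"
    unfolding imS by blast
  let ?v = "case_nat (v2 0) v'" and ?w = "case_nat (w1 0) w'" and ?d = "case_nat a d"
  have cI: "case_nat z h ` ?I = insert z (h ` {..<n})" for z and h :: "nat \<Rightarrow> 'c"
    unfolding IJ SucI[symmetric] by (simp add: image_image)
  have vc': "v' ` {..<n} \<subseteq> carrier M" "w' ` {..<n} \<subseteq> carrier M" using d by auto
  have "span (?v ` ?I) = span (v2 ` ?I)"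
    unfolding cI im(1) v2J[symmetric]
    by (rule span_insert_cong[OF v20(1) vc'(1) _ sv]) (use v1J v2J in simp)
  moreover have "span (?w ` ?I) = span (w1 ` ?I)"
    unfolding cI using span_insert_cong[OF w10 vc'(2) xJ sw] spw by simp
  moreover have "\<forall>i<Suc n. ?v i \<in> carrier M \<and> ?d i \<in> carrier R \<and> ?w i = ?d i \<odot>\<^bsub>M\<^esub> ?v i"
    using d v20 aR by (auto split: nat.splits)
  ultimately show ?case using good2 unfolding good_def by metis
qed

end

section \<open>Lattices and their forms\<close>

lemma act_semilinear:
  assumes "RG_module G R M" "g \<in> carrier G"
  shows "semilinear R R (\<lambda>a. a) M M (act M g)"
proof -
  interpret RG_module G R M by (rule assms)
  show ?thesis
    using act_linear[OF assms(2)] semilinear_id_iff[OF module_axioms module_axioms] by blast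
qed

lemma RG_module_module: "RG_module G R M \<Longrightarrow> module R M"
  unfolding RG_module_def by blast

lemma RG_homD:
  assumes "f \<in> RG_hom G R M N" "module R M" "module R N"
  shows "semilinear R R (\<lambda>a. a) M N f"
    and "g \<in> carrier G \<Longrightarrow> x \<in> carrier M \<Longrightarrow> f (act M g x) = act N g (f x)"
  using assms semilinear_id_iff[OF assms(2,3)] unfolding RG_hom_def by auto

lemma RG_homI:
  assumes "semilinear R R (\<lambda>a. a) M N f"
    and "\<And>g x. g \<in> carrier G \<Longrightarrow> x \<in> carrier M \<Longrightarrow> f (act M g x) = act N g (f x)"
  shows "f \<in> RG_hom G R M N"
  using assms semilinear_id_iff[OF semilinear.dom[OF assms(1)] semilinear.cod[OF assms(1)]]
  unfolding RG_hom_def by auto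

lemma semilinear_inverse:
  assumes f: "semilinear R R (\<lambda>a. a) M N f" and bij: "bij_betw f (carrier M) (carrier N)"
  shows "semilinear R R (\<lambda>a. a) N M (inv_into (carrier M) f)"
proof -
  interpret f: semilinear R R "\<lambda>a. a" M N f by (rule f)
  interpret M: module R M by (rule f.dom)
  interpret N: module R N by (rule f.cod)
  let ?h = "inv_into (carrier M) f"
  have h: "?h y \<in> carrier M" "f (?h y) = y" if "y \<in> carrier N" for y
    using that bij bij_betw_imp_surj_on inv_into_into f_inv_into_f by metis+
  have eq: "x = y" if "f x = f y" "x \<in> carrier M" "y \<in> carrier M" for x y
    using that bij by (auto simp: bij_betw_def dest: inj_onD)
  show ?thesis
  proof (rule semilinear.intro[OF f.cod f.dom f.scal])
    show "?h x \<in> carrier M" if "x \<in> carrier N" for x using h that by blast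
    show "?h (x \<oplus>\<^bsub>N\<^esub> y) = ?h x \<oplus>\<^bsub>M\<^esub> ?h y" if "x \<in> carrier N" "y \<in> carrier N" for x y
      by (rule eq) (use h that in \<open>auto simp: f.add\<close>)
    show "?h (a \<odot>\<^bsub>N\<^esub> x) = a \<odot>\<^bsub>M\<^esub> ?h x" if "a \<in> carrier R" "x \<in> carrier N" for a x
      by (rule eq) (use h that in \<open>auto simp: f.smult\<close>)
  qed
qed

lemma (in exterior) functorial:
  assumes f: "semilinear R R (\<lambda>a. a) M N f"
  shows "\<exists>F. semilinear R R (\<lambda>a. a) E (exterior_power R k N) F \<and>
    (\<forall>xs\<in>tuples k M. F (wedge xs) = exterior.wedge R N k (map f xs))"
proof -
  interpret f: semilinear R R "\<lambda>a. a" M N f by (rule f)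
  interpret EN: exterior R N k by (rule exterior.intro[OF f.cod])
  have "alternating R (\<lambda>a. a) k M EN.E (EN.wedge \<circ> map f)"
    using alternating_map[OF EN.wedge_alternating f] by (simp add: comp_def)
  from universal[OF EN.module_E id_ring_hom this] show ?thesis by simp
qed

text \<open>The easy direction of the theorem: an isomorphism and its inverse induce maps of
  exterior powers, and that these are mutually inverse and equivariant is checked on wedges.\<close>

lemma exterior_power_isomorphic:
  assumes M: "RG_module G R M" and N: "RG_module G R N" and iso: "RG_isomorphic G R M N"
  shows "RG_isomorphic G R (exterior_power R k M) (exterior_power R k N)"
proof -
  obtain f where f: "f \<in> RG_hom G R M N" and bij: "bij_betw f (carrier M) (carrier N)"
    using iso unfolding RG_isomorphic_def by blast
  note mod = RG_module_module[OF M] RG_module_module[OF N]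
  interpret f: semilinear R R "\<lambda>a. a" M N f by (rule RG_homD(1)[OF f mod])
  let ?h = "inv_into (carrier M) f"
  interpret h: semilinear R R "\<lambda>a. a" N M ?h by (rule semilinear_inverse[OF f.semilinear_axioms bij])
  interpret EM: exterior R M k by (rule exterior.intro[OF mod(1)])
  interpret EN: exterior R N k by (rule exterior.intro[OF mod(2)])
  obtain F where F: "semilinear R R (\<lambda>a. a) EM.E EN.E F"
    "\<And>xs. xs \<in> tuples k M \<Longrightarrow> F (EM.wedge xs) = EN.wedge (map f xs)"
    using EM.functorial[OF f.semilinear_axioms] by blast
  obtain H where H: "semilinear R R (\<lambda>a. a) EN.E EM.E H"
    "\<And>xs. xs \<in> tuples k N \<Longrightarrow> H (EN.wedge xs) = EM.wedge (map ?h xs)"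
    using EN.functorial[OF h.semilinear_axioms] by blast
  interpret F: semilinear R R "\<lambda>a. a" EM.E EN.E F by (rule F(1))
  interpret H: semilinear R R "\<lambda>a. a" EN.E EM.E H by (rule H(1))
  have tf: "map f xs \<in> tuples k N" if "xs \<in> tuples k M" for xs
    by (rule tuples_map[OF that]) (use f.closed in blast)
  have th: "map ?h xs \<in> tuples k M" if "xs \<in> tuples k N" for xs
    by (rule tuples_map[OF that]) (use h.closed in blast)
  have hf: "map ?h (map f xs) = xs" if "xs \<in> tuples k M" for xs
    using that bij by (intro nth_equalityI) (auto simp: tuples_iff bij_betw_def subset_iff)
  have fh: "map f (map ?h xs) = xs" if "xs \<in> tuples k N" for xs
    using that bij by (intro nth_equalityI) (auto simp: tuples_iff bij_betw_def subset_iff f_inv_into_f)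
  have idM: "semilinear R R (\<lambda>a. a) EM.E EM.E (\<lambda>x. x)"
    by (rule semilinear.intro[OF EM.module_E EM.module_E id_ring_hom]) auto
  have idN: "semilinear R R (\<lambda>a. a) EN.E EN.E (\<lambda>x. x)"
    by (rule semilinear.intro[OF EN.module_E EN.module_E id_ring_hom]) auto
  have HF: "H (F A) = A" if "A \<in> carrier EM.E" for A
  proof -
    have "(H \<circ> F) A = (\<lambda>x. x) A"
    proof (rule EM.eq_on_wedges[OF _ idM _ that])
      show "semilinear R R (\<lambda>a. a) EM.E EM.E (H \<circ> F)" using F.comp[OF H(1)] by (simp add: comp_def)
    qed (simp add: F(2) H(2) tf hf del: map_map)
    then show ?thesis by simp
  qed
  have FH: "F (H A) = A" if "A \<in> carrier EN.E" for A
  proof -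
    have "(F \<circ> H) A = (\<lambda>x. x) A"
    proof (rule EN.eq_on_wedges[OF _ idN _ that])
      show "semilinear R R (\<lambda>a. a) EN.E EN.E (F \<circ> H)" using H.comp[OF F(1)] by (simp add: comp_def)
    qed (simp add: F(2) H(2) th fh del: map_map)
    then show ?thesis by simp
  qed
  have "F \<in> RG_hom G R EM.E EN.E"
  proof (rule RG_homI[OF F(1)])
    fix g A assume g: "g \<in> carrier G" and A: "A \<in> carrier EM.E"
    note aM = EM.act_semilinear[OF act_semilinear[OF M g]] and aN = EN.act_semilinear[OF act_semilinear[OF N g]]
    have actM: "act M g x \<in> carrier M" if "x \<in> carrier M" for x
      using semilinear.closed[OF act_semilinear[OF M g] that] .
    have "(F \<circ> act EM.E g) A = (act EN.E g \<circ> F) A"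
    proof (rule EM.eq_on_wedges[OF _ _ _ A])
      show "semilinear R R (\<lambda>a. a) EM.E EN.E (F \<circ> act EM.E g)"
        using semilinear.comp[OF aM(1) F(1)] by (simp add: comp_def)
      show "semilinear R R (\<lambda>a. a) EM.E EN.E (act EN.E g \<circ> F)"
        using F.comp[OF aN(1)] by (simp add: comp_def)
      show "(F \<circ> act EM.E g) (EM.wedge xs) = (act EN.E g \<circ> F) (EM.wedge xs)" if xs: "xs \<in> tuples k M" for xs
      proof -
        have "map (act M g) xs \<in> tuples k M" by (rule tuples_map[OF xs]) (use actM in blast)
        moreover have "map f (map (act M g) xs) = map (act N g) (map f xs)"
          using xs RG_homD(2)[OF f mod g] by (auto simp: tuples_iff)
        ultimately show ?thesis using xs tf[OF xs] by (simp add: aM(2) aN(2) F(2) del: map_map)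
      qed
    qed
    then show "F (act EM.E g A) = act EN.E g (F A)" by simp
  qed
  moreover have "bij_betw F (carrier EM.E) (carrier EN.E)"
    by (rule bij_betw_byWitness[where f' = H]) (use HF FH F.closed H.closed in auto)
  ultimately show ?thesis unfolding RG_isomorphic_def by blast
qed

text \<open>One place is varied at a time: with the others fixed, the vectors that keep the value in
  \<open>H\<close> form a submodule. The induction counts the initial places not yet confined to
  \<open>B\<close>.\<close>

lemma (in alternating) generated_by_spanning_set:
  assumes M: "module R M" and H: "LinearCombinations.submodule S H P" and \<iota>: "\<iota> \<in> ring_hom R S"
    and B: "B \<subseteq> carrier M" "module.span R M B = carrier M"
    and gen: "\<And>xs. length xs = k \<Longrightarrow> set xs \<subseteq> B \<Longrightarrow> h xs \<in> H"
    and xs: "xs \<in> tuples k M"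
  shows "h xs \<in> H"
proof -
  interpret M: module R M by (rule M)
  interpret H: LinearCombinations.submodule S H P by (rule H)
  have "h xs \<in> H" if "p \<le> k" "xs \<in> tuples k M" "\<forall>a. p \<le> a \<and> a < k \<longrightarrow> xs ! a \<in> B" for p xs
    using that
  proof (induction p arbitrary: xs)
    case 0
    then have "set xs \<subseteq> B" by (auto simp: tuples_iff in_set_conv_nth)
    then show ?case using gen 0 by (simp add: tuples_iff)
  next
    case (Suc p)
    have p: "p < k" "p < length xs" using Suc.prems by (auto simp: tuples_iff)
    have IH: "h (xs[p := b]) \<in> H" if "b \<in> B" for b
    proof (rule Suc.IH)
      show "xs[p := b] \<in> tuples k M" using Suc.prems(2) that B(1) by (intro tuples_update) auto
      show "\<forall>a. p \<le> a \<and> a < k \<longrightarrow> xs[p := b] ! a \<in> B"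
        using Suc.prems(3) that p(2) by (auto simp: nth_list_update)
    qed (use p in simp)
    have b0: "xs ! p \<in> carrier M" using p(2) Suc.prems(2) nth_mem[of p xs] by (auto simp: tuples_iff simp del: nth_mem)
    \<comment> \<open>A zero entry is the multiple by zero of the present entry, so the value
      vanishes. This is the zero of the submodule formed below.\<close>
    have z: "h (xs[p := \<zero>\<^bsub>M\<^esub>]) \<in> H"
    proof -
      have x: "h (xs[p := xs ! p]) \<in> carrier P" by (rule closed[OF tuples_update[OF Suc.prems(2) b0]])
      have "h (xs[p := \<zero>\<^bsub>R\<^esub> \<odot>\<^bsub>M\<^esub> (xs ! p)]) = \<iota> \<zero>\<^bsub>R\<^esub> \<odot>\<^bsub>P\<^esub> h (xs[p := xs ! p])"
        by (rule smult[OF Suc.prems(2) p(1) _ b0]) simp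
      moreover have "\<iota> \<zero>\<^bsub>R\<^esub> = \<zero>\<^bsub>S\<^esub>"
      proof -
        interpret P: module S P by (rule H.module)
        interpret ring_hom_cring R S \<iota> by unfold_locales (rule \<iota>)
        show ?thesis by simp
      qed
      ultimately have "h (xs[p := \<zero>\<^bsub>M\<^esub>]) = \<zero>\<^bsub>P\<^esub>"
        using b0 module.smult_l_null[OF H.module x] by simp
      then show ?thesis by simp
    qed
    have "LinearCombinations.submodule R {x \<in> carrier M. h (xs[p := x]) \<in> H} M"
      by (rule LinearCombinations.submodule.intro[OF M])
        (use z in \<open>auto simp: add[OF Suc.prems(2) p(1)] smult[OF Suc.prems(2) p(1)] ring_hom_closed[OF \<iota>]\<close>)
    from M.span_is_subset[OF _ this, of B] have "M.span B \<subseteq> {x \<in> carrier M. h (xs[p := x]) \<in> H}"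
      using IH B(1) by blast
    then have "h (xs[p := xs ! p]) \<in> H" using b0 B(2) by blast
    then show ?case by simp
  qed
  moreover have "\<forall>a. k \<le> a \<and> a < k \<longrightarrow> xs ! a \<in> B" by auto
  ultimately show ?thesis using xs by blast
qed

text \<open>Wedges of lists from \<open>B\<close> generate, and there are finitely many such lists
  of length \<open>k\<close>. Schur's lemma will be applied to this module.\<close>

lemma (in exterior) finite_dimensional:
  assumes K: "field R" and fin: "finite B" "B \<subseteq> carrier M" "M.span B = carrier M"
  shows "vectorspace.fin_dim R E"
proof -
  interpret E: module R E by (rule module_E)
  interpret field R by (rule K)
  interpret VS: vectorspace R E by unfold_locales
  interpret w: alternating R "\<lambda>a. a" k M E wedge by (rule wedge_alternating)
  let ?L = "{xs. set xs \<subseteq> B \<and> length xs = k}"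
  have L: "wedge ` ?L \<subseteq> carrier E" using fin(2) by (auto intro!: wedge_closed simp: tuples_iff)
  have sub: "LinearCombinations.submodule R (E.span (wedge ` ?L)) E" by (rule E.span_is_submodule[OF L])
  have "A \<in> E.span (wedge ` ?L)" if "A \<in> carrier E" for A
  proof (rule generated[OF sub _ that])
    show "wedge xs \<in> E.span (wedge ` ?L)" if "xs \<in> tuples k M" for xs
      by (rule w.generated_by_spanning_set[OF module sub id_ring_hom fin(2,3) _ that])
        (use E.in_own_span[OF L] in blast)
  qed
  then have "E.span (wedge ` ?L) = carrier E" using E.span_is_subset2[OF L] by blast
  moreover have "finite (wedge ` ?L)" using finite_lists_length_eq[OF fin(1)] by simp
  ultimately show ?thesis unfolding VS.fin_dim_def using L by blast
qed

section \<open>Forms as full lattices\<close>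

lemma RG_lattice_basis:
  assumes "RG_lattice G R M" "domain R"
  obtains B where "finite B" "B \<subseteq> carrier M" "\<not> module.lin_dep R M B" "module.span R M B = carrier M"
proof -
  interpret domain R by (rule assms)
  interpret M: module R M by (rule RG_module_module[of G]) (use assms(1) in \<open>simp add: RG_lattice_def\<close>)
  obtain A B where A: "finite A" "A \<subseteq> carrier M" "M.span A = carrier M"
    and B: "B \<subseteq> carrier M" "M.lin_indpt B" "M.span B = carrier M"
    using assms(1) unfolding RG_lattice_def by blast
  show thesis by (rule that[OF M.finite_basis_of_finite_span[OF A B one_not_zero] B])
qed

text \<open>The embedding sends \<open>m\<close> to the image of \<open>1 \<otimes> m\<close>. It is
  injective because the coordinate functionals of the free module \<open>M\<close> extend to
  \<open>K \<otimes> M\<close>. Denominators exist because the vectors that have one form a subspace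
  containing every \<open>1 \<otimes> m\<close>.\<close>

lemma (in fraction_field) form_embedding_of_form:
  fixes V :: "('k, 'v, 'g, 'e) gmodule_scheme" and M :: "('r, 'm, 'g, 'f) gmodule_scheme"
  assumes form: "is_form G R K \<iota> V M" and V: "RG_module G K V"
  obtains i where "form_embedding R K \<iota> M V i"
    and "\<And>g m. g \<in> carrier G \<Longrightarrow> m \<in> carrier M \<Longrightarrow> i (act M g m) = act V g (i m)"
proof -
  have lat: "RG_lattice G R M" and "RG_isomorphic G K (extend_scalars R K \<iota> M) V"
    using form by (auto simp: is_form_def)
  then obtain \<psi> where \<psi>h: "\<psi> \<in> RG_hom G K (extend_scalars R K \<iota> M) V"
    and bij: "bij_betw \<psi> (carrier (extend_scalars R K \<iota> M)) (carrier V)"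
    unfolding RG_isomorphic_def by blast
  have RG: "RG_module G R M" using lat by (simp add: RG_lattice_def)
  interpret M: module R M by (rule RG_module_module[OF RG])
  interpret V: module K V by (rule RG_module_module[OF V])
  interpret X: scalar_extension R K \<iota> M
    by (rule scalar_extension.intro[OF M.module_axioms K.cring_axioms \<iota>_hom])
  note ring_as_module_sel [simp]
  let ?U = "extend_scalars R K \<iota> M"
  note \<psi> = RG_homD[OF \<psi>h X.module_U V.module_axioms]
  interpret \<psi>: semilinear K K "\<lambda>a. a" ?U V \<psi> by (rule \<psi>(1))
  obtain B where B: "finite B" "B \<subseteq> carrier M" "M.lin_indpt B" "M.span B = carrier M"
    using RG_lattice_basis[OF lat R.domain_axioms] by blast
  obtain c where c: "\<And>b. b \<in> B \<Longrightarrow> semilinear R R (\<lambda>a. a) M (self_module R) (c b)"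
    and expand: "\<And>x. x \<in> carrier M \<Longrightarrow> x = (\<Oplus>\<^bsub>M\<^esub> b\<in>B. c b x \<odot>\<^bsub>M\<^esub> b)"
    by (rule M.coordinates_exist[OF B], rule that; assumption)
  have cc: "c b x \<in> carrier R" if "b \<in> B" "x \<in> carrier M" for b x
    using semilinear.closed[OF c[OF that(1)] that(2)] by simp
  define i where "i m = \<psi> (X.tens \<one>\<^bsub>K\<^esub> m)" for m
  have t1: "X.tens \<one>\<^bsub>K\<^esub> m \<in> carrier ?U" if "m \<in> carrier M" for m using X.tens_closed that by simp
  have "semilinear R K \<iota> M V i"
    using semilinear.comp[OF X.semilinear_tens_one \<psi>(1)] unfolding i_def by (simp add: comp_def)
  moreover have "inj_on i (carrier M)"
  proof (rule inj_onI)
    fix x y assume xy: "x \<in> carrier M" "y \<in> carrier M" "i x = i y"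
    then have t: "X.tens \<one>\<^bsub>K\<^esub> x = X.tens \<one>\<^bsub>K\<^esub> y"
      using bij t1 unfolding i_def bij_betw_def by (auto dest: inj_onD)
    have "c b x = c b y" if b: "b \<in> B" for b
    proof -
      interpret cb: semilinear R R "\<lambda>a. a" M "self_module R" "c b" by (rule c[OF b])
      have selfK: "module K (self_module K)" by (rule self_module_module[OF K.cring_axioms])
      have "semilinear R K \<iota> M (self_module K) (\<lambda>m. \<iota> (c b m))"
        by (rule semilinear.intro[OF M.module_axioms selfK \<iota>_hom]) (use cb.add cb.smult cc[OF b] in auto)
      from X.universal[OF selfK this] obtain \<phi> where
        "\<forall>s\<in>carrier K. \<forall>m\<in>carrier M. \<phi> (X.tens s m) = s \<otimes>\<^bsub>K\<^esub> \<iota> (c b m)" by auto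
      then have "\<iota> (c b x) = \<iota> (c b y)" using t xy cc[OF b] by (metis K.l_one K.one_closed \<iota>.hom_closed)
      then show ?thesis using inj_onD[OF \<iota>_inj] cc[OF b] xy by blast
    qed
    then have "(\<Oplus>\<^bsub>M\<^esub> b\<in>B. c b x \<odot>\<^bsub>M\<^esub> b) = (\<Oplus>\<^bsub>M\<^esub> b\<in>B. c b y \<odot>\<^bsub>M\<^esub> b)"
      by (intro M.M.finsum_cong') (use B(2) cc xy in auto)
    then show "x = y" using expand xy(1,2) by metis
  qed
  moreover have "\<exists>t\<in>carrier R - {\<zero>\<^bsub>R\<^esub>}. \<exists>m\<in>carrier M. \<iota> t \<odot>\<^bsub>V\<^esub> x = i m" if x: "x \<in> carrier V" for x
  proof -
    let ?H = "{u \<in> carrier ?U. \<exists>t\<in>carrier R - {\<zero>\<^bsub>R\<^esub>}. \<exists>m\<in>carrier M. \<iota> t \<odot>\<^bsub>?U\<^esub> u = X.tens \<one>\<^bsub>K\<^esub> m}"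
    interpret t: semilinear R K \<iota> M ?U "X.tens \<one>\<^bsub>K\<^esub>" by (rule X.semilinear_tens_one)
    have one: "\<one>\<^bsub>R\<^esub> \<in> carrier R - {\<zero>\<^bsub>R\<^esub>}" using R.one_not_zero by simp
    have "LinearCombinations.submodule K ?H ?U"
    proof (rule LinearCombinations.submodule.intro[OF X.module_U])
      show "\<zero>\<^bsub>?U\<^esub> \<in> ?H"
        using one t.zero M.M.zero_closed by (auto intro!: bexI[of _ "\<one>\<^bsub>R\<^esub>"] bexI[of _ "\<zero>\<^bsub>M\<^esub>"])
      fix u v assume "u \<in> ?H" "v \<in> ?H"
      then obtain s m t n where u: "u \<in> carrier ?U" "s \<in> carrier R - {\<zero>\<^bsub>R\<^esub>}" "m \<in> carrier M"
        "\<iota> s \<odot>\<^bsub>?U\<^esub> u = X.tens \<one>\<^bsub>K\<^esub> m" and v: "v \<in> carrier ?U" "t \<in> carrier R - {\<zero>\<^bsub>R\<^esub>}" "n \<in> carrier M"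
        "\<iota> t \<odot>\<^bsub>?U\<^esub> v = X.tens \<one>\<^bsub>K\<^esub> n" by blast
      have st: "s \<otimes>\<^bsub>R\<^esub> t \<in> carrier R - {\<zero>\<^bsub>R\<^esub>}" using u(2) v(2) R.integral by auto
      have "\<iota> (s \<otimes>\<^bsub>R\<^esub> t) \<odot>\<^bsub>?U\<^esub> u = \<iota> t \<odot>\<^bsub>?U\<^esub> (\<iota> s \<odot>\<^bsub>?U\<^esub> u)"
        using u(1,2) v(2) by (simp add: X.U.smult_assoc1[symmetric] K.m_comm)
      moreover have "\<iota> (s \<otimes>\<^bsub>R\<^esub> t) \<odot>\<^bsub>?U\<^esub> v = \<iota> s \<odot>\<^bsub>?U\<^esub> (\<iota> t \<odot>\<^bsub>?U\<^esub> v)"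
        using v(1,2) u(2) by (simp add: X.U.smult_assoc1)
      ultimately have "\<iota> (s \<otimes>\<^bsub>R\<^esub> t) \<odot>\<^bsub>?U\<^esub> (u \<oplus>\<^bsub>?U\<^esub> v) = X.tens \<one>\<^bsub>K\<^esub> (t \<odot>\<^bsub>M\<^esub> m \<oplus>\<^bsub>M\<^esub> s \<odot>\<^bsub>M\<^esub> n)"
        using u v st by (simp add: X.U.smult_r_distr t.add t.smult)
      moreover have "t \<odot>\<^bsub>M\<^esub> m \<oplus>\<^bsub>M\<^esub> s \<odot>\<^bsub>M\<^esub> n \<in> carrier M" using u v by simp
      ultimately show "u \<oplus>\<^bsub>?U\<^esub> v \<in> ?H" using u(1) v(1) st by blast
    next
      fix a u assume a: "a \<in> carrier K" and "u \<in> ?H"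
      then obtain s m where u: "u \<in> carrier ?U" "s \<in> carrier R - {\<zero>\<^bsub>R\<^esub>}" "m \<in> carrier M"
        "\<iota> s \<odot>\<^bsub>?U\<^esub> u = X.tens \<one>\<^bsub>K\<^esub> m" by blast
      obtain p q where pq: "p \<in> carrier R" "q \<in> carrier R" "q \<noteq> \<zero>\<^bsub>R\<^esub>" "\<iota> q \<otimes>\<^bsub>K\<^esub> a = \<iota> p" using fraction[OF a] .
      have qs: "q \<otimes>\<^bsub>R\<^esub> s \<in> carrier R - {\<zero>\<^bsub>R\<^esub>}" using u(2) pq R.integral by auto
      have "\<iota> (q \<otimes>\<^bsub>R\<^esub> s) \<odot>\<^bsub>?U\<^esub> (a \<odot>\<^bsub>?U\<^esub> u) = (\<iota> q \<otimes>\<^bsub>K\<^esub> a) \<odot>\<^bsub>?U\<^esub> (\<iota> s \<odot>\<^bsub>?U\<^esub> u)"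
        using u(1,2) pq(2) a by (simp add: X.U.smult_assoc1[symmetric] K.m_ac)
      also have "\<dots> = X.tens \<one>\<^bsub>K\<^esub> (p \<odot>\<^bsub>M\<^esub> m)" unfolding pq(4) u(4) using t.smult[OF pq(1) u(3)] by simp
      finally have eq: "\<iota> (q \<otimes>\<^bsub>R\<^esub> s) \<odot>\<^bsub>?U\<^esub> (a \<odot>\<^bsub>?U\<^esub> u) = X.tens \<one>\<^bsub>K\<^esub> (p \<odot>\<^bsub>M\<^esub> m)" .
      then show "a \<odot>\<^bsub>?U\<^esub> u \<in> ?H"
        using qs X.U.smult_closed[OF a u(1)] M.smult_closed[OF pq(1) u(3)] by blast
    qed auto
    moreover have "X.tens \<one>\<^bsub>K\<^esub> m \<in> ?H" if "m \<in> carrier M" for m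
      using one t1[OF that] that by (auto intro!: bexI[of _ "\<one>\<^bsub>R\<^esub>"] bexI[of _ m])
    ultimately have all: "u \<in> ?H" if "u \<in> carrier ?U" for u using X.generated[of ?H u] that by blast
    obtain u where u: "u \<in> carrier ?U" "x = \<psi> u" using x bij by (auto simp: bij_betw_def)
    obtain t m where t: "t \<in> carrier R - {\<zero>\<^bsub>R\<^esub>}" "m \<in> carrier M" "\<iota> t \<odot>\<^bsub>?U\<^esub> u = X.tens \<one>\<^bsub>K\<^esub> m"
      using all[OF u(1)] by blast
    have "\<iota> t \<odot>\<^bsub>V\<^esub> x = i m" using \<psi>.smult[of "\<iota> t" u] u t by (simp add: i_def)
    then show ?thesis using t by blast
  qed
  ultimately have "form_embedding R K \<iota> M V i"
    by (intro form_embedding.intro form_embedding_axioms.intro fraction_field_axioms M.module_axioms V.module_axioms)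
  moreover have "i (act M g m) = act V g (i m)" if "g \<in> carrier G" "m \<in> carrier M" for g m
    using X.act_tens(2)[OF act_semilinear[OF RG that(1)] K.one_closed that(2)] \<psi>(2)[OF that(1) t1[OF that(2)]]
    by (simp add: i_def)
  ultimately show thesis by (rule that)
qed

section \<open>Comparison of two forms\<close>

text \<open>The composite of \<open>wedge\<close>, \<open>\<phi>\<close> and \<open>jN\<close> is
  alternating on \<open>M\<close> and extends to \<open>V\<close> by clearing denominators. The
  resulting endomorphism \<open>\<theta>\<close> commutes with the group, so Schur's lemma applies.
  That \<open>c\<close> is nonzero is seen only later, from determinants.\<close>

lemma exterior_scalar:
  fixes G :: "('g, 'a) monoid_scheme" and V :: "('k, 'v, 'g) gmodule"
    and M :: "('r, 'm, 'g) gmodule" and N :: "('r, 'n, 'g) gmodule"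
  assumes V: "RG_module G K V" and M: "RG_module G R M" and N: "RG_module G R N"
    and iM: "form_embedding R K \<iota> M V iM" and iN: "form_embedding R K \<iota> N V iN"
    and eqM: "\<And>g m. g \<in> carrier G \<Longrightarrow> m \<in> carrier M \<Longrightarrow> iM (act M g m) = act V g (iM m)"
    and eqN: "\<And>g m. g \<in> carrier G \<Longrightarrow> m \<in> carrier N \<Longrightarrow> iN (act N g m) = act V g (iN m)"
    and B: "finite B" "B \<subseteq> carrier V" "module.span K V B = carrier V"
    and simple: "absolutely_simple G K (exterior_power K k V)"
    and \<phi>: "\<phi> \<in> RG_hom G R (exterior_power R k M) (exterior_power R k N)"
  shows "\<exists>jM jN c. semilinear R K \<iota> (exterior_power R k M) (exterior_power K k V) jM \<and>
    (\<forall>xs\<in>tuples k M. jM (exterior.wedge R M k xs) = exterior.wedge K V k (map iM xs)) \<and>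
    semilinear R K \<iota> (exterior_power R k N) (exterior_power K k V) jN \<and>
    (\<forall>xs\<in>tuples k N. jN (exterior.wedge R N k xs) = exterior.wedge K V k (map iN xs)) \<and>
    c \<in> carrier K \<and> (\<forall>z\<in>carrier (exterior_power R k M). jN (\<phi> z) = c \<odot>\<^bsub>exterior_power K k V\<^esub> jM z)"
proof -
  interpret M: form_embedding R K \<iota> M V iM by (rule iM)
  interpret N: form_embedding R K \<iota> N V iN by (rule iN)
  interpret EM: exterior R M k by (rule exterior.intro[OF M.M.module_axioms])
  interpret EN: exterior R N k by (rule exterior.intro[OF N.M.module_axioms])
  interpret EV: exterior K V k by (rule exterior.intro[OF M.V.module_axioms])
  have altM: "alternating R \<iota> k M EV.E (EV.wedge \<circ> map iM)"
    using alternating_map[OF EV.wedge_alternating M.semilin] by (simp add: comp_def)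
  have altN: "alternating R \<iota> k N EV.E (EV.wedge \<circ> map iN)"
    using alternating_map[OF EV.wedge_alternating N.semilin] by (simp add: comp_def)
  obtain jM where jM: "semilinear R K \<iota> EM.E EV.E jM"
    "\<And>xs. xs \<in> tuples k M \<Longrightarrow> jM (EM.wedge xs) = EV.wedge (map iM xs)"
    using EM.universal[OF EV.module_E M.\<iota>_hom altM] by auto
  obtain jN where jN: "semilinear R K \<iota> EN.E EV.E jN"
    "\<And>xs. xs \<in> tuples k N \<Longrightarrow> jN (EN.wedge xs) = EV.wedge (map iN xs)"
    using EN.universal[OF EV.module_E M.\<iota>_hom altN] by auto
  interpret jM: semilinear R K \<iota> EM.E EV.E jM by (rule jM(1))
  interpret jN: semilinear R K \<iota> EN.E EV.E jN by (rule jN(1))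
  note \<phi>D = RG_homD[OF \<phi> EM.module_E EN.module_E]
  interpret \<phi>: semilinear R R "\<lambda>a. a" EM.E EN.E \<phi> by (rule \<phi>D(1))
  interpret wM: alternating R "\<lambda>a. a" k M EM.E EM.wedge by (rule EM.wedge_alternating)
  have jN\<phi>: "semilinear R K \<iota> EM.E EV.E (jN \<circ> \<phi>)" using \<phi>.comp[OF jN(1)] by (simp add: comp_def)
  have "alternating R \<iota> k M EV.E ((jN \<circ> \<phi>) \<circ> EM.wedge)"
    using alternating_comp[OF EM.wedge_alternating jN\<phi>] by (simp add: comp_def)
  from M.extend_alternating[OF EV.module_E this] obtain h where
    h: "alternating K (\<lambda>a. a) k V EV.E h" "\<And>ms. ms \<in> tuples k M \<Longrightarrow> h (map iM ms) = jN (\<phi> (EM.wedge ms))"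
    by auto
  obtain \<theta> where \<theta>: "semilinear K K (\<lambda>a. a) EV.E EV.E \<theta>" "\<And>xs. xs \<in> tuples k V \<Longrightarrow> \<theta> (EV.wedge xs) = h xs"
    using EV.universal[OF EV.module_E id_ring_hom h(1)] by auto
  interpret \<theta>: semilinear K K "\<lambda>a. a" EV.E EV.E \<theta> by (rule \<theta>(1))
  have tM: "map iM ms \<in> tuples k V" if "ms \<in> tuples k M" for ms
    by (rule tuples_map[OF that]) (use M.i.closed in blast)
  have tN: "map iN ms \<in> tuples k V" if "ms \<in> tuples k N" for ms
    by (rule tuples_map[OF that]) (use N.i.closed in blast)
  have \<theta>j: "\<theta> (jM z) = jN (\<phi> z)" if "z \<in> carrier EM.E" for z
  proof -
    have "(\<theta> \<circ> jM) z = (jN \<circ> \<phi>) z"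
    proof (rule EM.eq_on_wedges[OF _ jN\<phi> _ that])
      show "semilinear R K \<iota> EM.E EV.E (\<theta> \<circ> jM)" using jM.comp[OF \<theta>(1)] by (simp add: comp_def)
    qed (simp add: jM(2) \<theta>(2) h(2) tM)
    then show ?thesis by simp
  qed
  note aV = EV.act_semilinear[OF act_semilinear[OF V]]
  have act_jN: "jN (act EN.E g z) = act EV.E g (jN z)" if g: "g \<in> carrier G" and z: "z \<in> carrier EN.E" for g z
  proof -
    note aN = EN.act_semilinear[OF act_semilinear[OF N g]]
    have "(jN \<circ> act EN.E g) z = (act EV.E g \<circ> jN) z"
    proof (rule EN.eq_on_wedges[OF _ _ _ z])
      show "semilinear R K \<iota> EN.E EV.E (jN \<circ> act EN.E g)"
        using semilinear.comp[OF aN(1) jN(1)] by (simp add: comp_def)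
      show "semilinear R K \<iota> EN.E EV.E (act EV.E g \<circ> jN)"
        using jN.comp[OF aV(1)[OF g]] by (simp add: comp_def)
      fix xs assume xs: "xs \<in> tuples k N"
      have "map (act N g) xs \<in> tuples k N"
        by (rule tuples_map[OF xs]) (use semilinear.closed[OF act_semilinear[OF N g]] in blast)
      moreover have "map iN (map (act N g) xs) = map (act V g) (map iN xs)"
        using xs eqN[OF g] by (auto simp: tuples_iff)
      ultimately show "(jN \<circ> act EN.E g) (EN.wedge xs) = (act EV.E g \<circ> jN) (EN.wedge xs)"
        using xs by (simp add: aN(2) aV(2)[OF g] jN(2) tN del: map_map)
    qed
    then show ?thesis by simp
  qed
  have equiv: "\<theta> (act EV.E g x) = act EV.E g (\<theta> x)" if g: "g \<in> carrier G" and x: "x \<in> carrier EV.E" for g x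
  proof -
    note aM = EM.act_semilinear[OF act_semilinear[OF M g]]
    \<comment> \<open>Equivariance is tested on wedges from \<open>M\<close>, where
      \<open>\<theta>\<close> is given by \<open>jN\<close> after \<open>\<phi>\<close> and both of
      these are equivariant.\<close>
    have "(\<theta> \<circ> act EV.E g) x = (act EV.E g \<circ> \<theta>) x"
    proof (rule M.eq_on_form_wedges[OF EV.wedge_alternating, where x = x and f = "\<theta> \<circ> act EV.E g"
          and g = "act EV.E g \<circ> \<theta>"])
      show "x \<in> H" if "LinearCombinations.submodule K H EV.E" "\<And>xs. xs \<in> tuples k V \<Longrightarrow> EV.wedge xs \<in> H" for H
        by (rule EV.generated[OF that x])
      show "semilinear K K (\<lambda>a. a) EV.E EV.E (\<theta> \<circ> act EV.E g)"
        using semilinear.comp[OF aV(1)[OF g] \<theta>(1)] by (simp add: comp_def)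
      show "semilinear K K (\<lambda>a. a) EV.E EV.E (act EV.E g \<circ> \<theta>)"
        using \<theta>.comp[OF aV(1)[OF g]] by (simp add: comp_def)
      fix ms assume ms: "ms \<in> tuples k M"
      have ams: "map (act M g) ms \<in> tuples k M"
        by (rule tuples_map[OF ms]) (use semilinear.closed[OF act_semilinear[OF M g]] in blast)
      have e: "map (act V g) (map iM ms) = map iM (map (act M g) ms)"
        using ms eqM[OF g] by (auto simp: tuples_iff)
      have w: "EM.wedge ms \<in> carrier EM.E" by (rule EM.wedge_closed[OF ms])
      have "\<theta> (act EV.E g (EV.wedge (map iM ms))) = jN (\<phi> (EM.wedge (map (act M g) ms)))"
        unfolding aV(2)[OF g tM[OF ms]] e \<theta>(2)[OF tM[OF ams]] by (rule h(2)[OF ams])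
      also have "\<dots> = jN (act EN.E g (\<phi> (EM.wedge ms)))"
        unfolding aM(2)[OF ms, symmetric] \<phi>D(2)[OF g w] ..
      also have "\<dots> = act EV.E g (jN (\<phi> (EM.wedge ms)))" by (rule act_jN[OF g \<phi>.closed[OF w]])
      also have "jN (\<phi> (EM.wedge ms)) = \<theta> (EV.wedge (map iM ms))"
        unfolding \<theta>(2)[OF tM[OF ms]] by (rule h(2)[OF ms, symmetric])
      finally show "(\<theta> \<circ> act EV.E g) (EV.wedge (map iM ms)) = (act EV.E g \<circ> \<theta>) (EV.wedge (map iM ms))" by simp
    qed
    then show ?thesis by simp
  qed
  obtain c where c: "c \<in> carrier K" "\<And>x. x \<in> carrier EV.E \<Longrightarrow> \<theta> x = c \<odot>\<^bsub>EV.E\<^esub> x"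
    using absolutely_simple_endomorphism(2)[OF M.K.field_axioms simple EV.module_E
        EV.finite_dimensional[OF M.K.field_axioms B] aV(1) \<theta>(1) equiv] by blast
  have "jN (\<phi> z) = c \<odot>\<^bsub>EV.E\<^esub> jM z" if "z \<in> carrier EM.E" for z
    using \<theta>j[OF that] c(2)[OF jM.closed[OF that]] by simp
  then show ?thesis using jM jN c(1) by blast
qed

text \<open>Two selections of \<open>k\<close> places that differ only in containing
  \<open>i\<close> or \<open>j\<close> have associated products, and the common factor from the
  other \<open>k - 1\<close> places cancels. Such places exist because
  \<open>k - 1 \<le> n - 2\<close>.\<close>

lemma (in domain) exchange_associated:
  fixes d :: "nat \<Rightarrow> 'a" and C :: "'b \<Rightarrow> 'a"
  assumes d: "\<And>j. j < n \<Longrightarrow> d j \<in> carrier R" and k: "1 \<le> k" "k < n" and ij: "i < n" "j < n"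
    and assoc: "\<And>I. inj_on I {..<k} \<Longrightarrow> I ` {..<k} \<subseteq> {..<n} \<Longrightarrow>
      (\<Otimes> a\<in>{..<k}. d (I a)) \<noteq> \<zero> \<and> (\<Otimes> a\<in>{..<k}. d (I a)) \<sim> m"
    and m: "m \<in> carrier R"
  shows "d i \<noteq> \<zero> \<and> (\<exists>e\<in>carrier R. d j = d i \<otimes> e)"
proof -
  have main: "d i \<noteq> \<zero> \<and> (\<exists>e\<in>carrier R. d j = d i \<otimes> e)" if False: "i \<noteq> j" and j: "j < n" for j
  proof -
    note ij = ij(1) j
    obtain k' where k': "k = Suc k'" using k by (cases k) auto
    have "card ({..<n} - {i, j}) = n - 2" using False ij by (simp add: card_Diff_subset)
    then have "k' \<le> card ({..<n} - {i, j})" using k k' by simp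
    then obtain S where S: "S \<subseteq> {..<n} - {i, j}" "card S = k'" "finite S" by (rule obtain_subset_with_card_n)
    obtain h where h: "bij_betw h {..<k'} S"
      using ex_bij_betw_nat_finite[OF S(3)] S(2) by (auto simp: atLeast0LessThan)
    have hS: "h a < n" "h a \<noteq> i" "h a \<noteq> j" if "a < k'" for a
      using bij_betwE[OF h] S(1) that by auto
    let ?P = "\<Otimes> a\<in>{..<k'}. d (h a)"
    have P: "?P \<in> carrier R" using hS d by (intro finprod_closed) auto
    \<comment> \<open>The selection that has \<open>l\<close> at place 0 and the common places after
      it.\<close>
    have *: "(\<Otimes> a\<in>{..<k}. d (case_nat l h a)) = d l \<otimes> ?P \<and> (\<Otimes> a\<in>{..<k}. d (case_nat l h a)) \<noteq> \<zero> \<and>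
        (\<Otimes> a\<in>{..<k}. d (case_nat l h a)) \<sim> m" if l: "l \<in> {i, j}" for l
    proof -
      have ln: "l < n" using l ij by auto
      have lessS: "{..<k} = insert 0 (Suc ` {..<k'})" unfolding k' by (rule lessThan_Suc_eq_insert_0)
      have hl: "h a \<noteq> l" "l \<noteq> h a" if "a < k'" for a using hS[OF that] l by auto
      have "inj_on h {..<k'}" using h by (simp add: bij_betw_def)
      then have inj: "inj_on (case_nat l h) {..<k}"
        unfolding lessS using hl by (auto simp: inj_on_def)
      have img: "case_nat l h ` {..<k} \<subseteq> {..<n}" unfolding lessS using hS ln by auto
      have dS: "(\<lambda>a. d (case_nat l h a)) \<in> Suc ` {..<k'} \<rightarrow> carrier R" using hS d by auto
      have "(\<Otimes> a\<in>{..<k}. d (case_nat l h a)) = d l \<otimes> (\<Otimes> a\<in>Suc ` {..<k'}. d (case_nat l h a))"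
        unfolding lessS by (subst finprod_insert) (use dS d[OF ln] in auto)
      also have "(\<Otimes> a\<in>Suc ` {..<k'}. d (case_nat l h a)) = ?P"
        by (subst finprod_reindex[OF dS]) auto
      finally show ?thesis using assoc[OF inj img] by simp
    qed
    have i: "d i \<otimes> ?P \<noteq> \<zero>" "d i \<otimes> ?P \<sim> m" and j: "d j \<otimes> ?P \<sim> m" using *[of i] *[of j] by auto
    have di: "d i \<noteq> \<zero>" and P0: "?P \<noteq> \<zero>" using i(1) P d ij by auto
    have "d i \<otimes> ?P divides d j \<otimes> ?P"
      using associated_trans[OF i(2) associated_sym[OF j]] P d ij m by (auto simp: associated_def)
    then obtain e where e: "e \<in> carrier R" "d j \<otimes> ?P = (d i \<otimes> ?P) \<otimes> e" unfolding factor_def by blast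
    have "d j \<otimes> ?P = (d i \<otimes> e) \<otimes> ?P" using e P d[OF ij(1)] by (simp add: m_ac)
    then have "d j = d i \<otimes> e" using m_rcancel[OF P0 P] d ij e(1) by simp
    then show ?thesis using di e(1) by blast
  qed
  show ?thesis
  proof (cases "i = j")
    case True
    \<comment> \<open>Since \<open>1 < n\<close>, there is an index other than \<open>i\<close>; the
      comparison with it shows that \<open>d i\<close> is nonzero.\<close>
    have "(if i = 0 then 1 else 0) < n" using k by auto
    then have "d i \<noteq> \<zero>" using main[of "if i = 0 then 1 else 0"] by (auto split: if_splits)
    then show ?thesis using True d[OF ij(1)] by (auto intro!: bexI[of _ \<one>])
  qed (use main ij in blast)
qed

lemma linear_image_submodule:
  assumes f: "semilinear R R (\<lambda>a. a) M N f"
  shows "LinearCombinations.submodule R (f ` carrier M) N"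
proof -
  interpret f: semilinear R R "\<lambda>a. a" M N f by (rule f)
  interpret M: module R M by (rule f.dom)
  interpret N: module R N by (rule f.cod)
  show ?thesis
  proof (rule LinearCombinations.submodule.intro[OF N.module_axioms])
    show "\<zero>\<^bsub>N\<^esub> \<in> f ` carrier M" using f.zero M.M.zero_closed by (metis imageI)
    show "x \<oplus>\<^bsub>N\<^esub> y \<in> f ` carrier M" if xy: "x \<in> f ` carrier M" "y \<in> f ` carrier M" for x y
    proof -
      from xy obtain p q where "p \<in> carrier M" "x = f p" "q \<in> carrier M" "y = f q" by blast
      then show ?thesis using f.add[of p q] M.M.a_closed[of p q] by (auto intro!: image_eqI[of _ _ "p \<oplus>\<^bsub>M\<^esub> q"])
    qed
    show "a \<odot>\<^bsub>N\<^esub> x \<in> f ` carrier M" if a: "a \<in> carrier R" and x: "x \<in> f ` carrier M" for a x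
    proof -
      from x obtain p where "p \<in> carrier M" "x = f p" by blast
      then show ?thesis using a f.smult[of a p] M.smult_closed[of a p] by (auto intro!: image_eqI[of _ _ "a \<odot>\<^bsub>M\<^esub> p"])
    qed
  qed (use f.closed in blast)
qed

text \<open>The two inclusions express that \<open>t M\<close> and \<open>d N\<close> have the same
  image in \<open>V\<close>, so that scaling by \<open>t / d\<close> carries one lattice onto the
  other.\<close>

lemma form_comparison:
  fixes V :: "('k, 'v, 'g) gmodule" and M :: "('r, 'm, 'g) gmodule" and N :: "('r, 'n, 'g) gmodule"
  assumes pid: "principal_domain R"
    and iM: "form_embedding R K \<iota> M V iM" and iN: "form_embedding R K \<iota> N V iN"
    and BM: "finite BM" "BM \<subseteq> carrier M" "module.span R M BM = carrier M" "card BM = n"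
    and BN: "finite BN" "BN \<subseteq> carrier N" "module.span R N BN = carrier N" "card BN = n"
    and n: "vectorspace.dim K V = n" and k: "1 \<le> k" "k < n"
    and jM: "semilinear R K \<iota> (exterior_power R k M) (exterior_power K k V) jM"
      "\<And>xs. xs \<in> tuples k M \<Longrightarrow> jM (exterior.wedge R M k xs) = exterior.wedge K V k (map iM xs)"
    and jN: "semilinear R K \<iota> (exterior_power R k N) (exterior_power K k V) jN"
      "\<And>xs. xs \<in> tuples k N \<Longrightarrow> jN (exterior.wedge R N k xs) = exterior.wedge K V k (map iN xs)"
    and c: "c \<in> carrier K"
    and surj: "\<phi> ` carrier (exterior_power R k M) = carrier (exterior_power R k N)"
    and eq: "\<And>z. z \<in> carrier (exterior_power R k M) \<Longrightarrow> jN (\<phi> z) = c \<odot>\<^bsub>exterior_power K k V\<^esub> jM z"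
  shows "\<exists>t\<in>carrier R - {\<zero>\<^bsub>R\<^esub>}. \<exists>d\<in>carrier R - {\<zero>\<^bsub>R\<^esub>}.
    (\<forall>m\<in>carrier M. \<exists>y\<in>carrier N. iN (d \<odot>\<^bsub>N\<^esub> y) = \<iota> t \<odot>\<^bsub>V\<^esub> iM m) \<and>
    (\<forall>y\<in>carrier N. \<exists>m\<in>carrier M. iN (d \<odot>\<^bsub>N\<^esub> y) = \<iota> t \<odot>\<^bsub>V\<^esub> iM m)"
proof -
  interpret M: form_embedding R K \<iota> M V iM by (rule iM)
  interpret N: form_embedding R K \<iota> N V iN by (rule iN)
  interpret pid: principal_domain R by (rule pid)
  interpret VS: vectorspace K V by unfold_locales
  interpret EM: exterior R M k by (rule exterior.intro[OF M.M.module_axioms])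
  interpret EN: exterior R N k by (rule exterior.intro[OF N.M.module_axioms])
  interpret EV: exterior K V k by (rule exterior.intro[OF M.V.module_axioms])
  interpret jM: semilinear R K \<iota> EM.E EV.E jM by (rule jM(1))
  interpret jN: semilinear R K \<iota> EN.E EV.E jN by (rule jN(1))
  have R: "cring R" and K: "cring K" by unfold_locales

  \<comment> \<open>A common denominator and the resulting map from \<open>M\<close> to
    \<open>N\<close>\<close>
  have "\<exists>t\<in>carrier R - {\<zero>\<^bsub>R\<^esub>}. \<forall>b\<in>BM. \<exists>y\<in>carrier N. \<iota> t \<odot>\<^bsub>V\<^esub> iM b = iN y"
  proof (rule M.R.common_multiple[OF BM(1)])
    fix b assume "b \<in> BM"
    then have "iM b \<in> carrier V" using BM(2) M.i.closed by blast
    then show "\<exists>t\<in>carrier R - {\<zero>\<^bsub>R\<^esub>}. \<exists>y\<in>carrier N. \<iota> t \<odot>\<^bsub>V\<^esub> iM b = iN y" by (rule N.denom)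
  next
    fix b s t assume b: "b \<in> BM" and s: "s \<in> carrier R - {\<zero>\<^bsub>R\<^esub>}" and t: "t \<in> carrier R - {\<zero>\<^bsub>R\<^esub>}"
      and "\<exists>y\<in>carrier N. \<iota> t \<odot>\<^bsub>V\<^esub> iM b = iN y"
    then obtain y where y: "y \<in> carrier N" "\<iota> t \<odot>\<^bsub>V\<^esub> iM b = iN y" by blast
    have "iM b \<in> carrier V" using b BM(2) M.i.closed by blast
    then have "\<iota> (s \<otimes>\<^bsub>R\<^esub> t) \<odot>\<^bsub>V\<^esub> iM b = iN (s \<odot>\<^bsub>N\<^esub> y)"
      using s t y by (simp add: M.V.smult_assoc1 N.i.smult)
    then show "\<exists>y\<in>carrier N. \<iota> (s \<otimes>\<^bsub>R\<^esub> t) \<odot>\<^bsub>V\<^esub> iM b = iN y" using s y by blast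
  qed
  then obtain t where t: "t \<in> carrier R" "t \<noteq> \<zero>\<^bsub>R\<^esub>" "\<forall>b\<in>BM. \<exists>y\<in>carrier N. \<iota> t \<odot>\<^bsub>V\<^esub> iM b = iN y" by blast
  have \<iota>t: "\<iota> t \<in> carrier K" using t(1) by simp
  have sm_comm: "\<iota> t \<odot>\<^bsub>V\<^esub> (\<iota> a \<odot>\<^bsub>V\<^esub> x) = \<iota> a \<odot>\<^bsub>V\<^esub> (\<iota> t \<odot>\<^bsub>V\<^esub> x)" if "a \<in> carrier R" "x \<in> carrier V" for a x
    using that \<iota>t by (simp add: M.V.smult_assoc1[symmetric] M.K.m_comm)
  have "LinearCombinations.submodule R {m \<in> carrier M. \<exists>y\<in>carrier N. \<iota> t \<odot>\<^bsub>V\<^esub> iM m = iN y} M"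
  proof (rule LinearCombinations.submodule.intro[OF M.M.module_axioms])
    show "\<zero>\<^bsub>M\<^esub> \<in> {m \<in> carrier M. \<exists>y\<in>carrier N. \<iota> t \<odot>\<^bsub>V\<^esub> iM m = iN y}"
      using \<iota>t M.i.zero N.i.zero N.M.M.zero_closed by (auto intro!: bexI[of _ "\<zero>\<^bsub>N\<^esub>"])
    fix x y assume "x \<in> {m \<in> carrier M. \<exists>y\<in>carrier N. \<iota> t \<odot>\<^bsub>V\<^esub> iM m = iN y}"
      "y \<in> {m \<in> carrier M. \<exists>y\<in>carrier N. \<iota> t \<odot>\<^bsub>V\<^esub> iM m = iN y}"
    then obtain p q where pq: "x \<in> carrier M" "p \<in> carrier N" "\<iota> t \<odot>\<^bsub>V\<^esub> iM x = iN p"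
      "y \<in> carrier M" "q \<in> carrier N" "\<iota> t \<odot>\<^bsub>V\<^esub> iM y = iN q" by blast
    then have "\<iota> t \<odot>\<^bsub>V\<^esub> iM (x \<oplus>\<^bsub>M\<^esub> y) = iN (p \<oplus>\<^bsub>N\<^esub> q)"
      using \<iota>t by (simp add: M.i.add N.i.add M.V.smult_r_distr M.i.closed)
    then show "x \<oplus>\<^bsub>M\<^esub> y \<in> {m \<in> carrier M. \<exists>y\<in>carrier N. \<iota> t \<odot>\<^bsub>V\<^esub> iM m = iN y}"
      using pq M.M.M.a_closed N.M.M.a_closed by blast
  next
    fix a x assume a: "a \<in> carrier R" and "x \<in> {m \<in> carrier M. \<exists>y\<in>carrier N. \<iota> t \<odot>\<^bsub>V\<^esub> iM m = iN y}"
    then obtain p where p: "x \<in> carrier M" "p \<in> carrier N" "\<iota> t \<odot>\<^bsub>V\<^esub> iM x = iN p" by blast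
    then have "\<iota> t \<odot>\<^bsub>V\<^esub> iM (a \<odot>\<^bsub>M\<^esub> x) = iN (a \<odot>\<^bsub>N\<^esub> p)"
      using a by (simp add: M.i.smult N.i.smult sm_comm M.i.closed)
    then show "a \<odot>\<^bsub>M\<^esub> x \<in> {m \<in> carrier M. \<exists>y\<in>carrier N. \<iota> t \<odot>\<^bsub>V\<^esub> iM m = iN y}"
      using a p M.M.smult_closed N.M.smult_closed by blast
  qed blast
  then have "M.M.span BM \<subseteq> {m \<in> carrier M. \<exists>y\<in>carrier N. \<iota> t \<odot>\<^bsub>V\<^esub> iM m = iN y}"
    by (rule M.M.span_is_subset[rotated]) (use t(3) BM(2) in blast)
  then have "\<exists>y\<in>carrier N. \<iota> t \<odot>\<^bsub>V\<^esub> iM m = iN y" if "m \<in> carrier M" for m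
    using that unfolding BM(3) by blast
  then obtain f where fN: "\<And>m. m \<in> carrier M \<Longrightarrow> f m \<in> carrier N"
    and f: "\<And>m. m \<in> carrier M \<Longrightarrow> iN (f m) = \<iota> t \<odot>\<^bsub>V\<^esub> iM m" by metis
  interpret f: semilinear R R "\<lambda>a. a" M N f
  proof (rule semilinear.intro[OF M.M.module_axioms N.M.module_axioms id_ring_hom fN])
    show "f (x \<oplus>\<^bsub>M\<^esub> y) = f x \<oplus>\<^bsub>N\<^esub> f y" if "x \<in> carrier M" "y \<in> carrier M" for x y
      by (rule inj_onD[OF N.inj])
        (use that \<iota>t in \<open>simp_all add: fN f N.i.add M.i.add M.V.smult_r_distr M.i.closed\<close>)
    show "f (a \<odot>\<^bsub>M\<^esub> x) = a \<odot>\<^bsub>N\<^esub> f x" if "a \<in> carrier R" "x \<in> carrier M" for a x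
      by (rule inj_onD[OF N.inj])
        (use that in \<open>simp_all add: fN f N.i.smult M.i.smult sm_comm M.i.closed\<close>)
  qed
  have fimg: "LinearCombinations.submodule R (f ` carrier M) N"
    by (rule linear_image_submodule[OF f.semilinear_axioms])

  \<comment> \<open>The diagonal form of this map\<close>
  obtain v0 where v0: "bij_betw v0 {..<n} BN"
    using ex_bij_betw_nat_finite[OF BN(1)] BN(4) by (auto simp: atLeast0LessThan)
  obtain b where b: "bij_betw b {..<n} BM"
    using ex_bij_betw_nat_finite[OF BM(1)] BM(4) by (auto simp: atLeast0LessThan)
  have v0i: "v0 ` {..<n} = BN" and bi: "b ` {..<n} = BM" using v0 b by (simp_all add: bij_betw_def)
  have "b j \<in> carrier M" if "j < n" for j using bi BM(2) that by blast
  then have wN: "f (b j) \<in> carrier N" if "j < n" for j using fN that by blast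
  have v0N: "\<forall>i<n. v0 i \<in> carrier N" using v0i BN(2) by blast
  have "\<exists>v' w' d. (\<forall>i<n. v' i \<in> carrier N \<and> d i \<in> carrier R \<and> w' i = d i \<odot>\<^bsub>N\<^esub> v' i) \<and>
      N.M.span (v' ` {..<n}) = N.M.span (v0 ` {..<n}) \<and> N.M.span (w' ` {..<n}) = N.M.span ((\<lambda>j. f (b j)) ` {..<n})"
    by (rule N.M.diagonalise[OF pid v0N]) (use wN v0i BN(3) in simp)
  then obtain v w d where vd: "\<And>i. i < n \<Longrightarrow> v i \<in> carrier N \<and> d i \<in> carrier R \<and> w i = d i \<odot>\<^bsub>N\<^esub> v i"
    and sv: "N.M.span (v ` {..<n}) = carrier N" and sw: "N.M.span (w ` {..<n}) = N.M.span ((\<lambda>j. f (b j)) ` {..<n})"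
    unfolding v0i BN(3) by blast
  have vN: "v i \<in> carrier N" and dR: "d i \<in> carrier R" and w: "w i = d i \<odot>\<^bsub>N\<^esub> v i" if "i < n" for i
    using vd[OF that] by auto
  have vI: "v ` {..<n} \<subseteq> carrier N" and wI: "w ` {..<n} \<subseteq> carrier N" using vN dR w by auto
  have gI: "(\<lambda>j. f (b j)) ` {..<n} \<subseteq> carrier N" using wN by auto
  have "(\<lambda>j. f (b j)) ` {..<n} \<subseteq> f ` carrier M" using bi BM(2) by auto
  then have sw_sub: "N.M.span (w ` {..<n}) \<subseteq> f ` carrier M"
    unfolding sw by (rule N.M.span_is_subset[OF _ fimg])
  have f_sw: "f m \<in> N.M.span (w ` {..<n})" if m: "m \<in> carrier M" for m
  proof -
    interpret s: LinearCombinations.submodule R "N.M.span (w ` {..<n})" N by (rule N.M.span_is_submodule[OF wI])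
    have "LinearCombinations.submodule R {m \<in> carrier M. f m \<in> N.M.span (w ` {..<n})} M"
      by (rule LinearCombinations.submodule.intro[OF M.M.module_axioms])
        (use s.zero_closed in \<open>auto simp: f.add f.smult f.zero\<close>)
    then have "M.M.span BM \<subseteq> {m \<in> carrier M. f m \<in> N.M.span (w ` {..<n})}"
      by (rule M.M.span_is_subset[rotated]) (use N.M.in_own_span[OF gI] sw BM(2) bi in auto)
    then show ?thesis using m BM(3) by blast
  qed
  \<comment> \<open>The diagonal vectors lie in the image of \<open>f\<close>. Their preimages
    \<open>y j\<close> will realise the special value of the minors on \<open>M\<close>.\<close>
  have "\<forall>j<n. \<exists>y. y \<in> carrier M \<and> f y = w j"
    using sw_sub N.M.in_own_span[OF wI] by (metis imageE imageI lessThan_iff subsetD)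
  then obtain y where yM: "\<And>j. j < n \<Longrightarrow> y j \<in> carrier M" and fy: "\<And>j. j < n \<Longrightarrow> f (y j) = w j" by metis

  \<comment> \<open>Coordinate functionals adapted to the diagonal form\<close>
  define u where "u j = iN (v j)" for j
  have uV: "u j \<in> carrier V" if "j < n" for j using vN[OF that] N.i.closed by (simp add: u_def)
  have uimg: "u ` {..<n} = iN ` (v ` {..<n})" by (auto simp: u_def)
  have uC: "u ` {..<n} \<subseteq> carrier V" using uV by auto
  have uspan: "M.V.span (u ` {..<n}) = carrier V" unfolding uimg by (rule N.image_generates[OF vI sv])
  have ufin: "finite (u ` {..<n})" by simp
  \<comment> \<open>Only the span of \<open>v\<close> was controlled so far. Spanning
    \<open>V\<close> by \<open>n = dim V\<close> vectors forces the family to have no repetitions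
    and to be a basis.\<close>
  have "VS.dim \<le> card (u ` {..<n})" by (rule VS.gen_ge_dim[OF ufin uC uspan])
  then have ucard: "card (u ` {..<n}) = n" using n card_image_le[of "{..<n}" u] by simp
  then have uinj: "inj_on u {..<n}" using eq_card_imp_inj_on[of "{..<n}" u] by simp
  have ubasis: "VS.basis (u ` {..<n})" by (rule VS.dim_gen_is_basis[OF ufin uC uspan]) (use ucard n in simp)
  then have uli: "M.V.lin_indpt (u ` {..<n})" by (simp add: VS.basis_def)
  obtain co where co: "\<And>b. b \<in> u ` {..<n} \<Longrightarrow> semilinear K K (\<lambda>a. a) V (self_module K) (co b)"
    and co\<delta>: "\<And>b b'. b \<in> u ` {..<n} \<Longrightarrow> b' \<in> u ` {..<n} \<Longrightarrow> co b b' = (if b = b' then \<one>\<^bsub>K\<^esub> else \<zero>\<^bsub>K\<^esub>)"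
    by (rule M.V.coordinates_exist[OF ufin uC uli uspan], rule that; assumption)
  define l where "l j = co (u j)" for j
  have l: "semilinear K K (\<lambda>a. a) V (self_module K) (l j)" if "j < n" for j
    unfolding l_def by (rule co) (use that in simp)
  have l\<delta>: "l j (u i) = (if j = i then \<one>\<^bsub>K\<^esub> else \<zero>\<^bsub>K\<^esub>)" if "j < n" "i < n" for j i
    unfolding l_def using co\<delta>[of "u j" "u i"] inj_on_eq_iff[OF uinj, of j i] that by auto
  note lc = semilinear.closed[OF l, simplified] and la = semilinear.add[OF l, simplified]
    and ls = semilinear.smult[OF l, simplified] and lz = semilinear.zero[OF l, simplified]

  text \<open>\<open>l j\<close> takes values in \<open>R\<close> on \<open>N\<close>, and values in \<open>d j R\<close> on \<open>t M\<close>.\<close>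
  have integral: "\<exists>r\<in>carrier R. l j (iN z) = \<iota> (e \<otimes>\<^bsub>R\<^esub> r)"
    if j: "j < n" and e: "e \<in> carrier R" and x: "x ` {..<n} \<subseteq> carrier N"
      and xe: "\<And>i. i < n \<Longrightarrow> \<exists>r\<in>carrier R. l j (iN (x i)) = \<iota> (e \<otimes>\<^bsub>R\<^esub> r)"
      and z: "z \<in> N.M.span (x ` {..<n})" for j e x z
  proof -
    let ?H = "{z \<in> carrier N. \<exists>r\<in>carrier R. l j (iN z) = \<iota> (e \<otimes>\<^bsub>R\<^esub> r)}"
    have "LinearCombinations.submodule R ?H N"
    proof (rule LinearCombinations.submodule.intro[OF N.M.module_axioms])
      show "\<zero>\<^bsub>N\<^esub> \<in> ?H" using lz[OF j] e by (auto simp: N.i.zero intro!: bexI[of _ "\<zero>\<^bsub>R\<^esub>"])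
      fix p q assume "p \<in> ?H" "q \<in> ?H"
      then obtain r s where rs: "p \<in> carrier N" "q \<in> carrier N" "r \<in> carrier R" "s \<in> carrier R"
        "l j (iN p) = \<iota> (e \<otimes>\<^bsub>R\<^esub> r)" "l j (iN q) = \<iota> (e \<otimes>\<^bsub>R\<^esub> s)" by blast
      then have "l j (iN (p \<oplus>\<^bsub>N\<^esub> q)) = \<iota> (e \<otimes>\<^bsub>R\<^esub> (r \<oplus>\<^bsub>R\<^esub> s))"
        using la[OF j] e by (simp add: N.i.add N.i.closed M.R.r_distr M.K.r_distr)
      then show "p \<oplus>\<^bsub>N\<^esub> q \<in> ?H" using rs N.M.M.a_closed M.R.a_closed by blast
    next
      fix a p assume a: "a \<in> carrier R" and "p \<in> ?H"
      then obtain r where r: "p \<in> carrier N" "r \<in> carrier R" "l j (iN p) = \<iota> (e \<otimes>\<^bsub>R\<^esub> r)" by blast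
      then have "l j (iN (a \<odot>\<^bsub>N\<^esub> p)) = \<iota> (e \<otimes>\<^bsub>R\<^esub> (a \<otimes>\<^bsub>R\<^esub> r))"
        using ls[OF j] e a by (simp add: N.i.smult N.i.closed M.K.m_lcomm)
      then show "a \<odot>\<^bsub>N\<^esub> p \<in> ?H" using a r N.M.smult_closed M.R.m_closed by blast
    qed blast
    then have "N.M.span (x ` {..<n}) \<subseteq> ?H"
      by (rule N.M.span_is_subset[rotated]) (use x xe in blast)
    then show ?thesis using z by blast
  qed
  have lN: "\<exists>r\<in>carrier R. l j (iN z) = \<iota> r" if j: "j < n" and z: "z \<in> carrier N" for j z
  proof -
    have "\<exists>r\<in>carrier R. l j (iN (v i)) = \<iota> (\<one>\<^bsub>R\<^esub> \<otimes>\<^bsub>R\<^esub> r)" if "i < n" for i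
      using l\<delta>[OF j that] by (auto simp: u_def intro: bexI[of _ "\<one>\<^bsub>R\<^esub>"] bexI[of _ "\<zero>\<^bsub>R\<^esub>"])
    from integral[OF j _ vI this, of z] z sv show ?thesis by auto
  qed
  have lM: "\<exists>r\<in>carrier R. l j (\<iota> t \<odot>\<^bsub>V\<^esub> iM m) = \<iota> (d j \<otimes>\<^bsub>R\<^esub> r)" if j: "j < n" and m: "m \<in> carrier M" for j m
  proof -
    have "\<exists>r\<in>carrier R. l j (iN (w i)) = \<iota> (d j \<otimes>\<^bsub>R\<^esub> r)" if i: "i < n" for i
    proof (cases "i = j")
      case True
      then have "l j (iN (w i)) = \<iota> (d j \<otimes>\<^bsub>R\<^esub> \<one>\<^bsub>R\<^esub>)"
        using ls[OF j, of "\<iota> (d i)" "u i"] l\<delta>[OF j i] vN[OF i] dR[OF i] uV[OF i] w[OF i] by (simp add: N.i.smult u_def)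
      then show ?thesis by blast
    next
      case False
      then have "l j (iN (w i)) = \<iota> (d j \<otimes>\<^bsub>R\<^esub> \<zero>\<^bsub>R\<^esub>)"
        using ls[OF j, of "\<iota> (d i)" "u i"] l\<delta>[OF j i] vN[OF i] dR[OF i] dR[OF j] uV[OF i]
        by (simp add: w[OF i] N.i.smult u_def)
      then show ?thesis by blast
    qed
    from integral[OF j dR[OF j] wI this f_sw[OF m]] show ?thesis unfolding f[OF m] .
  qed

  \<comment> \<open>Values of minors on the two exterior powers\<close>
  define T where "T = (\<Otimes>\<^bsub>R\<^esub> a\<in>{..<k}. t)"
  have T: "T \<in> carrier R" "T \<noteq> \<zero>\<^bsub>R\<^esub>"
  proof -
    have "T = t [^]\<^bsub>R\<^esub> k" unfolding T_def using M.R.finprod_const[OF t(1), of "{..<k}"] by simp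
    moreover have "t [^]\<^bsub>R\<^esub> q \<in> carrier R \<and> t [^]\<^bsub>R\<^esub> q \<noteq> \<zero>\<^bsub>R\<^esub>" for q :: nat
      by (induction q) (use t M.R.one_not_zero M.R.integral in auto)
    ultimately show "T \<in> carrier R" "T \<noteq> \<zero>\<^bsub>R\<^esub>" by auto
  qed
  \<comment> \<open>The factor that a minor acquires when each of its \<open>k\<close> rows is
    multiplied by \<open>t\<close>.\<close>
  have \<iota>T: "\<iota> T = (\<Otimes>\<^bsub>K\<^esub> a\<in>{..<k}. \<iota> t)" unfolding T_def by (subst M.\<iota>.hom_finprod) (use t in \<open>auto simp: comp_def\<close>)
  \<comment> \<open>Divisibility in both directions between \<open>T\<close> and \<open>c\<close>
    times the product of the \<open>d (I a)\<close>, written without dividing by \<open>c\<close>,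
    which is not yet known to be nonzero.\<close>
  have key: "(\<exists>r\<in>carrier R. c \<otimes>\<^bsub>K\<^esub> \<iota> (\<Otimes>\<^bsub>R\<^esub> a\<in>{..<k}. d (I a)) = \<iota> (T \<otimes>\<^bsub>R\<^esub> r)) \<and>
      (\<exists>s\<in>carrier R. \<iota> T = c \<otimes>\<^bsub>K\<^esub> \<iota> ((\<Otimes>\<^bsub>R\<^esub> a\<in>{..<k}. d (I a)) \<otimes>\<^bsub>R\<^esub> s))"
    if I: "inj_on I {..<k}" "I ` {..<k} \<subseteq> {..<n}" for I
  proof -
    have In: "I a < n" if "a < k" for a using I(2) that by auto
    have I\<delta>: "(I a = I b) = (a = b)" if "a < k" "b < k" for a b using I(1) that by (auto dest: inj_onD)
    let ?d = "\<Otimes>\<^bsub>R\<^esub> a\<in>{..<k}. d (I a)"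
    have dc: "?d \<in> carrier R" using dR In by (intro M.R.finprod_closed) auto
    \<comment> \<open>The minor for the functionals at the places \<open>I\<close>. The functional
      \<open>F\<close> obtained from it is evaluated on the images of both lattices.\<close>
    define D where "D xs = mdet K k (\<lambda>a b. l (I a) (xs ! b))" for xs
    have Dalt: "alternating K (\<lambda>a. a) k V (self_module K) D"
      unfolding D_def[abs_def] by (rule mdet_alternating[OF K l[OF In]])
    obtain F where F: "semilinear K K (\<lambda>a. a) EV.E (self_module K) F"
      and Fw: "\<And>xs. xs \<in> tuples k V \<Longrightarrow> F (EV.wedge xs) = D xs"
      using EV.universal[OF self_module_module[OF K] id_ring_hom Dalt] by blast
    note Fc = semilinear.closed[OF F, simplified] and Fa = semilinear.add[OF F, simplified]
      and Fs = semilinear.smult[OF F, simplified] and Fz = semilinear.zero[OF F, simplified]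
    have tM: "map iM xs \<in> tuples k V" if "xs \<in> tuples k M" for xs
      by (rule tuples_map[OF that]) (use M.i.closed in blast)
    have tN: "map iN xs \<in> tuples k V" if "xs \<in> tuples k N" for xs
      by (rule tuples_map[OF that]) (use N.i.closed in blast)
    have nthM: "xs ! b \<in> carrier M" "length xs = k" if "xs \<in> tuples k M" "b < k" for xs b
      using that nth_mem[of b xs] by (auto simp: tuples_iff simp del: nth_mem)
    have nthN: "xs ! b \<in> carrier N" "length xs = k" if "xs \<in> tuples k N" "b < k" for xs b
      using that nth_mem[of b xs] by (auto simp: tuples_iff simp del: nth_mem)

    \<comment> \<open>On wedges from \<open>N\<close> all entries of the minor lie in
      \<open>R\<close>, hence so does the minor.\<close>
    have FN: "\<exists>r\<in>carrier R. F (jN z) = \<iota> r" if z: "z \<in> carrier EN.E" for z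
    proof -
      let ?H = "{z \<in> carrier EN.E. \<exists>r\<in>carrier R. F (jN z) = \<iota> r}"
      interpret E: module R EN.E by (rule EN.module_E)
      have "LinearCombinations.submodule R ?H EN.E"
      proof (rule LinearCombinations.submodule.intro[OF EN.module_E])
        show "\<zero>\<^bsub>EN.E\<^esub> \<in> ?H" using Fz by (auto simp: jN.zero intro!: bexI[of _ "\<zero>\<^bsub>R\<^esub>"])
        fix p q assume "p \<in> ?H" "q \<in> ?H"
        then obtain r s where rs: "p \<in> carrier EN.E" "q \<in> carrier EN.E" "r \<in> carrier R" "s \<in> carrier R"
          "F (jN p) = \<iota> r" "F (jN q) = \<iota> s" by blast
        then have "F (jN (p \<oplus>\<^bsub>EN.E\<^esub> q)) = \<iota> (r \<oplus>\<^bsub>R\<^esub> s)" by (simp add: jN.add Fa jN.closed)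
        then show "p \<oplus>\<^bsub>EN.E\<^esub> q \<in> ?H" using rs E.M.a_closed M.R.a_closed by blast
      next
        fix a p assume a: "a \<in> carrier R" and "p \<in> ?H"
        then obtain r where r: "p \<in> carrier EN.E" "r \<in> carrier R" "F (jN p) = \<iota> r" by blast
        then have "F (jN (a \<odot>\<^bsub>EN.E\<^esub> p)) = \<iota> (a \<otimes>\<^bsub>R\<^esub> r)" using a by (simp add: jN.smult Fs jN.closed)
        then show "a \<odot>\<^bsub>EN.E\<^esub> p \<in> ?H" using a r E.smult_closed M.R.m_closed by blast
      qed blast
      moreover have "EN.wedge xs \<in> ?H" if xs: "xs \<in> tuples k N" for xs
      proof -
        have "\<exists>r\<in>carrier R. l (I a) (iN (xs ! b)) = \<iota> r" if "a < k" "b < k" for a b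
          by (rule lN[OF In[OF that(1)] nthN(1)[OF xs that(2)]])
        then obtain A where A: "\<And>a b. a < k \<Longrightarrow> b < k \<Longrightarrow> A a b \<in> carrier R"
          "\<And>a b. a < k \<Longrightarrow> b < k \<Longrightarrow> l (I a) (iN (xs ! b)) = \<iota> (A a b)" by metis
        have "F (jN (EN.wedge xs)) = mdet K k (\<lambda>a b. \<iota> (A a b))"
          unfolding jN(2)[OF xs] Fw[OF tN[OF xs]] D_def
          by (rule M.K.mdet_cong) (use A nthN[OF xs] in auto)
        also have "\<dots> = \<iota> (mdet R k A)" by (rule M.\<iota>.mdet_hom) (rule A(1))
        finally have "F (jN (EN.wedge xs)) = \<iota> (mdet R k A)" .
        moreover have "mdet R k A \<in> carrier R" by (rule M.R.mdet_closed; rule A; assumption)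
        ultimately show ?thesis using EN.wedge_closed[OF xs] by blast
      qed
      ultimately show ?thesis using EN.generated[of ?H z] z by blast
    qed

    \<comment> \<open>Multiplication by \<open>t\<close> makes the entries of row \<open>a\<close>
      multiples of \<open>d (I a)\<close>, and these factors come out of the determinant.\<close>
    have wedgeM: "\<iota> T \<otimes>\<^bsub>K\<^esub> F (jM (EM.wedge xs)) = \<iota> (?d \<otimes>\<^bsub>R\<^esub> mdet R k A)"
      if xs: "xs \<in> tuples k M" and A: "\<And>a b. a < k \<Longrightarrow> b < k \<Longrightarrow> A a b \<in> carrier R"
        "\<And>a b. a < k \<Longrightarrow> b < k \<Longrightarrow> l (I a) (\<iota> t \<odot>\<^bsub>V\<^esub> iM (xs ! b)) = \<iota> (d (I a) \<otimes>\<^bsub>R\<^esub> A a b)" for xs A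
    proof -
      have lx: "l (I a) (map iM xs ! b) \<in> carrier K" if "a < k" "b < k" for a b
        using lc[OF In[OF that(1)]] nthM[OF xs that(2)] that by (simp add: M.i.closed)
      have "\<iota> T \<otimes>\<^bsub>K\<^esub> F (jM (EM.wedge xs)) = mdet K k (\<lambda>a b. \<iota> t \<otimes>\<^bsub>K\<^esub> l (I a) (map iM xs ! b))"
        unfolding jM(2)[OF xs] Fw[OF tM[OF xs]] D_def \<iota>T
        by (rule M.K.mdet_scale_rows[symmetric]) (use lx \<iota>t in auto)
      also have "\<dots> = mdet K k (\<lambda>a b. \<iota> (d (I a) \<otimes>\<^bsub>R\<^esub> A a b))"
      proof (rule M.K.mdet_cong)
        fix a b assume ab: "a < k" "b < k"
        show "\<iota> t \<otimes>\<^bsub>K\<^esub> l (I a) (map iM xs ! b) = \<iota> (d (I a) \<otimes>\<^bsub>R\<^esub> A a b)"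
          using ls[OF In[OF ab(1)] \<iota>t, of "iM (xs ! b)"] nthM[OF xs ab(2)] A(2)[OF ab] ab by (simp add: M.i.closed)
        show "\<iota> (d (I a) \<otimes>\<^bsub>R\<^esub> A a b) \<in> carrier K" using A(1)[OF ab] dR[OF In[OF ab(1)]] by simp
      qed
      also have "\<dots> = \<iota> (mdet R k (\<lambda>a b. d (I a) \<otimes>\<^bsub>R\<^esub> A a b))"
        by (rule M.\<iota>.mdet_hom) (use A(1) dR In in auto)
      also have "mdet R k (\<lambda>a b. d (I a) \<otimes>\<^bsub>R\<^esub> A a b) = ?d \<otimes>\<^bsub>R\<^esub> mdet R k A"
        by (rule M.R.mdet_scale_rows) (use A(1) dR In in auto)
      finally show ?thesis .
    qed
    have FM: "\<exists>s\<in>carrier R. \<iota> T \<otimes>\<^bsub>K\<^esub> F (jM z) = \<iota> (?d \<otimes>\<^bsub>R\<^esub> s)" if z: "z \<in> carrier EM.E" for z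
    proof -
      let ?H = "{z \<in> carrier EM.E. \<exists>s\<in>carrier R. \<iota> T \<otimes>\<^bsub>K\<^esub> F (jM z) = \<iota> (?d \<otimes>\<^bsub>R\<^esub> s)}"
      interpret E: module R EM.E by (rule EM.module_E)
      have \<iota>Tc: "\<iota> T \<in> carrier K" using T(1) by simp
      have "LinearCombinations.submodule R ?H EM.E"
      proof (rule LinearCombinations.submodule.intro[OF EM.module_E])
        show "\<zero>\<^bsub>EM.E\<^esub> \<in> ?H" using Fz dc \<iota>Tc by (auto simp: jM.zero intro!: bexI[of _ "\<zero>\<^bsub>R\<^esub>"])
        fix p q assume "p \<in> ?H" "q \<in> ?H"
        then obtain r s where rs: "p \<in> carrier EM.E" "q \<in> carrier EM.E" "r \<in> carrier R" "s \<in> carrier R"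
          "\<iota> T \<otimes>\<^bsub>K\<^esub> F (jM p) = \<iota> (?d \<otimes>\<^bsub>R\<^esub> r)" "\<iota> T \<otimes>\<^bsub>K\<^esub> F (jM q) = \<iota> (?d \<otimes>\<^bsub>R\<^esub> s)" by blast
        have "\<iota> T \<otimes>\<^bsub>K\<^esub> F (jM (p \<oplus>\<^bsub>EM.E\<^esub> q)) = \<iota> T \<otimes>\<^bsub>K\<^esub> F (jM p) \<oplus>\<^bsub>K\<^esub> \<iota> T \<otimes>\<^bsub>K\<^esub> F (jM q)"
          using rs(1,2) \<iota>Tc by (simp add: jM.add Fa Fc jM.closed M.K.r_distr)
        also have "\<dots> = \<iota> (?d \<otimes>\<^bsub>R\<^esub> (r \<oplus>\<^bsub>R\<^esub> s))"
          unfolding rs(5,6) using rs(3,4) dc by (simp only: M.R.r_distr M.\<iota>.hom_add M.R.m_closed)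
        finally show "p \<oplus>\<^bsub>EM.E\<^esub> q \<in> ?H" using rs(1-4) E.M.a_closed M.R.a_closed by blast
      next
        fix a p assume a: "a \<in> carrier R" and "p \<in> ?H"
        then obtain r where r: "p \<in> carrier EM.E" "r \<in> carrier R" "\<iota> T \<otimes>\<^bsub>K\<^esub> F (jM p) = \<iota> (?d \<otimes>\<^bsub>R\<^esub> r)" by blast
        have "\<iota> T \<otimes>\<^bsub>K\<^esub> F (jM (a \<odot>\<^bsub>EM.E\<^esub> p)) = \<iota> a \<otimes>\<^bsub>K\<^esub> (\<iota> T \<otimes>\<^bsub>K\<^esub> F (jM p))"
          using r(1) \<iota>Tc a by (simp add: jM.smult Fs Fc jM.closed M.K.m_lcomm)
        also have "\<dots> = \<iota> (a \<otimes>\<^bsub>R\<^esub> (?d \<otimes>\<^bsub>R\<^esub> r))"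
          unfolding r(3) using r(2) dc a by (simp only: M.\<iota>.hom_mult M.R.m_closed)
        also have "a \<otimes>\<^bsub>R\<^esub> (?d \<otimes>\<^bsub>R\<^esub> r) = ?d \<otimes>\<^bsub>R\<^esub> (a \<otimes>\<^bsub>R\<^esub> r)" using r(2) dc a by (rule_tac M.R.m_lcomm)
        finally show "a \<odot>\<^bsub>EM.E\<^esub> p \<in> ?H" using a r(1,2) E.smult_closed M.R.m_closed by blast
      qed blast
      moreover have "EM.wedge xs \<in> ?H" if xs: "xs \<in> tuples k M" for xs
      proof -
        have "\<exists>r\<in>carrier R. l (I a) (\<iota> t \<odot>\<^bsub>V\<^esub> iM (xs ! b)) = \<iota> (d (I a) \<otimes>\<^bsub>R\<^esub> r)" if "a < k" "b < k" for a b
          by (rule lM[OF In[OF that(1)] nthM(1)[OF xs that(2)]])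
        then obtain A where A: "\<And>a b. a < k \<Longrightarrow> b < k \<Longrightarrow> A a b \<in> carrier R"
          "\<And>a b. a < k \<Longrightarrow> b < k \<Longrightarrow> l (I a) (\<iota> t \<odot>\<^bsub>V\<^esub> iM (xs ! b)) = \<iota> (d (I a) \<otimes>\<^bsub>R\<^esub> A a b)" by metis
        have "\<iota> T \<otimes>\<^bsub>K\<^esub> F (jM (EM.wedge xs)) = \<iota> (?d \<otimes>\<^bsub>R\<^esub> mdet R k A)"
          by (rule wedgeM[OF xs]; rule A; assumption)
        moreover have "mdet R k A \<in> carrier R" by (rule M.R.mdet_closed; rule A; assumption)
        ultimately show ?thesis using EM.wedge_closed[OF xs] by blast
      qed
      ultimately show ?thesis using EM.generated[of ?H z] z by blast
    qed

    \<comment> \<open>The lists at which the special values occur: on both, after the row factors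
      have been taken out, the minor is the determinant of an identity matrix.\<close>
    have yt: "map (\<lambda>a. y (I a)) [0..<k] \<in> tuples k M" using yM In by (auto simp: tuples_iff)
    have vt: "map (\<lambda>a. v (I a)) [0..<k] \<in> tuples k N" using vN In by (auto simp: tuples_iff)
    let ?y = "EM.wedge (map (\<lambda>a. y (I a)) [0..<k])" and ?v = "EN.wedge (map (\<lambda>a. v (I a)) [0..<k])"
    have yc: "?y \<in> carrier EM.E" and vc: "?v \<in> carrier EN.E" by (rule EM.wedge_closed[OF yt], rule EN.wedge_closed[OF vt])
    have Fy: "\<iota> T \<otimes>\<^bsub>K\<^esub> F (jM ?y) = \<iota> ?d"
    proof -
      have "l (I a) (\<iota> t \<odot>\<^bsub>V\<^esub> iM (map (\<lambda>a. y (I a)) [0..<k] ! b)) =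
          \<iota> (d (I a) \<otimes>\<^bsub>R\<^esub> (if a = b then \<one>\<^bsub>R\<^esub> else \<zero>\<^bsub>R\<^esub>))" if ab: "a < k" "b < k" for a b
      proof -
        have "\<iota> t \<odot>\<^bsub>V\<^esub> iM (y (I b)) = \<iota> (d (I b)) \<odot>\<^bsub>V\<^esub> u (I b)"
          using f[OF yM[OF In[OF ab(2)]]] fy[OF In[OF ab(2)]] w[OF In[OF ab(2)]] vN[OF In[OF ab(2)]] dR[OF In[OF ab(2)]]
          by (simp add: N.i.smult u_def)
        then show ?thesis
          using ab ls[OF In[OF ab(1)], of "\<iota> (d (I b))" "u (I b)"] l\<delta>[OF In[OF ab(1)] In[OF ab(2)]] I\<delta>[OF ab]
            dR[OF In[OF ab(1)]] dR[OF In[OF ab(2)]] uV[OF In[OF ab(2)]] by auto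
      qed
      then have "\<iota> T \<otimes>\<^bsub>K\<^esub> F (jM ?y) = \<iota> (?d \<otimes>\<^bsub>R\<^esub> mdet R k (\<lambda>a b. if a = b then \<one>\<^bsub>R\<^esub> else \<zero>\<^bsub>R\<^esub>))"
        by (intro wedgeM[OF yt]) auto
      then show ?thesis using M.R.mdet_identity[of k] dc by simp
    qed
    have Fv: "F (jN ?v) = \<one>\<^bsub>K\<^esub>"
    proof -
      have "F (jN ?v) = mdet K k (\<lambda>a b. if a = b then \<one>\<^bsub>K\<^esub> else \<zero>\<^bsub>K\<^esub>)"
        unfolding jN(2)[OF vt] Fw[OF tN[OF vt]] D_def
        by (rule M.K.mdet_cong) (use l\<delta> In I\<delta> in \<open>auto simp: u_def\<close>)
      then show ?thesis by (simp add: M.K.mdet_identity)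
    qed
    have F\<phi>: "F (jN (\<phi> z)) = c \<otimes>\<^bsub>K\<^esub> F (jM z)" if "z \<in> carrier EM.E" for z
      using eq[OF that] Fs[OF c jM.closed[OF that]] by simp
    have FMc: "F (jM z) \<in> carrier K" if "z \<in> carrier EM.E" for z using Fc jM.closed that by blast
    have \<iota>Tc: "\<iota> T \<in> carrier K" using T(1) by simp
    have "\<phi> ?y \<in> carrier EN.E" using surj yc by blast
    then obtain r where r: "r \<in> carrier R" "F (jN (\<phi> ?y)) = \<iota> r" using FN by blast
    \<comment> \<open>First equation: \<open>\<phi>\<close> sends the wedge of the
      \<open>y (I a)\<close> into the exterior power of \<open>N\<close>, where \<open>F\<close>
      takes values in \<open>R\<close>.\<close>
    have "c \<otimes>\<^bsub>K\<^esub> \<iota> ?d = \<iota> T \<otimes>\<^bsub>K\<^esub> (c \<otimes>\<^bsub>K\<^esub> F (jM ?y))"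
      unfolding Fy[symmetric] using c \<iota>Tc FMc[OF yc] by (rule M.K.m_lcomm)
    also have "\<dots> = \<iota> (T \<otimes>\<^bsub>R\<^esub> r)" using F\<phi>[OF yc] r T(1) by simp
    finally have 1: "c \<otimes>\<^bsub>K\<^esub> \<iota> ?d = \<iota> (T \<otimes>\<^bsub>R\<^esub> r)" .
    \<comment> \<open>Second equation: surjectivity provides a preimage of the wedge of the
      \<open>v (I a)\<close>, at which \<open>F\<close> has value one.\<close>
    obtain z where z: "z \<in> carrier EM.E" "\<phi> z = ?v" using vc unfolding surj[symmetric] by (elim imageE) (rule that, simp_all)
    obtain s where s: "s \<in> carrier R" "\<iota> T \<otimes>\<^bsub>K\<^esub> F (jM z) = \<iota> (?d \<otimes>\<^bsub>R\<^esub> s)" using FM[OF z(1)] by blast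
    have "c \<otimes>\<^bsub>K\<^esub> F (jM z) = \<one>\<^bsub>K\<^esub>" using F\<phi>[OF z(1)] Fv unfolding z(2) by simp
    then have "\<iota> T = \<iota> T \<otimes>\<^bsub>K\<^esub> (c \<otimes>\<^bsub>K\<^esub> F (jM z))" using \<iota>Tc by simp
    also have "\<dots> = c \<otimes>\<^bsub>K\<^esub> \<iota> (?d \<otimes>\<^bsub>R\<^esub> s)"
      unfolding s(2)[symmetric] using \<iota>Tc c FMc[OF z(1)] by (rule M.K.m_lcomm)
    finally show ?thesis using 1 r(1) s(1) by blast
  qed

  \<comment> \<open>From products of diagonal entries to single entries\<close>
  have c0: "c \<noteq> \<zero>\<^bsub>K\<^esub>"
  proof
    assume "c = \<zero>\<^bsub>K\<^esub>"
    moreover have "inj_on (\<lambda>a. a) {..<k}" "(\<lambda>a. a) ` {..<k} \<subseteq> {..<n}" using k by auto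
    \<comment> \<open>By the second equation \<open>T\<close> would vanish.\<close>
    ultimately show False
      using key[of "\<lambda>a. a"] T M.\<iota>_eq_zero_iff[OF T(1)] dR k by (auto simp: M.\<iota>_eq_zero_iff)
  qed
  \<comment> \<open>The product at the first \<open>k\<close> places is the reference to which all
    selections are compared.\<close>
  define m where "m = (\<Otimes>\<^bsub>R\<^esub> a\<in>{..<k}. d a)"
  have mR: "m \<in> carrier R" unfolding m_def using dR k by (intro M.R.finprod_closed) auto
  have assoc: "(\<Otimes>\<^bsub>R\<^esub> a\<in>{..<k}. d (I a)) \<noteq> \<zero>\<^bsub>R\<^esub> \<and> (\<Otimes>\<^bsub>R\<^esub> a\<in>{..<k}. d (I a)) \<sim>\<^bsub>R\<^esub> m"
    if I: "inj_on I {..<k}" "I ` {..<k} \<subseteq> {..<n}" for I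
  proof -
    have dI: "(\<Otimes>\<^bsub>R\<^esub> a\<in>{..<k}. d (J a)) \<in> carrier R" if "J ` {..<k} \<subseteq> {..<n}" for J
      using dR that by (intro M.R.finprod_closed) auto
    \<comment> \<open>The second equation for \<open>J\<close> and the first for \<open>J'\<close>
      combine, and \<open>c\<close> cancels.\<close>
    have div: "(\<Otimes>\<^bsub>R\<^esub> a\<in>{..<k}. d (J a)) divides\<^bsub>R\<^esub> (\<Otimes>\<^bsub>R\<^esub> a\<in>{..<k}. d (J' a))"
      if J: "inj_on J {..<k}" "J ` {..<k} \<subseteq> {..<n}" and J': "inj_on J' {..<k}" "J' ` {..<k} \<subseteq> {..<n}" for J J'
    proof -
      let ?p = "\<Otimes>\<^bsub>R\<^esub> a\<in>{..<k}. d (J a)" and ?q = "\<Otimes>\<^bsub>R\<^esub> a\<in>{..<k}. d (J' a)"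
      note pq = dI[OF J(2)] dI[OF J'(2)]
      obtain s where s: "s \<in> carrier R" "\<iota> T = c \<otimes>\<^bsub>K\<^esub> \<iota> (?p \<otimes>\<^bsub>R\<^esub> s)" using key[OF J] by blast
      obtain r where r: "r \<in> carrier R" "c \<otimes>\<^bsub>K\<^esub> \<iota> ?q = \<iota> (T \<otimes>\<^bsub>R\<^esub> r)" using key[OF J'] by blast
      have "c \<otimes>\<^bsub>K\<^esub> \<iota> ?q = (c \<otimes>\<^bsub>K\<^esub> \<iota> (?p \<otimes>\<^bsub>R\<^esub> s)) \<otimes>\<^bsub>K\<^esub> \<iota> r"
        unfolding r(2) s(2)[symmetric] using T(1) r(1) by (rule M.\<iota>.hom_mult)
      also have "\<dots> = c \<otimes>\<^bsub>K\<^esub> (\<iota> (?p \<otimes>\<^bsub>R\<^esub> s) \<otimes>\<^bsub>K\<^esub> \<iota> r)"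
        by (rule M.K.m_assoc[OF c]) (use pq s(1) r(1) in auto)
      also have "\<iota> (?p \<otimes>\<^bsub>R\<^esub> s) \<otimes>\<^bsub>K\<^esub> \<iota> r = \<iota> (?p \<otimes>\<^bsub>R\<^esub> s \<otimes>\<^bsub>R\<^esub> r)"
        by (rule M.\<iota>.hom_mult[symmetric]) (use pq s(1) r(1) in auto)
      finally have "\<iota> ?q = \<iota> (?p \<otimes>\<^bsub>R\<^esub> s \<otimes>\<^bsub>R\<^esub> r)"
        using M.K.m_lcancel[OF c0 c] pq s(1) r(1) by simp
      then have "?q = ?p \<otimes>\<^bsub>R\<^esub> s \<otimes>\<^bsub>R\<^esub> r"
        by (rule inj_onD[OF M.\<iota>_inj]) (use pq s(1) r(1) in auto)
      then show ?thesis using pq s(1) r(1) by (auto simp: factor_def M.R.m_assoc intro!: bexI[of _ "s \<otimes>\<^bsub>R\<^esub> r"])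
    qed
    have "(\<Otimes>\<^bsub>R\<^esub> a\<in>{..<k}. d (I a)) \<noteq> \<zero>\<^bsub>R\<^esub>"
    proof
      assume 0: "(\<Otimes>\<^bsub>R\<^esub> a\<in>{..<k}. d (I a)) = \<zero>\<^bsub>R\<^esub>"
      obtain s where s: "s \<in> carrier R" "\<iota> T = c \<otimes>\<^bsub>K\<^esub> \<iota> ((\<Otimes>\<^bsub>R\<^esub> a\<in>{..<k}. d (I a)) \<otimes>\<^bsub>R\<^esub> s)" using key[OF I] by blast
      then have "\<iota> T = \<zero>\<^bsub>K\<^esub>" unfolding 0 using c by simp
      then show False using T M.\<iota>_eq_zero_iff by blast
    qed
    moreover have id: "inj_on (\<lambda>a. a) {..<k}" "(\<lambda>a. a) ` {..<k} \<subseteq> {..<n}" using k by auto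
    ultimately show ?thesis unfolding m_def associated_def using div[OF I id] div[OF id I] by blast
  qed
  have exch: "d i \<noteq> \<zero>\<^bsub>R\<^esub> \<and> (\<exists>e\<in>carrier R. d j = d i \<otimes>\<^bsub>R\<^esub> e)" if "i < n" "j < n" for i j
    by (rule M.R.exchange_associated[OF dR k that assoc mR])
  have n0: "0 < n" using k by simp
  have d0: "d 0 \<in> carrier R - {\<zero>\<^bsub>R\<^esub>}" using exch[OF n0 n0] dR[OF n0] by blast
  \<comment> \<open>\<open>d 0\<close> divides every diagonal entry, so all \<open>w j\<close>, and
    with them the image of \<open>f\<close>, lie in \<open>d 0\<close> times
    \<open>N\<close>.\<close>
  have "\<exists>z\<in>carrier N. iN (d 0 \<odot>\<^bsub>N\<^esub> z) = \<iota> t \<odot>\<^bsub>V\<^esub> iM x" if x: "x \<in> carrier M" for x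
  proof -
    let ?H = "(\<lambda>z. d 0 \<odot>\<^bsub>N\<^esub> z) ` carrier N"
    have d0R: "d 0 \<in> carrier R" using d0 by blast
    interpret m: semilinear R R "\<lambda>a. a" N N "\<lambda>z. d 0 \<odot>\<^bsub>N\<^esub> z"
      by (rule semilinear.intro[OF N.M.module_axioms N.M.module_axioms id_ring_hom])
        (use d0R in \<open>auto simp: N.M.smult_r_distr N.M.smult_assoc1[symmetric] M.R.m_comm\<close>)
    have "LinearCombinations.submodule R ?H N" by (rule linear_image_submodule[OF m.semilinear_axioms])
    moreover have "w ` {..<n} \<subseteq> ?H"
    proof
      fix q assume "q \<in> w ` {..<n}"
      then obtain j where j: "j < n" "q = w j" by blast
      obtain e where e: "e \<in> carrier R" "d j = d 0 \<otimes>\<^bsub>R\<^esub> e" using exch[OF n0 j(1)] by blast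
      have "q = d 0 \<odot>\<^bsub>N\<^esub> (e \<odot>\<^bsub>N\<^esub> v j)" using j w e d0R vN by (simp add: N.M.smult_assoc1)
      then show "q \<in> ?H" using e vN[OF j(1)] by blast
    qed
    ultimately have "N.M.span (w ` {..<n}) \<subseteq> ?H" by (rule N.M.span_is_subset[rotated])
    then obtain z where "z \<in> carrier N" "f x = d 0 \<odot>\<^bsub>N\<^esub> z" using f_sw[OF x] by blast
    then show ?thesis using f[OF x] by metis
  qed
  \<comment> \<open>Conversely every \<open>d j\<close> divides \<open>d 0\<close>, so
    \<open>d 0\<close> times \<open>v j\<close> is a multiple of \<open>w j\<close> and lies in the
    image of \<open>f\<close>.\<close>
  moreover have "\<exists>x\<in>carrier M. iN (d 0 \<odot>\<^bsub>N\<^esub> z) = \<iota> t \<odot>\<^bsub>V\<^esub> iM x" if z: "z \<in> carrier N" for z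
  proof -
    interpret s: LinearCombinations.submodule R "f ` carrier M" N by (rule fimg)
    have d0R: "d 0 \<in> carrier R" using d0 by blast
    have "LinearCombinations.submodule R {z \<in> carrier N. d 0 \<odot>\<^bsub>N\<^esub> z \<in> f ` carrier M} N"
    proof (rule LinearCombinations.submodule.intro[OF N.M.module_axioms])
      show "\<zero>\<^bsub>N\<^esub> \<in> {z \<in> carrier N. d 0 \<odot>\<^bsub>N\<^esub> z \<in> f ` carrier M}" using d0R s.zero_closed by simp
      show "p \<oplus>\<^bsub>N\<^esub> q \<in> {z \<in> carrier N. d 0 \<odot>\<^bsub>N\<^esub> z \<in> f ` carrier M}"
        if "p \<in> {z \<in> carrier N. d 0 \<odot>\<^bsub>N\<^esub> z \<in> f ` carrier M}" "q \<in> {z \<in> carrier N. d 0 \<odot>\<^bsub>N\<^esub> z \<in> f ` carrier M}" for p q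
        using that d0R s.m_closed by (simp add: N.M.smult_r_distr)
      show "a \<odot>\<^bsub>N\<^esub> p \<in> {z \<in> carrier N. d 0 \<odot>\<^bsub>N\<^esub> z \<in> f ` carrier M}"
        if a: "a \<in> carrier R" and p: "p \<in> {z \<in> carrier N. d 0 \<odot>\<^bsub>N\<^esub> z \<in> f ` carrier M}" for a p
      proof -
        have "d 0 \<odot>\<^bsub>N\<^esub> (a \<odot>\<^bsub>N\<^esub> p) = a \<odot>\<^bsub>N\<^esub> (d 0 \<odot>\<^bsub>N\<^esub> p)"
          using a p d0R by (simp add: N.M.smult_assoc1[symmetric] M.R.m_comm)
        then show ?thesis using a p s.smult_closed by simp
      qed
    qed blast
    moreover have "d 0 \<odot>\<^bsub>N\<^esub> v j \<in> f ` carrier M" if j: "j < n" for j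
    proof -
      obtain e where e: "e \<in> carrier R" "d 0 = d j \<otimes>\<^bsub>R\<^esub> e" using exch[OF j n0] by blast
      have "d 0 \<odot>\<^bsub>N\<^esub> v j = e \<odot>\<^bsub>N\<^esub> w j"
        using e dR[OF j] vN[OF j] w[OF j] by (simp add: N.M.smult_assoc1[symmetric] M.R.m_comm)
      moreover have "w j \<in> f ` carrier M" unfolding fy[OF j, symmetric] by (rule imageI[OF yM[OF j]])
      ultimately show ?thesis using s.smult_closed[OF e(1)] by simp
    qed
    ultimately have "N.M.span (v ` {..<n}) \<subseteq> {z \<in> carrier N. d 0 \<odot>\<^bsub>N\<^esub> z \<in> f ` carrier M}"
      by (intro N.M.span_is_subset) (use vN in auto)
    then obtain x where "x \<in> carrier M" "d 0 \<odot>\<^bsub>N\<^esub> z = f x" using z sv by blast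
    then show ?thesis using f by metis
  qed
  ultimately show ?thesis using t(1,2) d0 by blast
qed

theorem theorem4p5:
  fixes G :: "('g, 'a) monoid_scheme"
    and R :: "('r, 'b) ring_scheme"
    and K :: "('k, 'c) ring_scheme"
    and \<iota> :: "'r \<Rightarrow> 'k"
    and V :: "('k, 'v, 'g) gmodule"
    and M :: "('r, 'm, 'g) gmodule"
    and N :: "('r, 'n, 'g) gmodule"
    and k :: nat
  assumes "group G" and "finite (carrier G)"
    and "principal_domain R"
    and "field_of_fractions R K \<iota>"
    and "fg_RG_module G K V"
    and "absolutely_simple G K V"
    and "is_form G R K \<iota> V M"
    and "is_form G R K \<iota> V N"
    and "k \<in> {1..vectorspace.dim K V - 1}"
    and "absolutely_simple G K (exterior_power K k V)"
  shows "RG_isomorphic G R M N \<longleftrightarrow>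
    RG_isomorphic G R (exterior_power R k M) (exterior_power R k N)"
proof
  have M: "RG_module G R M" and N: "RG_module G R N" and V: "RG_module G K V"
    using assms(5,7,8) by (auto simp: is_form_def RG_lattice_def fg_RG_module_def)
  {
    assume "RG_isomorphic G R M N"
    then show "RG_isomorphic G R (exterior_power R k M) (exterior_power R k N)"
      by (rule exterior_power_isomorphic[OF M N])
  next
    assume "RG_isomorphic G R (exterior_power R k M) (exterior_power R k N)"
    then obtain \<phi> where \<phi>: "\<phi> \<in> RG_hom G R (exterior_power R k M) (exterior_power R k N)"
      "bij_betw \<phi> (carrier (exterior_power R k M)) (carrier (exterior_power R k N))"
      unfolding RG_isomorphic_def by blast
    interpret R: principal_domain R by (rule assms(3))
    interpret K: field K using assms(4) by (simp add: field_of_fractions_def)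
    interpret fraction_field R K \<iota>
      by (intro fraction_field.intro fraction_field_axioms.intro R.domain_axioms K.field_axioms assms(4))
    obtain iM where iM: "form_embedding R K \<iota> M V iM"
      and eqM: "\<And>g m. g \<in> carrier G \<Longrightarrow> m \<in> carrier M \<Longrightarrow> iM (act M g m) = act V g (iM m)"
      using form_embedding_of_form[OF assms(7) V] by blast
    obtain iN where iN: "form_embedding R K \<iota> N V iN"
      and eqN: "\<And>g m. g \<in> carrier G \<Longrightarrow> m \<in> carrier N \<Longrightarrow> iN (act N g m) = act V g (iN m)"
      using form_embedding_of_form[OF assms(8) V] by blast
    interpret M: form_embedding R K \<iota> M V iM by (rule iM)
    interpret N: form_embedding R K \<iota> N V iN by (rule iN)
    obtain BM where BM: "finite BM" "BM \<subseteq> carrier M" "M.M.lin_indpt BM" "M.M.span BM = carrier M"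
      using RG_lattice_basis[of G R M] assms(7) R.domain_axioms unfolding is_form_def by blast
    obtain BN where BN: "finite BN" "BN \<subseteq> carrier N" "N.M.lin_indpt BN" "N.M.span BN = carrier N"
      using RG_lattice_basis[of G R N] assms(8) R.domain_axioms unfolding is_form_def by blast
    have iBM: "finite (iM ` BM)" "iM ` BM \<subseteq> carrier V" using BM M.i.closed by auto
    obtain jM jN c where j: "semilinear R K \<iota> (exterior_power R k M) (exterior_power K k V) jM"
      "\<forall>xs\<in>tuples k M. jM (exterior.wedge R M k xs) = exterior.wedge K V k (map iM xs)"
      "semilinear R K \<iota> (exterior_power R k N) (exterior_power K k V) jN"
      "\<forall>xs\<in>tuples k N. jN (exterior.wedge R N k xs) = exterior.wedge K V k (map iN xs)"
      "c \<in> carrier K" "\<forall>z\<in>carrier (exterior_power R k M). jN (\<phi> z) = c \<odot>\<^bsub>exterior_power K k V\<^esub> jM z"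
      using exterior_scalar[OF V M N iM iN eqM eqN iBM M.image_generates[OF BM(2,4)] assms(10) \<phi>(1)] by blast
    \<comment> \<open>Since \<open>k\<close> is at least one, the truncated difference is positive,
      and \<open>k\<close> is strictly below the dimension.\<close>
    have k: "1 \<le> k" "k < vectorspace.dim K V" using assms(9) by auto
    have surj: "\<phi> ` carrier (exterior_power R k M) = carrier (exterior_power R k N)"
      using \<phi>(2) by (simp add: bij_betw_def)
    obtain t d where t: "t \<in> carrier R - {\<zero>\<^bsub>R\<^esub>}" and d: "d \<in> carrier R - {\<zero>\<^bsub>R\<^esub>}"
      and MN: "\<And>m. m \<in> carrier M \<Longrightarrow> \<exists>y\<in>carrier N. iN (d \<odot>\<^bsub>N\<^esub> y) = \<iota> t \<odot>\<^bsub>V\<^esub> iM m"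
      and NM: "\<And>y. y \<in> carrier N \<Longrightarrow> \<exists>m\<in>carrier M. iN (d \<odot>\<^bsub>N\<^esub> y) = \<iota> t \<odot>\<^bsub>V\<^esub> iM m"
      using form_comparison[OF assms(3) iM iN BM(1,2,4) M.card_basis_eq_dim[OF BM] BN(1,2,4)
          N.card_basis_eq_dim[OF BN] refl k j(1) _ j(3) _ j(5) surj] j(2,4,6) by blast
    \<comment> \<open>The map that multiplication by \<open>t / d\<close> on \<open>V\<close>
      induces from \<open>M\<close> to \<open>N\<close>.\<close>
    obtain \<chi> where \<chi>N: "\<And>m. m \<in> carrier M \<Longrightarrow> \<chi> m \<in> carrier N"
      and \<chi>: "\<And>m. m \<in> carrier M \<Longrightarrow> \<iota> d \<odot>\<^bsub>V\<^esub> iN (\<chi> m) = \<iota> t \<odot>\<^bsub>V\<^esub> iM m"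
      using MN d N.i.smult by (metis DiffD1)
    have \<iota>: "\<iota> t \<in> carrier K" "\<iota> d \<in> carrier K" using t d by auto
    \<comment> \<open>Equations between values of \<open>\<chi>\<close> are verified in
      \<open>V\<close> after multiplication by \<open>d\<close>, which loses nothing there.\<close>
    have uniq: "y = z" if "\<iota> d \<odot>\<^bsub>V\<^esub> iN y = \<iota> d \<odot>\<^bsub>V\<^esub> iN z" "y \<in> carrier N" "z \<in> carrier N" for y z
    proof -
      have "iN y = iN z" by (rule N.cancel[OF M.V.module_axioms, of d]) (use that d N.i.closed in auto)
      then show ?thesis using N.inj that by (auto dest: inj_onD)
    qed
    have sc: "\<iota> s \<odot>\<^bsub>V\<^esub> (\<iota> a \<odot>\<^bsub>V\<^esub> x) = \<iota> a \<odot>\<^bsub>V\<^esub> (\<iota> s \<odot>\<^bsub>V\<^esub> x)"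
      if "s \<in> carrier R" "a \<in> carrier R" "x \<in> carrier V" for s a x
      using that by (simp add: M.V.smult_assoc1[symmetric] K.m_comm)
    have "semilinear R R (\<lambda>a. a) M N \<chi>"
    proof (rule semilinear.intro[OF M.M.module_axioms N.M.module_axioms id_ring_hom \<chi>N])
      show "\<chi> (x \<oplus>\<^bsub>M\<^esub> y) = \<chi> x \<oplus>\<^bsub>N\<^esub> \<chi> y" if "x \<in> carrier M" "y \<in> carrier M" for x y
        by (rule uniq) (use that \<iota> in \<open>simp_all add: \<chi> \<chi>N M.i.add N.i.add M.V.smult_r_distr M.i.closed N.i.closed\<close>)
      show "\<chi> (a \<odot>\<^bsub>M\<^esub> x) = a \<odot>\<^bsub>N\<^esub> \<chi> x" if "a \<in> carrier R" "x \<in> carrier M" for a x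
        by (rule uniq) (use that t d in \<open>simp_all add: \<chi> \<chi>N M.i.smult N.i.smult sc M.i.closed N.i.closed\<close>)
    qed
    moreover have "\<chi> (act M g x) = act N g (\<chi> x)" if g: "g \<in> carrier G" and x: "x \<in> carrier M" for g x
    proof (rule uniq)
      interpret aV: semilinear K K "\<lambda>a. a" V V "act V g" by (rule act_semilinear[OF V g])
      have cl: "act M g x \<in> carrier M" "act N g (\<chi> x) \<in> carrier N"
        using semilinear.closed[OF act_semilinear[OF M g] x] semilinear.closed[OF act_semilinear[OF N g] \<chi>N[OF x]] by auto
      then show "\<chi> (act M g x) \<in> carrier N" "act N g (\<chi> x) \<in> carrier N" using \<chi>N by auto
      \<comment> \<open>The group acts on \<open>V\<close> by \<open>K\<close>-linear maps, so the
        factors \<open>t\<close> and \<open>d\<close> pass through the action.\<close>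
      have "\<iota> d \<odot>\<^bsub>V\<^esub> iN (\<chi> (act M g x)) = act V g (\<iota> t \<odot>\<^bsub>V\<^esub> iM x)"
        using \<chi>[OF cl(1)] eqM[OF g x] aV.smult[OF \<iota>(1) M.i.closed[OF x]] by simp
      also have "\<dots> = \<iota> d \<odot>\<^bsub>V\<^esub> iN (act N g (\<chi> x))"
        using \<chi>[OF x, symmetric] eqN[OF g \<chi>N[OF x]] aV.smult[OF \<iota>(2) N.i.closed[OF \<chi>N[OF x]]] by simp
      finally show "\<iota> d \<odot>\<^bsub>V\<^esub> iN (\<chi> (act M g x)) = \<iota> d \<odot>\<^bsub>V\<^esub> iN (act N g (\<chi> x))" .
    qed
    ultimately have "\<chi> \<in> RG_hom G R M N" by (rule RG_homI)
    moreover have "inj_on \<chi> (carrier M)"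
    proof (rule inj_onI)
      fix x y assume xy: "x \<in> carrier M" "y \<in> carrier M" "\<chi> x = \<chi> y"
      then have "\<iota> t \<odot>\<^bsub>V\<^esub> iM x = \<iota> t \<odot>\<^bsub>V\<^esub> iM y" using \<chi> by metis
      then have "iM x = iM y" using M.cancel[OF M.V.module_axioms, of t] t xy M.i.closed by blast
      then show "x = y" using M.inj xy by (auto dest: inj_onD)
    qed
    moreover have "\<chi> ` carrier M = carrier N"
    proof
      \<comment> \<open>For \<open>y\<close> in \<open>N\<close> the second inclusion finds
        \<open>d y\<close> in \<open>t M\<close>, and cancelling \<open>d\<close> gives a
        preimage.\<close>
      show "carrier N \<subseteq> \<chi> ` carrier M"
      proof
        fix y assume y: "y \<in> carrier N"
        then obtain x where x: "x \<in> carrier M" "iN (d \<odot>\<^bsub>N\<^esub> y) = \<iota> t \<odot>\<^bsub>V\<^esub> iM x" using NM by blast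
        then have "y = \<chi> x" by (intro uniq) (use \<chi> \<chi>N y d N.i.smult in auto)
        then show "y \<in> \<chi> ` carrier M" using x(1) by blast
      qed
    qed (use \<chi>N in blast)
    ultimately show "RG_isomorphic G R M N" unfolding RG_isomorphic_def bij_betw_def by blast
  }
qed

end
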